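(* Let $V$ be a discrete valuation ring with quotient field $F$, let $K/F$ be a finite Galois extension with group $G$, let $S$ be the integral closure of $V$ in $K$, and assume $S$ is unramified over $V$. Let $f\in Z^2(G,K\setminus\{0\})$ be a normalized two-cocycle with $f(G\times G)\subseteq S\setminus\{0\}$, and let $A_f=\sum_{\sigma\in G}Sx_\sigma$ be the associated crossed-product order. Then $A_f$ is hereditary if and only if $f(\tau,\gamma)\notin M^2$ for all $\tau,\gamma\in G$ and every maximal ideal $M$ of $S$.
   Context: A normalized two-cocycle is a map $f:G\times G\to K\setminus\{0\}$ with $\sigma(f(\tau,\gamma))\,f(\sigma,\tau\gamma)=f(\sigma,\tau)\,f(\sigma\tau,\gamma)$ and $f(1,\sigma)=f(\sigma,1)=1$ for all $\sigma,\tau,\gamma\in G$. It is not required that the values of $f$ be units of $S$. The crossed-product algebra is $\Sigma_f=(K/F,G,f)=\bigoplus_{\sigma\in G}Kx_\sigma$, with multiplication determined by $x_\sigma a=\sigma(a)x_\sigma$ ($a\in K$) and $x_\sigma x_\tau=f(\sigma,\tau)x_{\sigma\tau}$. The crossed-product order is the subring $A_f=\bigoplus_{\sigma\in G}Sx_\sigma$ of $\Sigma_f$; it is a $V$-order in $\Sigma_f$ with identity $1=x_1$. "Unramified" has its standard meaning: every maximal ideal of $S$ has ramification index $1$ over $V$ (so $J(V)S=J(S)$, where $J$ denotes the Jacobson radical) and separable residue field extension. A ring is hereditary if all its one-sided (left and right) ideals are projective modules. *)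

theory Defs
  imports "HOL-Algebra.Finite_Extensions" "HOL-Algebra.Ideal_Product" "HOL-Algebra.Bij" "HOL-Algebra.Module"
begin

section \<open>Modules over noncommutative rings\<close>

text \<open>The library locale \<^locale>\<open>module\<close> requires a commutative ring of scalars.\<close>

locale left_module = R?: ring R + M?: abelian_group M
    for R :: "('r, 'a) ring_scheme" (structure) and M :: "('r, 'm, 'b) module_scheme" (structure) +
  assumes smult_closed [simp, intro]:
      "\<lbrakk> a \<in> carrier R; x \<in> carrier M \<rbrakk> \<Longrightarrow> a \<odot>\<^bsub>M\<^esub> x \<in> carrier M"
    and smult_l_distr:
      "\<lbrakk> a \<in> carrier R; b \<in> carrier R; x \<in> carrier M \<rbrakk>
        \<Longrightarrow> (a \<oplus>\<^bsub>R\<^esub> b) \<odot>\<^bsub>M\<^esub> x = a \<odot>\<^bsub>M\<^esub> x \<oplus>\<^bsub>M\<^esub> b \<odot>\<^bsub>M\<^esub> x"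
    and smult_r_distr:
      "\<lbrakk> a \<in> carrier R; x \<in> carrier M; y \<in> carrier M \<rbrakk>
        \<Longrightarrow> a \<odot>\<^bsub>M\<^esub> (x \<oplus>\<^bsub>M\<^esub> y) = a \<odot>\<^bsub>M\<^esub> x \<oplus>\<^bsub>M\<^esub> a \<odot>\<^bsub>M\<^esub> y"
    and smult_assoc:
      "\<lbrakk> a \<in> carrier R; b \<in> carrier R; x \<in> carrier M \<rbrakk>
        \<Longrightarrow> (a \<otimes>\<^bsub>R\<^esub> b) \<odot>\<^bsub>M\<^esub> x = a \<odot>\<^bsub>M\<^esub> (b \<odot>\<^bsub>M\<^esub> x)"
    and smult_one [simp]: "x \<in> carrier M \<Longrightarrow> \<one>\<^bsub>R\<^esub> \<odot>\<^bsub>M\<^esub> x = x"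

definition left_module_hom ::
    "('r, 'a) ring_scheme \<Rightarrow> ('r, 'm, 'b) module_scheme \<Rightarrow> ('r, 'n, 'c) module_scheme
      \<Rightarrow> ('m \<Rightarrow> 'n) set"
  where "left_module_hom R M N = {h \<in> carrier M \<rightarrow> carrier N.
    (\<forall>x \<in> carrier M. \<forall>y \<in> carrier M. h (x \<oplus>\<^bsub>M\<^esub> y) = h x \<oplus>\<^bsub>N\<^esub> h y) \<and>
    (\<forall>a \<in> carrier R. \<forall>x \<in> carrier M. h (a \<odot>\<^bsub>M\<^esub> x) = a \<odot>\<^bsub>N\<^esub> h x)}"

text \<open>
  Projectivity is the lifting property against all surjections. HOL cannot quantify over modules of
  all types in a definition, so the source ranges over modules with elements of type
  \<^typ>\<open>'m \<Rightarrow> 'r\<close> (which includes the free module on the elements of \<open>P\<close>) and the target over modules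
  with elements of type \<^typ>\<open>'m\<close> (which includes \<open>P\<close>). This is no restriction: the lemma
  \<open>projective_module_lift\<close> below gives the lifting property for modules of arbitrary types.
\<close>

definition projective_module ::
    "('r, 'a) ring_scheme \<Rightarrow> ('r, 'm, 'b) module_scheme \<Rightarrow> bool"
  where "projective_module R P \<longleftrightarrow> left_module R P \<and>
    (\<forall>(M :: ('r, 'm \<Rightarrow> 'r) module) (N :: ('r, 'm) module) g h.
      left_module R M \<longrightarrow> left_module R N \<longrightarrow>
      g \<in> left_module_hom R M N \<longrightarrow> g ` carrier M = carrier N \<longrightarrow> h \<in> left_module_hom R P N \<longrightarrow>
      (\<exists>k \<in> left_module_hom R P M. \<forall>x \<in> carrier P. g (k x) = h x))"

text \<open>The next two constants serve only to prove \<open>projective_module_lift\<close>.\<close>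

definition module_comb ::
    "('r, 'a) ring_scheme \<Rightarrow> ('r, 'q, 'b) module_scheme \<Rightarrow> ('m \<Rightarrow> 'q) \<Rightarrow> ('m \<Rightarrow> 'r) \<Rightarrow> 'q"
  where "module_comb R Q t \<phi> = finsum Q (\<lambda>p. \<phi> p \<odot>\<^bsub>Q\<^esub> t p) {p. \<phi> p \<noteq> \<zero>\<^bsub>R\<^esub>}"

definition free_module :: "('r, 'a) ring_scheme \<Rightarrow> 'm set \<Rightarrow> ('r, 'm \<Rightarrow> 'r) module"
  where "free_module R B =
    \<lparr>carrier = {\<phi>. (\<forall>p. \<phi> p \<in> carrier R) \<and> {p. \<phi> p \<noteq> \<zero>\<^bsub>R\<^esub>} \<subseteq> B \<and> finite {p. \<phi> p \<noteq> \<zero>\<^bsub>R\<^esub>}},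
     monoid.mult = undefined, one = undefined, zero = (\<lambda>_. \<zero>\<^bsub>R\<^esub>),
     add = (\<lambda>\<phi> \<psi> p. \<phi> p \<oplus>\<^bsub>R\<^esub> \<psi> p), smult = (\<lambda>a \<phi> p. a \<otimes>\<^bsub>R\<^esub> \<phi> p)\<rparr>"

lemma (in left_module) smult_l_null: "x \<in> carrier M \<Longrightarrow> \<zero>\<^bsub>R\<^esub> \<odot>\<^bsub>M\<^esub> x = \<zero>\<^bsub>M\<^esub>"
  using smult_l_distr[of "\<zero>\<^bsub>R\<^esub>" "\<zero>\<^bsub>R\<^esub>" x] by simp

lemma (in left_module) smult_r_null: "a \<in> carrier R \<Longrightarrow> a \<odot>\<^bsub>M\<^esub> \<zero>\<^bsub>M\<^esub> = \<zero>\<^bsub>M\<^esub>"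
  using smult_r_distr[of a "\<zero>\<^bsub>M\<^esub>" "\<zero>\<^bsub>M\<^esub>"] by simp

lemma (in left_module) finsum_smult:
  assumes "finite A" "a \<in> carrier R" "u \<in> A \<rightarrow> carrier M"
  shows "a \<odot>\<^bsub>M\<^esub> finsum M u A = finsum M (\<lambda>p. a \<odot>\<^bsub>M\<^esub> u p) A"
  using assms
proof (induction A rule: finite_induct)
  case empty
  then show ?case by (simp add: smult_r_null)
next
  case (insert p A)
  then have u: "u \<in> A \<rightarrow> carrier M" "u p \<in> carrier M" by auto
  then have "(\<lambda>p. a \<odot>\<^bsub>M\<^esub> u p) \<in> A \<rightarrow> carrier M" using insert.prems by auto
  then show ?case using insert u by (simp add: smult_r_distr)
qed

lemma free_module_left_module:
  fixes R (structure)
  assumes "ring R" shows "left_module R (free_module R B)"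
proof -
  interpret ring R by fact
  have fin: "finite {p. \<phi> p \<oplus> \<psi> p \<noteq> \<zero>}" 
    if "finite {p. \<phi> p \<noteq> \<zero>}" "finite {p. \<psi> p \<noteq> \<zero>}" for \<phi> \<psi> :: "'c \<Rightarrow> 'a"
    by (rule finite_subset[of _ "{p. \<phi> p \<noteq> \<zero>} \<union> {p. \<psi> p \<noteq> \<zero>}"]) (use that in auto)
  have add: "\<phi> \<oplus>\<^bsub>free_module R B\<^esub> \<psi> \<in> carrier (free_module R B)"
    if "\<phi> \<in> carrier (free_module R B)" "\<psi> \<in> carrier (free_module R B)" for \<phi> \<psi>
  proof -
    have c: "\<forall>p. \<phi> p \<oplus> \<psi> p \<in> carrier R" and f: "finite {p. \<phi> p \<oplus> \<psi> p \<noteq> \<zero>}"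
      and S: "{p. \<phi> p \<noteq> \<zero>} \<subseteq> B" "{p. \<psi> p \<noteq> \<zero>} \<subseteq> B"
      using that fin[of \<phi> \<psi>] by (simp_all add: free_module_def)
    have "{p. \<phi> p \<oplus> \<psi> p \<noteq> \<zero>} \<subseteq> {p. \<phi> p \<noteq> \<zero>} \<union> {p. \<psi> p \<noteq> \<zero>}" by auto
    then have "{p. \<phi> p \<oplus> \<psi> p \<noteq> \<zero>} \<subseteq> B" using S by blast
    with c f show ?thesis by (simp add: free_module_def)
  qed
  have smult: "a \<odot>\<^bsub>free_module R B\<^esub> \<phi> \<in> carrier (free_module R B)"
    if "a \<in> carrier R" "\<phi> \<in> carrier (free_module R B)" for a \<phi>
  proof -
    have *: "{p. a \<otimes> \<phi> p \<noteq> \<zero>} \<subseteq> {p. \<phi> p \<noteq> \<zero>}" using that by auto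
    have c: "\<forall>p. a \<otimes> \<phi> p \<in> carrier R" and S: "{p. \<phi> p \<noteq> \<zero>} \<subseteq> B" "finite {p. \<phi> p \<noteq> \<zero>}"
      using that by (simp_all add: free_module_def)
    have "{p. a \<otimes> \<phi> p \<noteq> \<zero>} \<subseteq> B" "finite {p. a \<otimes> \<phi> p \<noteq> \<zero>}"
      using * S finite_subset by blast+
    with c show ?thesis by (simp add: free_module_def)
  qed
  have inv: "\<exists>\<psi> \<in> carrier (free_module R B). \<psi> \<oplus>\<^bsub>free_module R B\<^esub> \<phi> = \<zero>\<^bsub>free_module R B\<^esub>"
    if "\<phi> \<in> carrier (free_module R B)" for \<phi>
  proof (rule bexI[of _ "(\<ominus> \<one>) \<odot>\<^bsub>free_module R B\<^esub> \<phi>"])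
    have "(\<ominus> \<one>) \<otimes> \<phi> p \<oplus> \<phi> p = \<zero>" for p
      using that by (auto simp: free_module_def Pi_iff l_minus l_neg)
    then show "(\<ominus> \<one>) \<odot>\<^bsub>free_module R B\<^esub> \<phi> \<oplus>\<^bsub>free_module R B\<^esub> \<phi> = \<zero>\<^bsub>free_module R B\<^esub>"
      by (simp add: free_module_def)
    show "(\<ominus> \<one>) \<odot>\<^bsub>free_module R B\<^esub> \<phi> \<in> carrier (free_module R B)" using that by (simp add: smult)
  qed
  have "abelian_group (free_module R B)"
  proof (rule abelian_groupI)
    show "\<zero>\<^bsub>free_module R B\<^esub> \<in> carrier (free_module R B)" by (auto simp: free_module_def)
      show "\<And>x. x \<in> carrier (free_module R B) \<Longrightarrow>
        \<exists>y \<in> carrier (free_module R B). y \<oplus>\<^bsub>free_module R B\<^esub> x = \<zero>\<^bsub>free_module R B\<^esub>"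
      by (rule inv)
  qed (simp_all add: add, simp_all add: free_module_def fun_eq_iff a_ac)
  then show ?thesis
    unfolding left_module_def left_module_axioms_def
    using assms smult
    by (simp add: free_module_def fun_eq_iff l_distr r_distr m_assoc)
qed

context left_module
begin

lemma module_comb_superset:
  assumes "finite A" "{p. \<phi> p \<noteq> \<zero>\<^bsub>R\<^esub>} \<subseteq> A" "\<phi> \<in> A \<rightarrow> carrier R" "t \<in> A \<rightarrow> carrier M"
  shows "module_comb R M t \<phi> = finsum M (\<lambda>p. \<phi> p \<odot>\<^bsub>M\<^esub> t p) A"
  unfolding module_comb_def
  by (rule M.add.finprod_mono_neutral_cong_left) (use assms smult_l_null in \<open>auto simp: Pi_iff\<close>)

lemma module_comb_hom:
  assumes t: "t \<in> B \<rightarrow> carrier M"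
  shows "module_comb R M t \<in> left_module_hom R (free_module R B) M"
proof -
  have clos: "module_comb R M t \<phi> \<in> carrier M" if "\<phi> \<in> carrier (free_module R B)" for \<phi>
    unfolding module_comb_def
    by (rule M.finsum_closed) (use that t in \<open>auto simp: free_module_def Pi_iff subset_iff\<close>)
  have add: "module_comb R M t (\<lambda>p. \<phi> p \<oplus>\<^bsub>R\<^esub> \<psi> p)
      = module_comb R M t \<phi> \<oplus>\<^bsub>M\<^esub> module_comb R M t \<psi>"
    if "\<phi> \<in> carrier (free_module R B)" "\<psi> \<in> carrier (free_module R B)" for \<phi> \<psi>
  proof -
    let ?A = "{p. \<phi> p \<noteq> \<zero>\<^bsub>R\<^esub>} \<union> {p. \<psi> p \<noteq> \<zero>\<^bsub>R\<^esub>}"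
    have A: "finite ?A" "?A \<subseteq> B" and c: "\<phi> p \<in> carrier R" "\<psi> p \<in> carrier R" for p
      using that by (auto simp: free_module_def)
    have tA: "t \<in> ?A \<rightarrow> carrier M" using A t by auto
    have "module_comb R M t (\<lambda>p. \<phi> p \<oplus>\<^bsub>R\<^esub> \<psi> p)
        = finsum M (\<lambda>p. (\<phi> p \<oplus>\<^bsub>R\<^esub> \<psi> p) \<odot>\<^bsub>M\<^esub> t p) ?A"
      by (rule module_comb_superset) (use A tA c in auto)
    also have "\<dots> = finsum M (\<lambda>p. \<phi> p \<odot>\<^bsub>M\<^esub> t p \<oplus>\<^bsub>M\<^esub> \<psi> p \<odot>\<^bsub>M\<^esub> t p) ?A"
      by (rule M.finsum_cong') (use tA c in \<open>auto simp: smult_l_distr Pi_iff\<close>)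
    also have "\<dots> = finsum M (\<lambda>p. \<phi> p \<odot>\<^bsub>M\<^esub> t p) ?A \<oplus>\<^bsub>M\<^esub> finsum M (\<lambda>p. \<psi> p \<odot>\<^bsub>M\<^esub> t p) ?A"
      by (rule M.finsum_addf) (use tA c in \<open>auto simp: Pi_iff\<close>)
    also have "finsum M (\<lambda>p. \<phi> p \<odot>\<^bsub>M\<^esub> t p) ?A = module_comb R M t \<phi>"
      by (rule module_comb_superset[symmetric]) (use A tA c in auto)
    also have "finsum M (\<lambda>p. \<psi> p \<odot>\<^bsub>M\<^esub> t p) ?A = module_comb R M t \<psi>"
      by (rule module_comb_superset[symmetric]) (use A tA c in auto)
    finally show ?thesis .
  qed
  have sm: "module_comb R M t (\<lambda>p. a \<otimes>\<^bsub>R\<^esub> \<phi> p) = a \<odot>\<^bsub>M\<^esub> module_comb R M t \<phi>"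
    if "a \<in> carrier R" "\<phi> \<in> carrier (free_module R B)" for a \<phi>
  proof -
    let ?A = "{p. \<phi> p \<noteq> \<zero>\<^bsub>R\<^esub>}"
    have A: "finite ?A" "?A \<subseteq> B" and c: "\<phi> p \<in> carrier R" for p
      using that by (auto simp: free_module_def)
    have tA: "t \<in> ?A \<rightarrow> carrier M" using A t by auto
    have "module_comb R M t (\<lambda>p. a \<otimes>\<^bsub>R\<^esub> \<phi> p) = finsum M (\<lambda>p. (a \<otimes>\<^bsub>R\<^esub> \<phi> p) \<odot>\<^bsub>M\<^esub> t p) ?A"
      by (rule module_comb_superset) (use A tA c that in auto)
    also have "\<dots> = finsum M (\<lambda>p. a \<odot>\<^bsub>M\<^esub> (\<phi> p \<odot>\<^bsub>M\<^esub> t p)) ?A"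
      by (rule M.finsum_cong') (use tA c that in \<open>auto simp: smult_assoc Pi_iff\<close>)
    also have "\<dots> = a \<odot>\<^bsub>M\<^esub> module_comb R M t \<phi>"
      unfolding module_comb_def
      by (rule finsum_smult[symmetric]) (use A tA c that in \<open>auto simp: Pi_iff\<close>)
    finally show ?thesis .
  qed
  show ?thesis
    unfolding left_module_hom_def using clos add sm by (auto simp: free_module_def)
qed

end

lemma left_module_hom_comb:
  assumes "left_module R M" "left_module R N" and g: "g \<in> left_module_hom R M N"
    and t: "t \<in> B \<rightarrow> carrier M" and \<phi>: "\<phi> \<in> carrier (free_module R B)"
  shows "g (module_comb R M t \<phi>) = module_comb R N (\<lambda>p. g (t p)) \<phi>"
proof -
  interpret M: left_module R M by fact
  interpret N: left_module R N by fact
  have fin: "finite A \<Longrightarrow> A \<subseteq> B \<Longrightarrow>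
      g (finsum M (\<lambda>p. \<phi> p \<odot>\<^bsub>M\<^esub> t p) A) = finsum N (\<lambda>p. \<phi> p \<odot>\<^bsub>N\<^esub> g (t p)) A" for A
  proof (induction A rule: finite_induct)
    case empty
    have 1: "g \<zero>\<^bsub>M\<^esub> \<in> carrier N" using g by (auto simp: left_module_hom_def)
    have "\<forall>x \<in> carrier M. \<forall>y \<in> carrier M. g (x \<oplus>\<^bsub>M\<^esub> y) = g x \<oplus>\<^bsub>N\<^esub> g y"
      using g by (simp add: left_module_hom_def)
    then have "g (\<zero>\<^bsub>M\<^esub> \<oplus>\<^bsub>M\<^esub> \<zero>\<^bsub>M\<^esub>) = g \<zero>\<^bsub>M\<^esub> \<oplus>\<^bsub>N\<^esub> g \<zero>\<^bsub>M\<^esub>" by blast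
    then show ?case using 1 by simp
  next
    case (insert p A)
    have c: "\<phi> q \<in> carrier R" for q using \<phi> by (auto simp: free_module_def)
    have gc: "g x \<in> carrier N" if "x \<in> carrier M" for x using g that by (auto simp: left_module_hom_def)
    have 1: "t q \<in> carrier M" if "q \<in> insert p A" for q using t insert.prems that by auto
    have 2: "(\<lambda>q. \<phi> q \<odot>\<^bsub>M\<^esub> t q) \<in> A \<rightarrow> carrier M" using c 1 by auto
    have 3: "(\<lambda>q. \<phi> q \<odot>\<^bsub>N\<^esub> g (t q)) \<in> A \<rightarrow> carrier N" using c 1 gc by auto
    show ?case
      using insert 1 2 3 c gc g by (simp add: left_module_hom_def)
  qed
  show ?thesis unfolding module_comb_def by (rule fin) (use \<phi> in \<open>auto simp: free_module_def\<close>)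
qed

lemma projective_module_lift:
  fixes R :: "('r, 'a) ring_scheme" and P :: "('r, 'm, 'b) module_scheme"
    and M :: "('r, 'u, 'c) module_scheme" and N :: "('r, 'v, 'd) module_scheme"
  assumes P: "projective_module R P" and M: "left_module R M" and N: "left_module R N"
    and g: "g \<in> left_module_hom R M N" and surj: "g ` carrier M = carrier N"
    and h: "h \<in> left_module_hom R P N"
  shows "\<exists>k \<in> left_module_hom R P M. \<forall>x \<in> carrier P. g (k x) = h x"
proof -
  let ?FP = "free_module R (carrier P)"
  let ?P = "\<lparr>carrier = carrier P, monoid.mult = monoid.mult P, one = one P, zero = zero P,
    add = add P, smult = smult P\<rparr> :: ('r, 'm) module"
  have lP: "left_module R P" using P by (simp add: projective_module_def)
  interpret P: left_module R P by fact
  interpret M: left_module R M by fact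
  have ring: "ring R" by (rule P.ring_axioms)
  have FP: "left_module R ?FP" by (rule free_module_left_module[OF ring])
  have lP': "left_module R ?P"
  proof -
    have "abelian_group ?P"
      by (rule abelian_groupI) (auto simp: P.M.a_ac intro: P.M.l_neg)
    then show ?thesis
      unfolding left_module_def left_module_axioms_def using ring
      by (auto simp: P.smult_l_distr P.smult_r_distr P.smult_assoc)
  qed
  have e: "module_comb R P (\<lambda>p. p) \<in> left_module_hom R ?FP P"
    by (rule P.module_comb_hom) auto
  have surj_e: "module_comb R P (\<lambda>p. p) ` carrier ?FP = carrier P"
  proof
    show "module_comb R P (\<lambda>p. p) ` carrier ?FP \<subseteq> carrier P"
      using e by (auto simp: left_module_hom_def)
    show "carrier P \<subseteq> module_comb R P (\<lambda>p. p) ` carrier ?FP"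
    proof
      fix x assume x: "x \<in> carrier P"
      let ?d = "\<lambda>p. if p = x then \<one>\<^bsub>R\<^esub> else \<zero>\<^bsub>R\<^esub>"
      have "?d \<in> carrier ?FP" using x by (auto simp: free_module_def)
      moreover have "module_comb R P (\<lambda>p. p) ?d = finsum P (\<lambda>p. ?d p \<odot>\<^bsub>P\<^esub> p) {x}"
        by (rule P.module_comb_superset) (use x in auto)
      then have "module_comb R P (\<lambda>p. p) ?d = x" using x by simp
      ultimately show "x \<in> module_comb R P (\<lambda>p. p) ` carrier ?FP" by (metis imageI)
    qed
  qed
  have "\<exists>s \<in> left_module_hom R P ?FP. \<forall>x \<in> carrier P. module_comb R P (\<lambda>p. p) (s x) = x"
  proof -
    have "module_comb R P (\<lambda>p. p) \<in> left_module_hom R ?FP ?P"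
      using e by (simp add: left_module_hom_def)
    moreover have "(\<lambda>x. x) \<in> left_module_hom R P ?P" by (simp add: left_module_hom_def)
    moreover have "module_comb R P (\<lambda>p. p) ` carrier ?FP = carrier ?P" using surj_e by simp
    ultimately show ?thesis using P FP lP' unfolding projective_module_def by blast
  qed
  then obtain s where s: "s \<in> left_module_hom R P ?FP"
    and es: "\<And>x. x \<in> carrier P \<Longrightarrow> module_comb R P (\<lambda>p. p) (s x) = x" by blast
  have "\<exists>m \<in> carrier M. g m = h p" if "p \<in> carrier P" for p
  proof -
    have "h p \<in> g ` carrier M" using h that unfolding surj by (auto simp: left_module_hom_def)
    then show ?thesis by auto
  qed
  then obtain m where m: "\<And>p. p \<in> carrier P \<Longrightarrow> m p \<in> carrier M \<and> g (m p) = h p" by metis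
  have m': "m \<in> carrier P \<rightarrow> carrier M" using m by auto
  have em: "module_comb R M m \<in> left_module_hom R ?FP M" by (rule M.module_comb_hom[OF m'])
  have sc: "s x \<in> carrier ?FP" if "x \<in> carrier P" for x
    using s that by (auto simp: left_module_hom_def)
  show ?thesis
  proof (intro bexI[of _ "\<lambda>x. module_comb R M m (s x)"] ballI)
    show "(\<lambda>x. module_comb R M m (s x)) \<in> left_module_hom R P M"
      using em s by (auto simp: left_module_hom_def Pi_iff)
    fix x assume x: "x \<in> carrier P"
    interpret N: left_module R N by fact
    have hc: "h p \<in> carrier N" if "p \<in> carrier P" for p
      using h that by (auto simp: left_module_hom_def)
    have sx: "{p. s x p \<noteq> \<zero>\<^bsub>R\<^esub>} \<subseteq> carrier P" "s x p \<in> carrier R" for p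
      using sc[OF x] by (auto simp: free_module_def)
    have "g (module_comb R M m (s x)) = module_comb R N (\<lambda>p. g (m p)) (s x)"
      by (rule left_module_hom_comb[OF M N g m' sc[OF x]])
    also have "\<dots> = module_comb R N (\<lambda>p. h p) (s x)"
      unfolding module_comb_def
      by (rule N.M.finsum_cong') (use sx hc m in \<open>auto simp: subset_iff\<close>)
    also have "\<dots> = h (module_comb R P (\<lambda>p. p) (s x))"
      by (rule left_module_hom_comb[OF lP N h _ sc[OF x], symmetric]) auto
    finally show "g (module_comb R M m (s x)) = h x" using es[OF x] by simp
  qed
qed


section \<open>Hereditary rings\<close>

definition left_ideal :: "'r set \<Rightarrow> ('r, 'a) ring_scheme \<Rightarrow> bool"
  where "left_ideal I R \<longleftrightarrow> additive_subgroup I R \<and>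
    (\<forall>r \<in> carrier R. \<forall>x \<in> I. r \<otimes>\<^bsub>R\<^esub> x \<in> I)"

definition left_ideal_module :: "('r, 'a) ring_scheme \<Rightarrow> 'r set \<Rightarrow> ('r, 'r) module"
  where "left_ideal_module R I =
    \<lparr>carrier = I, monoid.mult = monoid.mult R, one = \<one>\<^bsub>R\<^esub>,
      zero = \<zero>\<^bsub>R\<^esub>, add = add R, smult = monoid.mult R\<rparr>"

text \<open>Right ideals and right modules are left ideals and left modules of the opposite ring.\<close>

definition opposite_ring :: "('r, 'a) ring_scheme \<Rightarrow> ('r, 'a) ring_scheme"
  where "opposite_ring R = R\<lparr>monoid.mult := \<lambda>x y. y \<otimes>\<^bsub>R\<^esub> x\<rparr>"

definition left_hereditary :: "('r, 'a) ring_scheme \<Rightarrow> bool"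
  where "left_hereditary R \<longleftrightarrow>
    (\<forall>I. left_ideal I R \<longrightarrow> projective_module R (left_ideal_module R I))"

definition hereditary :: "('r, 'a) ring_scheme \<Rightarrow> bool"
  where "hereditary R \<longleftrightarrow> left_hereditary R \<and> left_hereditary (opposite_ring R)"


section \<open>Galois extensions and unramified extensions of discrete valuation rings\<close>

text \<open>
  Automorphisms are restricted to the carrier (as in \<^const>\<open>Bij\<close>), so that each automorphism
  is represented by exactly one function.
\<close>

definition galois_group :: "('a, 'b) ring_scheme \<Rightarrow> 'a set \<Rightarrow> ('a \<Rightarrow> 'a) monoid"
  where "galois_group K F = (BijGroup (carrier K))
    \<lparr>carrier := {\<sigma> \<in> ring_iso K K \<inter> extensional (carrier K). \<forall>a \<in> F. \<sigma> a = a}\<rparr>"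

definition finite_galois_extension :: "('a, 'b) ring_scheme \<Rightarrow> 'a set \<Rightarrow> bool"
  where "finite_galois_extension K F \<longleftrightarrow>
    field K \<and> subfield F K \<and> ring.finite_dimension K F (carrier K) \<and>
    {x \<in> carrier K. \<forall>\<sigma> \<in> carrier (galois_group K F). \<sigma> x = x} = F"

definition discrete_valuation_ring :: "('a, 'b) ring_scheme \<Rightarrow> bool"
  where "discrete_valuation_ring R \<longleftrightarrow>
    principal_domain R \<and> (\<exists>!P. primeideal P R \<and> P \<noteq> {\<zero>\<^bsub>R\<^esub>})"

definition quotient_field_in :: "('a, 'b) ring_scheme \<Rightarrow> 'a set \<Rightarrow> 'a set"
  where "quotient_field_in K V = {a \<otimes>\<^bsub>K\<^esub> inv\<^bsub>K\<^esub> b | a b. a \<in> V \<and> b \<in> V - {\<zero>\<^bsub>K\<^esub>}}"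

definition integral_closure :: "('a, 'b) ring_scheme \<Rightarrow> 'a set \<Rightarrow> 'a set"
  where "integral_closure K V = {x \<in> carrier K.
    \<exists>p. polynomial\<^bsub>K\<^esub> V p \<and> p \<noteq> [] \<and> lead_coeff p = \<one>\<^bsub>K\<^esub> \<and> ring.eval K p x = \<zero>\<^bsub>K\<^esub>}"

text \<open>Polynomials are coefficient lists, leading coefficient first.\<close>

definition (in ring) poly_deriv :: "'a list \<Rightarrow> 'a list"
  where "poly_deriv p = normalize (map (\<lambda>i. add_pow R i (coeff p i)) (rev [1..<length p]))"

definition (in ring) separable_poly :: "'a set \<Rightarrow> 'a list \<Rightarrow> bool"
  where "separable_poly k p \<longleftrightarrow>
    (\<forall>d \<in> carrier (k[X]). d divides\<^bsub>k[X]\<^esub> p \<and> d divides\<^bsub>k[X]\<^esub> (poly_deriv p)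
      \<longrightarrow> d \<in> Units (k[X]))"

definition (in ring) separable_extension :: "'a set \<Rightarrow> bool"
  where "separable_extension k \<longleftrightarrow>
    (\<forall>x \<in> carrier R. algebraic k x \<and> separable_poly k (Irr k x))"

text \<open>
  In the next two definitions \<open>V\<close> is a subring of \<open>S\<close> and \<open>M\<close> a maximal ideal of \<open>S\<close>. The
  ramification index is the exponent of \<open>M\<close> in \<open>(M \<inter> V)S\<close>, and the residue field of \<open>V\<close> is
  identified with its image in \<open>S/M\<close>.
\<close>

definition ramification_index :: "('a, 'b) ring_scheme \<Rightarrow> 'a set \<Rightarrow> 'a set \<Rightarrow> nat"
  where "ramification_index S V M =
    (GREATEST e. Idl\<^bsub>S\<^esub> (M \<inter> V) \<subseteq> M [^]\<^bsub>ideals_set S\<^esub> e)"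

definition unramified :: "('a, 'b) ring_scheme \<Rightarrow> 'a set \<Rightarrow> bool"
  where "unramified S V \<longleftrightarrow> (\<forall>M. maximalideal M S \<longrightarrow>
    ramification_index S V M = 1 \<and>
    ring.separable_extension (S Quot M) ((\<lambda>v. M +>\<^bsub>S\<^esub> v) ` V))"


section \<open>Crossed products\<close>

text \<open>\<open>G\<close> is a group of functions acting on \<open>K\<close> by application.\<close>

definition normalized_cocycle ::
    "('a, 'b) ring_scheme \<Rightarrow> ('a \<Rightarrow> 'a, 'c) monoid_scheme
      \<Rightarrow> (('a \<Rightarrow> 'a) \<Rightarrow> ('a \<Rightarrow> 'a) \<Rightarrow> 'a) \<Rightarrow> bool"
  where "normalized_cocycle K G f \<longleftrightarrow>
    (\<forall>\<sigma> \<in> carrier G. \<forall>\<tau> \<in> carrier G. f \<sigma> \<tau> \<in> carrier K - {\<zero>\<^bsub>K\<^esub>}) \<and>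
    (\<forall>\<sigma> \<in> carrier G. \<forall>\<tau> \<in> carrier G. \<forall>\<gamma> \<in> carrier G.
      \<sigma> (f \<tau> \<gamma>) \<otimes>\<^bsub>K\<^esub> f \<sigma> (\<tau> \<otimes>\<^bsub>G\<^esub> \<gamma>) = f \<sigma> \<tau> \<otimes>\<^bsub>K\<^esub> f (\<sigma> \<otimes>\<^bsub>G\<^esub> \<tau>) \<gamma>) \<and>
    (\<forall>\<sigma> \<in> carrier G. f \<one>\<^bsub>G\<^esub> \<sigma> = \<one>\<^bsub>K\<^esub> \<and> f \<sigma> \<one>\<^bsub>G\<^esub> = \<one>\<^bsub>K\<^esub>)"

text \<open>
  A function \<open>x\<close> on \<open>G\<close> stands for the element \<open>\<Sum>\<sigma>. x \<sigma> \<cdot> x\<^sub>\<sigma>\<close>; the product comes from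
  \<open>(a x\<^sub>\<sigma>)(b x\<^sub>\<tau>) = a \<sigma>(b) f(\<sigma>,\<tau>) x\<^sub>\<sigma>\<^sub>\<tau>\<close>.
\<close>

definition crossed_product ::
    "('a, 'b) ring_scheme \<Rightarrow> ('a \<Rightarrow> 'a, 'c) monoid_scheme
      \<Rightarrow> (('a \<Rightarrow> 'a) \<Rightarrow> ('a \<Rightarrow> 'a) \<Rightarrow> 'a) \<Rightarrow> (('a \<Rightarrow> 'a) \<Rightarrow> 'a) ring"
  where "crossed_product K G f =
    \<lparr>carrier = carrier G \<rightarrow>\<^sub>E carrier K,
     monoid.mult = (\<lambda>x y. \<lambda>\<rho> \<in> carrier G.
       finsum K (\<lambda>(\<sigma>, \<tau>). x \<sigma> \<otimes>\<^bsub>K\<^esub> \<sigma> (y \<tau>) \<otimes>\<^bsub>K\<^esub> f \<sigma> \<tau>)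
         {(\<sigma>, \<tau>). \<sigma> \<in> carrier G \<and> \<tau> \<in> carrier G \<and> \<sigma> \<otimes>\<^bsub>G\<^esub> \<tau> = \<rho>}),
     one = (\<lambda>\<rho> \<in> carrier G. if \<rho> = \<one>\<^bsub>G\<^esub> then \<one>\<^bsub>K\<^esub> else \<zero>\<^bsub>K\<^esub>),
     zero = (\<lambda>\<rho> \<in> carrier G. \<zero>\<^bsub>K\<^esub>),
     add = (\<lambda>x y. \<lambda>\<rho> \<in> carrier G. x \<rho> \<oplus>\<^bsub>K\<^esub> y \<rho>)\<rparr>"

definition crossed_product_order ::
    "('a, 'b) ring_scheme \<Rightarrow> ('a \<Rightarrow> 'a, 'c) monoid_scheme \<Rightarrow> 'a set
      \<Rightarrow> (('a \<Rightarrow> 'a) \<Rightarrow> ('a \<Rightarrow> 'a) \<Rightarrow> 'a) \<Rightarrow> (('a \<Rightarrow> 'a) \<Rightarrow> 'a) ring"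
  where "crossed_product_order K G S f =
    (crossed_product K G f)\<lparr>carrier := carrier G \<rightarrow>\<^sub>E S\<rparr>"

end

theory Submission imports Defs
begin

text \<open>
  The maximal ideals \<open>M\<close> of \<open>S\<close> carry discrete valuations of \<open>K\<close> with the common uniformizer \<open>\<pi>\<close> of
  \<open>V\<close>, \<open>S\<close> is the intersection of their valuation rings, and by separability of the residue fields the
  stabilizer of \<open>M\<close> in \<open>G\<close> acts faithfully on \<open>S/M\<close>. By the cocycle identity, no value of \<open>f\<close> lies
  in any \<open>M\<^sup>2\<close> as soon as no \<open>f(\<sigma>,\<sigma>\<^sup>-\<^sup>1)\<close> does.

  If so, a left ideal of \<open>A\<^sub>f\<close> is a lattice over \<open>S\<close>, and averaging an \<open>S\<close>-linear map of finite rank over the \<open>x\<^sub>\<sigma>\<close>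
  makes it \<open>A\<^sub>f\<close>-linear. Elements of prescribed trace, which exist by Dedekind's independence of the residue
  automorphisms, turn these averages locally into the identity, so that the ideal is projective. If some
  value is in \<open>M\<^sup>2\<close>, an explicit left ideal attached to \<open>M\<close> has no such maps and is not projective.
  Right ideals are left ideals of the crossed product order for the opposite cocycle.
\<close>

text \<open>Averaging a functional \<psi> over G yields values in the order if all quotients
  \<psi>(x_\<sigma> x) / f(\<sigma>,\<sigma>^-1) are integral, and \<sigma> is bad at M if this
  denominator lies in M. Square-freeness bounds the pole by order one, so at M it is enough that
  \<psi> is integral and maps the bad part, spanned by \<pi>Z and the x_\<sigma> Z with \<sigma>
  bad, into the maximal ideal. A basis adapted to the bad part separates such functionals from basis
  vectors lying in the bad part. Averaging only the former gives \<theta> of finite rank such that 1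
  - \<theta> maps Z into the bad part, which is larger than \<pi>Z. Bad factors lower a
  combinatorial level of group elements, so card G applications of 1 - \<theta> do reach \<pi>Z.
  Multiplication by some power of \<pi> has finite rank as well, and together these make the
  identity a sum of two maps of finite rank. On the arithmetic side, the ramification index is a
  greatest exponent, which carries information only once the exponents are bounded. Relations over V
  of bounded length with a unit coefficient give that bound, and also make the localizations
  valuation rings.\<close>

section \<open>Endomorphisms of finite rank and projectivity\<close>

text \<open>Finite sums of maps \<open>x \<mapsto> \<phi> x \<odot> u\<close> with \<open>\<phi>\<close> linear into the ring: by the dual basis lemma a module
  is finitely generated projective iff its identity is of this kind.\<close>

inductive finite_rank_map ::
    "('r, 'a) ring_scheme \<Rightarrow> ('r, 'm, 'b) module_scheme \<Rightarrow> ('m \<Rightarrow> 'm) \<Rightarrow> bool"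
  for R P where
  zero: "(\<And>x. x \<in> carrier P \<Longrightarrow> \<theta> x = \<zero>\<^bsub>P\<^esub>) \<Longrightarrow> finite_rank_map R P \<theta>"
| add: "\<lbrakk> finite_rank_map R P \<theta>; \<phi> \<in> left_module_hom R P (left_ideal_module R (carrier R));
    u \<in> carrier P; \<And>x. x \<in> carrier P \<Longrightarrow> \<theta>' x = \<phi> x \<odot>\<^bsub>P\<^esub> u \<oplus>\<^bsub>P\<^esub> \<theta> x \<rbrakk> \<Longrightarrow> finite_rank_map R P \<theta>'"

lemma left_module_homD:
  assumes "h \<in> left_module_hom R M N"
  shows "x \<in> carrier M \<Longrightarrow> h x \<in> carrier N"
    and "x \<in> carrier M \<Longrightarrow> y \<in> carrier M \<Longrightarrow> h (x \<oplus>\<^bsub>M\<^esub> y) = h x \<oplus>\<^bsub>N\<^esub> h y"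
    and "a \<in> carrier R \<Longrightarrow> x \<in> carrier M \<Longrightarrow> h (a \<odot>\<^bsub>M\<^esub> x) = a \<odot>\<^bsub>N\<^esub> h x"
  using assms by (auto simp: left_module_hom_def)

lemma left_module_homI:
  assumes "\<And>x. x \<in> carrier M \<Longrightarrow> h x \<in> carrier N"
    and "\<And>x y. x \<in> carrier M \<Longrightarrow> y \<in> carrier M \<Longrightarrow> h (x \<oplus>\<^bsub>M\<^esub> y) = h x \<oplus>\<^bsub>N\<^esub> h y"
    and "\<And>a x. a \<in> carrier R \<Longrightarrow> x \<in> carrier M \<Longrightarrow> h (a \<odot>\<^bsub>M\<^esub> x) = a \<odot>\<^bsub>N\<^esub> h x"
  shows "h \<in> left_module_hom R M N"
  using assms by (auto simp: left_module_hom_def)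

lemma left_module_hom_zero:
  assumes "left_module R M" "left_module R N" "h \<in> left_module_hom R M N"
  shows "h \<zero>\<^bsub>M\<^esub> = \<zero>\<^bsub>N\<^esub>"
proof -
  interpret M: left_module R M by fact
  interpret N: left_module R N by fact
  show ?thesis
    using left_module_homD(3)[OF assms(3), of "\<zero>\<^bsub>R\<^esub>" "\<zero>\<^bsub>M\<^esub>"] left_module_homD(1)[OF assms(3), of "\<zero>\<^bsub>M\<^esub>"]
    by (simp add: M.smult_l_null N.smult_l_null)
qed

lemma left_ideal_module_simps [simp]:
  "carrier (left_ideal_module R I) = I" "add (left_ideal_module R I) = add R"
  "smult (left_ideal_module R I) = monoid.mult R" "zero (left_ideal_module R I) = \<zero>\<^bsub>R\<^esub>"
  by (simp_all add: left_ideal_module_def)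

context left_module
begin

lemma finite_rank_map_hom:
  assumes "finite_rank_map R M \<theta>" shows "\<theta> \<in> left_module_hom R M M"
  using assms
proof induction
  case (zero \<theta>)
  show ?case by (rule left_module_homI) (simp_all add: zero smult_r_null)
next
  case (add \<theta> \<phi> u \<theta>')
  note \<theta> = left_module_homD[OF add.IH] and \<phi> = left_module_homD[OF add.hyps(2), simplified]
  show ?case
    by (rule left_module_homI)
      (simp_all add: add.hyps \<theta> \<phi> smult_l_distr smult_r_distr smult_assoc M.a_ac)
qed

lemma finite_rank_map_add:
  assumes "finite_rank_map R M \<theta>" "finite_rank_map R M \<eta>"
    and "\<And>x. x \<in> carrier M \<Longrightarrow> \<theta>' x = \<theta> x \<oplus>\<^bsub>M\<^esub> \<eta> x"
  shows "finite_rank_map R M \<theta>'"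
  using assms(1,3)
proof (induction arbitrary: \<theta>')
  case (zero \<theta>)
  have eq: "\<theta>' x = \<eta> x" if "x \<in> carrier M" for x
    using zero that left_module_homD(1)[OF finite_rank_map_hom[OF assms(2)]] by simp
  \<comment> \<open>The rules fix a map only on the carrier, so the rule that produced
    \<open>\<eta>\<close> also produces \<open>\<theta>'\<close>.\<close>
  from assms(2) show ?case
    by cases (metis eq finite_rank_map.zero, metis eq finite_rank_map.add)
next
  case (add \<theta> \<phi> u \<theta>1)
  have "finite_rank_map R M (\<lambda>x. \<theta> x \<oplus>\<^bsub>M\<^esub> \<eta> x)" by (rule add.IH) simp
  then show ?case
    by (rule finite_rank_map.add[OF _ add.hyps(2,3)])
      (simp add: add.prems add.hyps M.a_assoc left_module_homD(1)[OF add.hyps(2), simplified]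
        left_module_homD(1)[OF finite_rank_map_hom[OF add.hyps(1)]]
        left_module_homD(1)[OF finite_rank_map_hom[OF assms(2)]])
qed

text \<open>Together with \<open>finite_rank_map_comp_right\<close>: the maps of finite rank form a
  two-sided ideal of the endomorphisms. Composition on the left moves the vectors \<open>u\<close>,
  on the right it pulls back the functionals \<open>\<phi>\<close>.\<close>

lemma finite_rank_map_comp_left:
  assumes \<eta>: "\<eta> \<in> left_module_hom R M M" and "finite_rank_map R M \<theta>"
    and "\<And>x. x \<in> carrier M \<Longrightarrow> \<theta>' x = \<eta> (\<theta> x)"
  shows "finite_rank_map R M \<theta>'"
  using assms(2,3)
proof (induction arbitrary: \<theta>')
  case (zero \<theta>)
  then show ?case
    using left_module_hom_zero[OF left_module_axioms left_module_axioms \<eta>]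
    by (intro finite_rank_map.zero) simp
next
  case (add \<theta> \<phi> u \<theta>1)
  have "finite_rank_map R M (\<lambda>x. \<eta> (\<theta> x))" by (rule add.IH) simp
  then show ?case
    by (rule finite_rank_map.add[OF _ add.hyps(2) left_module_homD(1)[OF \<eta> add.hyps(3)]])
      (simp add: add.prems add.hyps left_module_homD[OF \<eta>] left_module_homD(1)[OF add.hyps(2), simplified]
        left_module_homD(1)[OF finite_rank_map_hom[OF add.hyps(1)]])
qed

lemma finite_rank_map_comp_right:
  assumes \<eta>: "\<eta> \<in> left_module_hom R M M" and "finite_rank_map R M \<theta>"
    and "\<And>x. x \<in> carrier M \<Longrightarrow> \<theta>' x = \<theta> (\<eta> x)"
  shows "finite_rank_map R M \<theta>'"
  using assms(2,3)
proof (induction arbitrary: \<theta>')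
  case (zero \<theta>)
  then show ?case
    by (intro finite_rank_map.zero) (simp add: left_module_homD(1)[OF \<eta>])
next
  case (add \<theta> \<phi> u \<theta>1)
  have "finite_rank_map R M (\<lambda>x. \<theta> (\<eta> x))" by (rule add.IH) simp
  moreover have "(\<lambda>x. \<phi> (\<eta> x)) \<in> left_module_hom R M (left_ideal_module R (carrier R))"
    using add.hyps(2) \<eta> by (auto simp: left_module_hom_def Pi_iff)
  ultimately show ?case
    by (rule finite_rank_map.add[OF _ _ add.hyps(3)])
      (simp add: add.prems add.hyps left_module_homD(1)[OF \<eta>])
qed

text \<open>One half of the dual basis lemma. For every \<open>\<theta>\<close> of finite rank,
  \<open>h \<circ> \<theta>\<close> lifts along \<open>g\<close> by choosing a preimage of
  \<open>h u\<close> for each of the finitely many vectors \<open>u\<close>; the identity is the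
  case of interest.\<close>

lemma projective_moduleI:
  assumes id: "finite_rank_map R M (\<lambda>x. x)"
  shows "projective_module R M"
  unfolding projective_module_def
proof (intro conjI left_module_axioms allI impI)
  fix L :: "('r, 'm \<Rightarrow> 'r) module" and N :: "('r, 'm) module" and g h
  assume L: "left_module R L" and N: "left_module R N" and g: "g \<in> left_module_hom R L N"
    and surj: "g ` carrier L = carrier N" and h: "h \<in> left_module_hom R M N"
  interpret L: left_module R L by fact
  interpret N: left_module R N by fact
  have "\<exists>k \<in> left_module_hom R M L. \<forall>x \<in> carrier M. g (k x) = h (\<theta> x)"
    if "finite_rank_map R M \<theta>" for \<theta>
    using that
  proof induction
    case (zero \<theta>)
    have "(\<lambda>x. \<zero>\<^bsub>L\<^esub>) \<in> left_module_hom R M L"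
      by (rule left_module_homI) (simp_all add: L.smult_r_null)
    then show ?case
      using zero left_module_hom_zero[OF L N g] left_module_hom_zero[OF left_module_axioms N h]
      by (intro bexI[of _ "\<lambda>x. \<zero>\<^bsub>L\<^esub>"]) simp_all
  next
    case (add \<theta> \<phi> u \<theta>')
    from add.IH obtain k where k: "k \<in> left_module_hom R M L"
      and gk: "\<And>x. x \<in> carrier M \<Longrightarrow> g (k x) = h (\<theta> x)" by blast
    have "h u \<in> g ` carrier L" using left_module_homD(1)[OF h] add.hyps(3) surj by simp
    then obtain m where m: "m \<in> carrier L" "g m = h u" by auto
    note \<phi> = left_module_homD[OF add.hyps(2), simplified] and k' = left_module_homD[OF k]
    show ?case
    proof (intro bexI[of _ "\<lambda>x. \<phi> x \<odot>\<^bsub>L\<^esub> m \<oplus>\<^bsub>L\<^esub> k x"] ballI)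
      show "(\<lambda>x. \<phi> x \<odot>\<^bsub>L\<^esub> m \<oplus>\<^bsub>L\<^esub> k x) \<in> left_module_hom R M L"
        by (rule left_module_homI)
          (simp_all add: m k' \<phi> L.smult_l_distr L.smult_r_distr L.smult_assoc L.M.a_ac)
      fix x assume x: "x \<in> carrier M"
      show "g (\<phi> x \<odot>\<^bsub>L\<^esub> m \<oplus>\<^bsub>L\<^esub> k x) = h (\<theta>' x)"
        using x m k' \<phi> add.hyps(3) left_module_homD(1)[OF finite_rank_map_hom[OF add.hyps(1)]]
        by (simp add: add.hyps(4) left_module_homD[OF g] left_module_homD[OF h] gk)
    qed
  qed
  from this[OF id] show "\<exists>k \<in> left_module_hom R M L. \<forall>x \<in> carrier M. g (k x) = h x" .
qed

lemma finite_rank_map_finsum: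
  assumes "finite A" "\<And>p. p \<in> A \<Longrightarrow> \<phi> p \<in> left_module_hom R M (left_ideal_module R (carrier R))"
    and "\<And>p. p \<in> A \<Longrightarrow> u p \<in> carrier M"
    and "\<And>x. x \<in> carrier M \<Longrightarrow> \<theta> x = finsum M (\<lambda>p. \<phi> p x \<odot>\<^bsub>M\<^esub> u p) A"
  shows "finite_rank_map R M \<theta>"
  using assms
proof (induction A arbitrary: \<theta> rule: finite_induct)
  case empty
  then show ?case by (intro finite_rank_map.zero) simp
next
  case (insert p A)
  have "finite_rank_map R M (\<lambda>x. finsum M (\<lambda>p. \<phi> p x \<odot>\<^bsub>M\<^esub> u p) A)"
    by (rule insert.IH) (use insert.prems in auto)
  then show ?case
  proof (rule finite_rank_map.add)
    fix x assume x: "x \<in> carrier M"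
    have "\<phi> q x \<odot>\<^bsub>M\<^esub> u q \<in> carrier M" if "q \<in> insert p A" for q
      using that x insert.prems(2)[OF that] left_module_homD(1)[OF insert.prems(1)[OF that]] by simp
    then show "\<theta> x = \<phi> p x \<odot>\<^bsub>M\<^esub> u p \<oplus>\<^bsub>M\<^esub> finsum M (\<lambda>p. \<phi> p x \<odot>\<^bsub>M\<^esub> u p) A"
      using insert.hyps x insert.prems(3) by (simp add: Pi_iff)
  qed (use insert.prems in auto)
qed

end

text \<open>A pointwise form of the other half: a section into the free module on all elements of
  \<open>P\<close> may have infinitely many coordinate functionals, but only finitely many are
  nonzero at \<open>x0\<close>. Testing a single element is what refutes projectivity in
  \<open>projective_sqfree\<close>.\<close>

lemma projective_module_finite_rank:
  assumes P: "projective_module R P" and x0: "x0 \<in> carrier P"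
  shows "\<exists>\<theta>. finite_rank_map R P \<theta> \<and> \<theta> x0 = x0"
proof -
  interpret P: left_module R P using P by (simp add: projective_module_def)
  let ?F = "free_module R (carrier P)"
  have F: "left_module R ?F" by (rule free_module_left_module) (rule P.R.ring_axioms)
  let ?e = "module_comb R P (\<lambda>p. p)"
  have e: "?e \<in> left_module_hom R ?F P" by (rule P.module_comb_hom) auto
  have surj: "?e ` carrier ?F = carrier P"
  proof
    show "?e ` carrier ?F \<subseteq> carrier P" using left_module_homD(1)[OF e] by auto
    show "carrier P \<subseteq> ?e ` carrier ?F"
    proof
      fix x assume x: "x \<in> carrier P"
      let ?d = "\<lambda>p. if p = x then \<one>\<^bsub>R\<^esub> else \<zero>\<^bsub>R\<^esub>"
      have "?d \<in> carrier ?F" using x by (auto simp: free_module_def)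
      moreover have "?e ?d = finsum P (\<lambda>p. ?d p \<odot>\<^bsub>P\<^esub> p) {x}"
        by (rule P.module_comb_superset) (use x in auto)
      then have "?e ?d = x" using x by simp
      ultimately show "x \<in> ?e ` carrier ?F" by (metis imageI)
    qed
  qed
  have id: "(\<lambda>x. x) \<in> left_module_hom R P P" by (simp add: left_module_hom_def)
  from projective_module_lift[OF P F P.left_module_axioms e surj id] obtain s
    where s: "s \<in> left_module_hom R P ?F" and es: "\<And>x. x \<in> carrier P \<Longrightarrow> ?e (s x) = x" by blast
  let ?A = "{p. s x0 p \<noteq> \<zero>\<^bsub>R\<^esub>}"
  have A: "finite ?A" "?A \<subseteq> carrier P"
    using left_module_homD(1)[OF s x0] by (auto simp: free_module_def)
  have hom: "(\<lambda>x. s x p) \<in> left_module_hom R P (left_ideal_module R (carrier R))" for p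
    using s by (auto simp: left_module_hom_def free_module_def Pi_iff)
  have "finite_rank_map R P (\<lambda>x. finsum P (\<lambda>p. s x p \<odot>\<^bsub>P\<^esub> p) ?A)"
    by (rule P.finite_rank_map_finsum[OF A(1), of "\<lambda>p x. s x p" "\<lambda>p. p"]) (use A hom in auto)
  moreover have "finsum P (\<lambda>p. s x0 p \<odot>\<^bsub>P\<^esub> p) ?A = x0"
    using es[OF x0] by (simp add: module_comb_def)
  ultimately show ?thesis by blast
qed

section \<open>Transport along ring isomorphisms\<close>

lemma left_ideal_module_left_module:
  assumes "ring R" "left_ideal I R"
  shows "left_module R (left_ideal_module R I)"
proof -
  interpret ring R by fact
  interpret I: additive_subgroup I R using assms(2) by (simp add: left_ideal_def)
  have sub: "x \<in> I \<Longrightarrow> x \<in> carrier R" for x using I.a_Hcarr .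
  have "abelian_group (left_ideal_module R I)"
  proof (rule abelian_groupI)
    fix x assume "x \<in> carrier (left_ideal_module R I)"
    then show "\<exists>y \<in> carrier (left_ideal_module R I).
        y \<oplus>\<^bsub>left_ideal_module R I\<^esub> x = \<zero>\<^bsub>left_ideal_module R I\<^esub>"
      by (intro bexI[of _ "\<ominus>\<^bsub>R\<^esub> x"]) (auto simp: sub l_neg I.a_inv_closed)
  qed (auto simp: sub a_ac)
  then show ?thesis
    unfolding left_module_def left_module_axioms_def using assms
    by (auto simp: sub l_distr r_distr m_assoc left_ideal_def)
qed

lemma left_module_restrict_scalars:
  assumes "ring R" "h \<in> ring_hom R R'" "left_module R' M"
  shows "left_module R (M\<lparr>smult := \<lambda>a x. h a \<odot>\<^bsub>M\<^esub> x\<rparr>)"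
proof -
  interpret M: left_module R' M by fact
  have "abelian_group (M\<lparr>smult := \<lambda>a x. h a \<odot>\<^bsub>M\<^esub> x\<rparr>)"
    by (rule abelian_groupI) (auto simp: M.M.a_ac intro: M.M.l_neg)
  then show ?thesis
    unfolding left_module_def left_module_axioms_def using assms
    by (auto simp: ring_hom_closed ring_hom_add ring_hom_mult ring_hom_one
        M.smult_l_distr M.smult_r_distr M.smult_assoc)
qed

text \<open>A lifting problem over \<open>R'\<close> becomes one over \<open>R\<close> by
  restricting scalars along \<open>h\<close>, and the inverse \<open>g\<close> carries the solution
  back. This serves to treat the opposite of a crossed product order as another such order.\<close>

lemma left_hereditary_iso:
  fixes R :: "('r, 'a) ring_scheme" and R' :: "('r, 'b) ring_scheme"
  assumes R: "ring R" and R': "ring R'" and h: "h \<in> ring_iso R R'" and her: "left_hereditary R"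
  shows "left_hereditary R'"
  unfolding left_hereditary_def
proof (intro allI impI)
  fix J assume J: "left_ideal J R'"
  interpret R: ring R by fact
  interpret R': ring R' by fact
  have hh: "h \<in> ring_hom R R'" and bij: "bij_betw h (carrier R) (carrier R')"
    using h by (auto simp: ring_iso_def)
  define g where "g = inv_into (carrier R) h"
  have hg: "h (g x) = x" "g x \<in> carrier R" if "x \<in> carrier R'" for x
    using bij that unfolding g_def by (auto simp: bij_betw_def f_inv_into_f inv_into_into)
  have gh: "g (h x) = x" if "x \<in> carrier R" for x
    using bij that unfolding g_def by (auto simp: bij_betw_def)
  interpret h: ring_hom_ring R R' h
    by (rule ring_hom_ringI2) (use R R' hh in auto)
  have ghom: "g \<in> ring_hom R' R"
  proof (rule ring_hom_memI)
    fix x y assume "x \<in> carrier R'" "y \<in> carrier R'"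
    then have "h (g x \<otimes>\<^bsub>R\<^esub> g y) = x \<otimes>\<^bsub>R'\<^esub> y" "h (g x \<oplus>\<^bsub>R\<^esub> g y) = x \<oplus>\<^bsub>R'\<^esub> y"
      "g x \<otimes>\<^bsub>R\<^esub> g y \<in> carrier R" "g x \<oplus>\<^bsub>R\<^esub> g y \<in> carrier R" by (simp_all add: hg)
    then show "g (x \<otimes>\<^bsub>R'\<^esub> y) = g x \<otimes>\<^bsub>R\<^esub> g y" "g (x \<oplus>\<^bsub>R'\<^esub> y) = g x \<oplus>\<^bsub>R\<^esub> g y"
      by (metis gh)+
  next
    show "g \<one>\<^bsub>R'\<^esub> = \<one>\<^bsub>R\<^esub>" using gh[of "\<one>\<^bsub>R\<^esub>"] by simp
  qed (rule hg)
  interpret J: additive_subgroup J R' using J by (simp add: left_ideal_def)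
  define I where "I = g ` J"
  have hI: "h x \<in> J" if "x \<in> I" for x using that J.a_subset by (auto simp: I_def hg)
  have gJ: "g x \<in> I" if "x \<in> J" for x using that by (auto simp: I_def)
  have Isub: "I \<subseteq> carrier R" using J.a_subset hg by (auto simp: I_def)
  have memI: "x \<in> I \<longleftrightarrow> x \<in> carrier R \<and> h x \<in> J" for x
    using hI Isub gh unfolding I_def by (metis gJ I_def subsetD)
  have "left_ideal I R"
    unfolding left_ideal_def
  proof (intro conjI ballI)
    show "additive_subgroup I R"
    proof (rule additive_subgroup.intro, rule R.add.subgroupI)
      show "I \<subseteq> carrier R" by fact
      show "I \<noteq> {}" using J.zero_closed gJ by blast
    qed (use J J.a_closed in \<open>simp_all add: memI J.a_inv_closed flip: a_inv_def\<close>)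
    fix r x assume "r \<in> carrier R" "x \<in> I"
    then show "r \<otimes>\<^bsub>R\<^esub> x \<in> I" using J by (simp add: memI left_ideal_def)
  qed
  then have proj: "projective_module R (left_ideal_module R I)"
    using her by (simp add: left_hereditary_def)
  show "projective_module R' (left_ideal_module R' J)"
    unfolding projective_module_def
  proof (intro conjI allI impI left_ideal_module_left_module R' J)
    fix M :: "('r, 'r \<Rightarrow> 'r) module" and N :: "('r, 'r) module" and p q
    assume M: "left_module R' M" and N: "left_module R' N" and p: "p \<in> left_module_hom R' M N"
      and surj: "p ` carrier M = carrier N"
      and q: "q \<in> left_module_hom R' (left_ideal_module R' J) N"
    let ?M = "M\<lparr>smult := \<lambda>a x. h a \<odot>\<^bsub>M\<^esub> x\<rparr>" and ?N = "N\<lparr>smult := \<lambda>a x. h a \<odot>\<^bsub>N\<^esub> x\<rparr>"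
    have M1: "left_module R ?M" and N1: "left_module R ?N"
      using left_module_restrict_scalars[OF R hh] M N by auto
    have p1: "p \<in> left_module_hom R ?M ?N" using p by (auto simp: left_module_hom_def)
    have q1: "(\<lambda>x. q (h x)) \<in> left_module_hom R (left_ideal_module R I) ?N"
      using q Isub hI by (auto simp: left_module_hom_def Pi_iff subset_iff)
    have "p ` carrier ?M = carrier ?N" using surj by simp
    from projective_module_lift[OF proj M1 N1 p1 this q1] obtain k where
      k: "k \<in> left_module_hom R (left_ideal_module R I) ?M"
      and pk: "\<forall>x \<in> I. p (k x) = q (h x)" by auto
    show "\<exists>k \<in> left_module_hom R' (left_ideal_module R' J) M.
        \<forall>x \<in> carrier (left_ideal_module R' J). p (k x) = q x"
    proof (intro bexI[of _ "\<lambda>x. k (g x)"] ballI)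
      fix x assume "x \<in> carrier (left_ideal_module R' J)"
      then show "p (k (g x)) = q x" using pk gJ J.a_subset by (auto simp: hg)
    next
      show "(\<lambda>x. k (g x)) \<in> left_module_hom R' (left_ideal_module R' J) M"
      proof (rule left_module_homI)
        fix x assume "x \<in> carrier (left_ideal_module R' J)"
        then show "k (g x) \<in> carrier M" using left_module_homD(1)[OF k] gJ by simp
      next
        fix x y assume "x \<in> carrier (left_ideal_module R' J)" "y \<in> carrier (left_ideal_module R' J)"
        then show "k (g (x \<oplus>\<^bsub>left_ideal_module R' J\<^esub> y)) = k (g x) \<oplus>\<^bsub>M\<^esub> k (g y)"
          using left_module_homD(2)[OF k] gJ J.a_subset by (simp add: ring_hom_add[OF ghom])
      next
        fix a x assume "a \<in> carrier R'" "x \<in> carrier (left_ideal_module R' J)"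
        then show "k (g (a \<odot>\<^bsub>left_ideal_module R' J\<^esub> x)) = a \<odot>\<^bsub>M\<^esub> k (g x)"
          using left_module_homD(3)[OF k, of "g a" "g x"] gJ J.a_subset
          by (simp add: ring_hom_mult[OF ghom] hg)
      qed
    qed
  qed
qed

section \<open>Crossed products\<close>

context field
begin

lemma inv_nonzero_closed [simp, intro]: "a \<in> carrier R \<Longrightarrow> a \<noteq> \<zero> \<Longrightarrow> inv a \<in> carrier R"
  using field_Units by auto

lemma r_inv_nonzero [simp]: "a \<in> carrier R \<Longrightarrow> a \<noteq> \<zero> \<Longrightarrow> a \<otimes> inv a = \<one>"
  using field_Units by auto

lemma l_inv_nonzero [simp]: "a \<in> carrier R \<Longrightarrow> a \<noteq> \<zero> \<Longrightarrow> inv a \<otimes> a = \<one>"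
  using field_Units by auto

lemma inv_nonzero [simp]: "a \<in> carrier R \<Longrightarrow> a \<noteq> \<zero> \<Longrightarrow> inv a \<noteq> \<zero>"
  by (metis l_inv_nonzero l_null one_not_zero)

lemma inv_cancel [simp]:
  assumes "a \<in> carrier R" "a \<noteq> \<zero>" "b \<in> carrier R"
  shows "a \<otimes> (inv a \<otimes> b) = b" "inv a \<otimes> (a \<otimes> b) = b"
  using assms by (simp_all flip: m_assoc)

lemma nonzero_mult [simp]:
  "a \<in> carrier R \<Longrightarrow> b \<in> carrier R \<Longrightarrow> a \<otimes> b = \<zero> \<longleftrightarrow> a = \<zero> \<or> b = \<zero>"
  using integral_iff by blast

lemma inv_mult_nonzero:
  assumes "a \<in> carrier R" "a \<noteq> \<zero>" "b \<in> carrier R" "b \<noteq> \<zero>"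
  shows "inv (a \<otimes> b) = inv a \<otimes> inv b"
proof (rule comm_inv_char)
  have "a \<otimes> b \<otimes> (inv a \<otimes> inv b) = a \<otimes> inv a \<otimes> (b \<otimes> inv b)"
    using assms by (simp add: m_ac del: r_inv_nonzero inv_cancel)
  then show "a \<otimes> b \<otimes> (inv a \<otimes> inv b) = \<one>" using assms by simp
qed (use assms in auto)

lemma inv_mult_cancel_left:
  assumes "a \<in> carrier R" "a \<noteq> \<zero>" "b \<in> carrier R" "b \<noteq> \<zero>" "d \<in> carrier R"
  shows "inv (b \<otimes> a) \<otimes> (b \<otimes> d) = inv a \<otimes> d"
proof -
  have "ib \<otimes> ia \<otimes> (b \<otimes> d) = ia \<otimes> d \<otimes> (ib \<otimes> b)"
    if "ib \<in> carrier R" "ia \<in> carrier R" for ia ib using assms that by (simp add: m_ac)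
  from this[of "inv b" "inv a"] show ?thesis using assms by (simp add: inv_mult_nonzero)
qed

lemma nonzero_cancel:
  assumes "a \<in> carrier R" "a \<noteq> \<zero>" "b \<in> carrier R" "c \<in> carrier R" "a \<otimes> b = a \<otimes> c"
  shows "b = c"
  using assms m_lcancel by blast

end

text \<open>Of the Galois group only a finite group acting by ring homomorphisms is kept, and
  \<open>f\<close> stays a parameter, so that all results can be instantiated again with the
  opposite cocycle.\<close>

locale crossed = field K for K (structure) +
  fixes G :: "('a \<Rightarrow> 'a) monoid" and f :: "('a \<Rightarrow> 'a) \<Rightarrow> ('a \<Rightarrow> 'a) \<Rightarrow> 'a"
  assumes grp: "group G" and fin [simp]: "finite (carrier G)"
    and aut: "\<sigma> \<in> carrier G \<Longrightarrow> \<sigma> \<in> ring_hom K K"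
    and act_mult: "\<sigma> \<in> carrier G \<Longrightarrow> \<tau> \<in> carrier G \<Longrightarrow> a \<in> carrier K \<Longrightarrow>
      (\<sigma> \<otimes>\<^bsub>G\<^esub> \<tau>) a = \<sigma> (\<tau> a)"
    and act_one [simp]: "a \<in> carrier K \<Longrightarrow> \<one>\<^bsub>G\<^esub> a = a"
    and cocycle: "normalized_cocycle K G f"
begin

sublocale G: group G by (rule grp)

lemma hom_cring: "\<sigma> \<in> carrier G \<Longrightarrow> ring_hom_cring K K \<sigma>"
  by (intro ring_hom_cring.intro ring_hom_cring_axioms.intro aut is_cring)

lemma act_closed [simp]: "\<sigma> \<in> carrier G \<Longrightarrow> a \<in> carrier K \<Longrightarrow> \<sigma> a \<in> carrier K"
  using aut ring_hom_closed by metis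
lemma act_add: "\<sigma> \<in> carrier G \<Longrightarrow> a \<in> carrier K \<Longrightarrow> b \<in> carrier K \<Longrightarrow> \<sigma> (a \<oplus> b) = \<sigma> a \<oplus> \<sigma> b"
  using aut ring_hom_add by metis
lemma act_times: "\<sigma> \<in> carrier G \<Longrightarrow> a \<in> carrier K \<Longrightarrow> b \<in> carrier K \<Longrightarrow> \<sigma> (a \<otimes> b) = \<sigma> a \<otimes> \<sigma> b"
  using aut ring_hom_mult by metis
lemma act_unit [simp]: "\<sigma> \<in> carrier G \<Longrightarrow> \<sigma> \<one> = \<one>"
  using aut ring_hom_one by metis
lemma act_zero [simp]: "\<sigma> \<in> carrier G \<Longrightarrow> \<sigma> \<zero> = \<zero>"
  using ring_hom_cring.hom_zero[OF hom_cring] .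
lemma act_neg: "\<sigma> \<in> carrier G \<Longrightarrow> a \<in> carrier K \<Longrightarrow> \<sigma> (\<ominus> a) = \<ominus> \<sigma> a"
  using ring_hom_cring.hom_a_inv[OF hom_cring] .
lemma act_finsum: "\<sigma> \<in> carrier G \<Longrightarrow> h \<in> A \<rightarrow> carrier K \<Longrightarrow> \<sigma> (finsum K h A) = finsum K (\<lambda>i. \<sigma> (h i)) A"
  using ring_hom_cring.hom_finsum[OF hom_cring, of \<sigma> h A] by (simp add: o_def)

lemma act_inv_act [simp]: "\<sigma> \<in> carrier G \<Longrightarrow> a \<in> carrier K \<Longrightarrow> (inv\<^bsub>G\<^esub> \<sigma>) (\<sigma> a) = a"
  using act_mult[of "inv\<^bsub>G\<^esub> \<sigma>" \<sigma> a] by simp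
lemma act_act_inv [simp]: "\<sigma> \<in> carrier G \<Longrightarrow> a \<in> carrier K \<Longrightarrow> \<sigma> ((inv\<^bsub>G\<^esub> \<sigma>) a) = a"
  using act_mult[of \<sigma> "inv\<^bsub>G\<^esub> \<sigma>" a] by simp

lemma act_eq_zero [simp]: "\<sigma> \<in> carrier G \<Longrightarrow> a \<in> carrier K \<Longrightarrow> \<sigma> a = \<zero> \<longleftrightarrow> a = \<zero>"
  by (metis act_inv_act act_zero G.inv_closed)

lemma act_inverse:
  assumes "\<sigma> \<in> carrier G" "a \<in> carrier K" "a \<noteq> \<zero>"
  shows "\<sigma> (inv a) = inv (\<sigma> a)"
proof -
  have "\<sigma> a \<otimes> \<sigma> (inv a) = \<one>" using assms by (simp flip: act_times)
  then show ?thesis using assms by (intro comm_inv_char[symmetric]) auto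
qed

lemma f_closed [simp, intro]: "\<sigma> \<in> carrier G \<Longrightarrow> \<tau> \<in> carrier G \<Longrightarrow> f \<sigma> \<tau> \<in> carrier K"
  and f_nonzero [simp]: "\<sigma> \<in> carrier G \<Longrightarrow> \<tau> \<in> carrier G \<Longrightarrow> f \<sigma> \<tau> \<noteq> \<zero>"
  and f_one_left [simp]: "\<sigma> \<in> carrier G \<Longrightarrow> f \<one>\<^bsub>G\<^esub> \<sigma> = \<one>"
  and f_one_right [simp]: "\<sigma> \<in> carrier G \<Longrightarrow> f \<sigma> \<one>\<^bsub>G\<^esub> = \<one>"
  and f_cocycle: "\<sigma> \<in> carrier G \<Longrightarrow> \<tau> \<in> carrier G \<Longrightarrow> \<gamma> \<in> carrier G \<Longrightarrow>
    \<sigma> (f \<tau> \<gamma>) \<otimes> f \<sigma> (\<tau> \<otimes>\<^bsub>G\<^esub> \<gamma>) = f \<sigma> \<tau> \<otimes> f (\<sigma> \<otimes>\<^bsub>G\<^esub> \<tau>) \<gamma>"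
  using cocycle unfolding normalized_cocycle_def by auto

lemma inv_mult_cancel [simp]:
  assumes "\<sigma> \<in> carrier G" "\<rho> \<in> carrier G"
  shows "\<sigma> \<otimes>\<^bsub>G\<^esub> (inv\<^bsub>G\<^esub> \<sigma> \<otimes>\<^bsub>G\<^esub> \<rho>) = \<rho>" "inv\<^bsub>G\<^esub> \<sigma> \<otimes>\<^bsub>G\<^esub> (\<sigma> \<otimes>\<^bsub>G\<^esub> \<rho>) = \<rho>"
    "\<rho> \<otimes>\<^bsub>G\<^esub> inv\<^bsub>G\<^esub> \<sigma> \<otimes>\<^bsub>G\<^esub> \<sigma> = \<rho>" "\<rho> \<otimes>\<^bsub>G\<^esub> \<sigma> \<otimes>\<^bsub>G\<^esub> inv\<^bsub>G\<^esub> \<sigma> = \<rho>"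
  using assms by (simp_all add: G.m_assoc) (simp_all flip: G.m_assoc)

text \<open>The cocycle identity at (\<tau>, \<tau>^-1, \<tau>\<gamma>). It exhibits every value
  \<open>f \<tau> \<gamma>\<close> as a divisor of the value at (\<tau>, \<tau>^-1), which is why
  only values at inverse pairs have to be controlled.\<close>

lemma f_inv_split:
  assumes "\<tau> \<in> carrier G" "\<gamma> \<in> carrier G"
  shows "f \<tau> \<gamma> \<otimes> \<tau> (f (inv\<^bsub>G\<^esub> \<tau>) (\<tau> \<otimes>\<^bsub>G\<^esub> \<gamma>)) = f \<tau> (inv\<^bsub>G\<^esub> \<tau>)"
  using f_cocycle[of \<tau> "inv\<^bsub>G\<^esub> \<tau>" "\<tau> \<otimes>\<^bsub>G\<^esub> \<gamma>"] assms by (simp add: m_comm)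

lemma act_f_inv: "\<tau> \<in> carrier G \<Longrightarrow> \<tau> (f (inv\<^bsub>G\<^esub> \<tau>) \<tau>) = f \<tau> (inv\<^bsub>G\<^esub> \<tau>)"
  using f_inv_split[of \<tau> "\<one>\<^bsub>G\<^esub>"] by simp

abbreviation \<Sigma> where "\<Sigma> \<equiv> crossed_product K G f"
abbreviation Sigma_mult (infixl "\<star>" 70) where "x \<star> y \<equiv> x \<otimes>\<^bsub>\<Sigma>\<^esub> y"
abbreviation Sigma_add (infixl "\<boxplus>" 65) where "x \<boxplus> y \<equiv> x \<oplus>\<^bsub>\<Sigma>\<^esub> y"
abbreviation G_inv ("\<iota> _" [81] 80) where "\<iota> \<sigma> \<equiv> inv\<^bsub>G\<^esub> \<sigma>"
abbreviation G_mult (infixl "\<bullet>" 70) where "\<sigma> \<bullet> \<tau> \<equiv> \<sigma> \<otimes>\<^bsub>G\<^esub> \<tau>"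

lemma carrier_Sigma: "carrier \<Sigma> = carrier G \<rightarrow>\<^sub>E carrier K"
  and zero_Sigma: "\<zero>\<^bsub>\<Sigma>\<^esub> = (\<lambda>\<rho> \<in> carrier G. \<zero>)"
  and one_Sigma: "\<one>\<^bsub>\<Sigma>\<^esub> = (\<lambda>\<rho> \<in> carrier G. if \<rho> = \<one>\<^bsub>G\<^esub> then \<one> else \<zero>)"
  by (simp_all add: crossed_product_def)

lemma Sigma_closed [simp]: "x \<in> carrier \<Sigma> \<Longrightarrow> \<rho> \<in> carrier G \<Longrightarrow> x \<rho> \<in> carrier K"
  by (auto simp: carrier_Sigma)

lemma Sigma_add [simp]: "\<rho> \<in> carrier G \<Longrightarrow> (x \<boxplus> y) \<rho> = x \<rho> \<oplus> y \<rho>"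
  by (simp add: crossed_product_def)

lemma Sigma_zero [simp]: "\<rho> \<in> carrier G \<Longrightarrow> \<zero>\<^bsub>\<Sigma>\<^esub> \<rho> = \<zero>"
  by (simp add: crossed_product_def)

lemma Sigma_eqI:
  assumes "x \<in> carrier \<Sigma>" "y \<in> carrier \<Sigma>" "\<And>\<rho>. \<rho> \<in> carrier G \<Longrightarrow> x \<rho> = y \<rho>"
  shows "x = y"
  using assms by (auto simp: carrier_Sigma intro: PiE_ext)

lemma Sigma_abelian: "abelian_group \<Sigma>"
proof (rule abelian_groupI)
  fix x assume "x \<in> carrier \<Sigma>"
  then show "\<exists>y \<in> carrier \<Sigma>. y \<boxplus> x = \<zero>\<^bsub>\<Sigma>\<^esub>"
    by (intro bexI[of _ "\<lambda>\<rho> \<in> carrier G. \<ominus> x \<rho>"])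
      (auto simp: crossed_product_def l_neg PiE_iff)
qed (auto simp: crossed_product_def fun_eq_iff a_ac PiE_iff restrict_def extensional_def)

sublocale S: abelian_group \<Sigma> by (rule Sigma_abelian)

definition scal :: "'a \<Rightarrow> (('a \<Rightarrow> 'a) \<Rightarrow> 'a) \<Rightarrow> ('a \<Rightarrow> 'a) \<Rightarrow> 'a" where
  "scal a x = (\<lambda>\<rho> \<in> carrier G. a \<otimes> x \<rho>)"

text \<open>Left multiplication by \<open>x\<^sub>\<sigma>\<close> and its inverse.\<close>

definition lx :: "('a \<Rightarrow> 'a) \<Rightarrow> (('a \<Rightarrow> 'a) \<Rightarrow> 'a) \<Rightarrow> ('a \<Rightarrow> 'a) \<Rightarrow> 'a" where
  "lx \<sigma> x = (\<lambda>\<rho> \<in> carrier G. \<sigma> (x (\<iota> \<sigma> \<bullet> \<rho>)) \<otimes> f \<sigma> (\<iota> \<sigma> \<bullet> \<rho>))"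

definition ly :: "('a \<Rightarrow> 'a) \<Rightarrow> (('a \<Rightarrow> 'a) \<Rightarrow> 'a) \<Rightarrow> ('a \<Rightarrow> 'a) \<Rightarrow> 'a" where
  "ly \<sigma> x = scal (inv (f (\<iota> \<sigma>) \<sigma>)) (lx (\<iota> \<sigma>) x)"

definition unit_vec :: "('a \<Rightarrow> 'a) \<Rightarrow> ('a \<Rightarrow> 'a) \<Rightarrow> 'a" where
  "unit_vec \<sigma> = (\<lambda>\<rho> \<in> carrier G. if \<rho> = \<sigma> then \<one> else \<zero>)"

text \<open>Every \<open>K\<close>-linear functional on the crossed product has this form, so
  functionals are handled as vectors \<open>c\<close> and their linearity is automatic.\<close>

definition dot :: "(('a \<Rightarrow> 'a) \<Rightarrow> 'a) \<Rightarrow> (('a \<Rightarrow> 'a) \<Rightarrow> 'a) \<Rightarrow> 'a" where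
  "dot c x = finsum K (\<lambda>\<rho>. c \<rho> \<otimes> x \<rho>) (carrier G)"

lemma scal_closed [simp, intro]: "a \<in> carrier K \<Longrightarrow> x \<in> carrier \<Sigma> \<Longrightarrow> scal a x \<in> carrier \<Sigma>"
  by (auto simp: scal_def carrier_Sigma)

lemma scal_app [simp]: "\<rho> \<in> carrier G \<Longrightarrow> scal a x \<rho> = a \<otimes> x \<rho>"
  by (simp add: scal_def)

lemma lx_closed [simp, intro]: "\<sigma> \<in> carrier G \<Longrightarrow> x \<in> carrier \<Sigma> \<Longrightarrow> lx \<sigma> x \<in> carrier \<Sigma>"
  by (auto simp: lx_def carrier_Sigma PiE_iff)

lemma lx_app: "\<rho> \<in> carrier G \<Longrightarrow>
  lx \<sigma> x \<rho> = \<sigma> (x (\<iota> \<sigma> \<bullet> \<rho>)) \<otimes> f \<sigma> (\<iota> \<sigma> \<bullet> \<rho>)"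
  by (simp add: lx_def)

lemma ly_closed [simp, intro]: "\<sigma> \<in> carrier G \<Longrightarrow> x \<in> carrier \<Sigma> \<Longrightarrow> ly \<sigma> x \<in> carrier \<Sigma>"
  by (auto simp: ly_def)

lemma unit_vec_closed [simp, intro]: "unit_vec \<sigma> \<in> carrier \<Sigma>"
  by (auto simp: unit_vec_def carrier_Sigma)

lemma dot_closed [simp, intro]: "c \<in> carrier \<Sigma> \<Longrightarrow> x \<in> carrier \<Sigma> \<Longrightarrow> dot c x \<in> carrier K"
  by (auto simp: dot_def)

lemma Sigma_finsum_app:
  assumes "finite A" "h \<in> A \<rightarrow> carrier \<Sigma>" "\<rho> \<in> carrier G"
  shows "finsum \<Sigma> h A \<rho> = finsum K (\<lambda>i. h i \<rho>) A"
  using assms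
proof (induction A rule: finite_induct)
  case (insert i A)
  then have "(\<lambda>i. h i \<rho>) \<in> A \<rightarrow> carrier K" "h i \<rho> \<in> carrier K"
    by (simp_all add: Pi_iff)
  then show ?case using insert by (simp add: Pi_iff)
qed simp

lemma scal_add: "a \<in> carrier K \<Longrightarrow> x \<in> carrier \<Sigma> \<Longrightarrow> y \<in> carrier \<Sigma> \<Longrightarrow>
    scal a (x \<boxplus> y) = scal a x \<boxplus> scal a y"
  by (rule Sigma_eqI) (auto simp: r_distr)
lemma scal_add_left: "a \<in> carrier K \<Longrightarrow> b \<in> carrier K \<Longrightarrow> x \<in> carrier \<Sigma> \<Longrightarrow>
    scal (a \<oplus> b) x = scal a x \<boxplus> scal b x"
  by (rule Sigma_eqI) (auto simp: l_distr)
lemma scal_scal: "a \<in> carrier K \<Longrightarrow> b \<in> carrier K \<Longrightarrow> x \<in> carrier \<Sigma> \<Longrightarrow>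
    scal a (scal b x) = scal (a \<otimes> b) x"
  by (rule Sigma_eqI) (auto simp: m_assoc)
lemma scal_one [simp]: "x \<in> carrier \<Sigma> \<Longrightarrow> scal \<one> x = x"
  by (rule Sigma_eqI) auto
lemma scal_zero_left [simp]: "x \<in> carrier \<Sigma> \<Longrightarrow> scal \<zero> x = \<zero>\<^bsub>\<Sigma>\<^esub>"
  by (rule Sigma_eqI) auto
lemma scal_zero [simp]: "a \<in> carrier K \<Longrightarrow> scal a \<zero>\<^bsub>\<Sigma>\<^esub> = \<zero>\<^bsub>\<Sigma>\<^esub>"
  by (rule Sigma_eqI) auto

lemma scal_finsum:
  assumes "finite A" "h \<in> A \<rightarrow> carrier \<Sigma>" "a \<in> carrier K"
  shows "scal a (finsum \<Sigma> h A) = finsum \<Sigma> (\<lambda>i. scal a (h i)) A"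
  using assms by (induction A rule: finite_induct) (auto simp: scal_add Pi_iff)

lemma scal_finsum_left:
  assumes "finite A" "h \<in> A \<rightarrow> carrier K" "x \<in> carrier \<Sigma>"
  shows "scal (finsum K h A) x = finsum \<Sigma> (\<lambda>i. scal (h i) x) A"
  using assms by (induction A rule: finite_induct) (auto simp: scal_add_left Pi_iff)

lemma lx_add: "\<sigma> \<in> carrier G \<Longrightarrow> x \<in> carrier \<Sigma> \<Longrightarrow> y \<in> carrier \<Sigma> \<Longrightarrow>
    lx \<sigma> (x \<boxplus> y) = lx \<sigma> x \<boxplus> lx \<sigma> y"
  by (rule Sigma_eqI) (auto simp: lx_app act_add l_distr)
lemma lx_zero [simp]: "\<sigma> \<in> carrier G \<Longrightarrow> lx \<sigma> \<zero>\<^bsub>\<Sigma>\<^esub> = \<zero>\<^bsub>\<Sigma>\<^esub>"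
  by (rule Sigma_eqI) (auto simp: lx_app)
lemma lx_scal: "\<sigma> \<in> carrier G \<Longrightarrow> a \<in> carrier K \<Longrightarrow> x \<in> carrier \<Sigma> \<Longrightarrow>
    lx \<sigma> (scal a x) = scal (\<sigma> a) (lx \<sigma> x)"
  by (rule Sigma_eqI) (auto simp: lx_app act_times m_assoc)
lemma lx_one [simp]: "x \<in> carrier \<Sigma> \<Longrightarrow> lx \<one>\<^bsub>G\<^esub> x = x"
  by (rule Sigma_eqI) (auto simp: lx_app)

text \<open>Coordinate by coordinate this is the cocycle identity at
  \<open>(\<sigma>, \<tau>, ?\<kappa>)\<close>.\<close>

lemma lx_lx:
  assumes "\<sigma> \<in> carrier G" "\<tau> \<in> carrier G" "x \<in> carrier \<Sigma>"
  shows "lx \<sigma> (lx \<tau> x) = scal (f \<sigma> \<tau>) (lx (\<sigma> \<bullet> \<tau>) x)"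
proof (rule Sigma_eqI)
  fix \<rho> assume \<rho>: "\<rho> \<in> carrier G"
  let ?\<kappa> = "\<iota> \<tau> \<bullet> (\<iota> \<sigma> \<bullet> \<rho>)"
  have \<kappa>: "?\<kappa> \<in> carrier G" using assms \<rho> by simp
  have "\<iota> (\<sigma> \<bullet> \<tau>) \<bullet> \<rho> = ?\<kappa>" using assms \<rho> by (simp add: G.inv_mult_group G.m_assoc)
  moreover have "\<sigma> (f \<tau> ?\<kappa>) \<otimes> f \<sigma> (\<iota> \<sigma> \<bullet> \<rho>) = f \<sigma> \<tau> \<otimes> f (\<sigma> \<bullet> \<tau>) ?\<kappa>"
    using f_cocycle[of \<sigma> \<tau> ?\<kappa>] assms \<rho> by simp
  ultimately show "lx \<sigma> (lx \<tau> x) \<rho> = scal (f \<sigma> \<tau>) (lx (\<sigma> \<bullet> \<tau>) x) \<rho>"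
    using assms \<rho> \<kappa> by (simp add: lx_app act_times m_assoc act_mult) (simp add: m_ac)
qed (use assms in auto)

lemma lx_finsum:
  assumes "finite A" "h \<in> A \<rightarrow> carrier \<Sigma>" "\<sigma> \<in> carrier G"
  shows "lx \<sigma> (finsum \<Sigma> h A) = finsum \<Sigma> (\<lambda>i. lx \<sigma> (h i)) A"
  using assms by (induction A rule: finite_induct) (auto simp: lx_add Pi_iff)

lemma ly_lx [simp]: "\<sigma> \<in> carrier G \<Longrightarrow> x \<in> carrier \<Sigma> \<Longrightarrow> ly \<sigma> (lx \<sigma> x) = x"
  by (simp add: ly_def lx_lx scal_scal)

lemma ly_add: "\<sigma> \<in> carrier G \<Longrightarrow> x \<in> carrier \<Sigma> \<Longrightarrow> y \<in> carrier \<Sigma> \<Longrightarrow>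
    ly \<sigma> (x \<boxplus> y) = ly \<sigma> x \<boxplus> ly \<sigma> y"
  by (simp add: ly_def lx_add scal_add)

lemma ly_scal:
  assumes "\<sigma> \<in> carrier G" "a \<in> carrier K" "x \<in> carrier \<Sigma>"
  shows "ly \<sigma> (scal a x) = scal ((\<iota> \<sigma>) a) (ly \<sigma> x)"
  using assms by (simp add: ly_def lx_scal scal_scal m_comm)

lemma ly_zero [simp]: "\<sigma> \<in> carrier G \<Longrightarrow> ly \<sigma> \<zero>\<^bsub>\<Sigma>\<^esub> = \<zero>\<^bsub>\<Sigma>\<^esub>"
  by (simp add: ly_def)

lemma dot_add:
  assumes "c \<in> carrier \<Sigma>" "x \<in> carrier \<Sigma>" "y \<in> carrier \<Sigma>"
  shows "dot c (x \<boxplus> y) = dot c x \<oplus> dot c y"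
proof -
  have "dot c (x \<boxplus> y) = finsum K (\<lambda>\<rho>. c \<rho> \<otimes> x \<rho> \<oplus> c \<rho> \<otimes> y \<rho>) (carrier G)"
    unfolding dot_def by (rule finsum_cong') (use assms in \<open>auto simp: r_distr\<close>)
  also have "\<dots> = dot c x \<oplus> dot c y"
    unfolding dot_def by (rule finsum_addf) (use assms in auto)
  finally show ?thesis .
qed

lemma dot_commute: "c \<in> carrier \<Sigma> \<Longrightarrow> x \<in> carrier \<Sigma> \<Longrightarrow> dot c x = dot x c"
  unfolding dot_def by (rule finsum_cong') (auto simp: m_comm)

lemma dot_add_left: "c \<in> carrier \<Sigma> \<Longrightarrow> x \<in> carrier \<Sigma> \<Longrightarrow> y \<in> carrier \<Sigma> \<Longrightarrow>
    dot (x \<boxplus> y) c = dot x c \<oplus> dot y c"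
  by (simp add: dot_add dot_commute[of _ c])

lemma dot_scal:
  assumes "c \<in> carrier \<Sigma>" "x \<in> carrier \<Sigma>" "a \<in> carrier K"
  shows "dot c (scal a x) = a \<otimes> dot c x"
proof -
  have "a \<otimes> dot c x = finsum K (\<lambda>\<rho>. a \<otimes> (c \<rho> \<otimes> x \<rho>)) (carrier G)"
    unfolding dot_def by (rule finsum_rdistr) (use assms in auto)
  also have "\<dots> = dot c (scal a x)"
    unfolding dot_def by (rule finsum_cong') (use assms in \<open>auto simp: m_lcomm\<close>)
  finally show ?thesis ..
qed

lemma dot_scal_left: "c \<in> carrier \<Sigma> \<Longrightarrow> x \<in> carrier \<Sigma> \<Longrightarrow> a \<in> carrier K \<Longrightarrow>
    dot (scal a c) x = a \<otimes> dot c x"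
  by (simp add: dot_scal dot_commute[of _ x])

lemma dot_zero [simp]: "c \<in> carrier \<Sigma> \<Longrightarrow> dot c \<zero>\<^bsub>\<Sigma>\<^esub> = \<zero>"
  unfolding dot_def by (rule add.finprod_one_eqI) auto
lemma dot_unit_vec:
  assumes "\<rho> \<in> carrier G" "x \<in> carrier \<Sigma>"
  shows "dot (unit_vec \<rho>) x = x \<rho>"
proof -
  have "dot (unit_vec \<rho>) x = finsum K (\<lambda>\<kappa>. if \<rho> = \<kappa> then x \<kappa> else \<zero>) (carrier G)"
    unfolding dot_def unit_vec_def by (rule finsum_cong') (use assms in auto)
  also have "\<dots> = x \<rho>" by (rule finsum_singleton) (use assms in auto)
  finally show ?thesis .
qed

text \<open>The pairs with product \<open>\<rho>\<close> are parametrized by their first component.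
  In this form a product is a combination of left translations, and the ring axioms reduce to rules
  for \<open>scal\<close> and \<open>lx\<close>.\<close>

lemma Sigma_mult:
  assumes "x \<in> carrier \<Sigma>" "y \<in> carrier \<Sigma>"
  shows "x \<star> y = finsum \<Sigma> (\<lambda>\<sigma>. scal (x \<sigma>) (lx \<sigma> y)) (carrier G)"
proof
  fix \<rho>
  show "(x \<star> y) \<rho> = finsum \<Sigma> (\<lambda>\<sigma>. scal (x \<sigma>) (lx \<sigma> y)) (carrier G) \<rho>"
  proof (cases "\<rho> \<in> carrier G")
    case False
    moreover have "finsum \<Sigma> (\<lambda>\<sigma>. scal (x \<sigma>) (lx \<sigma> y)) (carrier G) \<in> carrier \<Sigma>"
      using assms by auto
    ultimately show ?thesis
      by (auto simp: crossed_product_def PiE_iff extensional_def)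
  next
    case True
    let ?h = "\<lambda>\<sigma>. (\<sigma>, \<iota> \<sigma> \<bullet> \<rho>)"
    have *: "{(\<sigma>, \<tau>). \<sigma> \<in> carrier G \<and> \<tau> \<in> carrier G \<and> \<sigma> \<bullet> \<tau> = \<rho>} = ?h ` carrier G"
      using True by (auto simp: image_iff)
    have "(x \<star> y) \<rho> = finsum K (\<lambda>(\<sigma>, \<tau>). x \<sigma> \<otimes> \<sigma> (y \<tau>) \<otimes> f \<sigma> \<tau>) (?h ` carrier G)"
      unfolding *[symmetric] using True by (simp add: crossed_product_def)
    also have "\<dots> = finsum K (\<lambda>\<sigma>. x \<sigma> \<otimes> \<sigma> (y (\<iota> \<sigma> \<bullet> \<rho>)) \<otimes> f \<sigma> (\<iota> \<sigma> \<bullet> \<rho>)) (carrier G)"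
      by (subst finsum_reindex) (use assms True in \<open>auto simp: inj_on_def\<close>)
    also have "\<dots> = finsum K (\<lambda>\<sigma>. scal (x \<sigma>) (lx \<sigma> y) \<rho>) (carrier G)"
      by (rule finsum_cong') (use assms True in \<open>auto simp: lx_app m_assoc\<close>)
    also have "\<dots> = finsum \<Sigma> (\<lambda>\<sigma>. scal (x \<sigma>) (lx \<sigma> y)) (carrier G) \<rho>"
      by (rule Sigma_finsum_app[symmetric]) (use assms True in auto)
    finally show ?thesis .
  qed
qed

lemma Sigma_mult_closed [simp, intro]: "x \<in> carrier \<Sigma> \<Longrightarrow> y \<in> carrier \<Sigma> \<Longrightarrow> x \<star> y \<in> carrier \<Sigma>"
  by (auto simp: Sigma_mult)

lemma Sigma_l_distr:
  assumes "x \<in> carrier \<Sigma>" "y \<in> carrier \<Sigma>" "z \<in> carrier \<Sigma>"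
  shows "(x \<boxplus> y) \<star> z = x \<star> z \<boxplus> y \<star> z"
proof -
  have "(x \<boxplus> y) \<star> z
      = finsum \<Sigma> (\<lambda>\<sigma>. scal (x \<sigma>) (lx \<sigma> z) \<boxplus> scal (y \<sigma>) (lx \<sigma> z)) (carrier G)"
    unfolding Sigma_mult[OF S.a_closed[OF assms(1,2)] assms(3)]
    by (rule S.finsum_cong') (use assms in \<open>auto simp: scal_add_left\<close>)
  also have "\<dots> = x \<star> z \<boxplus> y \<star> z"
    unfolding Sigma_mult[OF assms(1,3)] Sigma_mult[OF assms(2,3)]
    by (rule S.finsum_addf) (use assms in auto)
  finally show ?thesis .
qed

lemma Sigma_r_distr:
  assumes "x \<in> carrier \<Sigma>" "y \<in> carrier \<Sigma>" "z \<in> carrier \<Sigma>"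
  shows "z \<star> (x \<boxplus> y) = z \<star> x \<boxplus> z \<star> y"
proof -
  have "z \<star> (x \<boxplus> y)
      = finsum \<Sigma> (\<lambda>\<sigma>. scal (z \<sigma>) (lx \<sigma> x) \<boxplus> scal (z \<sigma>) (lx \<sigma> y)) (carrier G)"
    unfolding Sigma_mult[OF assms(3) S.a_closed[OF assms(1,2)]]
    by (rule S.finsum_cong') (use assms in \<open>auto simp: lx_add scal_add\<close>)
  also have "\<dots> = z \<star> x \<boxplus> z \<star> y"
    unfolding Sigma_mult[OF assms(3,1)] Sigma_mult[OF assms(3,2)]
    by (rule S.finsum_addf) (use assms in auto)
  finally show ?thesis .
qed

lemma scal_mult:
  assumes "a \<in> carrier K" "x \<in> carrier \<Sigma>" "y \<in> carrier \<Sigma>"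
  shows "scal a x \<star> y = scal a (x \<star> y)"
  using assms unfolding Sigma_mult[OF scal_closed[OF assms(1,2)] assms(3)] Sigma_mult[OF assms(2,3)]
  by (subst scal_finsum) (auto intro!: S.finsum_cong' simp: scal_scal)

text \<open>Associativity when the first factor is x_\<sigma>; the general case follows by
  additivity. Reindexing the left-hand product by \<rho> = \<sigma>\<tau> makes \<open>lx_lx\<close>
  applicable term by term.\<close>

lemma lx_mult:
  assumes "\<sigma> \<in> carrier G" "x \<in> carrier \<Sigma>" "y \<in> carrier \<Sigma>"
  shows "lx \<sigma> x \<star> y = lx \<sigma> (x \<star> y)"
proof -
  have im: "(\<lambda>\<tau>. \<sigma> \<bullet> \<tau>) ` carrier G = carrier G"
    using G.surj_const_mult[OF assms(1)] .
  have "lx \<sigma> x \<star> y = finsum \<Sigma> (\<lambda>\<rho>. scal (lx \<sigma> x \<rho>) (lx \<rho> y)) ((\<lambda>\<tau>. \<sigma> \<bullet> \<tau>) ` carrier G)"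
    using assms by (simp add: Sigma_mult im)
  also have "\<dots> = finsum \<Sigma> (\<lambda>\<tau>. scal (lx \<sigma> x (\<sigma> \<bullet> \<tau>)) (lx (\<sigma> \<bullet> \<tau>) y)) (carrier G)"
  proof (rule S.finsum_reindex)
    show "(\<lambda>\<rho>. scal (lx \<sigma> x \<rho>) (lx \<rho> y)) \<in> (\<lambda>\<tau>. \<sigma> \<bullet> \<tau>) ` carrier G \<rightarrow> carrier \<Sigma>"
      unfolding im using assms by auto
    show "inj_on (\<lambda>\<tau>. \<sigma> \<bullet> \<tau>) (carrier G)" using G.inj_on_cmult[OF assms(1)] .
  qed
  also have "\<dots> = finsum \<Sigma> (\<lambda>\<tau>. lx \<sigma> (scal (x \<tau>) (lx \<tau> y))) (carrier G)"
    by (rule S.finsum_cong') (use assms in \<open>auto simp: lx_app lx_scal lx_lx scal_scal\<close>)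
  also have "\<dots> = lx \<sigma> (x \<star> y)"
    using assms by (auto simp: Sigma_mult lx_finsum Pi_iff)
  finally show ?thesis .
qed

lemma unit_vec_mult:
  assumes "\<sigma> \<in> carrier G" "x \<in> carrier \<Sigma>"
  shows "unit_vec \<sigma> \<star> x = lx \<sigma> x"
proof -
  have "unit_vec \<sigma> \<star> x = finsum \<Sigma> (\<lambda>\<rho>. if \<sigma> = \<rho> then lx \<rho> x else \<zero>\<^bsub>\<Sigma>\<^esub>) (carrier G)"
    unfolding Sigma_mult[OF unit_vec_closed assms(2)]
    by (rule S.finsum_cong') (use assms in \<open>auto simp: unit_vec_def\<close>)
  also have "\<dots> = lx \<sigma> x" by (rule S.finsum_singleton) (use assms in auto)
  finally show ?thesis .
qed

lemma one_Sigma': "\<one>\<^bsub>\<Sigma>\<^esub> = unit_vec \<one>\<^bsub>G\<^esub>"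
  by (simp add: one_Sigma unit_vec_def)

lemma Sigma_l_one: "x \<in> carrier \<Sigma> \<Longrightarrow> \<one>\<^bsub>\<Sigma>\<^esub> \<star> x = x"
  by (simp add: one_Sigma' unit_vec_mult)

lemma scal_one_mult: "a \<in> carrier K \<Longrightarrow> x \<in> carrier \<Sigma> \<Longrightarrow> scal a \<one>\<^bsub>\<Sigma>\<^esub> \<star> x = scal a x"
  using scal_mult[of a "\<one>\<^bsub>\<Sigma>\<^esub>" x] by (simp add: Sigma_l_one) (simp add: one_Sigma')

lemma Sigma_finsum_mult:
  assumes "finite A" "h \<in> A \<rightarrow> carrier \<Sigma>" "x \<in> carrier \<Sigma>"
  shows "finsum \<Sigma> h A \<star> x = finsum \<Sigma> (\<lambda>i. h i \<star> x) A"
  using assms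
proof (induction A rule: finite_induct)
  case empty
  then show ?case using scal_mult[of \<zero> "\<zero>\<^bsub>\<Sigma>\<^esub>" x] by simp
qed (auto simp: Sigma_l_distr Pi_iff)

lemma Sigma_assoc:
  assumes "x \<in> carrier \<Sigma>" "y \<in> carrier \<Sigma>" "z \<in> carrier \<Sigma>"
  shows "x \<star> y \<star> z = x \<star> (y \<star> z)"
proof -
  have "x \<star> y \<star> z = finsum \<Sigma> (\<lambda>\<sigma>. scal (x \<sigma>) (lx \<sigma> y) \<star> z) (carrier G)"
    unfolding Sigma_mult[OF assms(1,2)] by (rule Sigma_finsum_mult) (use assms in auto)
  also have "\<dots> = finsum \<Sigma> (\<lambda>\<sigma>. scal (x \<sigma>) (lx \<sigma> (y \<star> z))) (carrier G)"
    by (rule S.finsum_cong') (use assms in \<open>auto simp: scal_mult lx_mult\<close>)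
  also have "\<dots> = x \<star> (y \<star> z)" using assms by (simp add: Sigma_mult[of x "y \<star> z"])
  finally show ?thesis .
qed

lemma Sigma_decomp:
  assumes "x \<in> carrier \<Sigma>" shows "x = finsum \<Sigma> (\<lambda>\<sigma>. scal (x \<sigma>) (unit_vec \<sigma>)) (carrier G)"
proof (rule Sigma_eqI)
  fix \<rho> assume \<rho>: "\<rho> \<in> carrier G"
  have "finsum \<Sigma> (\<lambda>\<sigma>. scal (x \<sigma>) (unit_vec \<sigma>)) (carrier G) \<rho>
      = finsum K (\<lambda>\<sigma>. scal (x \<sigma>) (unit_vec \<sigma>) \<rho>) (carrier G)"
    by (rule Sigma_finsum_app) (use assms \<rho> in auto)
  also have "\<dots> = finsum K (\<lambda>\<sigma>. if \<rho> = \<sigma> then x \<sigma> else \<zero>) (carrier G)"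
    by (rule finsum_cong') (use assms \<rho> in \<open>auto simp: unit_vec_def\<close>)
  also have "\<dots> = x \<rho>" by (rule finsum_singleton) (use assms \<rho> in auto)
  finally show "x \<rho> = finsum \<Sigma> (\<lambda>\<sigma>. scal (x \<sigma>) (unit_vec \<sigma>)) (carrier G) \<rho>" ..
qed (use assms in auto)

lemma lx_unit_vec_one: "\<sigma> \<in> carrier G \<Longrightarrow> lx \<sigma> (unit_vec \<one>\<^bsub>G\<^esub>) = unit_vec \<sigma>"
proof (rule Sigma_eqI)
  fix \<rho> assume "\<sigma> \<in> carrier G" "\<rho> \<in> carrier G"
  then show "lx \<sigma> (unit_vec \<one>\<^bsub>G\<^esub>) \<rho> = unit_vec \<sigma> \<rho>"
    by (auto simp: lx_app unit_vec_def G.inv_solve_left')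
qed auto

lemma Sigma_r_one:
  assumes "x \<in> carrier \<Sigma>" shows "x \<star> \<one>\<^bsub>\<Sigma>\<^esub> = x"
proof -
  have "x \<star> \<one>\<^bsub>\<Sigma>\<^esub> = finsum \<Sigma> (\<lambda>\<sigma>. scal (x \<sigma>) (lx \<sigma> (unit_vec \<one>\<^bsub>G\<^esub>))) (carrier G)"
    using assms by (simp add: Sigma_mult one_Sigma')
  also have "\<dots> = finsum \<Sigma> (\<lambda>\<sigma>. scal (x \<sigma>) (unit_vec \<sigma>)) (carrier G)"
    by (rule S.finsum_cong') (use assms in \<open>auto simp: lx_unit_vec_one\<close>)
  also have "\<dots> = x" using Sigma_decomp[OF assms] ..
  finally show ?thesis .
qed

lemma Sigma_ring: "ring \<Sigma>"
proof (rule ringI)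
  show "monoid \<Sigma>"
    by (rule monoidI) (auto simp: Sigma_assoc Sigma_l_one Sigma_r_one, simp add: one_Sigma')
qed (auto simp: Sigma_l_distr Sigma_r_distr Sigma_abelian)

text \<open>The element by which the \<open>\<Sigma>\<close>-linear extension \<open>x \<mapsto> \<Sum>\<sigma>. x\<^sub>\<sigma>\<^sup>-\<^sup>1 \<psi>(x\<^sub>\<sigma> x)\<close> of the
  \<open>K\<close>-linear functional \<open>\<psi> = dot c\<close> is given, using \<open>x\<^sub>\<sigma>\<^sup>-\<^sup>1 = x\<^sub>\<rho> f(\<sigma>,\<rho>)\<^sup>-\<^sup>1\<close> for \<open>\<rho> = \<sigma>\<^sup>-\<^sup>1\<close>.\<close>

definition extend :: "(('a \<Rightarrow> 'a) \<Rightarrow> 'a) \<Rightarrow> (('a \<Rightarrow> 'a) \<Rightarrow> 'a) \<Rightarrow> ('a \<Rightarrow> 'a) \<Rightarrow> 'a" where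
  "extend c x = (\<lambda>\<rho> \<in> carrier G. inv (f \<rho> (\<iota> \<rho>)) \<otimes> \<rho> (dot c (lx (\<iota> \<rho>) x)))"

lemma extend_closed [simp, intro]:
  assumes "c \<in> carrier \<Sigma>" "x \<in> carrier \<Sigma>" shows "extend c x \<in> carrier \<Sigma>"
proof -
  have "inv (f \<rho> (\<iota> \<rho>)) \<otimes> \<rho> (dot c (lx (\<iota> \<rho>) x)) \<in> carrier K" if "\<rho> \<in> carrier G" for \<rho>
    using assms that by auto
  then show ?thesis by (simp add: extend_def carrier_Sigma)
qed

lemma extend_app: "\<rho> \<in> carrier G \<Longrightarrow>
    extend c x \<rho> = inv (f \<rho> (\<iota> \<rho>)) \<otimes> \<rho> (dot c (lx (\<iota> \<rho>) x))"
  by (simp add: extend_def)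

lemma extend_add: "c \<in> carrier \<Sigma> \<Longrightarrow> x \<in> carrier \<Sigma> \<Longrightarrow> y \<in> carrier \<Sigma> \<Longrightarrow>
    extend c (x \<boxplus> y) = extend c x \<boxplus> extend c y"
  by (rule Sigma_eqI) (auto simp: extend_app lx_add dot_add act_add r_distr)

lemma extend_scal: "c \<in> carrier \<Sigma> \<Longrightarrow> x \<in> carrier \<Sigma> \<Longrightarrow> a \<in> carrier K \<Longrightarrow>
    extend c (scal a x) = scal a (extend c x)"
  by (rule Sigma_eqI) (auto simp: extend_app lx_scal dot_scal act_times m_lcomm)

text \<open>With \<open>extend_scal\<close> this gives linearity over the whole crossed product.
  Both sides reduce to \<open>inv (f \<rho> (\<iota> ?\<kappa>)) \<otimes> \<rho> d\<close>, the
  left one by the cocycle identity at (\<rho>, \<rho>^-1, \<tau>), the right one by that at (\<tau>,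
  \<kappa>, \<kappa>^-1).\<close>

lemma extend_lx:
  assumes "c \<in> carrier \<Sigma>" "x \<in> carrier \<Sigma>" "\<tau> \<in> carrier G"
  shows "extend c (lx \<tau> x) = lx \<tau> (extend c x)"
proof (rule Sigma_eqI)
  fix \<rho> assume \<rho>: "\<rho> \<in> carrier G"
  let ?\<kappa> = "\<iota> \<tau> \<bullet> \<rho>"
  have \<kappa>: "?\<kappa> \<in> carrier G" using assms \<rho> by simp
  have inv\<kappa>: "\<iota> ?\<kappa> = \<iota> \<rho> \<bullet> \<tau>" using assms \<rho> by (simp add: G.inv_mult_group)
  define d where "d = dot c (lx (\<iota> \<rho> \<bullet> \<tau>) x)"
  have d: "d \<in> carrier K" using assms \<rho> by (auto simp: d_def)
  have 1: "\<tau> (f ?\<kappa> (\<iota> ?\<kappa>)) = f \<tau> ?\<kappa> \<otimes> f \<rho> (\<iota> ?\<kappa>)"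
    using f_cocycle[of \<tau> ?\<kappa> "\<iota> ?\<kappa>"] assms \<rho> \<kappa> by simp
  have 2: "\<rho> (f (\<iota> \<rho>) \<tau>) \<otimes> f \<rho> (\<iota> ?\<kappa>) = f \<rho> (\<iota> \<rho>)"
    using f_cocycle[of \<rho> "\<iota> \<rho>" \<tau>] assms \<rho> by (simp add: inv\<kappa>)
  have L: "extend c (lx \<tau> x) \<rho> = inv (f \<rho> (\<iota> \<rho>)) \<otimes> (\<rho> (f (\<iota> \<rho>) \<tau>) \<otimes> \<rho> d)"
    using assms \<rho> by (simp add: extend_def lx_lx dot_scal act_times d_def)
  have "\<tau> (?\<kappa> d) = \<rho> d" using act_mult[of \<tau> ?\<kappa> d] assms \<rho> d by simp
  then have R: "lx \<tau> (extend c x) \<rho> = inv (\<tau> (f ?\<kappa> (\<iota> ?\<kappa>))) \<otimes> \<rho> d \<otimes> f \<tau> ?\<kappa>"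
    using assms \<rho> \<kappa> d by (simp add: lx_app extend_def act_times act_inverse inv\<kappa> d_def[symmetric])
  let ?a = "f \<rho> (\<iota> ?\<kappa>)" and ?b = "\<rho> (f (\<iota> \<rho>) \<tau>)" and ?c = "f \<tau> ?\<kappa>"
  have cl: "?a \<in> carrier K" "?b \<in> carrier K" "?c \<in> carrier K" "?a \<noteq> \<zero>" "?b \<noteq> \<zero>" "?c \<noteq> \<zero>" "\<rho> d \<in> carrier K"
    using assms \<rho> \<kappa> d by auto
  have "extend c (lx \<tau> x) \<rho> = inv ?a \<otimes> \<rho> d"
    unfolding L 2[symmetric] using cl by (simp add: inv_mult_cancel_left)
  also have "\<dots> = inv (?c \<otimes> ?a) \<otimes> (?c \<otimes> \<rho> d)" using cl by (simp add: inv_mult_cancel_left)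
  also have "\<dots> = inv (?c \<otimes> ?a) \<otimes> \<rho> d \<otimes> ?c" using cl by (simp add: m_ac)
  also have "\<dots> = lx \<tau> (extend c x) \<rho>" unfolding R 1 ..
  finally show "extend c (lx \<tau> x) \<rho> = lx \<tau> (extend c x) \<rho>" .
qed (use assms in auto)

text \<open>The map of rank one on the left is the average of the \<open>K\<close>-linear map
  \<open>x \<mapsto> scal (dot c x) u\<close> over its conjugates by the x_\<sigma>. The summation
  index is \<sigma> = \<rho>^-1.\<close>

lemma extend_mult:
  assumes "c \<in> carrier \<Sigma>" "x \<in> carrier \<Sigma>" "u \<in> carrier \<Sigma>"
  shows "extend c x \<star> u = finsum \<Sigma> (\<lambda>\<sigma>. ly \<sigma> (scal (dot c (lx \<sigma> x)) u)) (carrier G)"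
proof -
  have im: "m_inv G ` carrier G = carrier G"
    by (auto simp: image_iff) (metis G.inv_closed G.inv_inv)
  have "extend c x \<star> u = finsum \<Sigma> (\<lambda>\<rho>. scal (extend c x \<rho>) (lx \<rho> u)) (m_inv G ` carrier G)"
    using assms by (simp add: Sigma_mult im)
  also have "\<dots> = finsum \<Sigma> (\<lambda>\<sigma>. scal (extend c x (\<iota> \<sigma>)) (lx (\<iota> \<sigma>) u)) (carrier G)"
  proof (rule S.finsum_reindex)
    show "(\<lambda>\<rho>. scal (extend c x \<rho>) (lx \<rho> u)) \<in> m_inv G ` carrier G \<rightarrow> carrier \<Sigma>"
      unfolding im using assms by auto
    show "inj_on (m_inv G) (carrier G)" by (rule G.inv_inj)
  qed
  also have "\<dots> = finsum \<Sigma> (\<lambda>\<sigma>. ly \<sigma> (scal (dot c (lx \<sigma> x)) u)) (carrier G)"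
    by (rule S.finsum_cong') (use assms in \<open>auto simp: ly_def lx_scal scal_scal extend_def\<close>)
  finally show ?thesis .
qed

end

section \<open>Crossed product orders\<close>

lemma opposite_ring_ring:
  assumes "ring R" shows "ring (opposite_ring R)"
proof -
  interpret ring R by fact
  show ?thesis
  proof (rule ringI)
    show "abelian_group (opposite_ring R)"
    proof (rule abelian_groupI)
      fix x assume "x \<in> carrier (opposite_ring R)"
      then show "\<exists>y \<in> carrier (opposite_ring R). y \<oplus>\<^bsub>opposite_ring R\<^esub> x = \<zero>\<^bsub>opposite_ring R\<^esub>"
        by (intro bexI[of _ "\<ominus>\<^bsub>R\<^esub> x"]) (auto simp: opposite_ring_def l_neg)
    qed (auto simp: opposite_ring_def a_ac)
    show "monoid (opposite_ring R)"
      by (rule monoidI) (auto simp: opposite_ring_def m_assoc)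
  qed (auto simp: opposite_ring_def l_distr r_distr)
qed

section \<open>Coordinates of products, and the opposite cocycle\<close>

context crossed
begin

lemma Sigma_mult_app:
  assumes "x \<in> carrier \<Sigma>" "y \<in> carrier \<Sigma>" "\<rho> \<in> carrier G"
  shows "(x \<star> y) \<rho> = finsum K (\<lambda>\<sigma>. x \<sigma> \<otimes> (\<sigma> (y (\<iota> \<sigma> \<bullet> \<rho>)) \<otimes> f \<sigma> (\<iota> \<sigma> \<bullet> \<rho>))) (carrier G)"
proof -
  have "(x \<star> y) \<rho> = finsum K (\<lambda>\<sigma>. scal (x \<sigma>) (lx \<sigma> y) \<rho>) (carrier G)"
    unfolding Sigma_mult[OF assms(1,2)] by (rule Sigma_finsum_app) (use assms in auto)
  also have "\<dots> = finsum K (\<lambda>\<sigma>. x \<sigma> \<otimes> (\<sigma> (y (\<iota> \<sigma> \<bullet> \<rho>)) \<otimes> f \<sigma> (\<iota> \<sigma> \<bullet> \<rho>))) (carrier G)"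
    by (rule finsum_cong') (use assms in \<open>auto simp: lx_app\<close>)
  finally show ?thesis .
qed

lemma Sigma_neg: "x \<in> carrier \<Sigma> \<Longrightarrow> \<ominus>\<^bsub>\<Sigma>\<^esub> x = scal (\<ominus> \<one>) x"
  by (rule S.minus_equality) (auto intro!: Sigma_eqI simp: l_minus l_neg)

text \<open>Arises by writing coefficients on the right. With e_\<sigma> = x_(\<sigma>^-1), the
  product of e_\<sigma> and e_\<tau> in the opposite ring is x_(\<tau>^-1) x_(\<sigma>^-1) =
  f(\<tau>^-1,\<sigma>^-1) x_((\<sigma>\<tau>)^-1), and moving the coefficient to the right of the
  basis element applies \<sigma>\<tau> to it.\<close>

definition op_cocycle :: "('a \<Rightarrow> 'a) \<Rightarrow> ('a \<Rightarrow> 'a) \<Rightarrow> 'a" where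
  "op_cocycle \<sigma> \<tau> = (\<sigma> \<bullet> \<tau>) (f (\<iota> \<tau>) (\<iota> \<sigma>))"

lemma op_cocycle: "normalized_cocycle K G op_cocycle"
  unfolding normalized_cocycle_def
proof (intro conjI ballI)
  fix \<sigma> \<tau> \<gamma> assume g: "\<sigma> \<in> carrier G" "\<tau> \<in> carrier G" "\<gamma> \<in> carrier G"
  let ?\<rho> = "\<sigma> \<bullet> \<tau> \<bullet> \<gamma>" and ?i = "\<lambda>x. \<iota> x"
  \<comment> \<open>The identity for \<open>f\<close> at the inverses in reversed order; applying
    \<open>?\<rho>\<close> to it gives the claim.\<close>
  have c: "(?i \<gamma>) (f (?i \<tau>) (?i \<sigma>)) \<otimes> f (?i \<gamma>) (?i \<tau> \<bullet> ?i \<sigma>)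
      = f (?i \<gamma>) (?i \<tau>) \<otimes> f (?i \<gamma> \<bullet> ?i \<tau>) (?i \<sigma>)"
    using f_cocycle[of "?i \<gamma>" "?i \<tau>" "?i \<sigma>"] g by simp
  have 1: "?\<rho> ((?i \<gamma>) a) = (\<sigma> \<bullet> \<tau>) a" if "a \<in> carrier K" for a
    using act_mult[of "\<sigma> \<bullet> \<tau>" \<gamma> "(?i \<gamma>) a"] g that by simp
  have "?\<rho> ((?i \<gamma>) (f (?i \<tau>) (?i \<sigma>))) \<otimes> ?\<rho> (f (?i \<gamma>) (?i \<tau> \<bullet> ?i \<sigma>))
      = ?\<rho> (f (?i \<gamma>) (?i \<tau>)) \<otimes> ?\<rho> (f (?i \<gamma> \<bullet> ?i \<tau>) (?i \<sigma>))"
    using arg_cong[OF c, of ?\<rho>] g by (simp add: act_times)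
  moreover have "\<sigma> (op_cocycle \<tau> \<gamma>) = ?\<rho> (f (?i \<gamma>) (?i \<tau>))"
    using g by (simp add: op_cocycle_def act_mult)
  moreover have "op_cocycle \<sigma> (\<tau> \<bullet> \<gamma>) = ?\<rho> (f (?i \<gamma> \<bullet> ?i \<tau>) (?i \<sigma>))"
    using g by (simp add: op_cocycle_def G.inv_mult_group G.m_assoc)
  moreover have "op_cocycle \<sigma> \<tau> = ?\<rho> ((?i \<gamma>) (f (?i \<tau>) (?i \<sigma>)))"
    using g by (simp add: op_cocycle_def 1)
  moreover have "op_cocycle (\<sigma> \<bullet> \<tau>) \<gamma> = ?\<rho> (f (?i \<gamma>) (?i \<tau> \<bullet> ?i \<sigma>))"
    using g by (simp add: op_cocycle_def G.inv_mult_group)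
  ultimately show "\<sigma> (op_cocycle \<tau> \<gamma>) \<otimes> op_cocycle \<sigma> (\<tau> \<bullet> \<gamma>)
      = op_cocycle \<sigma> \<tau> \<otimes> op_cocycle (\<sigma> \<bullet> \<tau>) \<gamma>"
    by simp
qed (simp_all add: op_cocycle_def)

end

locale crossed_order = crossed +
  fixes S
  assumes S_subring: "subring S K"
    and act_S [simp]: "\<sigma> \<in> carrier G \<Longrightarrow> a \<in> S \<Longrightarrow> \<sigma> a \<in> S"
    and f_S [simp, intro]: "\<sigma> \<in> carrier G \<Longrightarrow> \<tau> \<in> carrier G \<Longrightarrow> f \<sigma> \<tau> \<in> S"
begin

lemma S_carrier: "a \<in> S \<Longrightarrow> a \<in> carrier K" using subringE(1)[OF S_subring] by auto
lemmas S_simps [simp, intro] = subringE(2,3,5-7)[OF S_subring]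

lemma S_finsum: "finite B \<Longrightarrow> h \<in> B \<rightarrow> S \<Longrightarrow> finsum K h B \<in> S"
  by (induction B rule: finite_induct) (auto simp: Pi_iff S_carrier)

abbreviation A where "A \<equiv> crossed_product_order K G S f"

lemma A_simps [simp]:
  "carrier A = carrier G \<rightarrow>\<^sub>E S" "monoid.mult A = monoid.mult \<Sigma>" "add A = add \<Sigma>"
  "\<zero>\<^bsub>A\<^esub> = \<zero>\<^bsub>\<Sigma>\<^esub>" "\<one>\<^bsub>A\<^esub> = \<one>\<^bsub>\<Sigma>\<^esub>"
  by (simp_all add: crossed_product_order_def)

lemma A_Sigma: "carrier G \<rightarrow>\<^sub>E S \<subseteq> carrier \<Sigma>"
  using S_carrier by (auto simp: carrier_Sigma)

lemma A_closed [simp]: "x \<in> carrier G \<rightarrow>\<^sub>E S \<Longrightarrow> \<rho> \<in> carrier G \<Longrightarrow> x \<rho> \<in> S"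
  by auto

lemma unit_vec_A [simp]: "unit_vec \<sigma> \<in> carrier G \<rightarrow>\<^sub>E S"
  by (auto simp: unit_vec_def)

lemma scal_A: "a \<in> S \<Longrightarrow> x \<in> carrier G \<rightarrow>\<^sub>E S \<Longrightarrow> scal a x \<in> carrier G \<rightarrow>\<^sub>E S"
  by (auto simp: scal_def)

lemma lx_A: "\<sigma> \<in> carrier G \<Longrightarrow> x \<in> carrier G \<rightarrow>\<^sub>E S \<Longrightarrow> lx \<sigma> x \<in> carrier G \<rightarrow>\<^sub>E S"
  by (auto simp: lx_def)

lemma A_subring: "subring (carrier A) \<Sigma>"
proof -
  interpret R: ring \<Sigma> by (rule Sigma_ring)
  show ?thesis
  proof (rule R.subringI)
    fix x y assume x: "x \<in> carrier A" and y: "y \<in> carrier A"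
    then have xy: "x \<in> carrier \<Sigma>" "y \<in> carrier \<Sigma>" using A_Sigma by auto
    have "(x \<star> y) \<rho> \<in> S" if "\<rho> \<in> carrier G" for \<rho>
      unfolding Sigma_mult_app[OF xy that]
      by (rule S_finsum) (use x y that in auto)
    then show "x \<star> y \<in> carrier A"
      using R.m_closed[OF xy] by (auto simp: carrier_Sigma PiE_iff)
  next
    fix x assume x: "x \<in> carrier A"
    then have "x \<in> carrier \<Sigma>" using A_Sigma by auto
    then show "\<ominus>\<^bsub>\<Sigma>\<^esub> x \<in> carrier A" using x by (simp add: Sigma_neg scal_A)
  next
    show "\<one>\<^bsub>\<Sigma>\<^esub> \<in> carrier A" by (auto simp: one_Sigma)
  next
    fix x y assume x: "x \<in> carrier A" and y: "y \<in> carrier A"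
    then show "x \<boxplus> y \<in> carrier A" by (auto simp: crossed_product_def PiE_iff)
  qed (use A_Sigma in auto)
qed

lemma A_ring: "ring A"
proof -
  interpret R: ring \<Sigma> by (rule Sigma_ring)
  show ?thesis using R.subring_is_ring[OF A_subring] by (simp add: crossed_product_order_def)
qed

text \<open>Left ideals of \<open>A\<close> are the \<open>S\<close>-submodules stable under left multiplication by every \<open>x\<^sub>\<sigma>\<close>.\<close>

definition stable :: "(('a \<Rightarrow> 'a) \<Rightarrow> 'a) set \<Rightarrow> bool" where
  "stable I \<longleftrightarrow> I \<subseteq> carrier G \<rightarrow>\<^sub>E S \<and> \<zero>\<^bsub>\<Sigma>\<^esub> \<in> I \<and> (\<forall>x \<in> I. \<forall>y \<in> I. x \<boxplus> y \<in> I) \<and>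
    (\<forall>a \<in> S. \<forall>x \<in> I. scal a x \<in> I) \<and> (\<forall>\<sigma> \<in> carrier G. \<forall>x \<in> I. lx \<sigma> x \<in> I)"

lemma stableD:
  assumes "stable I"
  shows "x \<in> I \<Longrightarrow> x \<in> carrier G \<rightarrow>\<^sub>E S" "x \<in> I \<Longrightarrow> x \<in> carrier \<Sigma>" "\<zero>\<^bsub>\<Sigma>\<^esub> \<in> I"
    "x \<in> I \<Longrightarrow> y \<in> I \<Longrightarrow> x \<boxplus> y \<in> I" "a \<in> S \<Longrightarrow> x \<in> I \<Longrightarrow> scal a x \<in> I"
    "\<sigma> \<in> carrier G \<Longrightarrow> x \<in> I \<Longrightarrow> lx \<sigma> x \<in> I"
proof -
  note * = assms[unfolded stable_def]
  show 1: "x \<in> I \<Longrightarrow> x \<in> carrier G \<rightarrow>\<^sub>E S" using * by (meson subsetD)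
  show "x \<in> I \<Longrightarrow> x \<in> carrier \<Sigma>" using 1 A_Sigma by (meson subsetD)
  show "\<zero>\<^bsub>\<Sigma>\<^esub> \<in> I" using * by (elim conjE)
  show "x \<in> I \<Longrightarrow> y \<in> I \<Longrightarrow> x \<boxplus> y \<in> I" using * by meson
  show "a \<in> S \<Longrightarrow> x \<in> I \<Longrightarrow> scal a x \<in> I" using * by meson
  show "\<sigma> \<in> carrier G \<Longrightarrow> x \<in> I \<Longrightarrow> lx \<sigma> x \<in> I" using * by meson
qed

lemma stable_finsum: "finite B \<Longrightarrow> stable I \<Longrightarrow> h \<in> B \<rightarrow> I \<Longrightarrow> finsum \<Sigma> h B \<in> I"
proof (induction B rule: finite_induct)
  case (insert b B)
  then have "h \<in> insert b B \<rightarrow> carrier \<Sigma>" using A_Sigma by (auto simp: stable_def Pi_iff)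
  then show ?case using insert by (simp add: stable_def Pi_iff)
qed (simp add: stable_def)

lemma left_ideal_iff_stable: "left_ideal I A \<longleftrightarrow> stable I"
proof
  assume I: "left_ideal I A"
  interpret I: additive_subgroup I A using I by (simp add: left_ideal_def)
  have sub: "I \<subseteq> carrier G \<rightarrow>\<^sub>E S" using I.a_subset by simp
  have "scal a x \<in> I" if "a \<in> S" "x \<in> I" for a x
  proof -
    have "scal a \<one>\<^bsub>\<Sigma>\<^esub> \<in> carrier A" using that by (simp add: one_Sigma' scal_A)
    then have "scal a \<one>\<^bsub>\<Sigma>\<^esub> \<star> x \<in> I" using I that by (auto simp: left_ideal_def)
    moreover have "x \<in> carrier \<Sigma>" using that sub A_Sigma by blast
    ultimately show ?thesis using that S_carrier by (simp add: scal_one_mult)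
  qed
  moreover have "lx \<sigma> x \<in> I" if "\<sigma> \<in> carrier G" "x \<in> I" for \<sigma> x
  proof -
    have "unit_vec \<sigma> \<star> x \<in> I" using I that unit_vec_A by (auto simp: left_ideal_def)
    moreover have "x \<in> carrier \<Sigma>" using that sub A_Sigma by blast
    ultimately show ?thesis using that by (simp add: unit_vec_mult)
  qed
  ultimately show "stable I"
    using sub I.zero_closed I.a_closed by (auto simp: stable_def)
next
  assume I: "stable I"
  interpret A: ring A by (rule A_ring)
  have mult: "r \<star> x \<in> I" if "r \<in> carrier A" "x \<in> I" for r x
  proof -
    have cl: "r \<in> carrier \<Sigma>" "x \<in> carrier \<Sigma>" using that stableD(2)[OF I] A_Sigma by auto
    show ?thesis
      unfolding Sigma_mult[OF cl] by (rule stable_finsum[OF fin I]) (use that in \<open>auto intro!: stableD(5,6)[OF I]\<close>)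
  qed
  have neg: "\<ominus>\<^bsub>A\<^esub> x \<in> I" if "x \<in> I" for x
  proof -
    have x: "x \<in> carrier A" using that stableD(1)[OF I] by simp
    have "(\<ominus>\<^bsub>A\<^esub> \<one>\<^bsub>A\<^esub>) \<otimes>\<^bsub>A\<^esub> x \<in> I"
      using mult[OF A.a_inv_closed[OF A.one_closed] that] by simp
    moreover have "(\<ominus>\<^bsub>A\<^esub> \<one>\<^bsub>A\<^esub>) \<otimes>\<^bsub>A\<^esub> x = \<ominus>\<^bsub>A\<^esub> x"
      using A.l_minus[OF A.one_closed x] A.l_one[OF x] by simp
    ultimately show ?thesis by simp
  qed
  have "additive_subgroup I A"
  proof (rule additive_subgroup.intro, rule A.add.subgroupI)
    show "I \<subseteq> carrier A" using stableD(1)[OF I] by (simp add: subset_iff)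
    show "I \<noteq> {}" using stableD(3)[OF I] by (metis empty_iff)
    show "\<ominus>\<^bsub>A\<^esub> x \<in> I" if "x \<in> I" for x using neg[OF that] .
    show "x \<oplus>\<^bsub>A\<^esub> y \<in> I" if "x \<in> I" "y \<in> I" for x y
      using stableD(4)[OF I that] by simp
  qed
  then show "left_ideal I A" using mult by (auto simp: left_ideal_def)
qed

text \<open>It is enough to test linearity on \<open>S\<close> and on the x_\<sigma>, since
  \<open>Sigma_mult\<close> expands every product with an element of \<open>A\<close> into
  these.\<close>

lemma A_hom:
  assumes I: "stable I" and J: "J \<subseteq> carrier \<Sigma>" and h: "h \<in> I \<rightarrow> J"
    and add: "\<And>x y. x \<in> I \<Longrightarrow> y \<in> I \<Longrightarrow> h (x \<boxplus> y) = h x \<boxplus> h y"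
    and scal: "\<And>a x. a \<in> S \<Longrightarrow> x \<in> I \<Longrightarrow> h (scal a x) = scal a (h x)"
    and lx: "\<And>\<sigma> x. \<sigma> \<in> carrier G \<Longrightarrow> x \<in> I \<Longrightarrow> h (lx \<sigma> x) = lx \<sigma> (h x)"
  shows "h \<in> left_module_hom A (left_ideal_module A I) (left_ideal_module A J)"
proof (rule left_module_homI)
  fix a x assume a: "a \<in> carrier A" and x: "x \<in> carrier (left_ideal_module A I)"
  have cl: "a \<in> carrier \<Sigma>" "x \<in> I" "x \<in> carrier \<Sigma>" "h x \<in> carrier \<Sigma>"
    using a x stableD(2)[OF I] J h A_Sigma by auto
  have h0: "h \<zero>\<^bsub>\<Sigma>\<^esub> = \<zero>\<^bsub>\<Sigma>\<^esub>"
    using scal[of \<zero> x] cl by simp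
  have hsum: "h (finsum \<Sigma> g B) = finsum \<Sigma> (\<lambda>i. h (g i)) B" if "finite B" "g \<in> B \<rightarrow> I" for g and B :: "('a \<Rightarrow> 'a) set"
    using that
  proof (induction B rule: finite_induct)
    case (insert b B)
    have g: "g \<in> insert b B \<rightarrow> carrier \<Sigma>" "(\<lambda>i. h (g i)) \<in> insert b B \<rightarrow> carrier \<Sigma>"
      using insert.prems stableD(2)[OF I] J h by (auto simp: Pi_iff subset_iff)
    have "finsum \<Sigma> g B \<in> I" by (rule stable_finsum[OF _ I]) (use insert in auto)
    then show ?case using insert g add by (simp add: Pi_iff)
  qed (simp add: h0)
  have "h (a \<star> x) = finsum \<Sigma> (\<lambda>\<sigma>. h (scal (a \<sigma>) (lx \<sigma> x))) (carrier G)"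
    unfolding Sigma_mult[OF cl(1,3)] by (rule hsum) (use a cl in \<open>auto intro!: stableD(5,6)[OF I]\<close>)
  also have "\<dots> = finsum \<Sigma> (\<lambda>\<sigma>. scal (a \<sigma>) (lx \<sigma> (h x))) (carrier G)"
    by (rule S.finsum_cong') (use a cl in \<open>auto simp: scal lx stableD(6)[OF I]\<close>)
  also have "\<dots> = a \<star> h x" using cl by (simp add: Sigma_mult)
  finally show "h (a \<odot>\<^bsub>left_ideal_module A I\<^esub> x) = a \<odot>\<^bsub>left_ideal_module A J\<^esub> h x" by simp
qed (use h add in auto)

text \<open>The hypothesis \<open>int\<close> makes \<open>extend c\<close> take values in the
  order: up to an automorphism, its expression is the coefficient of \<open>extend c x\<close> at
  \<open>\<iota> \<sigma>\<close>.\<close>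

lemma extend_finite_rank:
  assumes I: "stable I" and c: "c \<in> carrier \<Sigma>" and u: "u \<in> I"
    and int: "\<And>\<sigma> x. \<sigma> \<in> carrier G \<Longrightarrow> x \<in> I \<Longrightarrow> inv (f \<sigma> (\<iota> \<sigma>)) \<otimes> dot c (lx \<sigma> x) \<in> S"
    and \<theta>: "\<And>x. x \<in> I \<Longrightarrow> \<theta> x = finsum \<Sigma> (\<lambda>\<sigma>. ly \<sigma> (scal (dot c (lx \<sigma> x)) u)) (carrier G)"
  shows "finite_rank_map A (left_ideal_module A I) \<theta>"
proof (rule finite_rank_map.add[where \<theta> = "\<lambda>x. \<zero>\<^bsub>\<Sigma>\<^esub>" and \<phi> = "extend c" and u = u])
  have sub: "I \<subseteq> carrier \<Sigma>" "I \<subseteq> carrier G \<rightarrow>\<^sub>E S" using stableD(1,2)[OF I] by (simp_all add: subset_iff)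
  have "extend c x \<in> carrier A" if x: "x \<in> I" for x
  proof -
    have "extend c x \<rho> \<in> S" if \<rho>: "\<rho> \<in> carrier G" for \<rho>
    proof -
      let ?\<sigma> = "\<iota> \<rho>"
      have cl: "dot c (lx ?\<sigma> x) \<in> carrier K" using c x sub \<rho> by auto
      have "extend c x \<rho> = \<rho> (inv (f ?\<sigma> \<rho>) \<otimes> dot c (lx ?\<sigma> x))"
        using cl \<rho> by (simp add: extend_app act_times act_inverse act_f_inv)
      then show ?thesis using int[of ?\<sigma> x] \<rho> x by simp
    qed
    moreover have "extend c x \<in> carrier \<Sigma>" using c x sub by auto
    ultimately show ?thesis by (auto simp: carrier_Sigma PiE_iff)
  qed
  then show "extend c \<in> left_module_hom A (left_ideal_module A I) (left_ideal_module A (carrier A))"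
    using sub c A_Sigma S_carrier
    by (intro A_hom[OF I]) (auto simp: extend_add extend_scal extend_lx subset_iff)
  fix x assume "x \<in> carrier (left_ideal_module A I)"
  then have x: "x \<in> I" by simp
  then have "extend c x \<star> u = \<theta> x" using extend_mult[OF c, of x u] u sub \<theta> by auto
  moreover have "\<theta> x \<in> carrier \<Sigma>" using \<theta>[OF x] x u c sub by (auto simp: subset_iff)
  ultimately show "\<theta> x = extend c x \<odot>\<^bsub>left_ideal_module A I\<^esub> u \<oplus>\<^bsub>left_ideal_module A I\<^esub> \<zero>\<^bsub>\<Sigma>\<^esub>" by simp
qed (use u in \<open>auto intro: finite_rank_map.zero\<close>)

lemma op_crossed_order: "crossed_order K G op_cocycle S"
  by (intro crossed_order.intro crossed_order_axioms.intro crossed.intro crossed_axioms.intro)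
    (simp_all add: field_axioms grp aut act_mult op_cocycle op_cocycle_def S_subring)

lemma opposite_left_hereditary:
  assumes "left_hereditary (crossed_product_order K G S op_cocycle)"
  shows "left_hereditary (opposite_ring A)"
proof (rule left_hereditary_iso)
  interpret op: crossed_order K G op_cocycle S by (rule op_crossed_order)
  show "ring op.A" by (rule op.A_ring)
  show "ring (opposite_ring A)" by (rule opposite_ring_ring) (rule A_ring)
  \<comment> \<open>\<open>?h\<close> sends a e_\<sigma> to x_(\<sigma>^-1) a, that is, it moves the
    coefficients to the other side. On families of coefficients it is an involution, hence its own
    inverse.\<close>
  let ?h = "\<lambda>x. \<lambda>\<rho> \<in> carrier G. \<rho> (x (inv\<^bsub>G\<^esub> \<rho>))"
  have hh: "?h (?h x) = x" if "x \<in> carrier G \<rightarrow>\<^sub>E S" for x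
    using that S_carrier by (auto simp: fun_eq_iff PiE_iff extensional_def)
  have cl: "?h x \<in> carrier G \<rightarrow>\<^sub>E S" if "x \<in> carrier G \<rightarrow>\<^sub>E S" for x
    using that by auto
  have "?h \<in> ring_hom op.A (opposite_ring A)"
  proof (rule ring_hom_memI)
    fix x y assume x: "x \<in> carrier op.A" and y: "y \<in> carrier op.A"
    then have xy: "x \<in> carrier \<Sigma>" "y \<in> carrier \<Sigma>" using A_Sigma by auto
    have hxy: "?h x \<in> carrier \<Sigma>" "?h y \<in> carrier \<Sigma>" using cl x y A_Sigma by auto
    have "?h (x \<otimes>\<^bsub>op.\<Sigma>\<^esub> y) \<rho> = (?h y \<otimes>\<^bsub>\<Sigma>\<^esub> ?h x) \<rho>" if \<rho>: "\<rho> \<in> carrier G" for \<rho>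
    proof -
      \<comment> \<open>The summand of the product in \<open>A\<close>. The substitution \<tau> =
        \<rho>\<sigma> matches it with the summand of the product formed with the opposite
        cocycle.\<close>
      let ?k = "\<lambda>\<tau>. ?h y \<tau> \<otimes> (\<tau> (?h x (inv\<^bsub>G\<^esub> \<tau> \<otimes>\<^bsub>G\<^esub> \<rho>)) \<otimes> f \<tau> (inv\<^bsub>G\<^esub> \<tau> \<otimes>\<^bsub>G\<^esub> \<rho>))"
      have im: "(\<lambda>\<sigma>. \<rho> \<otimes>\<^bsub>G\<^esub> \<sigma>) ` carrier G = carrier G" using G.surj_const_mult[OF \<rho>] .
      have kcl: "?k \<tau> \<in> carrier K" if "\<tau> \<in> carrier G" for \<tau>
        using that \<rho> hxy by (simp add: Sigma_closed del: restrict_apply)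
      have "?h (x \<otimes>\<^bsub>op.\<Sigma>\<^esub> y) \<rho> = \<rho> (finsum K (\<lambda>\<sigma>. x \<sigma> \<otimes> (\<sigma> (y (inv\<^bsub>G\<^esub> \<sigma> \<otimes>\<^bsub>G\<^esub> inv\<^bsub>G\<^esub> \<rho>))
          \<otimes> op_cocycle \<sigma> (inv\<^bsub>G\<^esub> \<sigma> \<otimes>\<^bsub>G\<^esub> inv\<^bsub>G\<^esub> \<rho>))) (carrier G))"
        using op.Sigma_mult_app[of x y "inv\<^bsub>G\<^esub> \<rho>"] xy \<rho> by (simp add: op.carrier_Sigma carrier_Sigma)
      also have "\<dots> = finsum K (\<lambda>\<sigma>. \<rho> (x \<sigma> \<otimes> (\<sigma> (y (inv\<^bsub>G\<^esub> \<sigma> \<otimes>\<^bsub>G\<^esub> inv\<^bsub>G\<^esub> \<rho>))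
          \<otimes> op_cocycle \<sigma> (inv\<^bsub>G\<^esub> \<sigma> \<otimes>\<^bsub>G\<^esub> inv\<^bsub>G\<^esub> \<rho>)))) (carrier G)"
        by (rule act_finsum) (use xy \<rho> op.f_closed in auto)
      also have "\<dots> = finsum K (\<lambda>\<sigma>. ?k (\<rho> \<otimes>\<^bsub>G\<^esub> \<sigma>)) (carrier G)"
      proof (rule finsum_cong')
        show "(\<lambda>\<sigma>. ?k (\<rho> \<otimes>\<^bsub>G\<^esub> \<sigma>)) \<in> carrier G \<rightarrow> carrier K" using kcl \<rho> by simp
        fix \<sigma> assume \<sigma>: "\<sigma> \<in> carrier G"
        let ?\<tau> = "\<rho> \<otimes>\<^bsub>G\<^esub> \<sigma>"
        have 1: "inv\<^bsub>G\<^esub> ?\<tau> = inv\<^bsub>G\<^esub> \<sigma> \<otimes>\<^bsub>G\<^esub> inv\<^bsub>G\<^esub> \<rho>" using \<rho> \<sigma> by (simp add: G.inv_mult_group)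
        then have 2: "inv\<^bsub>G\<^esub> ?\<tau> \<otimes>\<^bsub>G\<^esub> \<rho> = inv\<^bsub>G\<^esub> \<sigma>" using \<rho> \<sigma> by simp
        have 3: "op_cocycle \<sigma> (inv\<^bsub>G\<^esub> \<sigma> \<otimes>\<^bsub>G\<^esub> inv\<^bsub>G\<^esub> \<rho>) = (inv\<^bsub>G\<^esub> \<rho>) (f ?\<tau> (inv\<^bsub>G\<^esub> \<sigma>))"
          using \<rho> \<sigma> by (simp add: op_cocycle_def G.inv_mult_group)
        have 4: "?h y ?\<tau> = \<rho> (\<sigma> (y (inv\<^bsub>G\<^esub> \<sigma> \<otimes>\<^bsub>G\<^esub> inv\<^bsub>G\<^esub> \<rho>)))"
          using \<rho> \<sigma> xy by (simp add: 1 act_mult)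
        have 5: "?\<tau> (?h x (inv\<^bsub>G\<^esub> ?\<tau> \<otimes>\<^bsub>G\<^esub> \<rho>)) = \<rho> (x \<sigma>)"
          unfolding 2 using \<rho> \<sigma> xy by (simp add: act_mult)
        show "\<rho> (x \<sigma> \<otimes> (\<sigma> (y (inv\<^bsub>G\<^esub> \<sigma> \<otimes>\<^bsub>G\<^esub> inv\<^bsub>G\<^esub> \<rho>)) \<otimes> op_cocycle \<sigma> (inv\<^bsub>G\<^esub> \<sigma> \<otimes>\<^bsub>G\<^esub> inv\<^bsub>G\<^esub> \<rho>)))
            = ?k ?\<tau>"
          unfolding 3 4 5 2 using \<rho> \<sigma> xy by (simp add: act_times act_mult m_lcomm)
      qed simp
      also have "\<dots> = finsum K ?k ((\<lambda>\<sigma>. \<rho> \<otimes>\<^bsub>G\<^esub> \<sigma>) ` carrier G)"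
      proof (rule finsum_reindex[symmetric])
        show "?k \<in> (\<lambda>\<sigma>. \<rho> \<otimes>\<^bsub>G\<^esub> \<sigma>) ` carrier G \<rightarrow> carrier K" unfolding im using kcl by simp
        show "inj_on (\<lambda>\<sigma>. \<rho> \<otimes>\<^bsub>G\<^esub> \<sigma>) (carrier G)" using G.inj_on_cmult[OF \<rho>] .
      qed
      also have "\<dots> = (?h y \<otimes>\<^bsub>\<Sigma>\<^esub> ?h x) \<rho>" unfolding im Sigma_mult_app[OF hxy(2,1) \<rho>] ..
      finally show ?thesis .
    qed
    note pt = this
    have "x \<otimes>\<^bsub>op.\<Sigma>\<^esub> y \<in> carrier \<Sigma>"
      using op.Sigma_mult_closed[of x y] xy by (simp only: op.carrier_Sigma carrier_Sigma)
    then have "(x \<otimes>\<^bsub>op.\<Sigma>\<^esub> y) (inv\<^bsub>G\<^esub> \<rho>) \<in> carrier K" if "\<rho> \<in> carrier G" for \<rho> using that by simp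
    then have "?h (x \<otimes>\<^bsub>op.\<Sigma>\<^esub> y) \<in> carrier \<Sigma>" by (simp add: carrier_Sigma)
    then have "?h (x \<otimes>\<^bsub>op.\<Sigma>\<^esub> y) = ?h y \<otimes>\<^bsub>\<Sigma>\<^esub> ?h x"
      by (rule Sigma_eqI[OF _ Sigma_mult_closed[OF hxy(2,1)] pt])
    then show "?h (x \<otimes>\<^bsub>op.A\<^esub> y) = ?h x \<otimes>\<^bsub>opposite_ring A\<^esub> ?h y"
      by (simp add: opposite_ring_def)
    show "?h (x \<oplus>\<^bsub>op.A\<^esub> y) = ?h x \<oplus>\<^bsub>opposite_ring A\<^esub> ?h y"
    proof -
      have "?h (x \<oplus>\<^bsub>op.\<Sigma>\<^esub> y) = ?h x \<oplus>\<^bsub>\<Sigma>\<^esub> ?h y"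
        using xy by (simp add: crossed_product_def act_add fun_eq_iff)
      then show ?thesis by (simp add: opposite_ring_def)
    qed
  next
    show "?h \<one>\<^bsub>op.A\<^esub> = \<one>\<^bsub>opposite_ring A\<^esub>"
    proof -
      have "?h \<one>\<^bsub>op.\<Sigma>\<^esub> = \<one>\<^bsub>\<Sigma>\<^esub>" unfolding one_Sigma op.one_Sigma by (rule ext) simp
      then show ?thesis by (simp add: opposite_ring_def)
    qed
  qed (use cl in \<open>simp add: opposite_ring_def\<close>)
  moreover have "bij_betw ?h (carrier op.A) (carrier (opposite_ring A))"
  proof (rule bij_betwI[where g = ?h])
    show "?h \<in> carrier op.A \<rightarrow> carrier (opposite_ring A)" using cl by (simp add: opposite_ring_def)
    show "?h \<in> carrier (opposite_ring A) \<rightarrow> carrier op.A" using cl by (simp add: opposite_ring_def)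
    show "?h (?h x) = x" if "x \<in> carrier op.A" for x using hh[of x] that by (simp only: op.A_simps)
    show "?h (?h x) = x" if "x \<in> carrier (opposite_ring A)" for x
    proof (rule hh)
      show "x \<in> carrier G \<rightarrow>\<^sub>E S" using that by (simp add: opposite_ring_def)
    qed
  qed
  ultimately show "?h \<in> ring_iso op.A (opposite_ring A)" by (simp add: ring_iso_def)
qed (rule assms)

end

section \<open>Crossed product orders over an intersection of discrete valuation rings\<close>

text \<open>Collects the arithmetic behind the main argument. \<open>v M\<close> is unspecified at
  zero, hence the alternatives \<open>a = \<zero>\<close> and \<open>e = \<one>\<close>.
  \<open>approx\<close> is weak approximation: close to 1 at one place and as small as desired at
  all others. \<open>faithful\<close> says that an automorphism other than 1 that fixes a place
  moves some residue class there.\<close>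

locale valued_crossed = crossed_order K G f S
  for K (structure) and G :: "('a \<Rightarrow> 'a) monoid" and f and S +
  fixes Pl :: "'p set" and act :: "('a \<Rightarrow> 'a) \<Rightarrow> 'p \<Rightarrow> 'p" and v :: "'p \<Rightarrow> 'a \<Rightarrow> int" and \<pi> :: 'a
  assumes Pl_finite [simp]: "finite Pl" and Pl_nonempty: "Pl \<noteq> {}"
    and act_Pl [simp, intro]: "\<sigma> \<in> carrier G \<Longrightarrow> M \<in> Pl \<Longrightarrow> act \<sigma> M \<in> Pl"
    and act_Pl_one [simp]: "M \<in> Pl \<Longrightarrow> act \<one>\<^bsub>G\<^esub> M = M"
    and act_Pl_mult: "\<sigma> \<in> carrier G \<Longrightarrow> \<tau> \<in> carrier G \<Longrightarrow> M \<in> Pl \<Longrightarrow>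
      act (\<sigma> \<bullet> \<tau>) M = act \<sigma> (act \<tau> M)"
    and v_act: "\<sigma> \<in> carrier G \<Longrightarrow> M \<in> Pl \<Longrightarrow> a \<in> carrier K \<Longrightarrow> a \<noteq> \<zero> \<Longrightarrow> v (act \<sigma> M) (\<sigma> a) = v M a"
    and v_mult: "M \<in> Pl \<Longrightarrow> a \<in> carrier K \<Longrightarrow> a \<noteq> \<zero> \<Longrightarrow> b \<in> carrier K \<Longrightarrow> b \<noteq> \<zero> \<Longrightarrow>
      v M (a \<otimes> b) = v M a + v M b"
    and v_add: "M \<in> Pl \<Longrightarrow> a \<in> carrier K \<Longrightarrow> a \<noteq> \<zero> \<Longrightarrow> b \<in> carrier K \<Longrightarrow> b \<noteq> \<zero> \<Longrightarrow>
      a \<oplus> b \<noteq> \<zero> \<Longrightarrow> min (v M a) (v M b) \<le> v M (a \<oplus> b)"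
    and S_eq: "S = {a \<in> carrier K. a = \<zero> \<or> (\<forall>M \<in> Pl. 0 \<le> v M a)}"
    and pi [simp]: "\<pi> \<in> carrier K" "\<pi> \<noteq> \<zero>"
    and act_pi [simp]: "\<sigma> \<in> carrier G \<Longrightarrow> \<sigma> \<pi> = \<pi>"
    and v_pi [simp]: "M \<in> Pl \<Longrightarrow> v M \<pi> = 1"
    and approx: "M \<in> Pl \<Longrightarrow> \<exists>e \<in> S. (e = \<one> \<or> 1 \<le> v M (e \<ominus> \<one>)) \<and>
      (\<forall>N \<in> Pl - {M}. e = \<zero> \<or> int n \<le> v N e)"
    and faithful: "\<sigma> \<in> carrier G \<Longrightarrow> \<sigma> \<noteq> \<one>\<^bsub>G\<^esub> \<Longrightarrow> M \<in> Pl \<Longrightarrow> act \<sigma> M = M \<Longrightarrow>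
      \<exists>s \<in> S. \<sigma> s \<noteq> s \<and> v M (\<sigma> s \<ominus> s) \<le> 0"
    and extensional: "\<sigma> \<in> carrier G \<Longrightarrow> \<tau> \<in> carrier G \<Longrightarrow> \<sigma> \<noteq> \<tau> \<Longrightarrow> \<exists>s \<in> carrier K. \<sigma> s \<noteq> \<tau> s"
begin

text \<open>Encodes the convention v(0) = \<infinity> for integer-valued \<open>v\<close>. On
  elements integral at \<open>M\<close>, \<open>vge M 1\<close> is membership in the maximal ideal,
  and its negation says that the element is a unit at \<open>M\<close>.\<close>

definition vge :: "'p \<Rightarrow> int \<Rightarrow> 'a \<Rightarrow> bool" where
  "vge M k a \<longleftrightarrow> a \<in> carrier K \<and> (a \<noteq> \<zero> \<longrightarrow> k \<le> v M a)"

lemma vge_carrier: "vge M k a \<Longrightarrow> a \<in> carrier K"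
  by (simp add: vge_def)

lemma vge_zero [simp]: "vge M k \<zero>"
  by (simp add: vge_def)

lemma vge_mono: "vge M k a \<Longrightarrow> l \<le> k \<Longrightarrow> vge M l a"
  by (auto simp: vge_def)

lemma vge_add: "M \<in> Pl \<Longrightarrow> vge M k a \<Longrightarrow> vge M k b \<Longrightarrow> vge M k (a \<oplus> b)"
  unfolding vge_def using v_add[of M a b] by (cases "a = \<zero>"; cases "b = \<zero>") auto

lemma vge_mult: "M \<in> Pl \<Longrightarrow> vge M k a \<Longrightarrow> vge M l b \<Longrightarrow> vge M (k + l) (a \<otimes> b)"
  unfolding vge_def using v_mult[of M a b] by auto

lemma vge_mult': "M \<in> Pl \<Longrightarrow> vge M k a \<Longrightarrow> vge M l b \<Longrightarrow> m \<le> k + l \<Longrightarrow> vge M m (a \<otimes> b)"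
  using vge_mult vge_mono by metis

lemma v_one [simp]: "M \<in> Pl \<Longrightarrow> v M \<one> = 0"
  using v_mult[of M \<one> \<one>] by simp

lemma vge_one [simp]: "M \<in> Pl \<Longrightarrow> vge M k \<one> \<longleftrightarrow> k \<le> 0"
  by (simp add: vge_def)

lemma minus_one_nonzero: "\<ominus> \<one> \<noteq> \<zero>"
  by (metis a_inv_closed one_closed minus_minus minus_zero one_not_zero)

lemma v_minus_one: "M \<in> Pl \<Longrightarrow> v M (\<ominus> \<one>) = 0"
  using v_mult[of M "\<ominus> \<one>" "\<ominus> \<one>"] minus_one_nonzero by (simp add: l_minus)

lemma vge_neg: "M \<in> Pl \<Longrightarrow> vge M k a \<Longrightarrow> vge M k (\<ominus> a)"
  using vge_mult[of M 0 "\<ominus> \<one>" k a] v_minus_one[of M] vge_carrier[of M k a]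
  by (simp add: l_minus vge_def)

lemma vge_minus: "M \<in> Pl \<Longrightarrow> vge M k a \<Longrightarrow> vge M k b \<Longrightarrow> vge M k (a \<ominus> b)"
  by (simp add: minus_eq vge_add vge_neg)

lemma vge_finsum: "finite B \<Longrightarrow> M \<in> Pl \<Longrightarrow> (\<And>i. i \<in> B \<Longrightarrow> vge M k (h i)) \<Longrightarrow> vge M k (finsum K h B)"
proof (induction B rule: finite_induct)
  case (insert i B)
  then have "h \<in> insert i B \<rightarrow> carrier K" using vge_carrier by blast
  then show ?case using insert by (simp add: vge_add Pi_iff)
qed simp

lemma v_inv: "M \<in> Pl \<Longrightarrow> a \<in> carrier K \<Longrightarrow> a \<noteq> \<zero> \<Longrightarrow> v M (inv a) = - v M a"
  using v_mult[of M a "inv a"] by simp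

lemma vge_inv: "M \<in> Pl \<Longrightarrow> a \<in> carrier K \<Longrightarrow> a \<noteq> \<zero> \<Longrightarrow> vge M k (inv a) \<longleftrightarrow> v M a \<le> - k"
  using v_inv[of M a] by (auto simp: vge_def)

lemma vge_act:
  assumes "M \<in> Pl" "\<sigma> \<in> carrier G" "a \<in> carrier K"
  shows "vge (act \<sigma> M) k (\<sigma> a) \<longleftrightarrow> vge M k a"
  using assms v_act[of \<sigma> M a] by (cases "a = \<zero>") (auto simp: vge_def)

lemma act_inv_Pl [simp]:
  assumes "M \<in> Pl" "\<sigma> \<in> carrier G"
  shows "act (\<iota> \<sigma>) (act \<sigma> M) = M" "act \<sigma> (act (\<iota> \<sigma>) M) = M"
  using assms by (simp_all flip: act_Pl_mult)

lemma vge_act':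
  assumes "M \<in> Pl" "\<sigma> \<in> carrier G" "a \<in> carrier K"
  shows "vge M k (\<sigma> a) \<longleftrightarrow> vge (act (\<iota> \<sigma>) M) k a"
  using vge_act[of "act (\<iota> \<sigma>) M" \<sigma> a k] assms by simp

lemma S_iff: "a \<in> S \<longleftrightarrow> a \<in> carrier K \<and> (\<forall>M \<in> Pl. vge M 0 a)"
  using Pl_nonempty unfolding S_eq by (auto simp: vge_def)

lemma S_vge [simp]: "a \<in> S \<Longrightarrow> M \<in> Pl \<Longrightarrow> vge M 0 a"
  by (simp add: S_iff)

lemma vge_pi: "M \<in> Pl \<Longrightarrow> vge M 1 \<pi>"
  by (simp add: vge_def)

lemma pi_S [simp, intro]: "\<pi> \<in> S"
  by (auto simp: S_iff intro: vge_mono[OF vge_pi])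

lemma unitD:
  assumes "M \<in> Pl" "vge M 0 a" "\<not> vge M 1 a"
  shows "a \<noteq> \<zero>" "v M a = 0" "vge M 0 (inv a)" "a \<in> carrier K"
proof -
  show a: "a \<noteq> \<zero>" "v M a = 0" "a \<in> carrier K" using assms by (auto simp: vge_def)
  then show "vge M 0 (inv a)" using assms(1) by (simp add: vge_inv)
qed

lemma vge_prime:
  assumes "M \<in> Pl" "vge M 0 a" "vge M 0 b" "vge M 1 (a \<otimes> b)"
  shows "vge M 1 a \<or> vge M 1 b"
  using assms v_mult[of M a b] by (auto simp: vge_def)

lemma unit_mult:
  assumes "M \<in> Pl" "vge M 0 a" "vge M 0 b" "\<not> vge M 1 a" "\<not> vge M 1 b"
  shows "\<not> vge M 1 (a \<otimes> b)"
  using vge_prime assms by blast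

lemma vge_unit_sum:
  assumes "M \<in> Pl" "vge M 1 a" "b \<in> carrier K" "\<not> vge M 1 b"
  shows "\<not> vge M 1 (a \<oplus> b)"
proof
  assume "vge M 1 (a \<oplus> b)"
  from vge_add[OF assms(1) this vge_neg[OF assms(1,2)]] have "vge M 1 ((a \<oplus> b) \<oplus> \<ominus> a)" .
  moreover have "(a \<oplus> b) \<oplus> \<ominus> a = b"
    using assms(3) vge_carrier[OF assms(2)] by algebra
  ultimately have "vge M 1 b" by (simp only:)
  then show False using assms(4) by contradiction
qed

lemma div_pi:
  assumes "M \<in> Pl" "vge M (k + 1) a"
  shows "\<exists>b. vge M k b \<and> a = \<pi> \<otimes> b"
proof (intro exI conjI)
  have a: "a \<in> carrier K" using assms(2) by (rule vge_carrier)
  then show "a = \<pi> \<otimes> (inv \<pi> \<otimes> a)" by simp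
  show "vge M k (inv \<pi> \<otimes> a)"
    by (rule vge_mult'[of _ "-1" _ "k + 1"]) (use assms in \<open>auto simp: vge_inv\<close>)
qed

lemma approxE:
  assumes "M \<in> Pl"
  obtains e where "e \<in> S" "vge M 1 (e \<ominus> \<one>)" "\<not> vge M 1 e" "\<And>N. N \<in> Pl \<Longrightarrow> N \<noteq> M \<Longrightarrow> vge N k e"
proof -
  from approx[OF assms, of "nat k"] obtain e where e: "e \<in> S" "e = \<one> \<or> 1 \<le> v M (e \<ominus> \<one>)"
    "\<And>N. N \<in> Pl - {M} \<Longrightarrow> e = \<zero> \<or> int (nat k) \<le> v N e" by blast
  have eK: "e \<in> carrier K" using e S_carrier by auto
  have "e \<ominus> \<one> = \<zero>" if "e = \<one>" using that by (simp add: r_neg minus_eq)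
  then have 1: "vge M 1 (e \<ominus> \<one>)" using e(2) eK by (auto simp: vge_def)
  have "\<one> \<oplus> (e \<ominus> \<one>) = e" using eK by (simp add: minus_eq a_ac r_neg)
  then have "\<not> vge M 1 e"
    using vge_unit_sum[OF assms 1, of \<one>] assms eK by (simp add: a_comm)
  moreover have "vge N k e" if "N \<in> Pl" "N \<noteq> M" for N
    using e(3)[of N] that eK by (auto simp: vge_def split: if_splits)
  ultimately show thesis using that e 1 by blast
qed

subsection \<open>Lattices over one valuation ring\<close>

definition lat :: "'p \<Rightarrow> (('a \<Rightarrow> 'a) \<Rightarrow> 'a) set \<Rightarrow> bool" where
  "lat M Z \<longleftrightarrow> Z \<subseteq> carrier \<Sigma> \<and> \<zero>\<^bsub>\<Sigma>\<^esub> \<in> Z \<and> (\<forall>x \<in> Z. \<forall>y \<in> Z. x \<boxplus> y \<in> Z) \<and>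
    (\<forall>a x. vge M 0 a \<longrightarrow> x \<in> Z \<longrightarrow> scal a x \<in> Z)"

lemma latD:
  assumes "lat M Z"
  shows "x \<in> Z \<Longrightarrow> x \<in> carrier \<Sigma>" "\<zero>\<^bsub>\<Sigma>\<^esub> \<in> Z" "x \<in> Z \<Longrightarrow> y \<in> Z \<Longrightarrow> x \<boxplus> y \<in> Z"
    "vge M 0 a \<Longrightarrow> x \<in> Z \<Longrightarrow> scal a x \<in> Z"
proof -
  note * = assms[unfolded lat_def]
  show "x \<in> Z \<Longrightarrow> x \<in> carrier \<Sigma>" using * by (meson subsetD)
  show "\<zero>\<^bsub>\<Sigma>\<^esub> \<in> Z" using * by (elim conjE)
  show "x \<in> Z \<Longrightarrow> y \<in> Z \<Longrightarrow> x \<boxplus> y \<in> Z" using * by meson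
  show "vge M 0 a \<Longrightarrow> x \<in> Z \<Longrightarrow> scal a x \<in> Z" using * by meson
qed

lemma lat_finsum: "finite B \<Longrightarrow> lat M Z \<Longrightarrow> (\<And>i. i \<in> B \<Longrightarrow> h i \<in> Z) \<Longrightarrow> finsum \<Sigma> h B \<in> Z"
proof (induction B rule: finite_induct)
  case (insert i B)
  then have "h \<in> insert i B \<rightarrow> carrier \<Sigma>" using latD(1)[OF insert.prems(1)] by blast
  then show ?case using insert latD(3)[OF insert.prems(1)] by (simp add: Pi_iff)
qed (simp add: latD)

text \<open>A \<open>K\<close>-linear map of finite rank, as a list of pairs of a functional and a
  vector: \<open>stacked_basis\<close> builds it one coordinate at a time and has to tell the parts
  \<open>L1\<close> and \<open>L0\<close> apart.\<close>

fun comb :: "((('a \<Rightarrow> 'a) \<Rightarrow> 'a) \<times> (('a \<Rightarrow> 'a) \<Rightarrow> 'a)) list \<Rightarrow> (('a \<Rightarrow> 'a) \<Rightarrow> 'a) \<Rightarrow> ('a \<Rightarrow> 'a) \<Rightarrow> 'a" where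
  "comb [] x = \<zero>\<^bsub>\<Sigma>\<^esub>"
| "comb ((c, b) # L) x = scal (dot c x) b \<boxplus> comb L x"

lemma comb_closed [simp]:
  "(\<And>c b. (c, b) \<in> set L \<Longrightarrow> c \<in> carrier \<Sigma> \<and> b \<in> carrier \<Sigma>) \<Longrightarrow> x \<in> carrier \<Sigma> \<Longrightarrow> comb L x \<in> carrier \<Sigma>"
proof (induction L)
  case (Cons p L)
  obtain c b where p: "p = (c, b)" by force
  have "c \<in> carrier \<Sigma>" "b \<in> carrier \<Sigma>" using Cons.prems(1)[of c b] by (auto simp: p)
  moreover have "comb L x \<in> carrier \<Sigma>" by (rule Cons.IH) (use Cons.prems in auto)
  ultimately show ?case using Cons.prems by (simp add: p)
qed simp

lemma comb_append:
  "(\<And>c b. (c, b) \<in> set (L @ L') \<Longrightarrow> c \<in> carrier \<Sigma> \<and> b \<in> carrier \<Sigma>) \<Longrightarrow> x \<in> carrier \<Sigma> \<Longrightarrow>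
    comb (L @ L') x = comb L x \<boxplus> comb L' x"
proof (induction L)
  case (Cons p L)
  obtain c b where p: "p = (c, b)" by force
  have "c \<in> carrier \<Sigma>" "b \<in> carrier \<Sigma>" using Cons.prems(1)[of c b] by (auto simp: p)
  moreover have "comb L x \<in> carrier \<Sigma>" "comb L' x \<in> carrier \<Sigma>"
    by (rule comb_closed; use Cons.prems in auto)+
  moreover have "comb (L @ L') x = comb L x \<boxplus> comb L' x" by (rule Cons.IH) (use Cons.prems in auto)
  ultimately show ?case using Cons.prems(2) by (simp add: p S.a_assoc)
qed simp

text \<open>Stacked bases: \<open>U\<close> lies between \<open>\<pi>Z\<close> and \<open>Z\<close>, and \<open>Z\<close> has a basis each of whose elements either
  lies in \<open>U\<close> (the list \<open>L0\<close>) or has a coordinate function mapping \<open>U\<close> into the maximal ideal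
  (the list \<open>L1\<close>). The induction strips off one coordinate at a time, choosing an element of \<open>Z\<close>, in \<open>U\<close>
  if possible, for which that coordinate has minimal valuation.\<close>

lemma stacked_basis:
  assumes M: "M \<in> Pl" and "finite B" and "B \<subseteq> carrier G" and "lat M Z" "lat M U" "U \<subseteq> Z"
    and "\<And>x. x \<in> Z \<Longrightarrow> scal \<pi> x \<in> U"
    and "\<And>x \<rho>. x \<in> Z \<Longrightarrow> \<rho> \<in> carrier G \<Longrightarrow> vge M k (x \<rho>)"
    and "\<And>x \<rho>. x \<in> Z \<Longrightarrow> \<rho> \<in> carrier G - B \<Longrightarrow> x \<rho> = \<zero>"
    and "\<And>x. x \<in> Z \<Longrightarrow> \<exists>e. vge M 0 e \<and> \<not> vge M 1 e \<and> scal e x \<in> Z0"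
  shows "\<exists>L1 L0. (\<forall>(c, b) \<in> set (L1 @ L0). c \<in> carrier \<Sigma> \<and> b \<in> Z \<and> b \<in> Z0 \<and> (\<forall>x \<in> Z. vge M 0 (dot c x))) \<and>
    (\<forall>(c, b) \<in> set L0. b \<in> U) \<and> (\<forall>(c, b) \<in> set L1. \<forall>x \<in> U. vge M 1 (dot c x)) \<and>
    (\<forall>x \<in> Z. comb (L1 @ L0) x = x)"
  using assms(2-)
proof (induction B arbitrary: Z U rule: finite_induct)
  case empty
  have *: "x = \<zero>\<^bsub>\<Sigma>\<^esub>" if "x \<in> Z" for x
    by (rule Sigma_eqI) (use empty.prems(7)[OF that] latD(1)[OF empty.prems(2) that] in auto)
  have "comb ([] @ []) x = x" if "x \<in> Z" for x using *[OF that] by simp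
  then show ?case by (intro exI[of _ "[]"] conjI ballI) simp_all
next
  case (insert g B)
  note Z = latD[OF insert.prems(2)] and U = latD[OF insert.prems(3)]
  have g: "g \<in> carrier G" and B: "B \<subseteq> carrier G" using insert.prems(1) by auto
  show ?case
  proof (cases "\<forall>x \<in> Z. x g = \<zero>")
    case True
    show ?thesis
    proof (rule insert.IH[OF B insert.prems(2-4)])
      show "scal \<pi> x \<in> U" if "x \<in> Z" for x by (rule insert.prems(5)[OF that])
      show "vge M k (x \<rho>)" if "x \<in> Z" "\<rho> \<in> carrier G" for x \<rho> by (rule insert.prems(6)[OF that])
      show "x \<rho> = \<zero>" if "x \<in> Z" "\<rho> \<in> carrier G - B" for x \<rho>
        using insert.prems(7)[of x \<rho>] that True by (cases "\<rho> = g") auto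
      show "\<exists>e. vge M 0 e \<and> \<not> vge M 1 e \<and> scal e x \<in> Z0" if "x \<in> Z" for x
        by (rule insert.prems(8)[OF that])
    qed
  next
    case False
    define N where "N = {x \<in> Z. x g \<noteq> \<zero>}"
    \<comment> \<open>The lower bound \<open>k\<close> turns the valuations of this coordinate into
      natural numbers, so that a minimum exists.\<close>
    define m where "m x = nat (v M (x g) - k)" for x
    obtain x0 where x0: "x0 \<in> N" "\<And>y. y \<in> N \<Longrightarrow> m x0 \<le> m y"
      using False ex_has_least_nat[of "\<lambda>x. x \<in> N" _ m] by (auto simp: N_def)
    have kN: "k \<le> v M (x g)" if "x \<in> N" for x
      using insert.prems(6)[of x g] that g by (auto simp: N_def vge_def)
    have min0: "v M (x0 g) \<le> v M (y g)" if "y \<in> N" for y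
      using x0(2)[OF that] kN[OF that] kN[OF x0(1)] by (simp add: m_def)
    obtain b1 where b1: "b1 \<in> N" "v M (b1 g) = v M (x0 g)"
      "b1 \<in> U \<or> (\<forall>y \<in> U. y g \<noteq> \<zero> \<longrightarrow> v M (x0 g) < v M (y g))"
    proof (cases "\<exists>y \<in> U. y g \<noteq> \<zero> \<and> v M (y g) = v M (x0 g)")
      case True
      then show ?thesis using that insert.prems(4) by (auto simp: N_def)
    next
      case False
      then have "v M (x0 g) < v M (y g)" if "y \<in> U" "y g \<noteq> \<zero>" for y
        using min0[of y] that insert.prems(4) by (fastforce simp: N_def)
      then show ?thesis using that[of x0] x0 by blast
    qed
    \<comment> \<open>In the application \<open>Z\<close> is a localization and \<open>Z0\<close>
      the ideal itself. Rescaling by a unit at \<open>M\<close> moves the basis vector into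
      \<open>Z0\<close> and changes no valuation at \<open>M\<close>.\<close>
    obtain e where e: "vge M 0 e" "\<not> vge M 1 e" "scal e b1 \<in> Z0"
      using insert.prems(8)[of b1] b1 by (auto simp: N_def)
    note e' = unitD[OF M e(1,2)]
    define b where "b = scal e b1"
    have b1Z: "b1 \<in> Z" "b1 g \<noteq> \<zero>" "b1 g \<in> carrier K" using b1 Z(1) g by (auto simp: N_def)
    have b: "b \<in> Z" "b \<in> Z0" "b \<in> carrier \<Sigma>" using Z(4)[OF e(1) b1Z(1)] e(3) Z(1) by (simp_all add: b_def)
    have bg: "b g \<in> carrier K" "b g \<noteq> \<zero>" using b b1Z e' g by (auto simp: b_def)
    have vb: "v M (b g) = v M (x0 g)" using b1 b1Z e' M g by (simp add: b_def v_mult)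
    have bU: "b \<in> U \<or> (\<forall>y \<in> U. y g \<noteq> \<zero> \<longrightarrow> v M (b g) < v M (y g))"
      using b1(3) U(4)[OF e(1)] vb by (auto simp: b_def)
    define r where "r x = inv (b g) \<otimes> x g" for x
    have rcl: "r x \<in> carrier K" if "x \<in> Z" for x using Z(1)[OF that] bg g by (simp add: r_def)
    have rZ: "vge M 0 (r x)" if "x \<in> Z" for x
    proof (cases "x g = \<zero>")
      case False
      then have "v M (b g) \<le> v M (x g)" using min0[of x] that vb by (simp add: N_def)
      then show ?thesis using False that Z(1)[OF that] bg g M by (simp add: r_def vge_def v_mult v_inv)
    qed (use bg in \<open>simp add: r_def\<close>)
    \<comment> \<open>If the chosen minimum is not attained in \<open>U\<close>, this coordinate has
      larger valuation on all of \<open>U\<close>. The new functional then maps \<open>U\<close>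
      into the maximal ideal and belongs to \<open>L1\<close>.\<close>
    have rU: "vge M 1 (r y)" if "y \<in> U" "b \<notin> U" for y
    proof (cases "y g = \<zero>")
      case False
      then have "v M (b g) < v M (y g)" using bU that by auto
      then show ?thesis using False that U(1)[OF that(1)] bg g M by (simp add: r_def vge_def v_mult v_inv)
    qed (use bg in \<open>simp add: r_def\<close>)
    \<comment> \<open>The projection along \<open>b\<close> onto the vectors whose coordinate
      \<open>g\<close> vanishes; \<open>t\<close> below is its transpose on functionals.\<close>
    define q where "q x = x \<boxplus> scal (\<ominus> r x) b" for x
    define c0 where "c0 = scal (inv (b g)) (unit_vec g)"
    have c0: "c0 \<in> carrier \<Sigma>" "dot c0 x = r x" if "x \<in> Z" for x
      using that Z(1)[OF that] bg g by (auto simp: c0_def r_def dot_scal_left dot_unit_vec)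
    define t where "t c = c \<boxplus> scal (\<ominus> dot c b) c0" for c
    have t: "t c \<in> carrier \<Sigma>" "dot (t c) x = dot c (q x)" if "c \<in> carrier \<Sigma>" "x \<in> Z" for c x
      using that Z(1)[OF that(2)] b c0[OF that(2)] rcl[OF that(2)]
      by (simp_all add: t_def q_def dot_add dot_add_left dot_scal dot_scal_left l_minus r_minus m_comm)
    have qZ: "q x \<in> Z" if "x \<in> Z" for x
      unfolding q_def using Z(3)[OF that Z(4)[OF vge_neg[OF M rZ[OF that]] b(1)]] .
    have qg: "q x g = \<zero>" if "x \<in> Z" for x
    proof -
      have xg: "x g \<in> carrier K" using Z(1)[OF that] g by simp
      have "r x \<otimes> b g = x g" using bg xg m_comm[of "inv (b g) \<otimes> x g" "b g"] by (simp add: r_def)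
      then show ?thesis using g bg xg rcl[OF that] by (simp add: q_def l_minus r_neg)
    qed
    have split: "scal (r x) b \<boxplus> q x = x" if "x \<in> Z" for x
    proof -
      have "scal (r x) b \<boxplus> scal (\<ominus> r x) b = \<zero>\<^bsub>\<Sigma>\<^esub>"
        using rcl[OF that] b by (simp flip: scal_add_left add: r_neg)
      then show ?thesis
        using Z(1)[OF that] rcl[OF that] b by (simp add: q_def S.a_lcomm)
    qed
    define Z' where "Z' = {x \<in> Z. x g = \<zero>}"
    define U' where "U' = {x \<in> U. x g = \<zero>}"
    have lat0: "lat M {x \<in> T. x g = \<zero>}" if T: "lat M T" for T
      unfolding lat_def
    proof (intro conjI ballI allI impI)
      show "{x \<in> T. x g = \<zero>} \<subseteq> carrier \<Sigma>" using latD(1)[OF T] by auto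
      show "\<zero>\<^bsub>\<Sigma>\<^esub> \<in> {x \<in> T. x g = \<zero>}" using latD(2)[OF T] g by simp
      show "x \<boxplus> y \<in> {x \<in> T. x g = \<zero>}" if "x \<in> {x \<in> T. x g = \<zero>}" "y \<in> {x \<in> T. x g = \<zero>}" for x y
        using latD(3)[OF T, of x y] that g by simp
      show "scal a x \<in> {x \<in> T. x g = \<zero>}" if "vge M 0 a" "x \<in> {x \<in> T. x g = \<zero>}" for a x
        using latD(4)[OF T that(1), of x] that g vge_carrier[OF that(1)] by simp
    qed
    then have lat': "lat M Z'" "lat M U'" using insert.prems(2,3) by (simp_all add: Z'_def U'_def)
    have Z'sub: "Z' \<subseteq> Z" "U' \<subseteq> U" by (auto simp: Z'_def U'_def)
    have "\<exists>L1 L0. (\<forall>(c, b) \<in> set (L1 @ L0). c \<in> carrier \<Sigma> \<and> b \<in> Z' \<and> b \<in> Z0 \<and> (\<forall>x \<in> Z'. vge M 0 (dot c x))) \<and>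
      (\<forall>(c, b) \<in> set L0. b \<in> U') \<and> (\<forall>(c, b) \<in> set L1. \<forall>x \<in> U'. vge M 1 (dot c x)) \<and>
      (\<forall>x \<in> Z'. comb (L1 @ L0) x = x)"
    proof (rule insert.IH[OF B lat'])
      show "U' \<subseteq> Z'" using insert.prems(4) by (auto simp: Z'_def U'_def)
      show "scal \<pi> x \<in> U'" if "x \<in> Z'" for x
        using insert.prems(5)[of x] that g by (simp add: Z'_def U'_def)
      show "vge M k (x \<rho>)" if "x \<in> Z'" "\<rho> \<in> carrier G" for x \<rho>
        using insert.prems(6)[of x \<rho>] that by (simp add: Z'_def)
      show "x \<rho> = \<zero>" if "x \<in> Z'" "\<rho> \<in> carrier G - B" for x \<rho>
        using insert.prems(7)[of x \<rho>] that by (cases "\<rho> = g") (auto simp: Z'_def)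
      show "\<exists>e. vge M 0 e \<and> \<not> vge M 1 e \<and> scal e x \<in> Z0" if "x \<in> Z'" for x
        using insert.prems(8)[of x] that by (simp add: Z'_def)
    qed
    then obtain L1 L0 where
      L': "\<forall>(c, b) \<in> set (L1 @ L0). c \<in> carrier \<Sigma> \<and> b \<in> Z' \<and> b \<in> Z0 \<and> (\<forall>x \<in> Z'. vge M 0 (dot c x))"
      and L0': "\<forall>(c, b) \<in> set L0. b \<in> U'"
      and L1': "\<forall>(c, b) \<in> set L1. \<forall>x \<in> U'. vge M 1 (dot c x)"
      and id': "\<forall>x \<in> Z'. comb (L1 @ L0) x = x" by (elim exE conjE)
    have L: "c \<in> carrier \<Sigma> \<and> b \<in> Z' \<and> b \<in> Z0 \<and> (\<forall>x \<in> Z'. vge M 0 (dot c x))"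
      if "(c, b) \<in> set (L1 @ L0)" for c b using bspec[OF L' that] by simp
    have L0: "b \<in> U'" if "(c, b) \<in> set L0" for c b using bspec[OF L0' that] by simp
    have L1: "vge M 1 (dot c x)" if "(c, b) \<in> set L1" "x \<in> U'" for c b x
      using bspec[OF L1' that(1)] that(2) by simp
    have id: "comb (L1 @ L0) x = x" if "x \<in> Z'" for x using bspec[OF id' that] .
    let ?t = "map (\<lambda>(c, b). (t c, b))"
    have comb_t: "comb (?t L) x = comb L (q x)"
      if "x \<in> Z" "\<And>c b. (c, b) \<in> set L \<Longrightarrow> c \<in> carrier \<Sigma>" for L x
      using that(2)
    proof (induction L)
      case (Cons p L)
      obtain c b where p: "p = (c, b)" by force
      have "comb (?t L) x = comb L (q x)" by (rule Cons.IH) (use Cons.prems in auto)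
      moreover have "c \<in> carrier \<Sigma>" using Cons.prems[of c b] p by simp
      ultimately show ?case using t(2)[of c x] that(1) by (simp add: p)
    qed simp
    have qZ': "q x \<in> Z'" if "x \<in> Z" for x using qZ[OF that] qg[OF that] by (simp add: Z'_def)
    have id2: "scal (dot c0 x) b \<boxplus> comb (?t (L1 @ L0)) x = x" if "x \<in> Z" for x
    proof -
      have "comb (?t (L1 @ L0)) x = comb (L1 @ L0) (q x)"
        by (rule comb_t) (use that L in blast)+
      also have "\<dots> = q x" by (rule id[OF qZ'[OF that]])
      finally show ?thesis using split[OF that] c0(2)[OF that] by simp
    qed
    have Lt: "c \<in> carrier \<Sigma> \<and> b \<in> Z \<and> b \<in> Z0 \<and> (\<forall>x \<in> Z. vge M 0 (dot c x))"
      if cb: "(c, b) \<in> set (?t (L1 @ L0))" for c b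
    proof -
      from cb obtain c' where c': "(c', b) \<in> set (L1 @ L0)" "c = t c'"
        unfolding set_map by auto
      then show ?thesis
        using L[OF c'(1)] t[of c'] b(1) Z'sub(1) qZ' by auto
    qed
    have q_U: "q y \<in> U'" if "y \<in> U" for y
    proof -
      have yX: "y \<in> Z" using that insert.prems(4) by auto
      have "scal (\<ominus> r y) b \<in> U"
      proof (cases "b \<in> U")
        case True
        then show ?thesis using U(4) vge_neg[OF M rZ[OF yX]] by blast
      next
        \<comment> \<open>Here \<open>b\<close> is outside \<open>U\<close>, but \<open>r y\<close>
          is divisible by \<pi>, and \<pi>b is in \<open>U\<close>: this is where \<open>U\<close>
          has to contain \<pi>Z.\<close>
        case False
        then have "vge M (0 + 1) (\<ominus> r y)" using rU[OF that] vge_neg M by simp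
        from div_pi[OF M this] obtain s where s: "vge M 0 s" "\<ominus> r y = \<pi> \<otimes> s" by blast
        have "scal (\<ominus> r y) b = scal s (scal \<pi> b)"
          using s vge_carrier[OF s(1)] b by (simp add: scal_scal m_comm)
        then show ?thesis using U(4)[OF s(1)] insert.prems(5)[OF b(1)] by simp
      qed
      then show ?thesis using U(3)[OF that] qg[OF yX] by (simp add: U'_def q_def)
    qed
    have Lt1: "vge M 1 (dot c x)" if "(c, b) \<in> set (?t L1)" "x \<in> U" for c b x
    proof -
      from that(1) obtain c' where c': "(c', b) \<in> set L1" "c = t c'" by auto
      then show ?thesis
        using L[of c' b] t(2)[of c' x] L1[OF c'(1) q_U[OF that(2)]] that(2) insert.prems(4) by auto
    qed
    have b0: "c0 \<in> carrier \<Sigma> \<and> b \<in> Z \<and> b \<in> Z0 \<and> (\<forall>x \<in> Z. vge M 0 (dot c0 x))"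
      using c0 b rZ by auto
    have Lt0: "b \<in> U" if "(c, b) \<in> set (?t L0)" for c b
      using that L0 Z'sub(2) by auto
    have cl: "c \<in> carrier \<Sigma> \<and> b \<in> carrier \<Sigma>" if "(c, b) \<in> set (?t (L1 @ L0))" for c b
      using Lt[OF that] Z(1) by blast
    have cl1: "c \<in> carrier \<Sigma> \<and> b \<in> carrier \<Sigma>" if "(c, b) \<in> set (?t L1)" for c b
      by (rule cl) (use that in \<open>simp only: map_append set_append Un_iff simp_thms\<close>)
    have cl0: "c \<in> carrier \<Sigma> \<and> b \<in> carrier \<Sigma>" if "(c, b) \<in> set (?t L0)" for c b
      by (rule cl) (use that in \<open>simp only: map_append set_append Un_iff simp_thms\<close>)
    have LtB: "\<forall>(c, b) \<in> set (?t (L1 @ L0)). c \<in> carrier \<Sigma> \<and> b \<in> Z \<and> b \<in> Z0 \<and> (\<forall>x \<in> Z. vge M 0 (dot c x))"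
    proof (rule ballI)
      fix p assume "p \<in> set (?t (L1 @ L0))"
      then have "(fst p, snd p) \<in> set (?t (L1 @ L0))" by (simp only: prod.collapse)
      from Lt[OF this] show "case p of (c, b) \<Rightarrow> c \<in> carrier \<Sigma> \<and> b \<in> Z \<and> b \<in> Z0 \<and> (\<forall>x \<in> Z. vge M 0 (dot c x))"
        unfolding split_beta .
    qed
    have Lt0B: "\<forall>(c, b) \<in> set (?t L0). b \<in> U"
    proof (rule ballI)
      fix p assume "p \<in> set (?t L0)"
      then have "(fst p, snd p) \<in> set (?t L0)" by (simp only: prod.collapse)
      from Lt0[OF this] show "case p of (c, b) \<Rightarrow> b \<in> U"
        unfolding split_beta .
    qed
    have Lt1B: "\<forall>(c, b) \<in> set (?t L1). \<forall>x \<in> U. vge M 1 (dot c x)"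
    proof (rule ballI)
      fix p assume "p \<in> set (?t L1)"
      then have "(fst p, snd p) \<in> set (?t L1)" by (simp only: prod.collapse)
      from Lt1[OF this] have "\<forall>x \<in> U. vge M 1 (dot (fst p) x)" by (rule ballI)
      then show "case p of (c, b) \<Rightarrow> \<forall>x \<in> U. vge M 1 (dot c x)"
        unfolding split_beta .
    qed
    show ?thesis
    proof (cases "b \<in> U")
      case True
      have id3: "comb (?t L1 @ (c0, b) # ?t L0) x = x" if x: "x \<in> Z" for x
      proof -
        have clx1: "comb (?t L1) x \<in> carrier \<Sigma>" by (rule comb_closed[OF _ Z(1)[OF x]]) (rule cl1)
        have clx0: "comb (?t L0) x \<in> carrier \<Sigma>" by (rule comb_closed[OF _ Z(1)[OF x]]) (rule cl0)
        have "comb (?t L1 @ (c0, b) # ?t L0) x = comb (?t L1) x \<boxplus> comb ((c0, b) # ?t L0) x"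
        proof (rule comb_append[OF _ Z(1)[OF x]])
          fix c' b' assume "(c', b') \<in> set (?t L1 @ (c0, b) # ?t L0)"
          then consider "(c', b') \<in> set (?t L1)" | "(c', b') \<in> set (?t L0)" | "c' = c0" "b' = b"
            unfolding set_append list.set by blast
          then show "c' \<in> carrier \<Sigma> \<and> b' \<in> carrier \<Sigma>"
            using cl0 cl1 b0 b by cases blast+
        qed
        also have "\<dots> = scal (dot c0 x) b \<boxplus> (comb (?t L1) x \<boxplus> comb (?t L0) x)"
          using clx1 clx0 b0 b Z(1)[OF x] by (simp add: S.a_lcomm)
        also have "comb (?t L1) x \<boxplus> comb (?t L0) x = comb (?t L1 @ ?t L0) x"
          by (rule comb_append[OF _ Z(1)[OF x], symmetric]) (rule cl, simp only: map_append)
        finally show ?thesis using id2[OF x] by simp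
      qed
      show ?thesis
      proof (rule exI[of _ "?t L1"], rule exI[of _ "(c0, b) # ?t L0"], intro conjI)
        show "\<forall>(c, b) \<in> set (?t L1 @ (c0, b) # ?t L0).
            c \<in> carrier \<Sigma> \<and> b \<in> Z \<and> b \<in> Z0 \<and> (\<forall>x \<in> Z. vge M 0 (dot c x))"
          using LtB b0 by (simp add: ball_Un del: set_map)
        show "\<forall>(c, b) \<in> set ((c0, b) # ?t L0). b \<in> U" using Lt0B True by (simp del: set_map)
        show "\<forall>(c, b) \<in> set (?t L1). \<forall>x \<in> U. vge M 1 (dot c x)" using Lt1B .
        show "\<forall>x \<in> Z. comb (?t L1 @ (c0, b) # ?t L0) x = x"
          by (intro ballI) (rule id3)
      qed
    next
      case False
      show ?thesis
      proof (rule exI[of _ "(c0, b) # ?t L1"], rule exI[of _ "?t L0"], intro conjI)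
        show "\<forall>(c, b) \<in> set (((c0, b) # ?t L1) @ ?t L0).
            c \<in> carrier \<Sigma> \<and> b \<in> Z \<and> b \<in> Z0 \<and> (\<forall>x \<in> Z. vge M 0 (dot c x))"
          using LtB b0 by (simp add: ball_Un del: set_map)
        show "\<forall>(c, b) \<in> set (?t L0). b \<in> U" using Lt0B .
        have "vge M 1 (dot c0 x)" if "x \<in> U" for x
          using c0(2)[of x] rU[OF that False] that insert.prems(4) by (auto simp: subset_iff)
        then show "\<forall>(c, b) \<in> set ((c0, b) # ?t L1). \<forall>x \<in> U. vge M 1 (dot c x)"
          using Lt1B by (simp del: set_map)
        show "\<forall>x \<in> Z. comb (((c0, b) # ?t L1) @ ?t L0) x = x"
          using id2 by (intro ballI) simp
      qed
    qed
  qed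
qed

end

context valued_crossed
begin

subsection \<open>Elements with prescribed trace\<close>

text \<open>Dedekind's independence of characters modulo a prime ideal \<open>P\<close> of \<open>R\<close>.\<close>

lemma dedekind_independence:
  assumes P: "P \<subseteq> R" "R \<subseteq> carrier K" "\<And>a b. a \<in> P \<Longrightarrow> b \<in> P \<Longrightarrow> a \<ominus> b \<in> P"
      "\<And>a b. a \<in> R \<Longrightarrow> b \<in> P \<Longrightarrow> a \<otimes> b \<in> P" "\<And>a b. a \<in> R \<Longrightarrow> b \<in> R \<Longrightarrow> a \<otimes> b \<in> P \<Longrightarrow> a \<in> P \<or> b \<in> P"
    and R: "\<one> \<in> T" "\<And>a b. a \<in> R \<Longrightarrow> b \<in> R \<Longrightarrow> a \<ominus> b \<in> R" "\<And>a b. a \<in> R \<Longrightarrow> b \<in> R \<Longrightarrow> a \<otimes> b \<in> R"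
    and T: "T \<subseteq> carrier K" "\<And>a b. a \<in> T \<Longrightarrow> b \<in> T \<Longrightarrow> a \<otimes> b \<in> T"
      "\<And>\<sigma> a. \<sigma> \<in> H \<Longrightarrow> a \<in> T \<Longrightarrow> \<sigma> a \<in> R"
    and H: "finite H" "H \<subseteq> carrier G"
    and dist: "\<And>\<sigma> \<tau>. \<sigma> \<in> H \<Longrightarrow> \<tau> \<in> H \<Longrightarrow> \<sigma> \<noteq> \<tau> \<Longrightarrow> \<exists>s \<in> T. \<sigma> s \<ominus> \<tau> s \<notin> P"
    and a: "\<And>\<sigma>. \<sigma> \<in> H \<Longrightarrow> a \<sigma> \<in> R" "\<kappa> \<in> H" "a \<kappa> \<notin> P"
  shows "\<exists>c \<in> T. finsum K (\<lambda>\<sigma>. a \<sigma> \<otimes> \<sigma> c) H \<notin> P"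
  using H T(3) dist a
proof (induction "card H" arbitrary: H a)
  case 0
  then show ?case by simp
next
  case (Suc n)
  have K: "\<sigma> c \<in> carrier K" "a \<sigma> \<in> carrier K" if "\<sigma> \<in> H" "c \<in> T" for \<sigma> c
    using Suc.prems(3,5) P(2) that by blast+
  show ?case
  proof (cases "H = {\<kappa>}")
    case True
    have "a \<kappa> \<in> carrier K" "\<kappa> \<in> carrier G"
      using K(2)[OF Suc.prems(6) R(1)] Suc.prems(2,6) by auto
    then have "finsum K (\<lambda>\<sigma>. a \<sigma> \<otimes> \<sigma> \<one>) H = a \<kappa>" unfolding True by simp
    then show ?thesis using R(1) Suc.prems(7) by (intro bexI[of _ \<one>]) simp_all
  next
    case False
    then obtain \<tau> where \<tau>: "\<tau> \<in> H" "\<tau> \<noteq> \<kappa>" using Suc.prems(6) by blast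
    obtain s where s: "s \<in> T" "\<kappa> s \<ominus> \<tau> s \<notin> P" using Suc.prems(4)[OF Suc.prems(6) \<tau>(1)] \<tau>(2) by blast
    define H' where "H' = H - {\<tau>}"
    \<comment> \<open>Dedekind's elimination: with \<open>?F\<close> the original sum, the
      difference of \<open>?F (s \<otimes> c) H\<close> and \<open>\<tau> s \<otimes> ?F c H\<close>
      has the coefficients \<open>b \<sigma>\<close>, and the one at \<open>\<tau>\<close> vanishes.
      If the shorter sum is outside \<open>P\<close>, so is one of the two values of
      \<open>?F\<close>.\<close>
    define b where "b \<sigma> = a \<sigma> \<otimes> (\<sigma> s \<ominus> \<tau> s)" for \<sigma>
    have bR: "b \<sigma> \<in> R" if "\<sigma> \<in> H" for \<sigma>
      unfolding b_def
      by (rule R(3)[OF Suc.prems(5)[OF that] R(2)[OF Suc.prems(3)[OF that s(1)] Suc.prems(3)[OF \<tau>(1) s(1)]]])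
    have H': "finite H'" "H' \<subseteq> H" "H = insert \<tau> H'" "\<tau> \<notin> H'" "n = card H'" "H' \<subseteq> carrier G"
      using Suc.prems(1,2) Suc.hyps(2) \<tau> by (auto simp: H'_def)
    have "\<exists>c \<in> T. finsum K (\<lambda>\<sigma>. b \<sigma> \<otimes> \<sigma> c) H' \<notin> P"
    proof (rule Suc.hyps(1)[OF H'(5) H'(1) H'(6)])
      show "b \<kappa> \<notin> P"
        using P(5)[OF Suc.prems(5)[OF Suc.prems(6)]
            R(2)[OF Suc.prems(3)[OF Suc.prems(6) s(1)] Suc.prems(3)[OF \<tau>(1) s(1)]]] Suc.prems(7) s(2)
        unfolding b_def by blast
      show "\<kappa> \<in> H'" using Suc.prems(6) \<tau>(2) by (simp add: H'_def)
      show "b \<sigma> \<in> R" if "\<sigma> \<in> H'" for \<sigma> using bR that H'(2) by blast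
      show "\<sigma> c \<in> R" if "\<sigma> \<in> H'" "c \<in> T" for \<sigma> c
        by (rule Suc.prems(3)) (use that H'(2) in auto)
      show "\<exists>s \<in> T. \<sigma> s \<ominus> \<gamma> s \<notin> P" if "\<sigma> \<in> H'" "\<gamma> \<in> H'" "\<sigma> \<noteq> \<gamma>" for \<sigma> \<gamma>
        by (rule Suc.prems(4)) (use that H'(2) in auto)
    qed
    then obtain c where c: "c \<in> T" "finsum K (\<lambda>\<sigma>. b \<sigma> \<otimes> \<sigma> c) H' \<notin> P" by blast
    have sc: "s \<otimes> c \<in> T" using T(2) s c by blast
    have \<tau>s: "\<tau> s \<in> carrier K" by (rule K(1)[OF \<tau>(1) s(1)])
    let ?F = "\<lambda>c H. finsum K (\<lambda>\<sigma>. a \<sigma> \<otimes> \<sigma> c) H"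
    have Fcl: "a \<sigma> \<otimes> \<sigma> c \<in> carrier K" if "c \<in> T" "\<sigma> \<in> H" for c \<sigma>
      using K(2,1)[OF that(2,1)] by (rule m_closed)
    have "finsum K (\<lambda>\<sigma>. b \<sigma> \<otimes> \<sigma> c) H' = finsum K (\<lambda>\<sigma>. b \<sigma> \<otimes> \<sigma> c) H"
    proof -
      have \<tau>0: "b \<tau> \<otimes> \<tau> c = \<zero>"
        using K(1)[OF \<tau>(1) c(1)] K(2)[OF \<tau>(1) c(1)] \<tau>s by (simp add: b_def r_neg minus_eq)
      have "b \<sigma> \<otimes> \<sigma> c \<in> carrier K" if "\<sigma> \<in> H" for \<sigma>
        using subsetD[OF P(2) bR[OF that]] K(1)[OF that c(1)] by (rule m_closed)
      then have cl: "(\<lambda>\<sigma>. b \<sigma> \<otimes> \<sigma> c) \<in> H' \<rightarrow> carrier K" using H'(2) by blast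
      have "finsum K (\<lambda>\<sigma>. b \<sigma> \<otimes> \<sigma> c) (insert \<tau> H') = finsum K (\<lambda>\<sigma>. b \<sigma> \<otimes> \<sigma> c) H'"
        using H'(1,4) cl \<tau>0 by simp
      then show ?thesis unfolding H'(3)[symmetric] ..
    qed
    also have "\<dots> = finsum K (\<lambda>\<sigma>. a \<sigma> \<otimes> \<sigma> (s \<otimes> c) \<oplus> (\<ominus> \<tau> s) \<otimes> (a \<sigma> \<otimes> \<sigma> c)) H"
    proof (rule finsum_cong')
      fix \<sigma> assume \<sigma>: "\<sigma> \<in> H"
      then have "\<sigma> (s \<otimes> c) = \<sigma> s \<otimes> \<sigma> c" using act_times Suc.prems(2) s c T(1) by blast
      moreover have "a \<sigma> \<otimes> (x \<ominus> y) \<otimes> z = a \<sigma> \<otimes> (x \<otimes> z) \<oplus> (\<ominus> y) \<otimes> (a \<sigma> \<otimes> z)"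
        if "x \<in> carrier K" "y \<in> carrier K" "z \<in> carrier K" for x y z
        using K(2)[OF \<sigma> s(1)] that by algebra
      ultimately show "b \<sigma> \<otimes> \<sigma> c = a \<sigma> \<otimes> \<sigma> (s \<otimes> c) \<oplus> (\<ominus> \<tau> s) \<otimes> (a \<sigma> \<otimes> \<sigma> c)"
        using K(1)[OF \<sigma> s(1)] K(1)[OF \<sigma> c(1)] \<tau>s by (simp only: b_def)
    next
      show "(\<lambda>\<sigma>. a \<sigma> \<otimes> \<sigma> (s \<otimes> c) \<oplus> (\<ominus> \<tau> s) \<otimes> (a \<sigma> \<otimes> \<sigma> c)) \<in> H \<rightarrow> carrier K"
        using Fcl[OF sc] Fcl[OF c(1)] \<tau>s by (simp add: Pi_iff)
    qed simp
    also have "\<dots> = ?F (s \<otimes> c) H \<oplus> finsum K (\<lambda>\<sigma>. (\<ominus> \<tau> s) \<otimes> (a \<sigma> \<otimes> \<sigma> c)) H"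
      by (rule finsum_addf) (use Fcl[OF sc] Fcl[OF c(1)] \<tau>s in \<open>simp_all add: Pi_iff\<close>)
    also have "finsum K (\<lambda>\<sigma>. (\<ominus> \<tau> s) \<otimes> (a \<sigma> \<otimes> \<sigma> c)) H = (\<ominus> \<tau> s) \<otimes> ?F c H"
      by (rule finsum_rdistr[symmetric]) (use Fcl[OF c(1)] \<tau>s Suc.prems(1) in \<open>simp_all add: Pi_iff\<close>)
    also have "?F (s \<otimes> c) H \<oplus> (\<ominus> \<tau> s) \<otimes> ?F c H = ?F (s \<otimes> c) H \<ominus> \<tau> s \<otimes> ?F c H"
    proof -
      have "?F c H \<in> carrier K" by (rule finsum_closed) (use Fcl[OF c(1)] in \<open>simp add: Pi_iff\<close>)
      then show ?thesis using \<tau>s by (simp add: l_minus minus_eq)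
    qed
    finally have eq: "finsum K (\<lambda>\<sigma>. b \<sigma> \<otimes> \<sigma> c) H' = ?F (s \<otimes> c) H \<ominus> \<tau> s \<otimes> ?F c H" .
    have "\<tau> s \<in> R" by (rule Suc.prems(3)[OF \<tau>(1) s(1)])
    then have "\<not> (?F (s \<otimes> c) H \<in> P \<and> ?F c H \<in> P)"
      using c(2) P(3)[of "?F (s \<otimes> c) H" "\<tau> s \<otimes> ?F c H"] P(4)[of "\<tau> s" "?F c H"] unfolding eq by argo
    then show ?thesis using sc c by blast
  qed
qed

lemma finsum_act_reindex:
  assumes H: "subgroup H G" and \<tau>: "\<tau> \<in> H" and c: "c \<in> carrier K"
  shows "\<tau> (finsum K (\<lambda>\<sigma>. \<sigma> c) H) = finsum K (\<lambda>\<sigma>. \<sigma> c) H"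
proof -
  have HG: "H \<subseteq> carrier G" using subgroup.subset[OF H] .
  have im: "(\<lambda>\<sigma>. \<tau> \<bullet> \<sigma>) ` H = H"
  proof (intro equalityI subsetI)
    fix x assume "x \<in> H"
    then have "\<iota> \<tau> \<bullet> x \<in> H" "x = \<tau> \<bullet> (\<iota> \<tau> \<bullet> x)"
      using subgroup.m_closed[OF H] subgroup.m_inv_closed[OF H \<tau>] HG \<tau> by (auto simp: subset_iff)
    then show "x \<in> (\<lambda>\<sigma>. \<tau> \<bullet> \<sigma>) ` H" by blast
  qed (use subgroup.m_closed[OF H \<tau>] in auto)
  have "\<tau> (finsum K (\<lambda>\<sigma>. \<sigma> c) H) = finsum K (\<lambda>\<sigma>. \<tau> (\<sigma> c)) H"
    by (rule act_finsum) (use \<tau> c HG in auto)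
  also have "\<dots> = finsum K (\<lambda>\<sigma>. (\<tau> \<bullet> \<sigma>) c) H"
    by (rule finsum_cong') (use \<tau> c HG in \<open>auto simp: act_mult subset_iff\<close>)
  also have "\<dots> = finsum K (\<lambda>\<sigma>. \<sigma> c) ((\<lambda>\<sigma>. \<tau> \<bullet> \<sigma>) ` H)"
  proof (rule finsum_reindex[symmetric])
    show "(\<lambda>\<sigma>. \<sigma> c) \<in> (\<lambda>\<sigma>. \<tau> \<bullet> \<sigma>) ` H \<rightarrow> carrier K" unfolding im using HG c by auto
    show "inj_on (\<lambda>\<sigma>. \<tau> \<bullet> \<sigma>) H"
      using G.inj_on_cmult HG \<tau> by (meson inj_on_subset subsetD)
  qed
  finally show ?thesis unfolding im .
qed

text \<open>The trace over a subgroup is fixed by that subgroup, so its inverse can be pulled out of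
  the sum.\<close>

lemma finsum_act_normalize:
  assumes H: "subgroup H G" and c: "c \<in> carrier K" and nz: "finsum K (\<lambda>\<sigma>. \<sigma> c) H \<noteq> \<zero>"
  defines "t \<equiv> finsum K (\<lambda>\<sigma>. \<sigma> c) H"
  shows "finsum K (\<lambda>\<sigma>. \<sigma> (inv t \<otimes> c)) H = \<one>"
proof -
  have HG: "H \<subseteq> carrier G" using subgroup.subset[OF H] .
  have t: "t \<in> carrier K" "t \<noteq> \<zero>" unfolding t_def using HG c nz by (auto simp: subset_iff)
  have "finsum K (\<lambda>\<sigma>. \<sigma> (inv t \<otimes> c)) H = finsum K (\<lambda>\<sigma>. inv t \<otimes> \<sigma> c) H"
  proof (rule finsum_cong')
    fix \<sigma> assume \<sigma>: "\<sigma> \<in> H"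
    have "\<sigma> (inv t) = inv t"
      using act_inverse[of \<sigma> t] t \<sigma> HG finsum_act_reindex[OF H \<sigma> c] by (auto simp: t_def)
    then show "\<sigma> (inv t \<otimes> c) = inv t \<otimes> \<sigma> c" using t c \<sigma> HG by (auto simp: act_times)
  qed (use t c HG in \<open>auto simp: subset_iff\<close>)
  also have "\<dots> = inv t \<otimes> finsum K (\<lambda>\<sigma>. \<sigma> c) H"
    by (rule finsum_rdistr[symmetric]) (use t c HG finite_subset[OF HG fin] in \<open>auto simp: subset_iff\<close>)
  also have "\<dots> = inv t \<otimes> t" by (simp add: t_def)
  finally show ?thesis using t by simp
qed

text \<open>The independence lemma for the zero ideal of \<open>K\<close>. The element found may
  have poles; they are paid for by the power of \<pi> in
  \<open>pi_power_finite_rank\<close>.\<close>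

lemma trace_one: "\<exists>c \<in> carrier K. finsum K (\<lambda>\<sigma>. \<sigma> c) (carrier G) = \<one>"
proof -
  have "\<exists>c \<in> carrier K. finsum K (\<lambda>\<sigma>. \<one> \<otimes> \<sigma> c) (carrier G) \<notin> {\<zero>}"
  proof (rule dedekind_independence[where R = "carrier K" and \<kappa> = "\<one>\<^bsub>G\<^esub>"])
    fix \<sigma> \<tau> assume st: "\<sigma> \<in> carrier G" "\<tau> \<in> carrier G" "\<sigma> \<noteq> \<tau>"
    then obtain s where "s \<in> carrier K" "\<sigma> s \<noteq> \<tau> s" using extensional by blast
    then show "\<exists>s \<in> carrier K. \<sigma> s \<ominus> \<tau> s \<notin> {\<zero>}" using st by (intro bexI[of _ s]) auto
  qed (auto simp: minus_eq)
  then obtain c where c: "c \<in> carrier K" "finsum K (\<lambda>\<sigma>. \<one> \<otimes> \<sigma> c) (carrier G) \<noteq> \<zero>" by blast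
  have "finsum K (\<lambda>\<sigma>. \<one> \<otimes> \<sigma> c) (carrier G) = finsum K (\<lambda>\<sigma>. \<sigma> c) (carrier G)"
    by (rule finsum_cong') (use c in auto)
  then have "finsum K (\<lambda>\<sigma>. \<sigma> c) (carrier G) \<noteq> \<zero>" using c by simp
  from finsum_act_normalize[OF G.subgroup_self c(1) this] show ?thesis
    using c by (intro bexI[of _ "inv (finsum K (\<lambda>\<sigma>. \<sigma> c) (carrier G)) \<otimes> c"])
      (auto simp: \<open>finsum K (\<lambda>\<sigma>. \<sigma> c) (carrier G) \<noteq> \<zero>\<close>)
qed

text \<open>Approximation beyond the largest pole order of \<open>r\<close> removes the poles away
  from \<open>M\<close> and does not disturb \<open>r\<close> modulo \<open>M\<close>.\<close>

lemma approx_unit: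
  assumes M: "M \<in> Pl" and r: "vge M 0 r"
  obtains e where "e \<in> S" "vge M 1 (e \<ominus> \<one>)" "\<not> vge M 1 e" "e \<otimes> r \<in> S"
    "\<And>N. N \<in> Pl \<Longrightarrow> N \<noteq> M \<Longrightarrow> vge N k e"
proof -
  define m where "m = Max (insert (max k 0) ((\<lambda>N. - v N r) ` Pl))"
  have m: "k \<le> m" "0 \<le> m" "- v N r \<le> m" if "N \<in> Pl" for N
    using that by (auto simp: m_def intro: Max_ge_iff[THEN iffD2])
  from approxE[OF M, of m] obtain e where e: "e \<in> S" "vge M 1 (e \<ominus> \<one>)" "\<not> vge M 1 e"
    and eN: "\<And>N. N \<in> Pl \<Longrightarrow> N \<noteq> M \<Longrightarrow> vge N m e" by blast
  have rK: "r \<in> carrier K" using r vge_carrier by blast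
  have "vge N 0 (e \<otimes> r)" if "N \<in> Pl" for N
  proof (cases "N = M")
    case True
    then show ?thesis using vge_mult[OF that, of 0 e 0 r] e r that by simp
  next
    case False
    have "vge N (- m) r" using m[OF that] rK by (auto simp: vge_def)
    then show ?thesis using vge_mult[OF that eN[OF that False]] by fastforce
  qed
  then have "e \<otimes> r \<in> S" using S_carrier[OF e(1)] rK by (simp add: S_iff)
  moreover have "vge N k e" if "N \<in> Pl" "N \<noteq> M" for N
    by (rule vge_mono[OF eN[OF that] m(1)[OF that(1)]])
  ultimately show thesis using that e by metis
qed

text \<open>The independence lemma modulo the maximal ideal at \<open>M\<close>; distinctness comes
  from \<open>faithful\<close> applied to \<tau>^-1 \<sigma>. After normalization the element has
  trace exactly 1 but is integral at \<open>M\<close> only, and \<open>approx_unit\<close> trades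
  the exact trace for an element of \<open>S\<close>.\<close>

lemma trace_one_mod:
  assumes M: "M \<in> Pl" and H: "subgroup H G" and stab: "\<And>\<sigma>. \<sigma> \<in> H \<Longrightarrow> act \<sigma> M = M"
  shows "\<exists>c \<in> S. vge M 1 (finsum K (\<lambda>\<sigma>. \<sigma> c) H \<ominus> \<one>)"
proof -
  have HG: "H \<subseteq> carrier G" using subgroup.subset[OF H] .
  have fH: "finite H" using finite_subset[OF HG fin] .
  have vs: "vge M k (\<sigma> a) \<longleftrightarrow> vge M k a" if "\<sigma> \<in> H" "a \<in> carrier K" for \<sigma> a k
    using vge_act[OF M, of \<sigma> a k] stab that HG by auto
  have "\<exists>c \<in> S. finsum K (\<lambda>\<sigma>. \<one> \<otimes> \<sigma> c) H \<notin> {a. vge M 1 a}"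
  proof (rule dedekind_independence[where R = "{a. vge M 0 a}" and \<kappa> = "\<one>\<^bsub>G\<^esub>"])
    fix \<sigma> \<tau> assume st: "\<sigma> \<in> H" "\<tau> \<in> H" "\<sigma> \<noteq> \<tau>"
    then have stG: "\<sigma> \<in> carrier G" "\<tau> \<in> carrier G" using HG by auto
    let ?\<kappa> = "\<iota> \<tau> \<bullet> \<sigma>"
    have "?\<kappa> \<in> H" using subgroup.m_closed[OF H] subgroup.m_inv_closed[OF H] st by blast
    moreover have "?\<kappa> \<noteq> \<one>\<^bsub>G\<^esub>" using st stG by (metis G.inv_closed G.inv_inv G.inv_equality)
    ultimately obtain s where s: "s \<in> S" "?\<kappa> s \<noteq> s" "v M (?\<kappa> s \<ominus> s) \<le> 0"
      using faithful[of ?\<kappa> M] stab M HG by (metis subsetD)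
    have sK: "s \<in> carrier K" using s S_carrier by blast
    have "\<not> vge M 1 (?\<kappa> s \<ominus> s)" using s sK stG by (auto simp: vge_def)
    moreover have "\<tau> (?\<kappa> s \<ominus> s) = \<sigma> s \<ominus> \<tau> s"
      using stG sK by (simp add: minus_eq act_add act_neg act_mult)
    ultimately have "\<not> vge M 1 (\<sigma> s \<ominus> \<tau> s)" using vs[OF st(2), of "?\<kappa> s \<ominus> s" 1] stG sK by simp
    then show "\<exists>s \<in> S. \<sigma> s \<ominus> \<tau> s \<notin> {a. vge M 1 a}" using s by blast
  next
    show "\<And>a b. a \<in> {a. vge M 0 a} \<Longrightarrow> b \<in> {a. vge M 1 a} \<Longrightarrow> a \<otimes> b \<in> {a. vge M 1 a}"
      using vge_mult[OF M, of 0 _ 1] by auto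
    show "\<And>a b. a \<in> {a. vge M 0 a} \<Longrightarrow> b \<in> {a. vge M 0 a} \<Longrightarrow> a \<otimes> b \<in> {a. vge M 0 a}"
      using vge_mult[OF M, of 0 _ 0] by auto
    show "\<one>\<^bsub>G\<^esub> \<in> H" using subgroup.one_closed[OF H] .
    show "{a. vge M 1 a} \<subseteq> {a. vge M 0 a}" using vge_mono[of M 1 _ 0] by auto
  qed (use M HG fH S_carrier vge_prime[OF M] in \<open>auto simp: vge_minus vge_carrier vs subset_iff\<close>)
  then obtain c where c: "c \<in> S" "\<not> vge M 1 (finsum K (\<lambda>\<sigma>. \<one> \<otimes> \<sigma> c) H)" by blast
  have cK: "c \<in> carrier K" using c S_carrier by blast
  define t where "t = finsum K (\<lambda>\<sigma>. \<sigma> c) H"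
  have "finsum K (\<lambda>\<sigma>. \<one> \<otimes> \<sigma> c) H = t"
    unfolding t_def by (rule finsum_cong') (use cK HG in auto)
  moreover have "vge M 0 t" unfolding t_def
    by (rule vge_finsum[OF fH M]) (use vs cK c M in auto)
  ultimately have t: "t \<noteq> \<zero>" "vge M 0 (inv t)" "t \<in> carrier K" using unitD[OF M, of t] c by auto
  define r where "r = inv t \<otimes> c"
  have r: "vge M 0 r" "r \<in> carrier K" unfolding r_def using vge_mult[OF M t(2), of 0 c] c M t cK by auto
  have tr: "finsum K (\<lambda>\<sigma>. \<sigma> r) H = \<one>"
    using finsum_act_normalize[OF H cK] t(1) by (simp add: r_def t_def)
  from approx_unit[OF M r(1), of 0] obtain e where e: "e \<in> S" "vge M 1 (e \<ominus> \<one>)" "e \<otimes> r \<in> S" by blast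
  have eK: "e \<in> carrier K" using e S_carrier by blast
  have "finsum K (\<lambda>\<sigma>. \<sigma> (e \<otimes> r)) H = finsum K (\<lambda>\<sigma>. \<sigma> ((e \<ominus> \<one>) \<otimes> r) \<oplus> \<sigma> r) H"
  proof (rule finsum_cong')
    fix \<sigma> assume "\<sigma> \<in> H"
    moreover have "e \<otimes> r = (e \<ominus> \<one>) \<otimes> r \<oplus> r" using eK r(2) by algebra
    ultimately show "\<sigma> (e \<otimes> r) = \<sigma> ((e \<ominus> \<one>) \<otimes> r) \<oplus> \<sigma> r"
      using HG eK r(2) act_add[of \<sigma> "(e \<ominus> \<one>) \<otimes> r" r] by auto
  qed (use eK r(2) HG in auto)
  also have "\<dots> = finsum K (\<lambda>\<sigma>. \<sigma> ((e \<ominus> \<one>) \<otimes> r)) H \<oplus> finsum K (\<lambda>\<sigma>. \<sigma> r) H"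
    by (rule finsum_addf) (use eK r(2) HG in auto)
  also have "\<dots> = finsum K (\<lambda>\<sigma>. \<sigma> ((e \<ominus> \<one>) \<otimes> r)) H \<oplus> \<one>" unfolding tr ..
  finally have "finsum K (\<lambda>\<sigma>. \<sigma> (e \<otimes> r)) H \<ominus> \<one> = finsum K (\<lambda>\<sigma>. \<sigma> ((e \<ominus> \<one>) \<otimes> r)) H"
  proof -
    assume "finsum K (\<lambda>\<sigma>. \<sigma> (e \<otimes> r)) H = finsum K (\<lambda>\<sigma>. \<sigma> ((e \<ominus> \<one>) \<otimes> r)) H \<oplus> \<one>"
    moreover have "finsum K (\<lambda>\<sigma>. \<sigma> ((e \<ominus> \<one>) \<otimes> r)) H \<in> carrier K"
      by (rule finsum_closed) (use eK r(2) HG in auto)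
    ultimately show ?thesis by (simp add: minus_eq a_assoc r_neg)
  qed
  moreover have "vge M 1 (finsum K (\<lambda>\<sigma>. \<sigma> ((e \<ominus> \<one>) \<otimes> r)) H)"
    by (rule vge_finsum[OF fH M]) (use vge_mult[OF M e(2) r(1)] vs eK r(2) in auto)
  ultimately show ?thesis using e(3) by (intro bexI[of _ "e \<otimes> r"]) simp_all
qed

end

context valued_crossed
begin

subsection \<open>Localizations of submodules\<close>

definition submod :: "(('a \<Rightarrow> 'a) \<Rightarrow> 'a) set \<Rightarrow> bool" where
  "submod Z \<longleftrightarrow> Z \<subseteq> carrier \<Sigma> \<and> \<zero>\<^bsub>\<Sigma>\<^esub> \<in> Z \<and> (\<forall>x \<in> Z. \<forall>y \<in> Z. x \<boxplus> y \<in> Z) \<and>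
    (\<forall>a \<in> S. \<forall>x \<in> Z. scal a x \<in> Z)"

lemma submodD:
  assumes "submod Z"
  shows "x \<in> Z \<Longrightarrow> x \<in> carrier \<Sigma>" "\<zero>\<^bsub>\<Sigma>\<^esub> \<in> Z" "x \<in> Z \<Longrightarrow> y \<in> Z \<Longrightarrow> x \<boxplus> y \<in> Z"
    "a \<in> S \<Longrightarrow> x \<in> Z \<Longrightarrow> scal a x \<in> Z"
proof -
  note * = assms[unfolded submod_def]
  show "x \<in> Z \<Longrightarrow> x \<in> carrier \<Sigma>" using * by (meson subsetD)
  show "\<zero>\<^bsub>\<Sigma>\<^esub> \<in> Z" using * by (elim conjE)
  show "x \<in> Z \<Longrightarrow> y \<in> Z \<Longrightarrow> x \<boxplus> y \<in> Z" using * by meson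
  show "a \<in> S \<Longrightarrow> x \<in> Z \<Longrightarrow> scal a x \<in> Z" using * by meson
qed

lemma stable_submod: "stable Z \<Longrightarrow> submod Z"
  unfolding submod_def using stableD(2)[of Z] stableD(3-5)[of Z] by (meson subsetI)

definition loc :: "'p \<Rightarrow> (('a \<Rightarrow> 'a) \<Rightarrow> 'a) set \<Rightarrow> (('a \<Rightarrow> 'a) \<Rightarrow> 'a) set" where
  "loc M Z = {x \<in> carrier \<Sigma>. \<exists>e \<in> S. \<not> vge M 1 e \<and> scal e x \<in> Z}"

lemma locI: "x \<in> carrier \<Sigma> \<Longrightarrow> e \<in> S \<Longrightarrow> \<not> vge M 1 e \<Longrightarrow> scal e x \<in> Z \<Longrightarrow> x \<in> loc M Z"
  by (auto simp: loc_def)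

lemma locE:
  assumes "x \<in> loc M Z"
  obtains e where "x \<in> carrier \<Sigma>" "e \<in> S" "e \<in> carrier K" "\<not> vge M 1 e" "scal e x \<in> Z"
  using assms S_carrier unfolding loc_def by blast

lemma lat_loc:
  assumes M: "M \<in> Pl" and Z: "submod Z"
  shows "lat M (loc M Z)"
  unfolding lat_def
proof (intro conjI ballI allI impI)
  show "loc M Z \<subseteq> carrier \<Sigma>" by (auto simp: loc_def)
  show "\<zero>\<^bsub>\<Sigma>\<^esub> \<in> loc M Z" by (rule locI[of _ \<one>]) (use submodD(2)[OF Z] M in simp_all)
  fix x y assume x: "x \<in> loc M Z" and y: "y \<in> loc M Z"
  obtain d where d: "x \<in> carrier \<Sigma>" "d \<in> S" "d \<in> carrier K" "\<not> vge M 1 d" "scal d x \<in> Z" using x by (rule locE)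
  obtain e where e: "y \<in> carrier \<Sigma>" "e \<in> S" "e \<in> carrier K" "\<not> vge M 1 e" "scal e y \<in> Z" using y by (rule locE)
  show "x \<boxplus> y \<in> loc M Z"
  proof (rule locI)
    show "x \<boxplus> y \<in> carrier \<Sigma>" using d e by simp
    show "d \<otimes> e \<in> S" using d e by simp
    show "\<not> vge M 1 (d \<otimes> e)" by (rule unit_mult) (use M d e in simp_all)
    have "scal (d \<otimes> e) (x \<boxplus> y) = scal e (scal d x) \<boxplus> scal d (scal e y)"
      using d(1,3) e(1,3) by (simp add: scal_add scal_scal m_comm)
    then show "scal (d \<otimes> e) (x \<boxplus> y) \<in> Z"
      using submodD(3)[OF Z submodD(4)[OF Z e(2) d(5)] submodD(4)[OF Z d(2) e(5)]] by simp
  qed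
next
  fix a x assume a: "vge M 0 a" and x: "x \<in> loc M Z"
  obtain d where d: "x \<in> carrier \<Sigma>" "d \<in> S" "d \<in> carrier K" "\<not> vge M 1 d" "scal d x \<in> Z" using x by (rule locE)
  obtain e where e: "e \<in> S" "\<not> vge M 1 e" "e \<otimes> a \<in> S" by (rule approx_unit[OF M a])
  have aK: "a \<in> carrier K" "e \<in> carrier K" using vge_carrier[OF a] S_carrier[OF e(1)] .
  show "scal a x \<in> loc M Z"
  proof (rule locI)
    show "scal a x \<in> carrier \<Sigma>" using d aK by simp
    show "d \<otimes> e \<in> S" using d e by simp
    show "\<not> vge M 1 (d \<otimes> e)" by (rule unit_mult) (use M d e in simp_all)
    have "scal (d \<otimes> e) (scal a x) = scal (e \<otimes> a) (scal d x)"
      using d(1,3) aK by (simp add: scal_scal m_ac)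
    then show "scal (d \<otimes> e) (scal a x) \<in> Z" using submodD(4)[OF Z e(3) d(5)] by simp
  qed
qed

lemma loc_mono: "Z \<subseteq> Z' \<Longrightarrow> loc M Z \<subseteq> loc M Z'"
  by (auto simp: loc_def)

lemma sub_loc: "M \<in> Pl \<Longrightarrow> submod Z \<Longrightarrow> x \<in> Z \<Longrightarrow> x \<in> loc M Z"
  by (rule locI[of _ \<one>]) (simp_all add: submodD(1))

lemma loc_unscale:
  assumes M: "M \<in> Pl" and Z: "submod Z" and e: "vge M 0 e" "\<not> vge M 1 e"
    and x: "x \<in> carrier \<Sigma>" "scal e x \<in> loc M Z"
  shows "x \<in> loc M Z"
proof -
  note u = unitD[OF M e]
  have "scal (inv e) (scal e x) \<in> loc M Z" by (rule latD(4)[OF lat_loc[OF M Z] u(3) x(2)])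
  then show ?thesis using u x by (simp add: scal_scal)
qed

text \<open>The local denominators \<open>e M\<close> are combined with weights \<open>d M\<close>
  that are units at \<open>M\<close> and small elsewhere. The sum \<open>u\<close> is a unit at
  every place, hence invertible in \<open>S\<close>, and it multiplies \<open>x\<close> into
  \<open>Z\<close>.\<close>

lemma inter_loc:
  assumes Z: "submod Z" and x: "\<And>M. M \<in> Pl \<Longrightarrow> x \<in> loc M Z"
  shows "x \<in> Z"
proof -
  obtain M0 where "M0 \<in> Pl" using Pl_nonempty by blast
  then have xS: "x \<in> carrier \<Sigma>" using x by (auto simp: loc_def)
  have "\<exists>e. e \<in> S \<and> \<not> vge M 1 e \<and> scal e x \<in> Z" if "M \<in> Pl" for M
    using x[OF that] by (auto simp: loc_def)
  then obtain e where e: "\<And>M. M \<in> Pl \<Longrightarrow> e M \<in> S \<and> \<not> vge M 1 (e M) \<and> scal (e M) x \<in> Z" by metis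
  have "\<exists>d. d \<in> S \<and> \<not> vge M 1 d \<and> (\<forall>N \<in> Pl. N \<noteq> M \<longrightarrow> vge N 1 d)" if M: "M \<in> Pl" for M
    using approxE[OF M, of 1] by metis
  then obtain d where d: "\<And>M. M \<in> Pl \<Longrightarrow> d M \<in> S \<and> \<not> vge M 1 (d M) \<and> (\<forall>N \<in> Pl. N \<noteq> M \<longrightarrow> vge N 1 (d M))"
    by metis
  define u where "u = finsum K (\<lambda>M. d M \<otimes> e M) Pl"
  have de: "d M \<otimes> e M \<in> S" if "M \<in> Pl" for M using d[OF that] e[OF that] by simp
  have uS: "u \<in> S" unfolding u_def by (rule S_finsum) (use de in auto)
  have un: "\<not> vge M 1 u" if M: "M \<in> Pl" for M
  proof -
    let ?r = "finsum K (\<lambda>M. d M \<otimes> e M) (Pl - {M})"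
    have "u = finsum K (\<lambda>M. d M \<otimes> e M) (insert M (Pl - {M}))" using M by (simp add: u_def insert_absorb)
    also have "\<dots> = d M \<otimes> e M \<oplus> ?r"
      by (rule finsum_insert) (use de M S_carrier in \<open>auto simp: Pi_iff\<close>)
    finally have u: "u = ?r \<oplus> d M \<otimes> e M"
      using de M S_carrier by (subst a_comm) (auto intro!: finsum_closed)
    have "vge M 1 (d N \<otimes> e N)" if "N \<in> Pl - {M}" for N
      using vge_mult[OF M, of 1 "d N" 0 "e N"] d[of N] e[of N] that M by auto
    then have "vge M 1 ?r" using M by (intro vge_finsum) auto
    moreover have "\<not> vge M 1 (d M \<otimes> e M)" by (rule unit_mult) (use M d[OF M] e[OF M] in auto)
    ultimately show ?thesis unfolding u using vge_unit_sum[OF M] S_carrier[OF de[OF M]] by simp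
  qed
  have uK: "u \<in> carrier K" "u \<noteq> \<zero>" using uS S_carrier un[OF \<open>M0 \<in> Pl\<close>] by auto
  have "vge M 0 (inv u)" if "M \<in> Pl" for M using unitD(3)[OF that _ un[OF that]] uS that by simp
  then have iu: "inv u \<in> S" using uK by (simp add: S_iff)
  have "scal u x = finsum \<Sigma> (\<lambda>M. scal (d M \<otimes> e M) x) Pl"
    unfolding u_def by (rule scal_finsum_left) (use de S_carrier xS in auto)
  also have "\<dots> \<in> Z"
  proof -
    have "finsum \<Sigma> h B \<in> Z" if "finite B" "\<And>M. M \<in> B \<Longrightarrow> h M \<in> Z" for h and B :: "'p set"
      using that
    proof (induction B rule: finite_induct)
      case (insert b B)
      then have "h \<in> insert b B \<rightarrow> carrier \<Sigma>" using submodD(1)[OF Z] by blast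
      then show ?case using insert submodD(3)[OF Z] by (simp add: Pi_iff)
    qed (simp add: submodD(2)[OF Z])
    moreover have "scal (d M \<otimes> e M) x \<in> Z" if "M \<in> Pl" for M
    proof -
      have "scal (d M) (scal (e M) x) \<in> Z" using submodD(4)[OF Z] d[OF that] e[OF that] by blast
      then show ?thesis using d[OF that] e[OF that] S_carrier xS by (simp add: scal_scal)
    qed
    ultimately show ?thesis by simp
  qed
  finally have "scal (inv u) (scal u x) \<in> Z" by (rule submodD(4)[OF Z iu])
  then show ?thesis using uK xS by (simp add: scal_scal)
qed

text \<open>The summand with \<open>\<pi>\<close> keeps the span between \<pi>Z and Z, as
  \<open>stacked_basis\<close> asks of \<open>U\<close>. For empty \<open>\<Omega>\<close> only
  \<pi>Z is left, and the descent through the levels below ends there.\<close>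

definition span :: "('a \<Rightarrow> 'a) set \<Rightarrow> (('a \<Rightarrow> 'a) \<Rightarrow> 'a) set \<Rightarrow> (('a \<Rightarrow> 'a) \<Rightarrow> 'a) set" where
  "span \<Omega> Z = {finsum \<Sigma> (\<lambda>\<sigma>. lx \<sigma> (y \<sigma>)) \<Omega> \<boxplus> scal \<pi> z | y z. y \<in> \<Omega> \<rightarrow> Z \<and> z \<in> Z}"

lemma spanI:
  "y \<in> \<Omega> \<rightarrow> Z \<Longrightarrow> z \<in> Z \<Longrightarrow> x = finsum \<Sigma> (\<lambda>\<sigma>. lx \<sigma> (y \<sigma>)) \<Omega> \<boxplus> scal \<pi> z \<Longrightarrow> x \<in> span \<Omega> Z"
  unfolding span_def by (rule CollectI, rule exI[of _ y], rule exI[of _ z]) simp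

lemma span_pi:
  assumes Z: "stable Z" and \<Omega>: "\<Omega> \<subseteq> carrier G" and z: "z \<in> Z"
  shows "scal \<pi> z \<in> span \<Omega> Z"
  unfolding span_def
proof (rule CollectI, intro exI conjI)
  have "finsum \<Sigma> (\<lambda>\<sigma>. lx \<sigma> \<zero>\<^bsub>\<Sigma>\<^esub>) \<Omega> = \<zero>\<^bsub>\<Sigma>\<^esub>"
    by (rule S.add.finprod_one_eqI) (use \<Omega> in auto)
  then show "scal \<pi> z = finsum \<Sigma> (\<lambda>\<sigma>. lx \<sigma> ((\<lambda>_. \<zero>\<^bsub>\<Sigma>\<^esub>) \<sigma>)) \<Omega> \<boxplus> scal \<pi> z"
    using stableD(2)[OF Z z] by simp
qed (use stableD(3)[OF Z] z in auto)

lemma span_lx: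
  assumes Z: "stable Z" and \<Omega>: "\<Omega> \<subseteq> carrier G" and z: "z \<in> Z" and \<sigma>: "\<sigma> \<in> \<Omega>"
  shows "lx \<sigma> z \<in> span \<Omega> Z"
  unfolding span_def
proof (rule CollectI, intro exI conjI)
  let ?y = "\<lambda>\<kappa>. if \<sigma> = \<kappa> then z else \<zero>\<^bsub>\<Sigma>\<^esub>"
  have zS: "z \<in> carrier \<Sigma>" using stableD(2)[OF Z z] .
  have "finsum \<Sigma> (\<lambda>\<kappa>. lx \<kappa> (?y \<kappa>)) \<Omega> = finsum \<Sigma> (\<lambda>\<kappa>. if \<sigma> = \<kappa> then lx \<kappa> z else \<zero>\<^bsub>\<Sigma>\<^esub>) \<Omega>"
    by (rule S.finsum_cong') (use \<Omega> zS in auto)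
  also have "\<dots> = lx \<sigma> z"
    by (rule S.finsum_singleton) (use \<Omega> zS \<sigma> finite_subset[OF \<Omega> fin] in auto)
  finally show "lx \<sigma> z = finsum \<Sigma> (\<lambda>\<kappa>. lx \<kappa> (?y \<kappa>)) \<Omega> \<boxplus> scal \<pi> \<zero>\<^bsub>\<Sigma>\<^esub>"
    using zS \<Omega> \<sigma> by auto
qed (use stableD(3)[OF Z] z in auto)

lemma span_sub:
  assumes Z: "stable Z" and \<Omega>: "\<Omega> \<subseteq> carrier G"
  shows "span \<Omega> Z \<subseteq> Z"
proof
  fix x assume "x \<in> span \<Omega> Z"
  then obtain y z where x: "x = finsum \<Sigma> (\<lambda>\<sigma>. lx \<sigma> (y \<sigma>)) \<Omega> \<boxplus> scal \<pi> z" "y \<in> \<Omega> \<rightarrow> Z" "z \<in> Z"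
    by (auto simp: span_def)
  have "finsum \<Sigma> (\<lambda>\<sigma>. lx \<sigma> (y \<sigma>)) \<Omega> \<in> Z"
    by (rule stable_finsum[OF finite_subset[OF \<Omega> fin] Z]) (use \<Omega> x(2) stableD(6)[OF Z] in blast)
  then show "x \<in> Z" unfolding x(1) using stableD(4)[OF Z] stableD(5)[OF Z pi_S x(3)] by blast
qed

lemma span_submod:
  assumes Z: "stable Z" and \<Omega>: "\<Omega> \<subseteq> carrier G"
  shows "submod (span \<Omega> Z)"
  unfolding submod_def
proof (intro conjI ballI)
  show "span \<Omega> Z \<subseteq> carrier \<Sigma>" using span_sub[OF assms] stableD(2)[OF Z] by blast
  show "\<zero>\<^bsub>\<Sigma>\<^esub> \<in> span \<Omega> Z" using span_pi[OF assms stableD(3)[OF Z]] by simp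
  have fO: "finite \<Omega>" using finite_subset[OF \<Omega> fin] .
  fix x assume "x \<in> span \<Omega> Z"
  then obtain y z where x: "x = finsum \<Sigma> (\<lambda>\<sigma>. lx \<sigma> (y \<sigma>)) \<Omega> \<boxplus> scal \<pi> z" "y \<in> \<Omega> \<rightarrow> Z" "z \<in> Z"
    by (auto simp: span_def)
  have ycl: "(\<lambda>\<sigma>. lx \<sigma> (y \<sigma>)) \<in> \<Omega> \<rightarrow> carrier \<Sigma>" and y1: "y \<sigma> \<in> carrier \<Sigma>" if "\<sigma> \<in> \<Omega>" for \<sigma>
    using x(2) \<Omega> stableD(2)[OF Z] that by blast+
  have zcl: "z \<in> carrier \<Sigma>" using stableD(2)[OF Z x(3)] .
  have y1: "y \<sigma> \<in> carrier \<Sigma>" if "\<sigma> \<in> \<Omega>" for \<sigma> using x(2) stableD(2)[OF Z] that by blast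
  have ycl: "(\<lambda>\<sigma>. lx \<sigma> (y \<sigma>)) \<in> \<Omega> \<rightarrow> carrier \<Sigma>" using y1 \<Omega> by blast
  { fix x' assume "x' \<in> span \<Omega> Z"
    then obtain y' z' where x': "x' = finsum \<Sigma> (\<lambda>\<sigma>. lx \<sigma> (y' \<sigma>)) \<Omega> \<boxplus> scal \<pi> z'" "y' \<in> \<Omega> \<rightarrow> Z" "z' \<in> Z"
      by (auto simp: span_def)
    have zcl': "z' \<in> carrier \<Sigma>" using stableD(2)[OF Z x'(3)] .
    have y1': "y' \<sigma> \<in> carrier \<Sigma>" if "\<sigma> \<in> \<Omega>" for \<sigma> using x'(2) stableD(2)[OF Z] that by blast
    have ycl': "(\<lambda>\<sigma>. lx \<sigma> (y' \<sigma>)) \<in> \<Omega> \<rightarrow> carrier \<Sigma>" using y1' \<Omega> by blast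
    have "finsum \<Sigma> (\<lambda>\<sigma>. lx \<sigma> (y \<sigma> \<boxplus> y' \<sigma>)) \<Omega> = finsum \<Sigma> (\<lambda>\<sigma>. lx \<sigma> (y \<sigma>) \<boxplus> lx \<sigma> (y' \<sigma>)) \<Omega>"
      by (rule S.finsum_cong') (use ycl ycl' y1 y1' \<Omega> lx_add in \<open>auto simp: Pi_iff subset_iff\<close>)
    also have "\<dots> = finsum \<Sigma> (\<lambda>\<sigma>. lx \<sigma> (y \<sigma>)) \<Omega> \<boxplus> finsum \<Sigma> (\<lambda>\<sigma>. lx \<sigma> (y' \<sigma>)) \<Omega>"
      by (rule S.finsum_addf[OF ycl ycl'])
    finally have "x \<boxplus> x' = finsum \<Sigma> (\<lambda>\<sigma>. lx \<sigma> (y \<sigma> \<boxplus> y' \<sigma>)) \<Omega> \<boxplus> scal \<pi> (z \<boxplus> z')"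
      using S.finsum_closed[OF ycl] S.finsum_closed[OF ycl'] zcl zcl'
      by (simp add: x(1) x'(1) scal_add S.a_ac)
    from spanI[OF _ stableD(4)[OF Z x(3) x'(3)] this] show "x \<boxplus> x' \<in> span \<Omega> Z"
      using x(2) x'(2) stableD(4)[OF Z] by blast }
  fix a assume a: "a \<in> S"
  then have aK: "a \<in> carrier K" using S_carrier by blast
  have "scal a (finsum \<Sigma> (\<lambda>\<sigma>. lx \<sigma> (y \<sigma>)) \<Omega>) = finsum \<Sigma> (\<lambda>\<sigma>. scal a (lx \<sigma> (y \<sigma>))) \<Omega>"
    by (rule scal_finsum[OF fO ycl aK])
  also have "\<dots> = finsum \<Sigma> (\<lambda>\<sigma>. lx \<sigma> (scal ((\<iota> \<sigma>) a) (y \<sigma>))) \<Omega>"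
  proof (rule S.finsum_cong')
    fix \<sigma> assume \<sigma>: "\<sigma> \<in> \<Omega>"
    then have "\<sigma> \<in> carrier G" using \<Omega> by blast
    then show "scal a (lx \<sigma> (y \<sigma>)) = lx \<sigma> (scal ((\<iota> \<sigma>) a) (y \<sigma>))"
      using aK y1[OF \<sigma>] by (simp add: lx_scal)
  qed (use aK y1 \<Omega> in \<open>auto simp: subset_iff\<close>)
  finally have "scal a x = finsum \<Sigma> (\<lambda>\<sigma>. lx \<sigma> (scal ((\<iota> \<sigma>) a) (y \<sigma>))) \<Omega> \<boxplus> scal \<pi> (scal a z)"
    using S.finsum_closed[OF ycl] zcl aK by (simp add: x(1) scal_add scal_scal m_comm)
  note eq = this
  show "scal a x \<in> span \<Omega> Z"
  proof (rule spanI[OF _ stableD(5)[OF Z a x(3)] eq], rule Pi_I)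
    fix \<sigma> assume \<sigma>: "\<sigma> \<in> \<Omega>"
    then have "\<sigma> \<in> carrier G" "y \<sigma> \<in> Z" using \<Omega> x(2) by blast+
    then show "scal ((\<iota> \<sigma>) a) (y \<sigma>) \<in> Z" using stableD(5)[OF Z act_S[of "\<iota> \<sigma>" a]] a by simp
  qed
qed

lemma loc_span_ge1:
  assumes M: "M \<in> Pl" and Z: "stable Z" and \<Omega>: "\<Omega> \<subseteq> carrier G" and a: "vge M 1 a" and z: "z \<in> Z"
  shows "scal a z \<in> loc M (span \<Omega> Z)"
proof -
  obtain b where b: "vge M 0 b" "a = \<pi> \<otimes> b" using div_pi[OF M, of 0 a] a by auto
  have "scal a z = scal b (scal \<pi> z)"
    using b vge_carrier[OF b(1)] stableD(2)[OF Z z] by (simp add: scal_scal m_comm)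
  moreover have "scal \<pi> z \<in> loc M (span \<Omega> Z)"
    by (rule sub_loc[OF M span_submod[OF Z \<Omega>] span_pi[OF Z \<Omega> z]])
  ultimately show ?thesis using latD(4)[OF lat_loc[OF M span_submod[OF Z \<Omega>]] b(1)] by simp
qed

text \<open>Translation by x_\<tau> leads from the place \<tau>^-1 M to M. Each product x_\<tau>
  x_\<sigma> = f(\<tau>,\<sigma>) x_(\<tau>\<sigma>) is either a multiple of \<pi> at M or has its
  index in \<open>\<Omega>'\<close>.\<close>

lemma lx_loc_span:
  assumes M: "M \<in> Pl" and \<tau>: "\<tau> \<in> carrier G" and Z: "stable Z"
    and \<Omega>: "\<Omega> \<subseteq> carrier G" and \<Omega>': "\<Omega>' \<subseteq> carrier G"
    and y: "y \<in> loc (act (\<iota> \<tau>) M) (span \<Omega> Z)"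
    and *: "\<And>\<sigma>. \<sigma> \<in> \<Omega> \<Longrightarrow> vge M 1 (f \<tau> \<sigma>) \<or> \<tau> \<bullet> \<sigma> \<in> \<Omega>'"
  shows "lx \<tau> y \<in> loc M (span \<Omega>' Z)"
proof -
  let ?L = "loc M (span \<Omega>' Z)"
  note sub = span_submod[OF Z \<Omega>']
  note L = latD[OF lat_loc[OF M sub]]
  obtain e where e: "y \<in> carrier \<Sigma>" "e \<in> S" "e \<in> carrier K" "\<not> vge (act (\<iota> \<tau>) M) 1 e" "scal e y \<in> span \<Omega> Z"
    using y by (rule locE)
  obtain w z where w: "scal e y = finsum \<Sigma> (\<lambda>\<sigma>. lx \<sigma> (w \<sigma>)) \<Omega> \<boxplus> scal \<pi> z" "w \<in> \<Omega> \<rightarrow> Z" "z \<in> Z"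
    using e(5) by (auto simp: span_def)
  have fO: "finite \<Omega>" using finite_subset[OF \<Omega> fin] .
  have wZ: "w \<sigma> \<in> Z" "w \<sigma> \<in> carrier \<Sigma>" "\<sigma> \<in> carrier G" if "\<sigma> \<in> \<Omega>" for \<sigma>
    using w(2) \<Omega> stableD(2)[OF Z] that by blast+
  have zS: "z \<in> carrier \<Sigma>" using stableD(2)[OF Z w(3)] .
  have wcl: "(\<lambda>\<sigma>. lx \<sigma> (w \<sigma>)) \<in> \<Omega> \<rightarrow> carrier \<Sigma>" using wZ by blast
  have "scal (\<tau> e) (lx \<tau> y) = lx \<tau> (scal e y)" using \<tau> e(1,3) by (simp add: lx_scal)
  also have "\<dots> = finsum \<Sigma> (\<lambda>\<sigma>. lx \<tau> (lx \<sigma> (w \<sigma>))) \<Omega> \<boxplus> lx \<tau> (scal \<pi> z)"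
    unfolding w(1) using lx_add[OF \<tau> S.finsum_closed[OF wcl]] lx_finsum[OF fO wcl \<tau>] zS by simp
  finally have eq: "scal (\<tau> e) (lx \<tau> y) = finsum \<Sigma> (\<lambda>\<sigma>. lx \<tau> (lx \<sigma> (w \<sigma>))) \<Omega> \<boxplus> lx \<tau> (scal \<pi> z)" .
  have "lx \<tau> (lx \<sigma> (w \<sigma>)) \<in> ?L" if \<sigma>: "\<sigma> \<in> \<Omega>" for \<sigma>
  proof -
    have eq: "lx \<tau> (lx \<sigma> (w \<sigma>)) = scal (f \<tau> \<sigma>) (lx (\<tau> \<bullet> \<sigma>) (w \<sigma>))"
      using \<tau> wZ[OF \<sigma>] by (simp add: lx_lx)
    have lZ: "lx (\<tau> \<bullet> \<sigma>) (w \<sigma>) \<in> Z" using stableD(6)[OF Z] \<tau> wZ[OF \<sigma>] by simp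
    show ?thesis
    proof (cases "vge M 1 (f \<tau> \<sigma>)")
      case True
      then show ?thesis unfolding eq by (rule loc_span_ge1[OF M Z \<Omega>' _ lZ])
    next
      case False
      then have "\<tau> \<bullet> \<sigma> \<in> \<Omega>'" using *[OF \<sigma>] by simp
      then have "lx (\<tau> \<bullet> \<sigma>) (w \<sigma>) \<in> ?L" by (rule sub_loc[OF M sub span_lx[OF Z \<Omega>' wZ(1)[OF \<sigma>]]])
      then show ?thesis unfolding eq using L(4) S_vge[OF f_S[OF \<tau> wZ(3)[OF \<sigma>]] M] by blast
    qed
  qed
  then have "finsum \<Sigma> (\<lambda>\<sigma>. lx \<tau> (lx \<sigma> (w \<sigma>))) \<Omega> \<in> ?L"
    by (rule lat_finsum[OF fO lat_loc[OF M sub]])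
  moreover have "lx \<tau> (scal \<pi> z) = scal \<pi> (lx \<tau> z)" using \<tau> zS by (simp add: lx_scal)
  then have "lx \<tau> (scal \<pi> z) \<in> ?L"
    using sub_loc[OF M sub span_pi[OF Z \<Omega>' stableD(6)[OF Z \<tau> w(3)]]] by simp
  ultimately have "scal (\<tau> e) (lx \<tau> y) \<in> ?L" unfolding eq by (rule L(3))
  moreover have "\<not> vge M 1 (\<tau> e)" using e(3,4) vge_act'[OF M \<tau>] by simp
  moreover have "vge M 0 (\<tau> e)" using e(2) \<tau> M by simp
  ultimately show ?thesis using loc_unscale[OF M sub] \<tau> e(1) by blast
qed

abbreviation End :: "(('a \<Rightarrow> 'a) \<Rightarrow> 'a) set \<Rightarrow> ((('a \<Rightarrow> 'a) \<Rightarrow> 'a) \<Rightarrow> ('a \<Rightarrow> 'a) \<Rightarrow> 'a) set" where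
  "End Z \<equiv> left_module_hom A (left_ideal_module A Z) (left_ideal_module A Z)"

abbreviation frank :: "(('a \<Rightarrow> 'a) \<Rightarrow> 'a) set \<Rightarrow> ((('a \<Rightarrow> 'a) \<Rightarrow> 'a) \<Rightarrow> ('a \<Rightarrow> 'a) \<Rightarrow> 'a) \<Rightarrow> bool" where
  "frank Z \<equiv> finite_rank_map A (left_ideal_module A Z)"

lemma EndD:
  assumes Z: "stable Z" and h: "h \<in> End Z" and x: "x \<in> Z"
  shows "h x \<in> Z" "y \<in> Z \<Longrightarrow> h (x \<boxplus> y) = h x \<boxplus> h y"
    "a \<in> S \<Longrightarrow> h (scal a x) = scal a (h x)" "\<sigma> \<in> carrier G \<Longrightarrow> h (lx \<sigma> x) = lx \<sigma> (h x)"
proof -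
  note h' = left_module_homD[OF h, simplified]
  show hx: "h x \<in> Z" using h'(1) x by blast
  show "y \<in> Z \<Longrightarrow> h (x \<boxplus> y) = h x \<boxplus> h y" using h'(2) x by blast
  have cl: "x \<in> carrier \<Sigma>" "h x \<in> carrier \<Sigma>" using stableD(2)[OF Z] x hx by blast+
  show "h (scal a x) = scal a (h x)" if "a \<in> S"
    using h'(3)[OF scal_A[OF that unit_vec_A[of "\<one>\<^bsub>G\<^esub>"]] x] that S_carrier cl
    by (simp add: scal_one_mult flip: one_Sigma')
  show "h (lx \<sigma> x) = lx \<sigma> (h x)" if "\<sigma> \<in> carrier G"
    using h'(3)[OF unit_vec_A[of \<sigma>] x] that cl by (simp add: unit_vec_mult)
qed

lemma End_finsum:
  assumes Z: "stable Z" and h: "h \<in> End Z" and "finite B" "g \<in> B \<rightarrow> Z"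
  shows "h (finsum \<Sigma> g B) = finsum \<Sigma> (\<lambda>i. h (g i)) B"
  using assms(3,4)
proof (induction B rule: finite_induct)
  case empty
  have "h (scal \<zero> \<zero>\<^bsub>\<Sigma>\<^esub>) = scal \<zero> (h \<zero>\<^bsub>\<Sigma>\<^esub>)" by (rule EndD(3)[OF Z h stableD(3)[OF Z]]) simp
  then show ?case using stableD(2)[OF Z EndD(1)[OF Z h stableD(3)[OF Z]]] by simp
next
  case (insert b B)
  have g: "g i \<in> Z" if "i \<in> insert b B" for i using insert.prems that by blast
  have cl: "g \<in> insert b B \<rightarrow> carrier \<Sigma>" "(\<lambda>i. h (g i)) \<in> insert b B \<rightarrow> carrier \<Sigma>"
    using g stableD(2)[OF Z] EndD(1)[OF Z h] by blast+
  have "finsum \<Sigma> g B \<in> Z" by (rule stable_finsum[OF insert.hyps(1) Z]) (use g in blast)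
  then show ?case using insert cl EndD(2)[OF Z h g] by (simp add: Pi_iff)
qed

lemma left_module_Z: "stable Z \<Longrightarrow> left_module A (left_ideal_module A Z)"
  by (rule left_ideal_module_left_module[OF A_ring]) (simp add: left_ideal_iff_stable)

text \<open>An endomorphism commutes with the x_\<tau>, so its effect on the span of
  \<open>\<Omega>\<close> is governed by the translates \<open>lx \<tau> (h y)\<close>, while \<pi>Z
  is mapped into itself.\<close>

lemma End_loc_span:
  assumes M: "M \<in> Pl" and Z: "stable Z" and \<Omega>: "\<Omega> \<subseteq> carrier G" and \<Omega>': "\<Omega>' \<subseteq> carrier G"
    and h: "h \<in> End Z" and x: "x \<in> Z" "x \<in> loc M (span \<Omega> Z)"
    and *: "\<And>\<tau> y. \<tau> \<in> \<Omega> \<Longrightarrow> y \<in> Z \<Longrightarrow> lx \<tau> (h y) \<in> loc M (span \<Omega>' Z)"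
  shows "h x \<in> loc M (span \<Omega>' Z)"
proof -
  let ?L = "loc M (span \<Omega>' Z)"
  note sub = span_submod[OF Z \<Omega>']
  obtain e where e: "e \<in> S" "\<not> vge M 1 e" "scal e x \<in> span \<Omega> Z" using x(2) by (rule locE)
  obtain w z where w: "scal e x = finsum \<Sigma> (\<lambda>\<sigma>. lx \<sigma> (w \<sigma>)) \<Omega> \<boxplus> scal \<pi> z" "w \<in> \<Omega> \<rightarrow> Z" "z \<in> Z"
    using e(3) by (auto simp: span_def)
  have fO: "finite \<Omega>" using finite_subset[OF \<Omega> fin] .
  have wZ: "w \<sigma> \<in> Z" "\<sigma> \<in> carrier G" if "\<sigma> \<in> \<Omega>" for \<sigma> using w(2) \<Omega> that by blast+
  have lw: "(\<lambda>\<sigma>. lx \<sigma> (w \<sigma>)) \<in> \<Omega> \<rightarrow> Z" using wZ stableD(6)[OF Z] by blast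
  have sZ: "finsum \<Sigma> (\<lambda>\<sigma>. lx \<sigma> (w \<sigma>)) \<Omega> \<in> Z" by (rule stable_finsum[OF fO Z lw])
  have "scal e (h x) = h (scal e x)" using EndD(3)[OF Z h x(1) e(1)] ..
  also have "\<dots> = finsum \<Sigma> (\<lambda>\<sigma>. h (lx \<sigma> (w \<sigma>))) \<Omega> \<boxplus> scal \<pi> (h z)"
    unfolding w(1) EndD(2)[OF Z h sZ stableD(5)[OF Z pi_S w(3)]] End_finsum[OF Z h fO lw]
      EndD(3)[OF Z h w(3) pi_S] ..
  finally have eq: "scal e (h x) = finsum \<Sigma> (\<lambda>\<sigma>. h (lx \<sigma> (w \<sigma>))) \<Omega> \<boxplus> scal \<pi> (h z)" .
  have "h (lx \<sigma> (w \<sigma>)) \<in> ?L" if "\<sigma> \<in> \<Omega>" for \<sigma>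
    using *[OF that wZ(1)[OF that]] EndD(4)[OF Z h wZ(1)[OF that] wZ(2)[OF that]] by simp
  then have "finsum \<Sigma> (\<lambda>\<sigma>. h (lx \<sigma> (w \<sigma>))) \<Omega> \<in> ?L" by (rule lat_finsum[OF fO lat_loc[OF M sub]])
  moreover have "scal \<pi> (h z) \<in> ?L"
    by (rule sub_loc[OF M sub span_pi[OF Z \<Omega>' EndD(1)[OF Z h w(3)]]])
  ultimately have "scal e (h x) \<in> ?L" unfolding eq by (rule latD(3)[OF lat_loc[OF M sub]])
  then show ?thesis
    using loc_unscale[OF M sub _ e(2)] e(1) M stableD(2)[OF Z EndD(1)[OF Z h x(1)]] by simp
qed

lemma End_loc_span_same:
  assumes M: "M \<in> Pl" and Z: "stable Z" and \<Omega>: "\<Omega> \<subseteq> carrier G" and h: "h \<in> End Z"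
    and x: "x \<in> Z" "x \<in> loc M (span \<Omega> Z)"
  shows "h x \<in> loc M (span \<Omega> Z)"
proof (rule End_loc_span[OF M Z \<Omega> \<Omega> h x])
  fix \<tau> y assume "\<tau> \<in> \<Omega>" "y \<in> Z"
  then show "lx \<tau> (h y) \<in> loc M (span \<Omega> Z)"
    using sub_loc[OF M span_submod[OF Z \<Omega>] span_lx[OF Z \<Omega> EndD(1)[OF Z h]]] by blast
qed

end

context valued_crossed
begin

subsection \<open>Sufficiency\<close>

text \<open>The endomorphism 1 - h. Maps that differ from 1 by one of finite rank are closed under
  composition, and the smallness to be gained is a property of these complements, so the argument
  multiplies them.\<close>

definition cpl :: "((('a \<Rightarrow> 'a) \<Rightarrow> 'a) \<Rightarrow> ('a \<Rightarrow> 'a) \<Rightarrow> 'a) \<Rightarrow> (('a \<Rightarrow> 'a) \<Rightarrow> 'a) \<Rightarrow> ('a \<Rightarrow> 'a) \<Rightarrow> 'a" where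
  "cpl h x = x \<boxplus> scal (\<ominus> \<one>) (h x)"

lemma EndI:
  assumes Z: "stable Z" and "\<And>x. x \<in> Z \<Longrightarrow> h x \<in> Z"
    and "\<And>x y. x \<in> Z \<Longrightarrow> y \<in> Z \<Longrightarrow> h (x \<boxplus> y) = h x \<boxplus> h y"
    and "\<And>a x. a \<in> S \<Longrightarrow> x \<in> Z \<Longrightarrow> h (scal a x) = scal a (h x)"
    and "\<And>\<sigma> x. \<sigma> \<in> carrier G \<Longrightarrow> x \<in> Z \<Longrightarrow> h (lx \<sigma> x) = lx \<sigma> (h x)"
  shows "h \<in> End Z"
  by (rule A_hom[OF Z]) (use assms stableD(2)[OF Z] in blast)+

lemma neg_one_S [simp]: "\<ominus> \<one> \<in> S" by blast

lemma cpl_End: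
  assumes Z: "stable Z" and h: "h \<in> End Z" shows "cpl h \<in> End Z"
proof (rule EndI[OF Z])
  fix x assume x: "x \<in> Z"
  note hx = EndD[OF Z h x]
  have cl: "x \<in> carrier \<Sigma>" "h x \<in> carrier \<Sigma>" using stableD(2)[OF Z] x hx(1) by blast+
  show "cpl h x \<in> Z" unfolding cpl_def by (rule stableD(4)[OF Z x stableD(5)[OF Z neg_one_S hx(1)]])
  show "cpl h (scal a x) = scal a (cpl h x)" if "a \<in> S" for a
    using that hx(3)[OF that] S_carrier[OF that] cl by (simp add: cpl_def scal_add scal_scal m_comm)
  show "cpl h (lx \<sigma> x) = lx \<sigma> (cpl h x)" if "\<sigma> \<in> carrier G" for \<sigma>
    using that hx(4)[OF that] cl by (simp add: cpl_def lx_add lx_scal act_neg)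
  fix y assume y: "y \<in> Z"
  have cl': "y \<in> carrier \<Sigma>" "h y \<in> carrier \<Sigma>" using stableD(2)[OF Z] y EndD(1)[OF Z h] by blast+
  show "cpl h (x \<boxplus> y) = cpl h x \<boxplus> cpl h y"
    using hx(2)[OF y] cl cl' by (simp add: cpl_def scal_add S.a_ac)
qed

lemma frank_End: "stable Z \<Longrightarrow> frank Z h \<Longrightarrow> h \<in> End Z"
  using left_module.finite_rank_map_hom[OF left_module_Z] .

text \<open>The average over G of the \<open>K\<close>-linear map
  \<open>x \<mapsto> scal d (comb L x)\<close>. The weight \<open>d\<close> is absorbed into the
  functionals, where it can make them integral, and each pair contributes one instance of
  \<open>extend_finite_rank\<close>.\<close>

lemma comb_finite_rank:
  assumes Z: "stable Z" and d: "d \<in> carrier K"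
    and L: "\<And>c b. (c, b) \<in> set L \<Longrightarrow> c \<in> carrier \<Sigma> \<and> b \<in> Z \<and>
      (\<forall>\<sigma> \<in> carrier G. \<forall>x \<in> Z. inv (f \<sigma> (\<iota> \<sigma>)) \<otimes> (d \<otimes> dot c (lx \<sigma> x)) \<in> S)"
  shows "frank Z (\<lambda>x. finsum \<Sigma> (\<lambda>\<sigma>. ly \<sigma> (scal d (comb L (lx \<sigma> x)))) (carrier G))"
  using L
proof (induction L)
  case Nil
  show ?case
  proof (rule finite_rank_map.zero)
    fix x assume "x \<in> carrier (left_ideal_module A Z)"
    have "finsum \<Sigma> (\<lambda>\<sigma>. ly \<sigma> (scal d (comb [] (lx \<sigma> x)))) (carrier G) = \<zero>\<^bsub>\<Sigma>\<^esub>"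
      by (rule S.add.finprod_one_eqI) (use d in simp)
    then show "finsum \<Sigma> (\<lambda>\<sigma>. ly \<sigma> (scal d (comb [] (lx \<sigma> x)))) (carrier G) = \<zero>\<^bsub>left_ideal_module A Z\<^esub>"
      by simp
  qed
next
  case (Cons p L)
  obtain c b where p: "p = (c, b)" by force
  have cb: "c \<in> carrier \<Sigma>" "b \<in> Z" "b \<in> carrier \<Sigma>"
    and int: "\<And>\<sigma> x. \<sigma> \<in> carrier G \<Longrightarrow> x \<in> Z \<Longrightarrow> inv (f \<sigma> (\<iota> \<sigma>)) \<otimes> (d \<otimes> dot c (lx \<sigma> x)) \<in> S"
    using Cons.prems[of c b] stableD(2)[OF Z] p by auto
  let ?\<theta>1 = "\<lambda>x. finsum \<Sigma> (\<lambda>\<sigma>. ly \<sigma> (scal (dot (scal d c) (lx \<sigma> x)) b)) (carrier G)"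
  let ?\<theta>2 = "\<lambda>x. finsum \<Sigma> (\<lambda>\<sigma>. ly \<sigma> (scal d (comb L (lx \<sigma> x)))) (carrier G)"
  have "frank Z ?\<theta>1"
  proof (rule extend_finite_rank[OF Z _ cb(2)])
    show "scal d c \<in> carrier \<Sigma>" using d cb by simp
    show "inv (f \<sigma> (\<iota> \<sigma>)) \<otimes> dot (scal d c) (lx \<sigma> x) \<in> S" if "\<sigma> \<in> carrier G" "x \<in> Z" for \<sigma> x
      using int[OF that] cb d that stableD(2)[OF Z that(2)] by (simp add: dot_scal_left)
  qed simp
  moreover have "frank Z ?\<theta>2" by (rule Cons.IH, rule Cons.prems) simp
  ultimately show ?case
  proof (rule left_module.finite_rank_map_add[OF left_module_Z[OF Z]])
    fix x assume "x \<in> carrier (left_ideal_module A Z)"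
    then have x: "x \<in> carrier \<Sigma>" using stableD(2)[OF Z] by simp
    have L: "comb L y \<in> carrier \<Sigma>" if "y \<in> carrier \<Sigma>" for y
    proof (rule comb_closed[OF _ that])
      fix c b assume "(c, b) \<in> set L"
      then have "(c, b) \<in> set (p # L)" by simp
      from Cons.prems[OF this] show "c \<in> carrier \<Sigma> \<and> b \<in> carrier \<Sigma>" using stableD(2)[OF Z] by blast
    qed
    have "finsum \<Sigma> (\<lambda>\<sigma>. ly \<sigma> (scal d (comb (p # L) (lx \<sigma> x)))) (carrier G)
      = finsum \<Sigma> (\<lambda>\<sigma>. ly \<sigma> (scal (dot (scal d c) (lx \<sigma> x)) b) \<boxplus> ly \<sigma> (scal d (comb L (lx \<sigma> x)))) (carrier G)"
    proof (rule S.finsum_cong')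
      fix \<sigma> assume \<sigma>: "\<sigma> \<in> carrier G"
      show "ly \<sigma> (scal d (comb (p # L) (lx \<sigma> x)))
          = ly \<sigma> (scal (dot (scal d c) (lx \<sigma> x)) b) \<boxplus> ly \<sigma> (scal d (comb L (lx \<sigma> x)))"
        using \<sigma> x cb d L[OF lx_closed[OF \<sigma> x]] by (simp add: p ly_add[symmetric] scal_add scal_scal dot_scal_left)
    qed (use x cb d L in auto)
    also have "\<dots> = ?\<theta>1 x \<boxplus> ?\<theta>2 x"
      by (rule S.finsum_addf) (use x cb d L in auto)
    finally show "finsum \<Sigma> (\<lambda>\<sigma>. ly \<sigma> (scal d (comb (p # L) (lx \<sigma> x)))) (carrier G)
      = ?\<theta>1 x \<oplus>\<^bsub>left_ideal_module A Z\<^esub> ?\<theta>2 x" by simp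
  qed
qed

text \<open>Functionals that are integral at one place may have poles at the others. A common bound
  for these poles allows a single multiplier to remove them all.\<close>

lemma dot_bounded:
  assumes "finite C" "C \<subseteq> carrier \<Sigma>"
  shows "\<exists>k. \<forall>c \<in> C. \<forall>N \<in> Pl. \<forall>x \<in> carrier G \<rightarrow>\<^sub>E S. vge N k (dot c x)"
proof -
  define k where "k = Min (insert 0 ((\<lambda>(c, N, g). v N (c g)) ` (C \<times> Pl \<times> carrier G)))"
  have k: "k \<le> v N (c g)" if "c \<in> C" "N \<in> Pl" "g \<in> carrier G" for c N g
    unfolding k_def by (rule Min_le) (use assms(1) that in \<open>auto intro!: image_eqI[of _ _ "(c, N, g)"]\<close>)
  have "vge N k (dot c x)" if "c \<in> C" "N \<in> Pl" "x \<in> carrier G \<rightarrow>\<^sub>E S" for c N x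
    unfolding dot_def
  proof (rule vge_finsum[OF fin that(2)])
    fix g assume g: "g \<in> carrier G"
    have "vge N k (c g)" using k[OF that(1,2) g] assms(2) that(1) g by (auto simp: vge_def)
    moreover have "vge N 0 (x g)" using that g by simp
    ultimately show "vge N k (c g \<otimes> x g)" using vge_mult[OF that(2)] by fastforce
  qed
  then show ?thesis by blast
qed

text \<open>The functionals are integral at \<open>M\<close> only, but the vectors lie in
  \<open>Z\<close> itself and not just in its localization, because they become the vectors
  \<open>u\<close> of a map of finite rank.\<close>

definition stacked where
  "stacked M Z U L1 L0 \<longleftrightarrow>
    (\<forall>c b. (c, b) \<in> set (L1 @ L0) \<longrightarrow> c \<in> carrier \<Sigma> \<and> b \<in> Z \<and> (\<forall>x \<in> loc M Z. vge M 0 (dot c x))) \<and>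
    (\<forall>c b. (c, b) \<in> set L0 \<longrightarrow> b \<in> U) \<and> (\<forall>c b x. (c, b) \<in> set L1 \<longrightarrow> x \<in> U \<longrightarrow> vge M 1 (dot c x)) \<and>
    (\<forall>x \<in> loc M Z. comb (L1 @ L0) x = x)"

lemma stackedD:
  assumes "stacked M Z U L1 L0"
  shows "(c, b) \<in> set (L1 @ L0) \<Longrightarrow> c \<in> carrier \<Sigma> \<and> b \<in> Z \<and> (\<forall>x \<in> loc M Z. vge M 0 (dot c x))"
    and "(c, b) \<in> set L0 \<Longrightarrow> b \<in> U" and "(c, b) \<in> set L1 \<Longrightarrow> x \<in> U \<Longrightarrow> vge M 1 (dot c x)"
    and "x \<in> loc M Z \<Longrightarrow> comb (L1 @ L0) x = x"
  using assms unfolding stacked_def by meson+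

lemma stacked_basis_loc:
  assumes M: "M \<in> Pl" and Z: "stable Z" and U: "lat M U" "U \<subseteq> loc M Z"
    and piU: "\<And>x. x \<in> loc M Z \<Longrightarrow> scal \<pi> x \<in> U"
  shows "\<exists>L1 L0. stacked M Z U L1 L0"
proof -
  have "\<exists>L1 L0. (\<forall>(c, b) \<in> set (L1 @ L0). c \<in> carrier \<Sigma> \<and> b \<in> loc M Z \<and> b \<in> Z \<and> (\<forall>x \<in> loc M Z. vge M 0 (dot c x))) \<and>
    (\<forall>(c, b) \<in> set L0. b \<in> U) \<and> (\<forall>(c, b) \<in> set L1. \<forall>x \<in> U. vge M 1 (dot c x)) \<and>
    (\<forall>x \<in> loc M Z. comb (L1 @ L0) x = x)"
  proof (rule stacked_basis[where k = 0, OF M fin order_refl lat_loc[OF M stable_submod[OF Z]] U])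
    show "scal \<pi> x \<in> U" if "x \<in> loc M Z" for x by (rule piU[OF that])
    show "x \<rho> = \<zero>" if "x \<in> loc M Z" "\<rho> \<in> carrier G - carrier G" for x \<rho> using that by simp
    show "\<exists>e. vge M 0 e \<and> \<not> vge M 1 e \<and> scal e x \<in> Z" if "x \<in> loc M Z" for x
      using that M by (elim locE) (metis S_vge)
    show "vge M 0 (x \<rho>)" if xl: "x \<in> loc M Z" and \<rho>: "\<rho> \<in> carrier G" for x \<rho>
    proof -
      obtain e where e: "x \<in> carrier \<Sigma>" "e \<in> S" "e \<in> carrier K" "\<not> vge M 1 e" "scal e x \<in> Z"
        using xl by (rule locE)
      note u = unitD[OF M S_vge[OF e(2) M] e(4)]
      have "e \<otimes> x \<rho> \<in> S" using stableD(1)[OF Z e(5)] A_closed[of "scal e x" \<rho>] \<rho> by simp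
      then have "vge M 0 (inv e \<otimes> (e \<otimes> x \<rho>))" using vge_mult[OF M u(3)] M by fastforce
      then show ?thesis using u e(1,3) \<rho> by simp
    qed
  qed
  then obtain L1 L0 where
    1: "\<forall>(c, b) \<in> set (L1 @ L0). c \<in> carrier \<Sigma> \<and> b \<in> loc M Z \<and> b \<in> Z \<and> (\<forall>x \<in> loc M Z. vge M 0 (dot c x))"
    and 2: "\<forall>(c, b) \<in> set L0. b \<in> U" and 3: "\<forall>(c, b) \<in> set L1. \<forall>x \<in> U. vge M 1 (dot c x)"
    and 4: "\<forall>x \<in> loc M Z. comb (L1 @ L0) x = x" by (elim exE conjE)
  have "stacked M Z U L1 L0"
    unfolding stacked_def
  proof (intro conjI allI impI)
    fix c b
    show "c \<in> carrier \<Sigma>" "b \<in> Z" "\<forall>x \<in> loc M Z. vge M 0 (dot c x)" if "(c, b) \<in> set (L1 @ L0)"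
      using bspec[OF 1 that] by simp_all
    show "b \<in> U" if "(c, b) \<in> set L0" using bspec[OF 2 that] by simp
    show "vge M 1 (dot c x)" if "(c, b) \<in> set L1" "x \<in> U" for x using bspec[OF 3 that(1)] that(2) by simp
  qed (rule 4)
  then show ?thesis by blast
qed

lemma power_pi: "\<pi> [^] (n::nat) \<in> carrier K" "\<pi> [^] n \<noteq> \<zero>" "M \<in> Pl \<Longrightarrow> v M (\<pi> [^] n) = int n"
  "\<sigma> \<in> carrier G \<Longrightarrow> \<sigma> (\<pi> [^] n) = \<pi> [^] n" "\<pi> [^] n \<in> S"
  by (induction n) (auto simp: v_mult act_times)

text \<open>Since x_\<sigma> x_(\<sigma>^-1) = f(\<sigma>,\<sigma>^-1), these are the \<sigma> for
  which averaging divides by a nonunit at \<open>M\<close>.\<close>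

abbreviation bad :: "'p \<Rightarrow> ('a \<Rightarrow> 'a) set" where
  "bad M \<equiv> {\<sigma> \<in> carrier G. vge M 1 (f \<sigma> (\<iota> \<sigma>))}"

context
  assumes sqfree: "\<And>\<sigma> M. \<sigma> \<in> carrier G \<Longrightarrow> M \<in> Pl \<Longrightarrow> \<not> vge M 2 (f \<sigma> (\<iota> \<sigma>))"
begin

lemma inv_f_vge:
  assumes "\<sigma> \<in> carrier G" "M \<in> Pl" shows "vge M (-1) (inv (f \<sigma> (\<iota> \<sigma>)))"
  using sqfree[OF assms] assms by (simp add: vge_inv) (simp add: vge_def)

lemma inv_f_vge':
  assumes "\<sigma> \<in> carrier G" "M \<in> Pl" shows "vge M (-1) (inv (f (\<iota> \<sigma>) \<sigma>))"
  using inv_f_vge[of "\<iota> \<sigma>" M] assms by simp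

lemma inv_f_vge0:
  assumes "\<sigma> \<in> carrier G" "M \<in> Pl" "\<not> vge M 1 (f \<sigma> (\<iota> \<sigma>))" shows "vge M 0 (inv (f \<sigma> (\<iota> \<sigma>)))"
  using unitD(3)[OF assms(2) _ assms(3)] assms by simp

text \<open>The identity of \<open>Z\<close>, written in a basis at an arbitrary place, is averaged
  with the weight \<pi>^s c, where c has trace 1. Averaging a multiple of the identity gives the
  trace of the weight, here \<pi>^s, and a large s outweighs the poles of the functionals, of c and
  of the inverses of f.\<close>

lemma pi_power_finite_rank:
  assumes Z: "stable Z"
  shows "\<exists>s. frank Z (scal (\<pi> [^] (s::nat)))"
proof -
  obtain M where M: "M \<in> Pl" using Pl_nonempty by blast
  have sub: "submod Z" using stable_submod[OF Z] .
  note lat = lat_loc[OF M sub]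
  have "scal \<pi> x \<in> loc M Z" if "x \<in> loc M Z" for x
    by (rule latD(4)[OF lat _ that]) (simp add: M)
  from stacked_basis_loc[OF M Z lat order_refl this] obtain L1 L0 where st: "stacked M Z (loc M Z) L1 L0" by blast
  note L = stackedD(1)[OF st] and id = stackedD(4)[OF st]
  define L' where "L' = L1 @ L0"
  have L': "c \<in> carrier \<Sigma>" "b \<in> Z" if "(c, b) \<in> set L'" for c b
    using L[folded L'_def, OF that] by simp_all
  obtain c where c: "c \<in> carrier K" "finsum K (\<lambda>\<sigma>. \<sigma> c) (carrier G) = \<one>" using trace_one by blast
  have "fst ` set L' \<subseteq> carrier \<Sigma>" using L' by force
  then obtain k where k: "\<forall>c \<in> fst ` set L'. \<forall>N \<in> Pl. \<forall>x \<in> carrier G \<rightarrow>\<^sub>E S. vge N k (dot c x)"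
    using dot_bounded[of "fst ` set L'"] by auto
  define m where "m = Min (insert 0 ((\<lambda>N. v N c) ` Pl))"
  have m: "vge N m c" if "N \<in> Pl" for N
  proof -
    have "m \<le> v N c" unfolding m_def by (rule Min_le) (use that in auto)
    then show ?thesis using c(1) by (simp add: vge_def)
  qed
  \<comment> \<open>\<open>- k\<close> and \<open>- m\<close> account for the poles of the
    functionals and of \<open>c\<close>, the extra 1 for the simple pole of the inverse of
    \<open>f\<close>.\<close>
  define s where "s = nat (1 - k - m)"
  define d where "d = \<pi> [^] s \<otimes> c"
  have dK: "d \<in> carrier K" using c(1) by (simp add: d_def power_pi)
  have d: "vge N (1 - k) d" if "N \<in> Pl" for N
  proof -
    have "vge N (int s) (\<pi> [^] s)" using that by (simp add: vge_def power_pi)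
    from vge_mult'[OF that this m[OF that], of "1 - k"] show ?thesis by (simp add: d_def s_def)
  qed
  have "frank Z (\<lambda>x. finsum \<Sigma> (\<lambda>\<sigma>. ly \<sigma> (scal d (comb L' (lx \<sigma> x)))) (carrier G))"
  proof (rule comb_finite_rank[OF Z dK], intro conjI ballI)
    fix c b assume cb: "(c, b) \<in> set L'"
    show "c \<in> carrier \<Sigma>" "b \<in> Z" using L'[OF cb] by simp_all
    fix \<sigma> x assume \<sigma>: "\<sigma> \<in> carrier G" and x: "x \<in> Z"
    have cl: "dot c (lx \<sigma> x) \<in> carrier K" using L'[OF cb] \<sigma> stableD(2)[OF Z x] by simp
    have "vge N 0 (inv (f \<sigma> (\<iota> \<sigma>)) \<otimes> (d \<otimes> dot c (lx \<sigma> x)))" if N: "N \<in> Pl" for N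
    proof -
      have "c \<in> fst ` set L'" using cb by force
      then have "vge N k (dot c (lx \<sigma> x))" using k N stableD(1)[OF Z stableD(6)[OF Z \<sigma> x]] by blast
      from vge_mult'[OF N d[OF N] this, of 1] have "vge N 1 (d \<otimes> dot c (lx \<sigma> x))" by simp
      from vge_mult'[OF N inv_f_vge[OF \<sigma> N] this, of 0] show ?thesis by simp
    qed
    then show "inv (f \<sigma> (\<iota> \<sigma>)) \<otimes> (d \<otimes> dot c (lx \<sigma> x)) \<in> S" using \<sigma> dK cl by (simp add: S_iff)
  qed
  moreover have "finsum \<Sigma> (\<lambda>\<sigma>. ly \<sigma> (scal d (comb L' (lx \<sigma> x)))) (carrier G) = scal (\<pi> [^] s) x" if x: "x \<in> Z" for x
  proof -
    have xS: "x \<in> carrier \<Sigma>" using stableD(2)[OF Z x] .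
    have im: "m_inv G ` carrier G = carrier G"
      by (auto simp: image_iff) (metis G.inv_closed G.inv_inv)
    have "finsum \<Sigma> (\<lambda>\<sigma>. ly \<sigma> (scal d (comb L' (lx \<sigma> x)))) (carrier G)
      = finsum \<Sigma> (\<lambda>\<sigma>. scal ((\<iota> \<sigma>) d) x) (carrier G)"
    proof (rule S.finsum_cong')
      fix \<sigma> assume \<sigma>: "\<sigma> \<in> carrier G"
      have "comb L' (lx \<sigma> x) = lx \<sigma> x"
        unfolding L'_def by (rule id[OF sub_loc[OF M sub stableD(6)[OF Z \<sigma> x]]])
      then show "ly \<sigma> (scal d (comb L' (lx \<sigma> x))) = scal ((\<iota> \<sigma>) d) x"
        using \<sigma> dK xS by (simp add: ly_scal)
    qed (use dK xS in auto)
    also have "\<dots> = scal (finsum K (\<lambda>\<sigma>. (\<iota> \<sigma>) d) (carrier G)) x"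
      by (rule scal_finsum_left[symmetric]) (use dK xS in auto)
    also have "finsum K (\<lambda>\<sigma>. (\<iota> \<sigma>) d) (carrier G) = finsum K (\<lambda>\<sigma>. \<sigma> d) (m_inv G ` carrier G)"
      by (rule finsum_reindex[symmetric]) (use dK im G.inv_inj in auto)
    also have "\<dots> = finsum K (\<lambda>\<sigma>. \<pi> [^] s \<otimes> \<sigma> c) (carrier G)"
      unfolding im by (rule finsum_cong') (use c in \<open>auto simp: d_def act_times power_pi\<close>)
    also have "\<dots> = \<pi> [^] s \<otimes> finsum K (\<lambda>\<sigma>. \<sigma> c) (carrier G)"
      by (rule finsum_rdistr[symmetric]) (use c in \<open>auto simp: power_pi\<close>)
    also have "\<dots> = \<pi> [^] s" using c by (simp add: power_pi)
    finally show ?thesis .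
  qed
  ultimately have "frank Z (scal (\<pi> [^] s))"
  proof -
    assume 1: "frank Z (\<lambda>x. finsum \<Sigma> (\<lambda>\<sigma>. ly \<sigma> (scal d (comb L' (lx \<sigma> x)))) (carrier G))"
      and 2: "\<And>x. x \<in> Z \<Longrightarrow> finsum \<Sigma> (\<lambda>\<sigma>. ly \<sigma> (scal d (comb L' (lx \<sigma> x)))) (carrier G) = scal (\<pi> [^] s) x"
    have "(\<lambda>x. x) \<in> End Z" by (rule EndI[OF Z]) simp_all
    from left_module.finite_rank_map_comp_left[OF left_module_Z[OF Z] this 1] show ?thesis
      using 2 by simp
  qed
  then show ?thesis ..
qed

text \<open>Take a basis at \<open>M\<close> stacked against the bad part \<open>?U\<close>. The
  \<open>L0\<close>-part of the identity already has its values in \<open>?U\<close>, so only the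
  \<open>L1\<close>-part is averaged, with a weight \<open>d\<close>. This is integral, since the
  functionals of \<open>L1\<close> map \<open>?U\<close> into the maximal ideal and so compensate
  the simple pole at a bad \<sigma>. Modulo \<open>?U\<close> the terms outside \<open>H\<close>
  vanish and those in \<open>H\<close> multiply \<open>x\<close> by conjugates of \<open>cc\<close>;
  their sum is the trace of \<open>cc\<close> over \<open>H\<close>, which is 1 modulo the maximal
  ideal.\<close>

lemma local_finite_rank:
  assumes Z: "stable Z" and M: "M \<in> Pl"
  shows "\<exists>\<theta>. frank Z \<theta> \<and> (\<forall>x \<in> Z. cpl \<theta> x \<in> loc M (span (bad M) Z))"
proof -
  have sub: "submod Z" using stable_submod[OF Z] .
  have bad: "bad M \<subseteq> carrier G" by blast
  let ?U = "loc M (span (bad M) Z)"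
  note latU = lat_loc[OF M span_submod[OF Z bad]]
  note U = latD[OF latU]
  have UZ: "?U \<subseteq> loc M Z" by (rule loc_mono[OF span_sub[OF Z bad]])
  have piU: "scal \<pi> x \<in> ?U" if xl: "x \<in> loc M Z" for x
  proof -
    obtain e where e: "x \<in> carrier \<Sigma>" "e \<in> S" "e \<in> carrier K" "\<not> vge M 1 e" "scal e x \<in> Z"
      using xl by (rule locE)
    have "scal e (scal \<pi> x) = scal \<pi> (scal e x)" using e(1,3) by (simp add: scal_scal m_comm)
    then have "scal e (scal \<pi> x) \<in> span (bad M) Z" using span_pi[OF Z bad e(5)] by simp
    then show ?thesis using e by (intro locI[of _ e]) simp_all
  qed
  from stacked_basis_loc[OF M Z latU UZ piU] obtain L1 L0 where st: "stacked M Z ?U L1 L0" by blast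
  note L = stackedD(1)[OF st] and L0 = stackedD(2)[OF st] and L1 = stackedD(3)[OF st] and id = stackedD(4)[OF st]
  have L1c: "c \<in> carrier \<Sigma>" "b \<in> Z" "b \<in> carrier \<Sigma>" "x \<in> Z \<Longrightarrow> vge M 0 (dot c x)"
    if "(c, b) \<in> set L1" for c b x
  proof -
    have "(c, b) \<in> set (L1 @ L0)" using that by simp
    from L[OF this] show "c \<in> carrier \<Sigma>" "b \<in> Z" "b \<in> carrier \<Sigma>" "x \<in> Z \<Longrightarrow> vge M 0 (dot c x)"
      using stableD(2)[OF Z] sub_loc[OF M sub, of x] by blast+
  qed
  \<comment> \<open>The \<sigma> whose terms survive modulo \<open>?U\<close>: they fix the place
    \<open>M\<close> and are not bad there. They form a group because for them every value
    \<open>f \<sigma> \<gamma>\<close> is a unit at \<open>M\<close>, as a divisor of the value at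
    the inverse pair.\<close>
  define H where "H = {\<sigma> \<in> carrier G. act \<sigma> M = M \<and> \<not> vge M 1 (f \<sigma> (\<iota> \<sigma>))}"
  have H_inv: "\<sigma> \<in> H \<longleftrightarrow> act \<sigma> M = M \<and> \<not> vge M 1 (f (\<iota> \<sigma>) \<sigma>)" if \<sigma>: "\<sigma> \<in> carrier G" for \<sigma>
    using vge_act[OF M \<sigma>, of "f (\<iota> \<sigma>) \<sigma>" 1] \<sigma> by (auto simp: H_def act_f_inv)
  have f_unit: "\<not> vge M 1 (f \<sigma> \<gamma>)" if "\<sigma> \<in> H" "\<gamma> \<in> carrier G" for \<sigma> \<gamma>
  proof
    assume "vge M 1 (f \<sigma> \<gamma>)"
    moreover have "\<sigma> \<in> carrier G" using that by (simp add: H_def)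
    ultimately have "vge M (1 + 0) (f \<sigma> \<gamma> \<otimes> \<sigma> (f (\<iota> \<sigma>) (\<sigma> \<bullet> \<gamma>)))"
      using that M by (intro vge_mult) auto
    then show False using that f_inv_split[of \<sigma> \<gamma>] by (simp add: H_def)
  qed
  have H: "subgroup H G"
  proof (rule G.subgroupI)
    show "H \<subseteq> carrier G" by (auto simp: H_def)
    have "\<one>\<^bsub>G\<^esub> \<in> H" using M by (simp add: H_def)
    then show "H \<noteq> {}" by blast
    show "\<iota> \<sigma> \<in> H" if "\<sigma> \<in> H" for \<sigma>
    proof -
      have \<sigma>: "\<sigma> \<in> carrier G" "act \<sigma> M = M" using that by (simp_all add: H_def)
      then have "act (\<iota> \<sigma>) M = M" using act_inv_Pl(1)[OF M \<sigma>(1)] by simp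
      then show ?thesis using that H_inv[OF \<sigma>(1)] \<sigma> by (simp add: H_def)
    qed
    show "\<sigma> \<bullet> \<tau> \<in> H" if st: "\<sigma> \<in> H" "\<tau> \<in> H" for \<sigma> \<tau>
    proof -
      have \<sigma>: "\<sigma> \<in> carrier G" "act \<sigma> M = M" and \<tau>: "\<tau> \<in> carrier G" "act \<tau> M = M" using st by (simp_all add: H_def)
      have a: "act (\<sigma> \<bullet> \<tau>) M = M" using \<sigma> \<tau> M by (simp add: act_Pl_mult)
      let ?i = "\<iota> \<tau> \<bullet> \<iota> \<sigma>"
      have "\<tau> \<bullet> ?i = \<iota> \<sigma>" using \<sigma> \<tau> by simp
      then have c: "\<sigma> (f \<tau> ?i) \<otimes> f \<sigma> (\<iota> \<sigma>) = f \<sigma> \<tau> \<otimes> f (\<sigma> \<bullet> \<tau>) ?i"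
        using f_cocycle[of \<sigma> \<tau> ?i] \<sigma> \<tau> by simp
      have "\<not> vge M 1 (\<sigma> (f \<tau> ?i) \<otimes> f \<sigma> (\<iota> \<sigma>))"
      proof (rule unit_mult[OF M])
        show "\<not> vge M 1 (\<sigma> (f \<tau> ?i))"
          using f_unit[OF st(2), of ?i] vge_act[OF M \<sigma>(1), of "f \<tau> ?i" 1] \<sigma> \<tau> by simp
        show "\<not> vge M 1 (f \<sigma> (\<iota> \<sigma>))" using st by (simp add: H_def)
      qed (use \<sigma> \<tau> M in simp_all)
      then have "\<not> vge M 1 (f (\<sigma> \<bullet> \<tau>) ?i)"
        unfolding c using vge_mult[OF M, of 0 "f \<sigma> \<tau>" 1 "f (\<sigma> \<bullet> \<tau>) ?i"] \<sigma> \<tau> M by auto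
      then show ?thesis using a \<sigma> \<tau> by (simp add: H_def G.inv_mult_group)
    qed
  qed
  have HG: "H \<subseteq> carrier G" by (auto simp: H_def)
  obtain cc where cc: "cc \<in> S" "vge M 1 (finsum K (\<lambda>\<sigma>. \<sigma> cc) H \<ominus> \<one>)"
    using trace_one_mod[OF M H] by (auto simp: H_def)
  have ccK: "cc \<in> carrier K" using cc S_carrier by blast
  have "fst ` set L1 \<subseteq> carrier \<Sigma>" using L1c(1) by force
  then obtain k where k: "\<forall>c \<in> fst ` set L1. \<forall>N \<in> Pl. \<forall>x \<in> carrier G \<rightarrow>\<^sub>E S. vge N k (dot c x)"
    using dot_bounded[of "fst ` set L1"] by auto
  \<comment> \<open>\<open>2 - k\<close> outweighs the poles of the functionals at the other places
    with 2 to spare: 1 for the inverse of \<open>f\<close>, and 1 to put the terms with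
    \<open>act \<sigma> M \<noteq> M\<close> into \<pi>Z.\<close>
  obtain e where e: "e \<in> S" "vge M 1 (e \<ominus> \<one>)" "\<And>N. N \<in> Pl \<Longrightarrow> N \<noteq> M \<Longrightarrow> vge N (2 - k) e"
    using approxE[OF M, of "2 - k"] by metis
  define d where "d = e \<otimes> cc"
  have eK: "e \<in> carrier K" using e S_carrier by blast
  have dS: "d \<in> S" "d \<in> carrier K" using e cc eK ccK by (simp_all add: d_def)
  have dN: "vge N 2 (d \<otimes> dot c x)" if N: "N \<in> Pl" "N \<noteq> M" and cb: "(c, b) \<in> set L1" and x: "x \<in> Z" for N c b x
  proof -
    have "c \<in> fst ` set L1" using cb by force
    then have kx: "vge N k (dot c x)" using k N(1) stableD(1)[OF Z x] by blast
    have "vge N (2 - k) d" unfolding d_def using vge_mult[OF N(1) e(3)[OF N] S_vge[OF cc(1) N(1)]] by simp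
    from vge_mult[OF N(1) this kx] show ?thesis by simp
  qed
  have dM: "vge M 1 (d \<otimes> dot c x)" if "x \<in> ?U" "(c, b) \<in> set L1" for c b x
    using vge_mult[OF M S_vge[OF dS(1) M] L1[OF that(2,1)]] by simp
  have dM0: "vge M 0 (d \<otimes> dot c x)" if "x \<in> Z" "(c, b) \<in> set L1" for c b x
    using vge_mult[OF M S_vge[OF dS(1) M] L1c(4)[OF that(2,1)]] by simp
  have badU: "lx \<sigma> x \<in> ?U" if "\<sigma> \<in> bad M" "x \<in> Z" for \<sigma> x
    by (rule sub_loc[OF M span_submod[OF Z bad] span_lx[OF Z bad that(2,1)]])
  let ?\<theta> = "\<lambda>x. finsum \<Sigma> (\<lambda>\<sigma>. ly \<sigma> (scal d (comb L1 (lx \<sigma> x)))) (carrier G)"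
  have "frank Z ?\<theta>"
  proof (rule comb_finite_rank[OF Z dS(2)], intro conjI ballI)
    fix c b assume cb: "(c, b) \<in> set L1"
    show "c \<in> carrier \<Sigma>" "b \<in> Z" using L1c(1,2)[OF cb] by simp_all
    fix \<sigma> x assume \<sigma>: "\<sigma> \<in> carrier G" and x: "x \<in> Z"
    have lZ: "lx \<sigma> x \<in> Z" by (rule stableD(6)[OF Z \<sigma> x])
    have cl: "dot c (lx \<sigma> x) \<in> carrier K" using L1c(1)[OF cb] \<sigma> stableD(2)[OF Z x] by simp
    have "vge N 0 (inv (f \<sigma> (\<iota> \<sigma>)) \<otimes> (d \<otimes> dot c (lx \<sigma> x)))" if N: "N \<in> Pl" for N
    proof -
      consider "N \<noteq> M" | "N = M" "\<sigma> \<in> bad M" | "N = M" "\<not> vge M 1 (f \<sigma> (\<iota> \<sigma>))" using \<sigma> by blast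
      then show ?thesis
      proof cases
        case 1
        show ?thesis by (rule vge_mult'[OF N inv_f_vge[OF \<sigma> N] dN[OF N 1 cb lZ]]) simp
      next
        case 2
        show ?thesis unfolding 2(1)
          by (rule vge_mult'[OF M inv_f_vge[OF \<sigma> M] dM[OF badU[OF 2(2) x] cb]]) simp
      next
        case 3
        show ?thesis unfolding 3(1)
          by (rule vge_mult'[OF M inv_f_vge0[OF \<sigma> M 3(2)] dM0[OF lZ cb]]) simp
      qed
    qed
    then show "inv (f \<sigma> (\<iota> \<sigma>)) \<otimes> (d \<otimes> dot c (lx \<sigma> x)) \<in> S" using \<sigma> dS(2) cl by (simp add: S_iff)
  qed
  moreover have "cpl ?\<theta> x \<in> ?U" if x: "x \<in> Z" for x
  proof -
    have xS: "x \<in> carrier \<Sigma>" using stableD(2)[OF Z x] .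
    have L1cl: "comb L1 y \<in> carrier \<Sigma>" if "y \<in> carrier \<Sigma>" for y
      by (rule comb_closed[OF _ that]) (use L1c(1,3) in blast)
    define t where "t \<sigma> = ly \<sigma> (scal d (comb L1 (lx \<sigma> x)))" for \<sigma>
    have tcl: "t \<sigma> \<in> carrier \<Sigma>" if "\<sigma> \<in> carrier G" for \<sigma>
      unfolding t_def using that dS(2) L1cl xS by simp
    have termwise: "ly \<sigma> (scal d (comb L y)) \<in> ?U"
      if \<sigma>: "\<sigma> \<in> carrier G" and y: "y \<in> carrier \<Sigma>" and sub: "set L \<subseteq> set L1"
        and t: "\<And>c b. (c, b) \<in> set L1 \<Longrightarrow> ly \<sigma> (scal (d \<otimes> dot c y) b) \<in> ?U" for \<sigma> y L
      using sub
    proof (induction L)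
      case Nil
      then show ?case using \<sigma> dS(2) U(2) by simp
    next
      case (Cons p L)
      obtain c b where p: "p = (c, b)" by force
      have cb: "(c, b) \<in> set L1" using Cons.prems p by auto
      have Lcl: "comb L y \<in> carrier \<Sigma>" by (rule comb_closed[OF _ y]) (use Cons.prems L1c(1,3) in \<open>simp; blast\<close>)
      have "ly \<sigma> (scal d (comb (p # L) y)) = ly \<sigma> (scal (d \<otimes> dot c y) b) \<boxplus> ly \<sigma> (scal d (comb L y))"
        using \<sigma> y dS(2) L1c(1,3)[OF cb] Lcl by (simp add: p scal_add scal_scal ly_add)
      then show ?case using U(3)[OF t[OF cb] Cons.IH] Cons.prems by simp
    qed
    have notH: "t \<sigma> \<in> ?U" if \<sigma>: "\<sigma> \<in> carrier G" "\<sigma> \<notin> H" for \<sigma>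
      unfolding t_def
    proof (rule termwise[OF \<sigma>(1) lx_closed[OF \<sigma>(1) xS] order_refl])
      fix c b assume cb: "(c, b) \<in> set L1"
      let ?\<tau> = "\<iota> \<sigma>" and ?y = "lx \<sigma> x"
      have \<tau>: "?\<tau> \<in> carrier G" using \<sigma> by simp
      have yZ: "?y \<in> Z" by (rule stableD(6)[OF Z \<sigma>(1) x])
      have ycl: "d \<otimes> dot c ?y \<in> carrier K" using dS(2) L1c(1)[OF cb] \<sigma> xS by simp
      have lb: "lx ?\<tau> b \<in> Z" by (rule stableD(6)[OF Z \<tau> L1c(2)[OF cb]])
      have eq: "ly \<sigma> (scal (d \<otimes> dot c ?y) b) = scal (inv (f ?\<tau> \<sigma>) \<otimes> ?\<tau> (d \<otimes> dot c ?y)) (lx ?\<tau> b)"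
        using \<sigma>(1) ycl L1c(3)[OF cb] by (simp add: ly_def lx_scal scal_scal)
      show "ly \<sigma> (scal (d \<otimes> dot c ?y) b) \<in> ?U"
      proof (cases "act \<sigma> M = M")
        \<comment> \<open>The functional takes small values at \<sigma>M, a place other than M;
          \<sigma>^-1 carries this to M, where one of the two orders is lost to the inverse of
          \<open>f\<close>.\<close>
        case False
        have "vge M 2 (?\<tau> (d \<otimes> dot c ?y))"
          using dN[OF act_Pl[OF \<sigma>(1) M] False cb yZ] vge_act'[OF M \<tau> ycl, of 2] \<sigma>(1) by simp
        from vge_mult'[OF M inv_f_vge'[OF \<sigma>(1) M] this, of 1]
        have "vge M 1 (inv (f ?\<tau> \<sigma>) \<otimes> ?\<tau> (d \<otimes> dot c ?y))" by simp
        then show ?thesis unfolding eq by (rule loc_span_ge1[OF M Z bad _ lb])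
      next
        \<comment> \<open>Both \<sigma> and \<sigma>^-1 are bad at M: the first makes the value of
          the functional absorb the pole, the second puts \<open>lx ?\<tau> b\<close> into the bad
          part.\<close>
        case True
        then have f1: "vge M 1 (f ?\<tau> \<sigma>)" using H_inv[OF \<sigma>(1)] \<sigma>(2) by blast
        then have "vge M 1 (f \<sigma> ?\<tau>)" using True \<sigma> by (simp add: H_def)
        then have "vge M 1 (d \<otimes> dot c ?y)" using dM[OF badU[OF _ x] cb] \<sigma>(1) by simp
        then have "vge M 1 (?\<tau> (d \<otimes> dot c ?y))" using vge_act'[OF M \<tau> ycl, of 1] True \<sigma>(1) by simp
        from vge_mult'[OF M inv_f_vge'[OF \<sigma>(1) M] this, of 0]
        have v0: "vge M 0 (inv (f ?\<tau> \<sigma>) \<otimes> ?\<tau> (d \<otimes> dot c ?y))" by simp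
        have "?\<tau> \<in> bad M" using f1 \<sigma>(1) by simp
        then show ?thesis unfolding eq using U(4)[OF v0 badU[OF _ L1c(2)[OF cb]]] by blast
      qed
    qed
    have inH: "\<exists>u \<in> ?U. scal ((\<iota> \<sigma>) cc) x = t \<sigma> \<boxplus> u" if \<sigma>H: "\<sigma> \<in> H" for \<sigma>
    proof -
      have \<sigma>: "\<sigma> \<in> carrier G" "act \<sigma> M = M" using \<sigma>H by (simp_all add: H_def)
      let ?\<tau> = "\<iota> \<sigma>" and ?y = "lx \<sigma> x"
      have \<tau>: "?\<tau> \<in> carrier G" using \<sigma> by simp
      have yZ: "?y \<in> Z" by (rule stableD(6)[OF Z \<sigma>(1) x])
      have yS: "?y \<in> carrier \<Sigma>" using stableD(2)[OF Z yZ] .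
      have L0cl: "comb L0 ?y \<in> carrier \<Sigma>" and L0U: "comb L0 ?y \<in> ?U"
      proof -
        have "comb L ?y \<in> ?U" if "set L \<subseteq> set L0" for L
          using that
        proof (induction L)
          case (Cons p L)
          obtain c b where p: "p = (c, b)" by force
          have cb: "(c, b) \<in> set L0" using Cons.prems p by auto
          then have "(c, b) \<in> set (L1 @ L0)" by simp
          from L[OF this] have "vge M 0 (dot c ?y)" using sub_loc[OF M sub yZ] by blast
          from U(3)[OF U(4)[OF this L0[OF cb]] Cons.IH] show ?case using Cons.prems p by simp
        qed (simp add: U(2))
        then show "comb L0 ?y \<in> ?U" by simp
        then show "comb L0 ?y \<in> carrier \<Sigma>" by (rule U(1))
      qed
      have yL: "?y = comb L1 ?y \<boxplus> comb L0 ?y"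
      proof -
        have "comb (L1 @ L0) ?y = comb L1 ?y \<boxplus> comb L0 ?y"
          by (rule comb_append[OF _ yS]) (use L stableD(2)[OF Z] in blast)
        then show ?thesis using id[OF sub_loc[OF M sub yZ]] by simp
      qed
      \<comment> \<open>The error between \<open>scal cc ?y\<close> and the averaged term before
        \<open>ly \<sigma>\<close> is applied: the omitted \<open>L0\<close>-part, and the change of
        weight from \<open>cc\<close> to \<open>d\<close>, which is small at
        \<open>M\<close>.\<close>
      define u1 where "u1 = scal d (comb L0 ?y) \<boxplus> scal (cc \<ominus> d) ?y"
      have "vge M 1 (\<one> \<ominus> e)"
      proof -
        have "\<one> \<ominus> e = \<ominus> (e \<ominus> \<one>)" using eK by algebra
        then show ?thesis using vge_neg[OF M e(2)] by simp
      qed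
      from vge_mult[OF M this S_vge[OF cc(1) M]] have "vge M 1 ((\<one> \<ominus> e) \<otimes> cc)" by simp
      moreover have "(\<one> \<ominus> e) \<otimes> cc = cc \<ominus> d" using eK ccK unfolding d_def by algebra
      ultimately have cd: "vge M 1 (cc \<ominus> d)" by simp
      have u1U: "u1 \<in> ?U"
        unfolding u1_def by (rule U(3)[OF U(4)[OF S_vge[OF dS(1) M] L0U] loc_span_ge1[OF M Z bad cd yZ]])
      have u1cl: "u1 \<in> carrier \<Sigma>" using U(1)[OF u1U] .
      have cceq: "d \<oplus> (cc \<ominus> d) = cc" using dS(2) ccK by algebra
      have "scal cc ?y = scal d ?y \<boxplus> scal (cc \<ominus> d) ?y"
        using scal_add_left[OF dS(2) _ yS, of "cc \<ominus> d"] dS(2) ccK cceq by simp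
      also have "scal d ?y = scal d (comb L1 ?y) \<boxplus> scal d (comb L0 ?y)"
        by (subst yL) (rule scal_add[OF dS(2) L1cl[OF yS] L0cl])
      finally have ccy: "scal cc ?y = scal d (comb L1 ?y) \<boxplus> u1"
        unfolding u1_def using dS(2) ccK L1cl[OF yS] L0cl yS by (simp add: S.a_assoc)
      have "scal (?\<tau> cc) x = ly \<sigma> (scal cc ?y)" using \<sigma>(1) xS ccK by (simp add: ly_scal)
      also have "\<dots> = t \<sigma> \<boxplus> ly \<sigma> u1"
        unfolding ccy t_def by (rule ly_add[OF \<sigma>(1) _ u1cl]) (use dS(2) L1cl[OF yS] in simp)
      finally have eq: "scal (?\<tau> cc) x = t \<sigma> \<boxplus> ly \<sigma> u1" .
      \<comment> \<open>For \<sigma> in \<open>H\<close> the inverse translation preserves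
        \<open>?U\<close>. By the cocycle identity at (\<tau>, \<kappa>, \<kappa>^-1), a bad
        \<kappa> makes \<open>f ?\<tau> \<kappa>\<close> a nonunit or
        \<open>?\<tau> \<bullet> \<kappa>\<close> bad again.\<close>
      have "lx ?\<tau> u1 \<in> ?U"
      proof (rule lx_loc_span[OF M \<tau> Z bad bad])
        show "u1 \<in> loc (act (\<iota> ?\<tau>) M) (span (bad M) Z)" using u1U \<sigma> by simp
        fix \<kappa> assume "\<kappa> \<in> bad M"
        then have \<kappa>: "\<kappa> \<in> carrier G" "vge M 1 (f \<kappa> (\<iota> \<kappa>))" by simp_all
        let ?\<rho> = "?\<tau> \<bullet> \<kappa>"
        have \<rho>: "?\<rho> \<in> carrier G" using \<tau> \<kappa> by simp
        have c: "?\<tau> (f \<kappa> (\<iota> \<kappa>)) = f ?\<tau> \<kappa> \<otimes> f ?\<rho> (\<iota> \<kappa>)"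
          using f_cocycle[of ?\<tau> \<kappa> "\<iota> \<kappa>"] \<tau> \<kappa> by simp
        have "vge M 1 (?\<tau> (f \<kappa> (\<iota> \<kappa>)))"
          using vge_act'[OF M \<tau>, of "f \<kappa> (\<iota> \<kappa>)" 1] \<kappa> \<sigma> by simp
        then have "vge M 1 (f ?\<tau> \<kappa>) \<or> vge M 1 (f ?\<rho> (\<iota> \<kappa>))"
          unfolding c using vge_prime[OF M] \<tau> \<kappa> \<rho> M by simp
        moreover have "vge M 1 (f ?\<rho> (\<iota> ?\<rho>))" if "vge M 1 (f ?\<rho> (\<iota> \<kappa>))"
          unfolding f_inv_split[OF \<rho> G.inv_closed[OF \<kappa>(1)], symmetric]
          using vge_mult[OF M that, of 0] \<rho> \<kappa> M by simp
        ultimately show "vge M 1 (f ?\<tau> \<kappa>) \<or> ?\<rho> \<in> bad M" using \<rho> by blast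
      qed
      moreover have "vge M 0 (inv (f ?\<tau> \<sigma>))"
        using unitD(3)[OF M, of "f ?\<tau> \<sigma>"] H_inv[OF \<sigma>(1)] \<sigma>H \<sigma>(1) M by simp
      ultimately have "ly \<sigma> u1 \<in> ?U" unfolding ly_def using U(4) by blast
      then show ?thesis using eq by blast
    qed
    define P where "P \<sigma> w \<longleftrightarrow> w \<in> ?U \<and> scal ((\<iota> \<sigma>) cc) x = t \<sigma> \<boxplus> w" for \<sigma> w
    have "\<forall>\<sigma> \<in> H. \<exists>w. P \<sigma> w"
    proof
      fix \<sigma> assume "\<sigma> \<in> H"
      from inH[OF this] show "\<exists>w. P \<sigma> w" unfolding P_def by (elim bexE) (intro exI conjI)
    qed
    from bchoice[OF this] obtain u where uP: "\<forall>\<sigma> \<in> H. P \<sigma> (u \<sigma>)" ..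
    have u: "u \<sigma> \<in> ?U" "scal ((\<iota> \<sigma>) cc) x = t \<sigma> \<boxplus> u \<sigma>" if "\<sigma> \<in> H" for \<sigma>
      using bspec[OF uP that] unfolding P_def by simp_all
    have fH: "finite H" using finite_subset[OF HG fin] .
    have ucl: "u \<sigma> \<in> carrier \<Sigma>" if "\<sigma> \<in> H" for \<sigma> using U(1)[OF u(1)[OF that]] .
    define tr where "tr = finsum K (\<lambda>\<sigma>. \<sigma> cc) H"
    have trK: "tr \<in> carrier K" unfolding tr_def using ccK HG by (auto simp: subset_iff)
    have imH: "m_inv G ` H = H"
    proof (intro equalityI subsetI)
      fix h assume h: "h \<in> H"
      then have "h = \<iota> (\<iota> h)" using HG by auto
      then show "h \<in> m_inv G ` H" using subgroup.m_inv_closed[OF H h] by blast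
    qed (use subgroup.m_inv_closed[OF H] in blast)
    have "tr = finsum K (\<lambda>\<sigma>. \<sigma> cc) (m_inv G ` H)" by (simp add: tr_def imH)
    also have "\<dots> = finsum K (\<lambda>\<sigma>. (\<iota> \<sigma>) cc) H"
    proof (rule finsum_reindex)
      show "(\<lambda>\<sigma>. \<sigma> cc) \<in> m_inv G ` H \<rightarrow> carrier K" unfolding imH using ccK HG by (auto simp: subset_iff)
      show "inj_on (m_inv G) H" by (rule inj_on_subset[OF G.inv_inj HG])
    qed
    finally have "scal tr x = finsum \<Sigma> (\<lambda>\<sigma>. scal ((\<iota> \<sigma>) cc) x) H"
      using scal_finsum_left[OF fH, of "\<lambda>\<sigma>. (\<iota> \<sigma>) cc" x] ccK xS HG by (auto simp: subset_iff)
    also have "\<dots> = finsum \<Sigma> (\<lambda>\<sigma>. t \<sigma> \<boxplus> u \<sigma>) H"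
      by (rule S.finsum_cong') (use u(2) tcl ucl HG in \<open>auto simp: subset_iff\<close>)
    also have "\<dots> = finsum \<Sigma> t H \<boxplus> finsum \<Sigma> u H"
      by (rule S.finsum_addf) (use tcl ucl HG in \<open>auto simp: subset_iff\<close>)
    finally have trx: "scal tr x = finsum \<Sigma> t H \<boxplus> finsum \<Sigma> u H" .
    have uU: "finsum \<Sigma> u H \<in> ?U" by (rule lat_finsum[OF fH latU u(1)])
    have tU: "finsum \<Sigma> t (carrier G - H) \<in> ?U"
      by (rule lat_finsum[OF _ latU notH]) auto
    have split: "?\<theta> x = finsum \<Sigma> t H \<boxplus> finsum \<Sigma> t (carrier G - H)"
    proof -
      have "H \<union> (carrier G - H) = carrier G" using HG by blast
      then have "?\<theta> x = finsum \<Sigma> t (H \<union> (carrier G - H))" by (simp only: t_def[abs_def])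
      also have "\<dots> = finsum \<Sigma> t H \<boxplus> finsum \<Sigma> t (carrier G - H)"
        by (rule S.finsum_Un_disjoint) (use fH tcl HG in auto)
      finally show ?thesis .
    qed
    have tHcl: "finsum \<Sigma> t H \<in> carrier \<Sigma>" by (rule S.finsum_closed) (use tcl HG in blast)
    let ?m = "scal (\<ominus> \<one>)"
    have cancel: "w \<boxplus> ?m w = \<zero>\<^bsub>\<Sigma>\<^esub>" if "w \<in> carrier \<Sigma>" for w
      using S.r_neg[OF that] by (simp add: Sigma_neg[OF that])
    have "vge M 1 (\<one> \<ominus> tr)"
    proof -
      have "\<one> \<ominus> tr = \<ominus> (tr \<ominus> \<one>)" using trK by algebra
      then show ?thesis using vge_neg[OF M cc(2)] by (simp add: tr_def)
    qed
    then have dx: "scal (\<one> \<ominus> tr) x \<in> ?U" by (rule loc_span_ge1[OF M Z bad _ x])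
    have "tr \<oplus> (\<one> \<ominus> tr) = \<one>" using trK by algebra
    then have xeq: "x = scal tr x \<boxplus> scal (\<one> \<ominus> tr) x"
      using scal_add_left[OF trK _ xS, of "\<one> \<ominus> tr"] trK xS by simp
    let ?a = "finsum \<Sigma> t H" and ?b = "finsum \<Sigma> u H" and ?c = "finsum \<Sigma> t (carrier G - H)"
      and ?e = "scal (\<one> \<ominus> tr) x"
    have cls: "?a \<in> carrier \<Sigma>" "?b \<in> carrier \<Sigma>" "?c \<in> carrier \<Sigma>" "?e \<in> carrier \<Sigma>"
      using tHcl U(1)[OF uU] U(1)[OF tU] U(1)[OF dx] by simp_all
    \<comment> \<open>The sum over \<open>H\<close> cancels. What remains are the errors of its
      terms, the defect of the trace and the terms outside \<open>H\<close>, all of them in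
      \<open>?U\<close>.\<close>
    have "cpl ?\<theta> x = (?a \<boxplus> ?b \<boxplus> ?e) \<boxplus> ?m (?a \<boxplus> ?c)"
      unfolding cpl_def split trx[symmetric] xeq[symmetric] ..
    also have "\<dots> = (?a \<boxplus> ?m ?a) \<boxplus> (?b \<boxplus> ?e \<boxplus> ?m ?c)"
      using cls by (simp add: scal_add S.a_ac)
    also have "\<dots> = ?b \<boxplus> ?e \<boxplus> ?m ?c" using cls cancel[OF cls(1)] by simp
    also have "\<dots> \<in> ?U"
      by (rule U(3)[OF U(3)[OF uU dx] U(4)[OF S_vge[OF neg_one_S M] tU]])
    finally show ?thesis .
  qed
  ultimately show ?thesis by blast
qed

end

end

section \<open>From one place to all places, and from the bad part to \<pi>Z\<close>

context valued_crossed
begin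

context
  assumes sqfree: "\<And>\<sigma> M. \<sigma> \<in> carrier G \<Longrightarrow> M \<in> Pl \<Longrightarrow> \<not> vge M 2 (f \<sigma> (\<iota> \<sigma>))"
begin

text \<open>The identity (1 - b)(1 - a) = 1 - (a + b(1 - a)).\<close>

lemma frank_combine:
  assumes Z: "stable Z" and a: "frank Z a" and b: "frank Z b"
  shows "\<exists>c. frank Z c \<and> (\<forall>x \<in> Z. cpl c x = cpl b (cpl a x))"
proof -
  note lm = left_module_Z[OF Z]
  have aE: "a \<in> End Z" and bE: "b \<in> End Z" using frank_End[OF Z] a b by blast+
  have caE: "cpl a \<in> End Z" by (rule cpl_End[OF Z aE])
  have ba: "frank Z (\<lambda>x. b (cpl a x))"
    by (rule left_module.finite_rank_map_comp_right[OF lm caE b]) simp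
  have "frank Z (\<lambda>x. a x \<boxplus> b (cpl a x))"
    by (rule left_module.finite_rank_map_add[OF lm a ba]) simp
  moreover have "cpl (\<lambda>x. a x \<boxplus> b (cpl a x)) x = cpl b (cpl a x)" if x: "x \<in> Z" for x
  proof -
    have "x \<in> carrier \<Sigma>" "a x \<in> carrier \<Sigma>" "b (cpl a x) \<in> carrier \<Sigma>"
      using x EndD(1)[OF Z aE x] EndD(1)[OF Z bE EndD(1)[OF Z caE x]] stableD(2)[OF Z] by blast+
    moreover have "cpl a x = x \<boxplus> scal (\<ominus> \<one>) (a x)" by (simp add: cpl_def)
    ultimately show ?thesis by (simp add: cpl_def[of b] cpl_def[of "\<lambda>x. a x \<boxplus> b (cpl a x)"] scal_add S.a_assoc)
  qed
  ultimately show ?thesis by blast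
qed

text \<open>The complements found for the single places are multiplied. Being endomorphisms, they
  preserve the bad part at every place, so nothing gained at one place is lost at the next.\<close>

lemma global_finite_rank:
  assumes Z: "stable Z"
  shows "\<exists>\<theta>. frank Z \<theta> \<and> (\<forall>M \<in> Pl. \<forall>x \<in> Z. cpl \<theta> x \<in> loc M (span (bad M) Z))"
proof -
  have "\<exists>\<theta>. frank Z \<theta> \<and> (\<forall>M \<in> Q. \<forall>x \<in> Z. cpl \<theta> x \<in> loc M (span (bad M) Z))"
    if "finite Q" "Q \<subseteq> Pl" for Q
    using that
  proof (induction Q rule: finite_induct)
    case empty
    have "frank Z (\<lambda>x. \<zero>\<^bsub>\<Sigma>\<^esub>)" by (rule finite_rank_map.zero) simp
    then show ?case by blast
  next
    case (insert M Q)
    then obtain a where a: "frank Z a" "\<forall>N \<in> Q. \<forall>x \<in> Z. cpl a x \<in> loc N (span (bad N) Z)" by blast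
    obtain b where b: "frank Z b" "\<forall>x \<in> Z. cpl b x \<in> loc M (span (bad M) Z)"
      using local_finite_rank[OF sqfree Z, of M] insert.prems by blast
    obtain c where c: "frank Z c" "\<forall>x \<in> Z. cpl c x = cpl b (cpl a x)"
      using frank_combine[OF Z a(1) b(1)] by blast
    have aE: "cpl a \<in> End Z" and bE: "cpl b \<in> End Z"
      using cpl_End[OF Z frank_End[OF Z]] a(1) b(1) by blast+
    have "cpl c x \<in> loc N (span (bad N) Z)" if N: "N \<in> insert M Q" and x: "x \<in> Z" for N x
    proof (cases "N = M")
      case True
      have "cpl b (cpl a x) \<in> loc M (span (bad M) Z)" using bspec[OF b(2) EndD(1)[OF Z aE x]] .
      then show ?thesis using bspec[OF c(2) x] True by simp
    next
      case False
      have "cpl b (cpl a x) \<in> loc N (span (bad N) Z)"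
        by (rule End_loc_span_same[OF _ Z _ bE EndD(1)[OF Z aE x]]) (use a(2) N x False insert.prems in auto)
      then show ?thesis using bspec[OF c(2) x] by simp
    qed
    then show ?case using c(1) by blast
  qed
  from this[OF Pl_finite order_refl] show ?thesis .
qed

text \<open>The elements above \<tau> in a divisibility relation: the condition says that x_\<tau>
  x_(\<tau>^-1 \<rho>) is x_\<rho> times a unit at \<open>M\<close>.\<close>

definition above :: "'p \<Rightarrow> ('a \<Rightarrow> 'a) \<Rightarrow> ('a \<Rightarrow> 'a) set" where
  "above M \<tau> = {\<rho> \<in> carrier G. \<not> vge M 1 (f \<tau> (\<iota> \<tau> \<bullet> \<rho>))}"

text \<open>Since \<tau> lies in \<open>above M \<tau>\<close>, level 0 is empty, while level
  \<open>card (carrier G)\<close> is the whole group; this fixes the number of steps of the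
  descent.\<close>

definition level :: "'p \<Rightarrow> nat \<Rightarrow> ('a \<Rightarrow> 'a) set" where
  "level M k = {\<tau> \<in> carrier G. card (above M \<tau>) \<le> k}"

text \<open>If \<open>f(\<tau>,\<sigma>)\<close> is a unit at \<open>M\<close> then \<open>above\<close> shrinks from \<open>\<tau>\<close> to \<open>\<tau>\<sigma>\<close>, strictly so if \<open>\<sigma>\<close> is bad at
  \<open>\<tau>\<^sup>-\<^sup>1 M\<close>. Hence applying \<open>|G|\<close> times a map that pushes into the bad part ends in \<open>\<pi>Z\<close>.\<close>

lemma above_decreasing:
  assumes M: "M \<in> Pl" and \<tau>: "\<tau> \<in> carrier G" and \<sigma>: "\<sigma> \<in> bad (act (\<iota> \<tau>) M)"
    and unit: "\<not> vge M 1 (f \<tau> \<sigma>)"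
  shows "card (above M (\<tau> \<bullet> \<sigma>)) < card (above M \<tau>)"
proof (rule psubset_card_mono)
  have \<sigma>G: "\<sigma> \<in> carrier G" using \<sigma> by simp
  have fin: "finite (above M \<tau>)" by (simp add: above_def)
  then show "finite (above M \<tau>)" .
  let ?\<rho> = "\<tau> \<bullet> \<sigma>"
  have sub: "above M ?\<rho> \<subseteq> above M \<tau>"
  proof
    fix \<kappa> assume "\<kappa> \<in> above M ?\<rho>"
    then have \<kappa>: "\<kappa> \<in> carrier G" "\<not> vge M 1 (f ?\<rho> (\<iota> ?\<rho> \<bullet> \<kappa>))" by (simp_all add: above_def)
    let ?\<gamma> = "\<iota> ?\<rho> \<bullet> \<kappa>"
    have \<gamma>: "?\<gamma> \<in> carrier G" using \<tau> \<sigma>G \<kappa> by simp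
    have "\<sigma> \<bullet> ?\<gamma> = \<iota> \<tau> \<bullet> \<kappa>" using \<tau> \<sigma>G \<kappa> by (simp add: G.inv_mult_group G.m_assoc)
    then have c: "\<tau> (f \<sigma> ?\<gamma>) \<otimes> f \<tau> (\<iota> \<tau> \<bullet> \<kappa>) = f \<tau> \<sigma> \<otimes> f ?\<rho> ?\<gamma>"
      using f_cocycle[of \<tau> \<sigma> ?\<gamma>] \<tau> \<sigma>G \<gamma> by simp
    have "\<not> vge M 1 (f \<tau> \<sigma> \<otimes> f ?\<rho> ?\<gamma>)"
      by (rule unit_mult[OF M _ _ unit \<kappa>(2)]) (use \<tau> \<sigma>G \<gamma> M in simp_all)
    then have "\<not> vge M 1 (f \<tau> (\<iota> \<tau> \<bullet> \<kappa>))"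
      unfolding c[symmetric]
      using vge_mult[OF M, of 0 "\<tau> (f \<sigma> ?\<gamma>)" 1 "f \<tau> (\<iota> \<tau> \<bullet> \<kappa>)"] \<tau> \<sigma>G \<gamma> M by auto
    then show "\<kappa> \<in> above M \<tau>" using \<kappa> by (simp add: above_def)
  qed
  \<comment> \<open>The inclusion is strict because \<tau> drops out: \<sigma> is bad at \<tau>^-1 M
    and \<open>f \<tau> \<sigma>\<close> is a unit, so the cocycle identity makes
    \<open>f ?\<rho> (\<iota> \<sigma>)\<close> a nonunit.\<close>
  have "vge M 1 (\<tau> (f \<sigma> (\<iota> \<sigma>)))"
    using \<sigma> vge_act'[OF M \<tau>, of "f \<sigma> (\<iota> \<sigma>)" 1] by simp
  moreover have c: "\<tau> (f \<sigma> (\<iota> \<sigma>)) = f \<tau> \<sigma> \<otimes> f ?\<rho> (\<iota> \<sigma>)"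
    using f_cocycle[of \<tau> \<sigma> "\<iota> \<sigma>"] \<tau> \<sigma>G by simp
  ultimately have "vge M 1 (f \<tau> \<sigma> \<otimes> f ?\<rho> (\<iota> \<sigma>))" by simp
  then have "vge M 1 (f ?\<rho> (\<iota> \<sigma>))"
    using vge_prime[OF M, of "f \<tau> \<sigma>" "f ?\<rho> (\<iota> \<sigma>)"] unit \<tau> \<sigma>G M by simp
  moreover have "\<iota> ?\<rho> \<bullet> \<tau> = \<iota> \<sigma>" using \<tau> \<sigma>G by (simp add: G.inv_mult_group)
  ultimately have "\<tau> \<notin> above M ?\<rho>" by (simp add: above_def)
  moreover have "\<tau> \<in> above M \<tau>" using \<tau> M by (simp add: above_def)
  ultimately show "above M ?\<rho> \<subset> above M \<tau>" using sub by blast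
qed

lemma level_sub: "level M k \<subseteq> carrier G" by (auto simp: level_def)

lemma End_level:
  assumes Z: "stable Z" and h: "h \<in> End Z" and M: "M \<in> Pl"
    and bad: "\<And>N x. N \<in> Pl \<Longrightarrow> x \<in> Z \<Longrightarrow> h x \<in> loc N (span (bad N) Z)"
    and x: "x \<in> Z" "x \<in> loc M (span (level M (Suc k)) Z)"
  shows "h x \<in> loc M (span (level M k) Z)"
proof (rule End_loc_span[OF M Z level_sub level_sub h x])
  fix \<tau> y assume \<tau>: "\<tau> \<in> level M (Suc k)" and y: "y \<in> Z"
  have \<tau>G: "\<tau> \<in> carrier G" using \<tau> by (simp add: level_def)
  have N: "act (\<iota> \<tau>) M \<in> Pl" using \<tau>G M by simp
  show "lx \<tau> (h y) \<in> loc M (span (level M k) Z)"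
  proof (rule lx_loc_span[OF M \<tau>G Z _ level_sub bad[OF N y]])
    fix \<sigma> assume \<sigma>: "\<sigma> \<in> bad (act (\<iota> \<tau>) M)"
    show "vge M 1 (f \<tau> \<sigma>) \<or> \<tau> \<bullet> \<sigma> \<in> level M k"
    proof (cases "vge M 1 (f \<tau> \<sigma>)")
      case False
      then show ?thesis using above_decreasing[OF M \<tau>G \<sigma> False] \<tau> \<tau>G \<sigma> by (auto simp: level_def)
    qed simp
  qed blast
qed

lemma End_power:
  assumes Z: "stable Z" and h: "h \<in> End Z"
  shows "(h ^^ n) \<in> End Z"
proof (induction n)
  case 0
  show ?case by (rule EndI[OF Z]) simp_all
next
  case (Suc n)
  note n = EndD[OF Z Suc]
  show ?case
    by (rule EndI[OF Z]) (use n EndD[OF Z h n(1)] in \<open>simp_all\<close>)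
qed

lemma End_power_pi:
  assumes Z: "stable Z" and h: "h \<in> End Z"
    and bad: "\<And>N x. N \<in> Pl \<Longrightarrow> x \<in> Z \<Longrightarrow> h x \<in> loc N (span (bad N) Z)" and x: "x \<in> Z"
  shows "\<exists>z \<in> Z. (h ^^ card (carrier G)) x = scal \<pi> z"
proof -
  let ?n = "card (carrier G)"
  have hZ: "(h ^^ k) x \<in> Z" for k by (rule EndD(1)[OF Z End_power[OF Z h] x])
  have lev: "(h ^^ k) x \<in> loc M (span (level M (?n - k)) Z)" if M: "M \<in> Pl" and "k \<le> ?n" for k M
    using that(2)
  proof (induction k)
    case 0
    have "\<one>\<^bsub>G\<^esub> \<in> level M ?n" by (auto simp: level_def above_def intro: card_mono)
    from span_lx[OF Z level_sub x this] have "x \<in> span (level M ?n) Z" using stableD(2)[OF Z x] by simp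
    then show ?case using sub_loc[OF M span_submod[OF Z level_sub]] by simp
  next
    case (Suc k)
    then have "?n - k = Suc (?n - Suc k)" by simp
    with Suc have "(h ^^ k) x \<in> loc M (span (level M (Suc (?n - Suc k))) Z)" by simp
    from End_level[OF Z h M bad hZ this] show ?case by simp
  qed
  define w where "w = (h ^^ ?n) x"
  have w: "w \<in> carrier \<Sigma>" using stableD(2)[OF Z hZ] by (simp add: w_def)
  have "scal (inv \<pi>) w \<in> Z"
  proof (rule inter_loc[OF stable_submod[OF Z]])
    fix M assume M: "M \<in> Pl"
    have "above M \<tau> \<noteq> {}" if "\<tau> \<in> carrier G" for \<tau>
    proof -
      have "\<tau> \<in> above M \<tau>" using that M by (simp add: above_def)
      then show ?thesis by blast
    qed
    \<comment> \<open>At level 0 only \<pi>Z is left of the span, at every place, and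
      \<open>inter_loc\<close> turns this into divisibility by \<pi> in \<open>Z\<close>.\<close>
    then have "level M 0 = {}" by (auto simp: level_def above_def)
    then have "w \<in> loc M (span {} Z)" using lev[OF M order_refl] by (simp add: w_def)
    then obtain e where e: "e \<in> S" "e \<in> carrier K" "\<not> vge M 1 e" "scal e w \<in> span {} Z" by (rule locE)
    then obtain z where z: "z \<in> Z" "scal e w = scal \<pi> z" using stableD(2)[OF Z] by (auto simp: span_def)
    have "scal e (scal (inv \<pi>) w) = scal (inv \<pi>) (scal e w)" using w e(2) by (simp add: scal_scal m_comm)
    also have "\<dots> = z" using stableD(2)[OF Z z(1)] by (simp add: z(2) scal_scal)
    finally show "scal (inv \<pi>) w \<in> loc M Z" using w e z(1) by (intro locI[of _ e]) simp_all
  qed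
  moreover have "w = scal \<pi> (scal (inv \<pi>) w)" using w by (simp add: scal_scal)
  ultimately show ?thesis unfolding w_def by blast
qed

text \<open>Let h = 1 - \<theta> and let p be its power with exponent s card G. Then p = 1 - c with
  c of finite rank. On the other hand p maps Z into \<pi>^s Z, so it factors through multiplication
  by \<pi>^s, which has finite rank. Hence 1 = c + p has finite rank.\<close>

lemma sqfree_projective:
  assumes Z: "stable Z"
  shows "projective_module A (left_ideal_module A Z)"
proof (rule left_module.projective_moduleI[OF left_module_Z[OF Z]])
  note lm = left_module_Z[OF Z]
  obtain \<theta> where \<theta>: "frank Z \<theta>" and bad: "\<And>M x. M \<in> Pl \<Longrightarrow> x \<in> Z \<Longrightarrow> cpl \<theta> x \<in> loc M (span (bad M) Z)"
    using global_finite_rank[OF Z] by blast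
  define h where "h = cpl \<theta>"
  have h: "h \<in> End Z" unfolding h_def by (rule cpl_End[OF Z frank_End[OF Z \<theta>]])
  have pw: "\<exists>c. frank Z c \<and> (\<forall>x \<in> Z. (h ^^ k) x = cpl c x)" for k
  proof (induction k)
    case 0
    have "frank Z (\<lambda>x. \<zero>\<^bsub>\<Sigma>\<^esub>)" by (rule finite_rank_map.zero) simp
    moreover have "(h ^^ 0) x = cpl (\<lambda>x. \<zero>\<^bsub>\<Sigma>\<^esub>) x" if "x \<in> Z" for x
      using stableD(2)[OF Z that] by (simp add: cpl_def)
    ultimately show ?case by blast
  next
    case (Suc k)
    then obtain c where c: "frank Z c" "\<forall>x \<in> Z. (h ^^ k) x = cpl c x" by blast
    from frank_combine[OF Z c(1) \<theta>] c(2) show ?case by (auto simp: h_def)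
  qed
  obtain s where s: "frank Z (scal (\<pi> [^] (s::nat)))" using pi_power_finite_rank[OF sqfree Z] by blast
  define g where "g = h ^^ card (carrier G)"
  have g: "g \<in> End Z" unfolding g_def by (rule End_power[OF Z h])
  have gpi: "\<exists>z \<in> Z. g x = scal \<pi> z" if "x \<in> Z" for x
    unfolding g_def by (rule End_power_pi[OF Z h _ that]) (simp add: h_def bad)
  have gs: "\<exists>z \<in> Z. (g ^^ j) x = scal (\<pi> [^] j) z" if "x \<in> Z" for j x
    using that
  proof (induction j)
    case 0
    then show ?case using stableD(2)[OF Z] by auto
  next
    case (Suc j)
    then obtain z where z: "z \<in> Z" "(g ^^ j) x = scal (\<pi> [^] j) z" by blast
    obtain z' where z': "z' \<in> Z" "g z = scal \<pi> z'" using gpi[OF z(1)] by blast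
    have "(g ^^ Suc j) x = scal (\<pi> [^] j) (g z)" using EndD(3)[OF Z g z(1) power_pi(5)] z(2) by simp
    also have "\<dots> = scal (\<pi> [^] Suc j) z'"
      using stableD(2)[OF Z z'(1)] by (simp add: z'(2) scal_scal power_pi)
    finally show ?case using z'(1) by blast
  qed
  define p where "p = g ^^ s"
  have p: "p \<in> End Z" unfolding p_def by (rule End_power[OF Z g])
  let ?i = "inv (\<pi> [^] s)"
  have iK: "?i \<in> carrier K" by (simp add: power_pi)
  define q where "q x = scal ?i (p x)" for x
  have pS: "p x \<in> carrier \<Sigma>" if "x \<in> Z" for x using stableD(2)[OF Z EndD(1)[OF Z p that]] .
  have qE: "q \<in> End Z"
  proof (rule EndI[OF Z])
    fix x assume x: "x \<in> Z"
    obtain z where z: "z \<in> Z" "p x = scal (\<pi> [^] s) z" using gs[OF x, of s] by (auto simp: p_def)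
    then have "q x = z" using stableD(2)[OF Z z(1)] by (simp add: q_def scal_scal power_pi)
    then show "q x \<in> Z" using z by simp
    show "q (scal a x) = scal a (q x)" if "a \<in> S" for a
      using EndD(3)[OF Z p x that] pS[OF x] iK S_carrier[OF that] by (simp add: q_def scal_scal m_comm)
    show "q (lx \<sigma> x) = lx \<sigma> (q x)" if "\<sigma> \<in> carrier G" for \<sigma>
      using EndD(4)[OF Z p x that] pS[OF x] iK that
      by (simp add: q_def lx_scal act_inverse power_pi)
    show "q (x \<boxplus> y) = q x \<boxplus> q y" if "y \<in> Z" for y
      using EndD(2)[OF Z p x that] pS[OF x] pS[OF that] iK by (simp add: q_def scal_add)
  qed
  have fp: "frank Z p"
  proof (rule left_module.finite_rank_map_comp_right[OF lm qE s])
    fix x assume "x \<in> carrier (left_ideal_module A Z)"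
    then show "p x = scal (\<pi> [^] s) (q x)" using pS by (simp add: q_def scal_scal power_pi)
  qed
  have "p = h ^^ (card (carrier G) * s)" by (simp add: p_def g_def funpow_mult)
  then obtain c where c: "frank Z c" "\<forall>x \<in> Z. p x = cpl c x" using pw by metis
  show "frank Z (\<lambda>x. x)"
  proof (rule left_module.finite_rank_map_add[OF lm c(1) fp])
    fix x assume "x \<in> carrier (left_ideal_module A Z)"
    then have x: "x \<in> Z" by simp
    have cl: "x \<in> carrier \<Sigma>" "c x \<in> carrier \<Sigma>"
      using stableD(2)[OF Z] x EndD(1)[OF Z frank_End[OF Z c(1)] x] by blast+
    have "p x = x \<boxplus> \<ominus>\<^bsub>\<Sigma>\<^esub> c x" using c(2) x cl by (simp add: cpl_def Sigma_neg)
    then have "c x \<boxplus> p x = x" using cl by (simp add: S.a_lcomm S.r_neg)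
    then show "x = c x \<oplus>\<^bsub>left_ideal_module A Z\<^esub> p x" by simp
  qed
qed

end

subsection \<open>Necessity\<close>

text \<open>If \<open>f(b\<^sup>-\<^sup>1,b)\<close> lies in \<open>M\<^sup>2\<close>, the left ideal of all \<open>\<Sum>\<sigma>. a\<^sub>\<sigma> x\<^sub>\<sigma>\<close> with \<open>a\<^sub>\<sigma> \<in> \<sigma>M\<close>
  whenever \<open>f(\<sigma> b\<^sup>-\<^sup>1,b) \<in> \<sigma>M\<close> is not projective: every endomorphism of finite rank maps \<open>\<pi>\<close> to an
  element whose coefficient at \<open>1\<close> lies in \<open>M\<^sup>2\<close>.\<close>

lemma projective_sqfree:
  assumes her: "left_hereditary A" and M: "M \<in> Pl" and b: "b \<in> carrier G"
    and f2: "vge M 2 (f (\<iota> b) b)"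
  shows False
proof -
  let ?i = "\<lambda>\<sigma>. \<iota> \<sigma>"
  define Z where "Z = {x \<in> carrier G \<rightarrow>\<^sub>E S. \<forall>\<sigma> \<in> carrier G.
    vge (act \<sigma> M) 1 (f (\<sigma> \<bullet> ?i b) b) \<longrightarrow> vge (act \<sigma> M) 1 (x \<sigma>)}"
  have ZD: "x \<in> carrier G \<rightarrow>\<^sub>E S" "x \<in> carrier \<Sigma>"
    "\<sigma> \<in> carrier G \<Longrightarrow> vge (act \<sigma> M) 1 (f (\<sigma> \<bullet> ?i b) b) \<Longrightarrow> vge (act \<sigma> M) 1 (x \<sigma>)" if "x \<in> Z" for x \<sigma>
    using that A_Sigma unfolding Z_def by blast+
  have ZI: "x \<in> Z" if "x \<in> carrier G \<rightarrow>\<^sub>E S"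
    "\<And>\<sigma>. \<sigma> \<in> carrier G \<Longrightarrow> vge (act \<sigma> M) 1 (f (\<sigma> \<bullet> ?i b) b) \<Longrightarrow> vge (act \<sigma> M) 1 (x \<sigma>)" for x
    using that unfolding Z_def by blast
  have Z: "stable Z"
    unfolding stable_def
  proof (intro conjI ballI)
    show "Z \<subseteq> carrier G \<rightarrow>\<^sub>E S" using ZD(1) by blast
    show "\<zero>\<^bsub>\<Sigma>\<^esub> \<in> Z" by (rule ZI) (simp_all add: zero_Sigma)
    fix x assume x: "x \<in> Z"
    show "x \<boxplus> y \<in> Z" if y: "y \<in> Z" for y
    proof (rule ZI)
      show "x \<boxplus> y \<in> carrier G \<rightarrow>\<^sub>E S"
        using ZD(1)[OF x] ZD(1)[OF y] by (auto simp: crossed_product_def)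
      show "vge (act \<sigma> M) 1 ((x \<boxplus> y) \<sigma>)"
        if "\<sigma> \<in> carrier G" "vge (act \<sigma> M) 1 (f (\<sigma> \<bullet> ?i b) b)" for \<sigma>
        using ZD(3)[OF x that] ZD(3)[OF y that] that(1) M by (simp add: vge_add)
    qed
    show "scal a x \<in> Z" if a: "a \<in> S" for a
    proof (rule ZI)
      show "scal a x \<in> carrier G \<rightarrow>\<^sub>E S" by (rule scal_A[OF a ZD(1)[OF x]])
      show "vge (act \<sigma> M) 1 (scal a x \<sigma>)"
        if "\<sigma> \<in> carrier G" "vge (act \<sigma> M) 1 (f (\<sigma> \<bullet> ?i b) b)" for \<sigma>
        using vge_mult[OF _ S_vge[OF a] ZD(3)[OF x that]] that(1) M by simp
    qed
    show "lx \<rho> x \<in> Z" if \<rho>: "\<rho> \<in> carrier G" for \<rho>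
    proof (rule ZI)
      show "lx \<rho> x \<in> carrier G \<rightarrow>\<^sub>E S" by (rule lx_A[OF \<rho> ZD(1)[OF x]])
      fix \<tau> assume \<tau>: "\<tau> \<in> carrier G" and v: "vge (act \<tau> M) 1 (f (\<tau> \<bullet> ?i b) b)"
      define \<sigma> where "\<sigma> = ?i \<rho> \<bullet> \<tau>"
      have \<sigma>: "\<sigma> \<in> carrier G" "\<rho> \<bullet> \<sigma> = \<tau>" using \<rho> \<tau> by (simp_all add: \<sigma>_def)
      have aM: "act \<rho> (act \<sigma> M) = act \<tau> M" using act_Pl_mult[OF \<rho> \<sigma>(1) M] \<sigma>(2) by simp
      have \<tau>M: "act \<tau> M \<in> Pl" "act \<sigma> M \<in> Pl" using \<tau> \<sigma> M by simp_all
      have xS: "x \<sigma> \<in> S" "x \<sigma> \<in> carrier K" using ZD(1)[OF x] ZD(2)[OF x] \<sigma> by simp_all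
      have "\<rho> \<bullet> (\<sigma> \<bullet> ?i b) = \<tau> \<bullet> ?i b" using \<rho> \<sigma>(1) b by (simp add: \<sigma>(2)[symmetric] G.m_assoc)
      \<comment> \<open>The cocycle identity at (\<rho>, \<sigma> b^-1, b): if the value attached to
        \<tau> = \<rho>\<sigma> is a nonunit, then either \<open>f \<rho> \<sigma>\<close> is one,
        or the value attached to \<sigma> is and the condition on \<open>x \<sigma>\<close>
        applies.\<close>
      then have c: "\<rho> (f (\<sigma> \<bullet> ?i b) b) \<otimes> f \<rho> \<sigma> = f \<rho> (\<sigma> \<bullet> ?i b) \<otimes> f (\<tau> \<bullet> ?i b) b"
        using f_cocycle[of \<rho> "\<sigma> \<bullet> ?i b" b] \<rho> \<sigma> b by simp
      have "vge (act \<tau> M) 1 (\<rho> (f (\<sigma> \<bullet> ?i b) b) \<otimes> f \<rho> \<sigma>)"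
        unfolding c using vge_mult[OF \<tau>M(1), of 0 _ 1, OF _ v] \<rho> \<sigma> b \<tau>M by simp
      then have "vge (act \<tau> M) 1 (\<rho> (f (\<sigma> \<bullet> ?i b) b)) \<or> vge (act \<tau> M) 1 (f \<rho> \<sigma>)"
        using vge_prime[OF \<tau>M(1)] \<rho> \<sigma> b \<tau>M by simp
      moreover have "vge (act \<tau> M) 1 (\<rho> (x \<sigma>))" if "vge (act \<tau> M) 1 (\<rho> (f (\<sigma> \<bullet> ?i b) b))"
      proof -
        have "vge (act \<sigma> M) 1 (f (\<sigma> \<bullet> ?i b) b)"
          using that vge_act[OF \<tau>M(2) \<rho>, of "f (\<sigma> \<bullet> ?i b) b" 1] \<sigma> b aM by simp
        from ZD(3)[OF x \<sigma>(1) this] show ?thesis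
          using vge_act[OF \<tau>M(2) \<rho> xS(2), of 1] aM by simp
      qed
      moreover have "vge (act \<tau> M) 0 (\<rho> (x \<sigma>))" "vge (act \<tau> M) 0 (f \<rho> \<sigma>)" using xS \<rho> \<sigma> \<tau>M by simp_all
      ultimately have "vge (act \<tau> M) 1 (\<rho> (x \<sigma>) \<otimes> f \<rho> \<sigma>)"
        using vge_mult'[OF \<tau>M(1), of 1 "\<rho> (x \<sigma>)" 0 "f \<rho> \<sigma>" 1] vge_mult'[OF \<tau>M(1), of 0 "\<rho> (x \<sigma>)" 1 "f \<rho> \<sigma>" 1] by auto
      then show "vge (act \<tau> M) 1 (lx \<rho> x \<tau>)" using \<tau> by (simp add: lx_app \<sigma>_def)
    qed
  qed
  \<comment> \<open>The test element for \<open>projective_module_finite_rank\<close>: it lies in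
    \<open>Z\<close>, its coefficient at 1 has valuation exactly 1, and multiplication by it from
    the right is scaling by \<pi>.\<close>
  define p where "p = scal \<pi> \<one>\<^bsub>\<Sigma>\<^esub>"
  have oneS: "\<one>\<^bsub>\<Sigma>\<^esub> \<in> carrier \<Sigma>" by (simp add: one_Sigma')
  have pS: "p \<in> carrier \<Sigma>" by (simp add: p_def one_Sigma')
  have pZ: "p \<in> Z"
  proof (rule ZI)
    show "p \<in> carrier G \<rightarrow>\<^sub>E S" unfolding p_def one_Sigma' by (rule scal_A[OF pi_S unit_vec_A])
    show "vge (act \<sigma> M) 1 (p \<sigma>)" if "\<sigma> \<in> carrier G" for \<sigma>
      using that M vge_pi[of "act \<sigma> M"] vge_pi[OF M] by (simp add: p_def one_Sigma)
  qed
  have mult_p: "x \<star> p = scal \<pi> x" if x: "x \<in> carrier \<Sigma>" for x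
  proof -
    have "x \<star> p = finsum \<Sigma> (\<lambda>\<sigma>. scal \<pi> (scal (x \<sigma>) (lx \<sigma> \<one>\<^bsub>\<Sigma>\<^esub>))) (carrier G)"
      unfolding Sigma_mult[OF x pS]
      by (rule S.finsum_cong') (use x oneS in \<open>auto simp: p_def lx_scal scal_scal m_comm\<close>)
    also have "\<dots> = scal \<pi> (x \<star> \<one>\<^bsub>\<Sigma>\<^esub>)"
      unfolding Sigma_mult[OF x oneS] by (rule scal_finsum[symmetric]) (use x oneS in auto)
    finally show ?thesis using Sigma_r_one[OF x] by simp
  qed
  have key: "vge M 2 ((\<phi> p \<star> u) \<one>\<^bsub>G\<^esub>)"
    if \<phi>: "\<phi> \<in> left_module_hom A (left_ideal_module A Z) (left_ideal_module A (carrier A))" and u: "u \<in> Z" for \<phi> u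
  proof -
    note \<phi>' = left_module_homD[OF \<phi>, simplified]
    define y where "y = \<phi> p"
    have yA: "y \<in> carrier G \<rightarrow>\<^sub>E S" using \<phi>'(1)[OF pZ] by (simp add: y_def)
    have yS: "y \<in> carrier \<Sigma>" using yA A_Sigma by blast
    have uS: "u \<in> carrier \<Sigma>" using ZD(2)[OF u] .
    \<comment> \<open>At \<sigma> = b the value in question is f(1,b) = 1, a unit, so
      \<open>Z\<close> imposes nothing on this coefficient.\<close>
    have bZ: "unit_vec b \<in> Z"
    proof (rule ZI)
      show "vge (act \<sigma> M) 1 (unit_vec b \<sigma>)"
        if "\<sigma> \<in> carrier G" "vge (act \<sigma> M) 1 (f (\<sigma> \<bullet> ?i b) b)" for \<sigma>
        using that b M by (cases "\<sigma> = b") (simp_all add: unit_vec_def)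
    qed simp
    \<comment> \<open>As \<pi> commutes with x_b, linearity gives x_b \<phi>(p) = \<phi>(\<pi> x_b)
      = \<pi> \<phi>(x_b). So the translate of \<open>y\<close> by x_b is divisible by \<pi>, even
      where \<open>y\<close> is not.\<close>
    have "lx b y = \<phi> (unit_vec b \<star> p)"
      using \<phi>'(3)[OF unit_vec_A[of b] pZ] unit_vec_mult[OF b yS] by (simp add: y_def)
    also have "\<dots> = \<phi> (scal \<pi> \<one>\<^bsub>\<Sigma>\<^esub> \<star> unit_vec b)"
      by (simp add: mult_p scal_one_mult)
    also have "\<dots> = scal \<pi> (\<phi> (unit_vec b))"
      using \<phi>'(3)[OF scal_A[OF pi_S unit_vec_A[of "\<one>\<^bsub>G\<^esub>"]] bZ] \<phi>'(1)[OF bZ] A_Sigma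
      by (simp add: one_Sigma'[symmetric] scal_one_mult subset_iff)
    finally have lxb: "lx b y = scal \<pi> (\<phi> (unit_vec b))" .
    have bdiv: "vge N 1 (lx b y \<rho>)" if "N \<in> Pl" "\<rho> \<in> carrier G" for N \<rho>
      unfolding lxb using vge_mult[OF that(1) vge_pi[OF that(1)] S_vge[OF A_closed[OF \<phi>'(1)[OF bZ] that(2)] that(1)]] that(2)
      by simp
    have "vge M 2 (y \<sigma> \<otimes> (\<sigma> (u (?i \<sigma> \<bullet> \<one>\<^bsub>G\<^esub>)) \<otimes> f \<sigma> (?i \<sigma> \<bullet> \<one>\<^bsub>G\<^esub>)))" if \<sigma>: "\<sigma> \<in> carrier G" for \<sigma>
    proof -
      let ?\<rho> = "?i \<sigma>" and ?N = "act (?i \<sigma>) M" and ?B = "act b M"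
      have \<rho>: "?\<rho> \<in> carrier G" and N: "?N \<in> Pl" and B: "?B \<in> Pl" using \<sigma> b M by simp_all
      have yK: "y \<sigma> \<in> carrier K" "vge M 0 (y \<sigma>)" using yS yA \<sigma> M by simp_all
      have uK: "u ?\<rho> \<in> carrier K" "u ?\<rho> \<in> S" using uS ZD(1)[OF u] \<rho> by simp_all
      have u0: "vge M 0 (\<sigma> (u ?\<rho>))" using uK(2) \<sigma> M by simp
      have vf: "vge M 0 (f \<sigma> ?\<rho>)" using \<sigma> M by simp
      have "\<sigma> \<bullet> (?\<rho> \<bullet> ?i b) = ?i b" using \<sigma> b by simp
      then have c1: "\<sigma> (f (?\<rho> \<bullet> ?i b) b) \<otimes> f \<sigma> ?\<rho> = f \<sigma> (?\<rho> \<bullet> ?i b) \<otimes> f (?i b) b"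
        using f_cocycle[of \<sigma> "?\<rho> \<bullet> ?i b" b] \<sigma> b by simp
      show ?thesis
      \<comment> \<open>Either the definition of \<open>Z\<close> makes \<open>u ?\<rho>\<close>
        small and \<open>bdiv\<close> makes \<open>y \<sigma> \<otimes> f \<sigma> ?\<rho>\<close>
        small, one order each, or \<open>c1\<close> shows that \<open>f \<sigma> ?\<rho>\<close>
        inherits both orders from \<open>f (?i b) b\<close>.\<close>
      proof (cases "vge ?N 1 (f (?\<rho> \<bullet> ?i b) b)")
        case True
        from ZD(3)[OF u \<rho> True] have u1: "vge M 1 (\<sigma> (u ?\<rho>))" using vge_act'[OF M \<sigma> uK(1), of 1] by simp
        have "b \<bullet> \<sigma> \<in> carrier G" using b \<sigma> by simp
        from bdiv[OF B this] have "vge ?B 1 (b (y \<sigma>) \<otimes> f b \<sigma>)" using b \<sigma> by (simp add: lx_app)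
        from vge_mult[OF B this, of 0 "f (b \<bullet> \<sigma>) ?\<rho>"]
        have "vge ?B 1 (b (y \<sigma>) \<otimes> (f b \<sigma> \<otimes> f (b \<bullet> \<sigma>) ?\<rho>))" using b \<sigma> B yK by (simp add: m_assoc)
        moreover have "f b \<sigma> \<otimes> f (b \<bullet> \<sigma>) ?\<rho> = b (f \<sigma> ?\<rho>)"
          using f_cocycle[of b \<sigma> ?\<rho>] b \<sigma> by simp
        ultimately have "vge ?B 1 (b (y \<sigma> \<otimes> f \<sigma> ?\<rho>))" using b \<sigma> yK by (simp add: act_times)
        then have yf: "vge M 1 (y \<sigma> \<otimes> f \<sigma> ?\<rho>)" using vge_act[OF M b, of "y \<sigma> \<otimes> f \<sigma> ?\<rho>" 1] yK \<sigma> by simp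
        have "vge M 2 (\<sigma> (u ?\<rho>) \<otimes> (y \<sigma> \<otimes> f \<sigma> ?\<rho>))" using vge_mult[OF M u1 yf] by simp
        moreover have "\<sigma> (u ?\<rho>) \<otimes> (y \<sigma> \<otimes> f \<sigma> ?\<rho>) = y \<sigma> \<otimes> (\<sigma> (u ?\<rho>) \<otimes> f \<sigma> ?\<rho>)"
          using yK uK \<sigma> by (simp add: m_lcomm)
        ultimately show ?thesis using \<sigma> by simp
      next
        case False
        let ?a = "\<sigma> (f (?\<rho> \<bullet> ?i b) b)"
        have aS: "?a \<in> S" "?a \<in> carrier K" using \<sigma> b by simp_all
        have "\<not> vge M 1 ?a" using False vge_act'[OF M \<sigma>, of "f (?\<rho> \<bullet> ?i b) b" 1] \<sigma> b by simp
        note ua = unitD[OF M S_vge[OF aS(1) M] this]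
        have "vge M 2 (?a \<otimes> f \<sigma> ?\<rho>)" unfolding c1 using vge_mult'[OF M _ f2, of 0] \<sigma> b M by simp
        from vge_mult[OF M ua(3) this] have f2': "vge M 2 (f \<sigma> ?\<rho>)" using ua aS(2) \<sigma> by simp
        have "vge M 2 (\<sigma> (u ?\<rho>) \<otimes> f \<sigma> ?\<rho>)" using vge_mult[OF M u0 f2'] by simp
        from vge_mult[OF M yK(2) this] show ?thesis using \<sigma> by simp
      qed
    qed
    then show ?thesis
      unfolding y_def[symmetric] Sigma_mult_app[OF yS uS G.one_closed] by (rule vge_finsum[OF fin M])
  qed
  have all: "vge M 2 (\<theta> p \<one>\<^bsub>G\<^esub>)" if "finite_rank_map A (left_ideal_module A Z) \<theta>" for \<theta>
    using that
  proof induction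
    case (zero \<theta>)
    then show ?case using pZ by simp
  next
    case (add \<theta> \<phi> u \<theta>')
    have "\<theta>' p = (\<phi> p \<star> u) \<boxplus> \<theta> p" using add.hyps(4)[of p] pZ by simp
    then show ?case using vge_add[OF M key[OF add.hyps(2)] add.IH] add.hyps(3) by simp
  qed
  have "projective_module A (left_ideal_module A Z)"
    using her Z by (simp add: left_hereditary_def left_ideal_iff_stable)
  from projective_module_finite_rank[OF this, of p] obtain \<theta> where
    "finite_rank_map A (left_ideal_module A Z) \<theta>" "\<theta> p = p" using pZ by auto
  then have "vge M 2 (p \<one>\<^bsub>G\<^esub>)" using all by metis
  then show False using M by (simp add: p_def one_Sigma vge_def)
qed

lemma left_hereditary_iff:
  "left_hereditary A \<longleftrightarrow> (\<forall>\<sigma> \<in> carrier G. \<forall>M \<in> Pl. \<not> vge M 2 (f \<sigma> (\<iota> \<sigma>)))"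
proof
  assume "left_hereditary A"
  then show "\<forall>\<sigma> \<in> carrier G. \<forall>M \<in> Pl. \<not> vge M 2 (f \<sigma> (\<iota> \<sigma>))"
    using projective_sqfree[of _ "\<iota> _"] by (metis G.inv_closed G.inv_inv)
next
  assume "\<forall>\<sigma> \<in> carrier G. \<forall>M \<in> Pl. \<not> vge M 2 (f \<sigma> (\<iota> \<sigma>))"
  then show "left_hereditary A"
    using sqfree_projective unfolding left_hereditary_def left_ideal_iff_stable by blast
qed

lemma op_valued_crossed: "valued_crossed K G op_cocycle S Pl act v \<pi>"
proof (intro valued_crossed.intro op_crossed_order valued_crossed_axioms.intro)
qed (fact Pl_finite Pl_nonempty act_Pl act_Pl_one act_Pl_mult v_act v_mult v_add S_eq pi act_pi v_pi
    approx faithful extensional)+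

theorem hereditary_iff:
  "hereditary A \<longleftrightarrow> (\<forall>\<tau> \<in> carrier G. \<forall>\<gamma> \<in> carrier G. \<forall>M \<in> Pl. \<not> vge M 2 (f \<tau> \<gamma>))"
proof
  assume "hereditary A"
  then have *: "\<not> vge M 2 (f \<sigma> (inv\<^bsub>G\<^esub> \<sigma>))" if "\<sigma> \<in> carrier G" "M \<in> Pl" for \<sigma> M
    using left_hereditary_iff that by (simp add: hereditary_def)
  show "\<forall>\<tau> \<in> carrier G. \<forall>\<gamma> \<in> carrier G. \<forall>M \<in> Pl. \<not> vge M 2 (f \<tau> \<gamma>)"
  proof (intro ballI notI)
    fix \<tau> \<gamma> M assume g: "\<tau> \<in> carrier G" "\<gamma> \<in> carrier G" and M: "M \<in> Pl" and v: "vge M 2 (f \<tau> \<gamma>)"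
    have "vge M 2 (f \<tau> \<gamma> \<otimes> \<tau> (f (inv\<^bsub>G\<^esub> \<tau>) (\<tau> \<otimes>\<^bsub>G\<^esub> \<gamma>)))"
      by (rule vge_mult'[OF M v, of 0]) (use g M in simp_all)
    then show False using f_inv_split[OF g] *[OF g(1) M] by simp
  qed
next
  assume *: "\<forall>\<tau> \<in> carrier G. \<forall>\<gamma> \<in> carrier G. \<forall>M \<in> Pl. \<not> vge M 2 (f \<tau> \<gamma>)"
  interpret op: valued_crossed K G op_cocycle S Pl act v \<pi> by (rule op_valued_crossed)
  \<comment> \<open>The criterion for left ideals sees only the values at inverse pairs, where the
    two cocycles agree. Hence right ideals lead to the same condition.\<close>
  have "op_cocycle \<sigma> (inv\<^bsub>G\<^esub> \<sigma>) = f \<sigma> (inv\<^bsub>G\<^esub> \<sigma>)" if "\<sigma> \<in> carrier G" for \<sigma>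
    using that by (simp add: op_cocycle_def)
  then have "left_hereditary op.A" unfolding op.left_hereditary_iff using * by simp
  from opposite_left_hereditary[OF this] show "hereditary A"
    using left_hereditary_iff * by (simp add: hereditary_def)
qed

end

section \<open>Valuation rings and integral closure\<close>

text \<open>Values at \<open>x\<close> of the coefficient lists of length \<open>n\<close>, leading zeros allowed.\<close>

primrec (in ring) poly_values :: "'a set \<Rightarrow> 'a \<Rightarrow> nat \<Rightarrow> 'a set" where
  "poly_values A x 0 = {\<zero>}"
| "poly_values A x (Suc n) = {e \<otimes> x \<oplus> a | e a. e \<in> poly_values A x n \<and> a \<in> A}"

definition (in ring) valuation_ring :: "'a set \<Rightarrow> bool"
  where "valuation_ring W \<longleftrightarrow> subring W R \<and>
    (\<forall>x \<in> carrier R - {\<zero>}. x \<in> W \<or> inv x \<in> W)"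

context field
begin

lemma inv_inv_nonzero:
  assumes "a \<in> carrier R" "a \<noteq> \<zero>"
  shows "inv (inv a) = a"
  by (rule comm_inv_char) (use assms in auto)

context
  fixes A x
  assumes A: "subring A R" and x: "x \<in> carrier R"
begin

lemma poly_values_closed: "poly_values A x n \<subseteq> carrier R"
  using x subringE(1)[OF A] by (induction n) auto

lemma poly_values_subset: "subring B R \<Longrightarrow> A \<subseteq> B \<Longrightarrow> x \<in> B \<Longrightarrow> poly_values A x n \<subseteq> B"
  by (induction n) (auto intro: subringE(2,6,7))

lemma poly_values_zero: "\<zero> \<in> poly_values A x n"
proof (induction n)
  case (Suc n)
  then show ?case using x subringE(2)[OF A] by (auto intro!: exI[of _ \<zero>])
qed simp

lemma poly_values_add:
  "d \<in> poly_values A x n \<Longrightarrow> e \<in> poly_values A x n \<Longrightarrow> d \<oplus> e \<in> poly_values A x n"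
proof (induction n arbitrary: d e)
  case (Suc n)
  then obtain d' a e' b where d: "d = d' \<otimes> x \<oplus> a" "d' \<in> poly_values A x n" "a \<in> A"
    and e: "e = e' \<otimes> x \<oplus> b" "e' \<in> poly_values A x n" "b \<in> A" by auto
  have c: "d' \<in> carrier R" "e' \<in> carrier R" "a \<in> carrier R" "b \<in> carrier R"
    using d e poly_values_closed[of n] subringE(1)[OF A] by auto
  have "d \<oplus> e = (d' \<oplus> e') \<otimes> x \<oplus> (a \<oplus> b)" unfolding d(1) e(1) using c x by algebra
  moreover have "d' \<oplus> e' \<in> poly_values A x n" using Suc.IH[OF d(2) e(2)] .
  moreover have "a \<oplus> b \<in> A" using subringE(7)[OF A d(3) e(3)] .
  ultimately show ?case by auto
qed simp

lemma poly_values_smult: "a \<in> A \<Longrightarrow> e \<in> poly_values A x n \<Longrightarrow> a \<otimes> e \<in> poly_values A x n"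
proof (induction n arbitrary: e)
  case 0
  then show ?case using subringE(1)[OF A] by auto
next
  case (Suc n)
  then obtain e' b where e: "e = e' \<otimes> x \<oplus> b" "e' \<in> poly_values A x n" "b \<in> A" by auto
  have c: "e' \<in> carrier R" "a \<in> carrier R" "b \<in> carrier R"
    using e Suc.prems poly_values_closed[of n] subringE(1)[OF A] by auto
  have "a \<otimes> e = (a \<otimes> e') \<otimes> x \<oplus> a \<otimes> b" unfolding e(1) using c x by algebra
  moreover have "a \<otimes> e' \<in> poly_values A x n" using Suc.IH[OF Suc.prems(1) e(2)] .
  moreover have "a \<otimes> b \<in> A" using subringE(6)[OF A Suc.prems(1) e(3)] .
  ultimately show ?case by auto
qed

lemma poly_values_times:
  assumes "e \<in> poly_values A x n"
  shows "x \<otimes> e \<in> poly_values A x (Suc n)"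
proof -
  have "e \<in> carrier R" using assms poly_values_closed by auto
  then have "x \<otimes> e = e \<otimes> x \<oplus> \<zero>" using x by (simp add: m_comm)
  then show ?thesis using assms subringE(2)[OF A] by auto
qed

lemma poly_values_power: "e \<in> poly_values A x n \<Longrightarrow> x [^] k \<otimes> e \<in> poly_values A x (k + n)"
proof (induction k)
  case 0
  then have "e \<in> carrier R" using poly_values_closed by blast
  then show ?case using 0 by simp
next
  case (Suc k)
  have "e \<in> carrier R" using Suc.prems poly_values_closed by auto
  then have "x [^] Suc k \<otimes> e = x \<otimes> (x [^] k \<otimes> e)" using x by (simp add: m_ac)
  then show ?case using poly_values_times[OF Suc.IH[OF Suc.prems]] by simp
qed

lemma poly_values_const: "a \<in> A \<Longrightarrow> a \<in> poly_values A x (Suc n)"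
proof -
  assume a: "a \<in> A"
  then have "a = \<zero> \<otimes> x \<oplus> a" using x subringE(1)[OF A] by auto
  then show ?thesis using a poly_values_zero[of n] by auto
qed

lemma poly_values_Suc: "poly_values A x n \<subseteq> poly_values A x (Suc n)"
proof (induction n)
  case 0
  then show ?case using poly_values_zero[of 1] by simp
next
  case (Suc n)
  then show ?case by auto
qed

lemma poly_values_top:
  "e \<in> poly_values A x (Suc n) \<Longrightarrow> \<exists>a \<in> A. \<exists>d \<in> poly_values A x n. e = a \<otimes> x [^] n \<oplus> d"
proof (induction n arbitrary: e)
  case 0
  then obtain a where "e = \<zero> \<otimes> x \<oplus> a" "a \<in> A" by auto
  moreover then have "a \<in> carrier R" using subringE(1)[OF A] by auto
  ultimately show ?case using x by (auto intro!: bexI[of _ a])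
next
  case (Suc n)
  obtain e' b where e: "e = e' \<otimes> x \<oplus> b" "e' \<in> poly_values A x (Suc n)" "b \<in> A"
    using Suc.prems unfolding poly_values.simps(2)[of A x "Suc n"] by blast
  obtain a d where a: "a \<in> A" and d: "d \<in> poly_values A x n" and e': "e' = a \<otimes> x [^] n \<oplus> d"
    using Suc.IH[OF e(2)] by blast
  have c: "a \<in> carrier R" "b \<in> carrier R" "d \<in> carrier R" "x [^] n \<in> carrier R"
    using a d e poly_values_closed[of n] subringE(1)[OF A] x by auto
  have "e = a \<otimes> (x [^] n \<otimes> x) \<oplus> (d \<otimes> x \<oplus> b)" unfolding e(1) e' using c x by algebra
  moreover have "d \<otimes> x \<oplus> b \<in> poly_values A x (Suc n)" using d e(3) by auto
  ultimately show ?case using a by auto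
qed

lemma simple_extension_poly_values:
  "e \<in> simple_extension A x \<Longrightarrow> \<exists>n. e \<in> poly_values A x n"
proof (induction e rule: simple_extension.induct)
  case zero
  then show ?case using poly_values_zero by blast
next
  case (lin e a)
  then obtain n where "e \<in> poly_values A x n" by blast
  then have "e \<otimes> x \<oplus> a \<in> poly_values A x (Suc n)" using lin by auto
  then show ?case by blast
qed

lemma poly_values_eval:
  "e \<in> poly_values A x n \<Longrightarrow> \<exists>p. set p \<subseteq> A \<and> length p = n \<and> eval p x = e"
proof (induction n arbitrary: e)
  case (Suc n)
  then obtain e' b where e: "e = e' \<otimes> x \<oplus> b" "e' \<in> poly_values A x n" "b \<in> A" by auto
  obtain p where p: "set p \<subseteq> A" "length p = n" "eval p x = e'" using Suc.IH[OF e(2)] by blast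
  have "set p \<subseteq> carrier R" "b \<in> carrier R" using p(1) e(3) subringE(1)[OF A] by auto
  then have "eval (p @ [b]) x = e" using eval_append_aux x p(3) e(1) by simp
  then show ?case using p e(3) by (auto intro!: exI[of _ "p @ [b]"])
qed simp

lemma eval_poly_values: "set p \<subseteq> A \<Longrightarrow> eval p x \<in> poly_values A x (length p)"
proof (induction p rule: rev_induct)
  case (snoc b p)
  have "set p \<subseteq> carrier R" "b \<in> carrier R" using snoc.prems subringE(1)[OF A] by auto
  then have "eval (p @ [b]) x = eval p x \<otimes> x \<oplus> b" using eval_append_aux x by simp
  then show ?case using snoc by auto
qed simp

end

text \<open>Multiplication by x^n reverses a coefficient list; the index counts coefficients, so
  \<open>Suc n\<close> stands for degree at most n.\<close>

lemma poly_values_reverse: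
  assumes A: "subring A R" and x: "x \<in> carrier R" "x \<noteq> \<zero>"
  shows "e \<in> poly_values A (inv x) (Suc n) \<Longrightarrow> x [^] n \<otimes> e \<in> poly_values A x (Suc n)"
proof (induction n arbitrary: e)
  case 0
  then obtain a where a: "e = \<zero> \<otimes> inv x \<oplus> a" "a \<in> A" by auto
  then have "a \<in> carrier R" using subringE(1)[OF A] by auto
  then have "x [^] (0::nat) \<otimes> e = a" using a x by simp
  then show ?case using poly_values_const[OF A x(1) a(2), of 0] by metis
next
  case (Suc n)
  have ix: "inv x \<in> carrier R" using x by simp
  obtain d b where e: "e = d \<otimes> inv x \<oplus> b" "d \<in> poly_values A (inv x) (Suc n)" "b \<in> A"
    using Suc.prems unfolding poly_values.simps(2)[of A "inv x" "Suc n"] by blast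
  have c: "d \<in> carrier R" "b \<in> carrier R" "x [^] n \<in> carrier R"
    using e poly_values_closed[OF A ix, of "Suc n"] subringE(1)[OF A] x by auto
  have "x [^] Suc n \<otimes> e = (x [^] n \<otimes> d) \<otimes> (x \<otimes> inv x) \<oplus> x [^] Suc n \<otimes> b"
    unfolding e(1) nat_pow_Suc using c x(1) ix by algebra
  then have *: "x [^] Suc n \<otimes> e = x [^] n \<otimes> d \<oplus> x [^] Suc n \<otimes> b" using x c by simp
  have 1: "x [^] n \<otimes> d \<in> poly_values A x (Suc (Suc n))"
    using Suc.IH[OF e(2)] poly_values_Suc[OF A x(1)] by blast
  have "x [^] Suc n \<otimes> b \<in> poly_values A x (Suc n + Suc 0)"
    by (rule poly_values_power[OF A x(1) poly_values_const[OF A x(1) e(3)]])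
  then have "x [^] Suc n \<otimes> b \<in> poly_values A x (Suc (Suc n))" by simp
  with 1 show ?case unfolding * by (rule poly_values_add[OF A x(1)])
qed

text \<open>If \<open>1 = t q\<^sub>1(x) = t q\<^sub>2(1/x)\<close>, then the longer one of \<open>q\<^sub>1\<close>, \<open>q\<^sub>2\<close> can be shortened: eliminate its
  leading term by means of the other relation.\<close>

lemma poly_values_shorten:
  assumes A: "subring A R" and t: "t \<in> A" "t \<noteq> \<zero>" "inv t \<notin> A" and x: "x \<in> carrier R" "x \<noteq> \<zero>"
    and m: "inv t \<in> poly_values A x (Suc m)" and n: "inv t \<in> poly_values A (inv x) (Suc n)"
    and le: "n \<le> m"
  shows "inv t \<in> poly_values A x m"
proof -
  have tc: "t \<in> carrier R" using t subringE(1)[OF A] by auto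
  have ix: "inv x \<in> carrier R" using x by simp
  obtain d b where e: "inv t = d \<otimes> inv x \<oplus> b" "d \<in> poly_values A (inv x) n" "b \<in> A"
    using n by auto
  have c: "d \<in> carrier R" "b \<in> carrier R"
    using e poly_values_closed[OF A ix] subringE(1)[OF A] by auto
  have "n \<noteq> 0"
  proof
    assume "n = 0"
    then have "inv t = b" using e(1,2) c ix by simp
    then show False using t(3) e(3) by simp
  qed
  then obtain k where k: "n = Suc k" by (cases n) auto
  have xk: "x [^] k \<in> carrier R" using x by simp
  have d: "x [^] k \<otimes> d \<in> poly_values A x n"
    using poly_values_reverse[OF A x] e(2) unfolding k by blast
  have b1: "\<one> \<ominus> t \<otimes> b = t \<otimes> (d \<otimes> inv x)"
  proof -
    have "\<one> = t \<otimes> (d \<otimes> inv x \<oplus> b)" using e(1) t tc by (metis r_inv_nonzero)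
    then show ?thesis using tc c ix by algebra
  qed
  \<comment> \<open>\<open>b\<close> is the constant coefficient of the relation in 1/x. Multiplied
    by x^n, that relation expresses (1 - t b) x^n by lower powers of x, which below eliminates the
    leading term a x^m of the other relation.\<close>
  have b2: "(\<one> \<ominus> t \<otimes> b) \<otimes> x [^] n = t \<otimes> (x [^] k \<otimes> d)"
  proof -
    have "(\<one> \<ominus> t \<otimes> b) \<otimes> x [^] n = t \<otimes> (x [^] k \<otimes> d) \<otimes> (x \<otimes> inv x)"
      unfolding b1 k nat_pow_Suc using tc c ix x(1) xk by algebra
    then show ?thesis using x tc c by simp
  qed
  obtain a q where a: "a \<in> A" and q: "q \<in> poly_values A x m" and iq: "inv t = a \<otimes> x [^] m \<oplus> q"
    using poly_values_top[OF A x(1) m] by blast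
  have c2: "a \<in> carrier R" "q \<in> carrier R"
    using a q poly_values_closed[OF A x(1), of m] subringE(1)[OF A] by auto
  obtain j where j: "m = j + n" using le by (metis le_iff_add add.commute)
  have xj: "x [^] j \<in> carrier R" "x [^] n \<in> carrier R" using x by auto
  have xm: "x [^] m = x [^] j \<otimes> x [^] n" unfolding j using x by (simp add: nat_pow_mult)
  have it: "inv t \<in> carrier R" using tc t by simp
  have "(\<one> \<ominus> t \<otimes> b) \<otimes> inv t = inv t \<ominus> (t \<otimes> inv t) \<otimes> b" using tc it c by algebra
  then have "(\<one> \<ominus> t \<otimes> b) \<otimes> inv t = inv t \<ominus> b" using tc t c by simp
  moreover have "(\<one> \<ominus> t \<otimes> b) \<otimes> inv t
      = a \<otimes> (x [^] j \<otimes> ((\<one> \<ominus> t \<otimes> b) \<otimes> x [^] n)) \<oplus> (\<one> \<ominus> t \<otimes> b) \<otimes> q"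
    unfolding iq xm using c2 c xj tc by algebra
  ultimately have ib: "inv t \<ominus> b = a \<otimes> (x [^] j \<otimes> (t \<otimes> (x [^] k \<otimes> d))) \<oplus> (\<one> \<ominus> t \<otimes> b) \<otimes> q"
    unfolding b2 by simp
  have "inv t = b \<oplus> (inv t \<ominus> b)" using it c by algebra
  also have "inv t \<ominus> b = (a \<otimes> t) \<otimes> (x [^] j \<otimes> (x [^] k \<otimes> d)) \<oplus> (\<one> \<ominus> t \<otimes> b) \<otimes> q"
    unfolding ib using c c2 xj xk tc by algebra
  finally have eq: "inv t = b \<oplus> ((a \<otimes> t) \<otimes> (x [^] j \<otimes> (x [^] k \<otimes> d)) \<oplus> (\<one> \<ominus> t \<otimes> b) \<otimes> q)" .
  have 1: "b \<in> poly_values A x m"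
    using poly_values_const[OF A x(1) e(3), of "m - 1"] le k by auto
  have 2: "(a \<otimes> t) \<otimes> (x [^] j \<otimes> (x [^] k \<otimes> d)) \<in> poly_values A x m"
    using poly_values_smult[OF A x(1) subringE(6)[OF A a t(1)] poly_values_power[OF A x(1) d, of j]]
    unfolding j by simp
  have "t \<otimes> b \<in> A" "\<one> \<in> A" using subringE(3,6)[OF A] t e(3) by auto
  then have "\<one> \<ominus> t \<otimes> b \<in> A" using subringE(5,7)[OF A] by (simp add: a_minus_def)
  then have 3: "(\<one> \<ominus> t \<otimes> b) \<otimes> q \<in> poly_values A x m"
    using poly_values_smult[OF A x(1)] q by blast
  show ?thesis by (subst eq) (rule poly_values_add[OF A x(1) 1 poly_values_add[OF A x(1) 2 3]])
qed

text \<open>If neither x nor 1/x is in A, maximality puts \<open>inv t\<close> into both A[x] and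
  A[1/x]. Of two expressions of least length the longer one is shortened by
  \<open>poly_values_shorten\<close>, a contradiction; the cases are exchanged by x \<mapsto>
  1/x.\<close>

lemma maximal_valuation_ring:
  assumes A: "subring A R" and t: "t \<in> A" "t \<noteq> \<zero>" "inv t \<notin> A"
    and max: "\<And>B. subring B R \<Longrightarrow> A \<subseteq> B \<Longrightarrow> inv t \<notin> B \<Longrightarrow> B = A"
  shows "valuation_ring A"
proof -
  have ex: "\<exists>n. inv t \<in> poly_values A x n" if "x \<in> carrier R" "x \<notin> A" for x
  proof -
    have "inv t \<in> simple_extension A x"
    proof (rule ccontr)
      assume "inv t \<notin> simple_extension A x"
      then have "simple_extension A x = A"
        using max[OF simple_extension_is_subring[OF A that(1)]]
          simple_extension_incl[OF subringE(1)[OF A] that(1)] by blast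
      then show False using simple_extension_mem[OF A that(1)] that(2) by simp
    qed
    then show ?thesis by (rule simple_extension_poly_values[OF A that(1)])
  qed
  have it: "inv t \<noteq> \<zero>" using t subringE(1)[OF A] by (metis inv_nonzero subset_iff)
  have False if x: "x \<in> carrier R" "x \<noteq> \<zero>" "x \<notin> A" "inv x \<notin> A" for x
  proof -
    have ix: "inv x \<in> carrier R" "inv x \<noteq> \<zero>" "inv (inv x) = x" using x by (auto simp: inv_inv_nonzero)
    define m where "m = (LEAST n. inv t \<in> poly_values A x n)"
    define n where "n = (LEAST n. inv t \<in> poly_values A (inv x) n)"
    have m: "inv t \<in> poly_values A x m" unfolding m_def by (rule LeastI_ex[OF ex]) (use x in auto)
    have n: "inv t \<in> poly_values A (inv x) n"
      unfolding n_def by (rule LeastI_ex[OF ex]) (use x in auto)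
    have "m \<noteq> 0" "n \<noteq> 0" using m n it by (auto intro!: Nat.gr0I)
    then obtain m' n' where mn: "m = Suc m'" "n = Suc n'" by (metis not0_implies_Suc)
    show False
    proof (cases "n' \<le> m'")
      case True
      have "inv t \<in> poly_values A x m'"
        by (rule poly_values_shorten[OF A t x(1,2) _ _ True]) (use m n mn in auto)
      then have "m \<le> m'" unfolding m_def by (rule Least_le)
      then show False using mn by simp
    next
      case False
      have "inv t \<in> poly_values A (inv x) n'"
        by (rule poly_values_shorten[OF A t ix(1,2), of n' m']) (use m n mn ix(3) False in auto)
      then have "n \<le> n'" unfolding n_def by (rule Least_le)
      then show False using mn by simp
    qed
  qed
  then show ?thesis unfolding valuation_ring_def using A by blast
qed

text \<open>Chevalley's existence theorem for a single nonunit: Zorn's lemma for the subrings that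
  contain \<open>A\<close> and omit \<open>inv t\<close>.\<close>

lemma exists_valuation_ring:
  assumes A: "subring A R" and t: "t \<in> A" "t \<noteq> \<zero>" "inv t \<notin> A"
  shows "\<exists>W. valuation_ring W \<and> A \<subseteq> W \<and> inv t \<notin> W"
proof -
  let ?\<A> = "{B. subring B R \<and> A \<subseteq> B \<and> inv t \<notin> B}"
  have "\<exists>M \<in> ?\<A>. \<forall>B \<in> ?\<A>. M \<subseteq> B \<longrightarrow> B = M"
  proof (rule subset_Zorn_nonempty)
    show "?\<A> \<noteq> {}" using A t by blast
    fix \<C> assume ne: "\<C> \<noteq> {}" and ch: "subset.chain ?\<A> \<C>"
    have sub: "subring B R" "A \<subseteq> B" "inv t \<notin> B" if "B \<in> \<C>" for B
      using ch that unfolding subset.chain_def by auto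
    have lin: "B \<subseteq> C \<or> C \<subseteq> B" if "B \<in> \<C>" "C \<in> \<C>" for B C
      using ch that unfolding subset_chain_def by blast
    have two: "\<exists>C \<in> \<C>. a \<in> C \<and> b \<in> C" if "a \<in> \<Union>\<C>" "b \<in> \<Union>\<C>" for a b
      using that lin by blast
    have "subring (\<Union>\<C>) R"
    proof (rule subringI)
      show "\<Union>\<C> \<subseteq> carrier R" using subringE(1)[OF sub(1)] by blast
      obtain C where "C \<in> \<C>" using ne by blast
      then show "\<one> \<in> \<Union>\<C>" using subringE(3)[OF sub(1)] by blast
      show "\<ominus> a \<in> \<Union>\<C>" if a: "a \<in> \<Union>\<C>" for a
      proof -
        obtain C where "C \<in> \<C>" "a \<in> C" using a by blast
        then show ?thesis using subringE(5)[OF sub(1)] by blast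
      qed
      show "a \<otimes> b \<in> \<Union>\<C>" if ab: "a \<in> \<Union>\<C>" "b \<in> \<Union>\<C>" for a b
      proof -
        obtain C where C: "C \<in> \<C>" "a \<in> C" "b \<in> C" using two[OF ab] by blast
        show ?thesis using subringE(6)[OF sub(1)[OF C(1)] C(2,3)] C(1) by blast
      qed
      show "a \<oplus> b \<in> \<Union>\<C>" if ab: "a \<in> \<Union>\<C>" "b \<in> \<Union>\<C>" for a b
      proof -
        obtain C where C: "C \<in> \<C>" "a \<in> C" "b \<in> C" using two[OF ab] by blast
        show ?thesis using subringE(7)[OF sub(1)[OF C(1)] C(2,3)] C(1) by blast
      qed
    qed
    moreover have "A \<subseteq> \<Union>\<C>" using ne sub(2) by blast
    moreover have "inv t \<notin> \<Union>\<C>" using sub(3) by blast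
    ultimately show "\<Union>\<C> \<in> ?\<A>" by simp
  qed
  then obtain W where W: "W \<in> ?\<A>" and m: "\<forall>B \<in> ?\<A>. W \<subseteq> B \<longrightarrow> B = W" ..
  have max: "B = W" if B: "subring B R" "W \<subseteq> B" "inv t \<notin> B" for B
  proof -
    have "B \<in> ?\<A>" using B W by auto
    then show ?thesis using m B(2) by simp
  qed
  have "valuation_ring W"
    by (rule maximal_valuation_ring[of W t]) (use W max t in auto)
  then show ?thesis using W by blast
qed

text \<open>Dividing an integral equation of degree n + 1 by x^n expresses x as a polynomial in 1/x
  over V.\<close>

lemma integral_in_ring:
  assumes V: "subring V R" and W: "subring W R" "V \<subseteq> W"
    and x: "x \<in> integral_closure R V" and ix: "inv x \<in> W"
  shows "x \<in> W"
proof (cases "x = \<zero>")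
  case True
  then show ?thesis using subringE(2)[OF W(1)] by simp
next
  case False
  have xc: "x \<in> carrier R" using x by (simp add: integral_closure_def)
  obtain p where p: "polynomial V p" "p \<noteq> []" "lead_coeff p = \<one>" "eval p x = \<zero>"
    using x by (auto simp: integral_closure_def)
  obtain q where q: "p = \<one> # q" using p(2,3) by (cases p) auto
  have qV: "set q \<subseteq> V" using p(1) unfolding q polynomial_def by auto
  have qc: "set q \<subseteq> carrier R" using qV subringE(1)[OF V] by auto
  have eq: "x [^] length q \<oplus> eval q x = \<zero>" using p(4) q xc by simp
  have "q \<noteq> []" using eq by auto
  then obtain n where n: "length q = Suc n" by (cases q) auto
  have ec: "eval q x \<in> carrier R" using eval_in_carrier[OF qc xc] .
  have i: "inv x \<in> carrier R" "inv x \<noteq> \<zero>" "inv (inv x) = x" using xc False by (auto simp: inv_inv_nonzero)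
  have "eval q x \<in> poly_values V x (Suc n)" using eval_poly_values[OF V xc qV] n by simp
  then have "inv x [^] n \<otimes> eval q x \<in> poly_values V (inv x) (Suc n)"
    using poly_values_reverse[OF V i(1,2), of "eval q x" n] i(3) by simp
  then have *: "inv x [^] n \<otimes> eval q x \<in> W"
    using poly_values_subset[OF V i(1) W(1,2) ix] by blast
  have "eval q x = \<ominus> (x [^] Suc n)" using eq n ec xc by (metis add.inv_comm minus_equality nat_pow_closed)
  then have "inv x [^] n \<otimes> eval q x = \<ominus> ((inv x [^] n \<otimes> x [^] n) \<otimes> x)"
    using xc i by (simp add: r_minus m_assoc)
  also have "inv x [^] n \<otimes> x [^] n = \<one>"
    using xc i False by (simp add: pow_mult_distrib[symmetric] m_comm)
  finally have "inv x [^] n \<otimes> eval q x = \<ominus> x" using xc by simp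
  then show ?thesis using * subringE(5)[OF W(1)] xc by (metis minus_minus)
qed

text \<open>An x in V[1/x] is integral, as clearing denominators shows. So for x not integral some
  valuation ring above V[1/x] omits x. In this description the closure under sums and products is
  immediate.\<close>

theorem integral_closure_eq:
  assumes V: "subring V R"
  shows "integral_closure R V = {x \<in> carrier R. \<forall>W. valuation_ring W \<and> V \<subseteq> W \<longrightarrow> x \<in> W}"
proof (intro subset_antisym subsetI CollectI conjI allI impI)
  fix x assume x: "x \<in> integral_closure R V"
  then show xc: "x \<in> carrier R" by (simp add: integral_closure_def)
  fix W assume W: "valuation_ring W \<and> V \<subseteq> W"
  then have "subring W R" "x = \<zero> \<or> x \<in> W \<or> inv x \<in> W"
    using xc unfolding valuation_ring_def by auto
  then show "x \<in> W" using integral_in_ring[OF V _ _ x] W subringE(2) by blast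
next
  fix x assume x: "x \<in> {x \<in> carrier R. \<forall>W. valuation_ring W \<and> V \<subseteq> W \<longrightarrow> x \<in> W}"
  then have xc: "x \<in> carrier R" by blast
  have one: "\<one> \<in> V" "\<one> \<noteq> \<zero>" using subringE(3)[OF V] by auto
  show "x \<in> integral_closure R V"
  proof (cases "x = \<zero>")
    case True
    have "polynomial V [\<one>, \<zero>]" using one subringE(2)[OF V] by (simp add: polynomial_def)
    moreover have "eval [\<one>, \<zero>] x = \<zero>" using True by simp
    ultimately show ?thesis using xc unfolding integral_closure_def
      by (intro CollectI conjI exI[of _ "[\<one>, \<zero>]"]) auto
  next
    case False
    have i: "inv x \<in> carrier R" "inv x \<noteq> \<zero>" "inv (inv x) = x" using xc False by (auto simp: inv_inv_nonzero)
    let ?A = "simple_extension V (inv x)"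
    have A: "subring ?A R" "V \<subseteq> ?A" "inv x \<in> ?A"
      using simple_extension_is_subring[OF V i(1)] simple_extension_mem[OF V i(1)]
        simple_extension_incl[OF subringE(1)[OF V] i(1)] by auto
    have "x \<in> ?A"
    proof (rule ccontr)
      assume "x \<notin> ?A"
      then have "\<exists>W. valuation_ring W \<and> ?A \<subseteq> W \<and> inv (inv x) \<notin> W"
        using exists_valuation_ring[OF A(1,3) i(2)] i(3) by simp
      then show False using x A(2) i(3) by auto
    qed
    then obtain n where "x \<in> poly_values V (inv x) n"
      using simple_extension_poly_values[OF V i(1)] by blast
    then have "x \<in> poly_values V (inv x) (Suc n)" using poly_values_Suc[OF V i(1)] by blast
    then have "x [^] n \<otimes> x \<in> poly_values V x (Suc n)" by (rule poly_values_reverse[OF V xc False])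
    then have "(\<ominus> \<one>) \<otimes> (x [^] n \<otimes> x) \<in> poly_values V x (Suc n)"
      by (rule poly_values_smult[OF V xc subringE(5)[OF V one(1)]])
    then obtain p where p: "set p \<subseteq> V" "length p = Suc n" "eval p x = (\<ominus> \<one>) \<otimes> (x [^] n \<otimes> x)"
      using poly_values_eval[OF V xc] by blast
    have "eval (\<one> # p) x = \<zero>" using p(2,3) xc by (simp add: l_minus r_neg)
    moreover have "polynomial V (\<one> # p)" using p(1) one by (simp add: polynomial_def)
    ultimately show ?thesis using xc unfolding integral_closure_def
      by (intro CollectI conjI exI[of _ "\<one> # p"]) auto
  qed
qed

lemma integral_closure_subring:
  assumes V: "subring V R" shows "subring (integral_closure R V) R"
proof (rule subringI)
  have sub: "subring W R" if "valuation_ring W" for W using that by (simp add: valuation_ring_def)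
  show "integral_closure R V \<subseteq> carrier R" by (auto simp: integral_closure_def)
  show "\<one> \<in> integral_closure R V" unfolding integral_closure_eq[OF V] using sub subringE(3) by auto
  show "\<ominus> a \<in> integral_closure R V" if "a \<in> integral_closure R V" for a
    using that unfolding integral_closure_eq[OF V] using sub subringE(5)[OF sub] by auto
  show "a \<otimes> b \<in> integral_closure R V"
    if "a \<in> integral_closure R V" "b \<in> integral_closure R V" for a b
    using that unfolding integral_closure_eq[OF V] using sub subringE(6)[OF sub] by auto
  show "a \<oplus> b \<in> integral_closure R V"
    if "a \<in> integral_closure R V" "b \<in> integral_closure R V" for a b
    using that unfolding integral_closure_eq[OF V] using sub subringE(7)[OF sub] by auto
qed

lemma integral_closure_superset:
  "subring V R \<Longrightarrow> V \<subseteq> integral_closure R V"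
  unfolding integral_closure_eq using subringE(1) by blast

text \<open>If \<open>q\<close> is the list of the leading coefficients of a relation for \<open>x\<close>, then both \<open>q(x)\<close> and \<open>x q(x)\<close>
  are integral: the rest of the relation expresses them as polynomials in \<open>1/x\<close>.\<close>

lemma integral_split:
  assumes V: "subring V R" and x: "x \<in> carrier R"
    and pq: "set p \<subseteq> V" "set q \<subseteq> V" "eval (p @ q) x = \<zero>"
  shows "eval p x \<in> integral_closure R V"
    and "q \<noteq> [] \<Longrightarrow> x \<otimes> eval p x \<in> integral_closure R V"
proof -
  have c: "set p \<subseteq> carrier R" "set q \<subseteq> carrier R" using pq subringE(1)[OF V] by auto
  have ec: "eval p x \<in> carrier R" "eval q x \<in> carrier R" using eval_in_carrier c x by auto
  have rel: "eval p x \<otimes> x [^] length q \<oplus> eval q x = \<zero>" using eval_append[OF c x] pq(3) by simp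
  have *: "eval p x \<in> W \<and> (q \<noteq> [] \<longrightarrow> x \<otimes> eval p x \<in> W)" if W: "valuation_ring W" "V \<subseteq> W" for W
  proof (cases "x \<in> W")
    case True
    have sub: "subring W R" using W by (simp add: valuation_ring_def)
    have "eval p x \<in> W"
      using poly_values_subset[OF V x sub W(2) True] eval_poly_values[OF V x pq(1)] by blast
    then show ?thesis using subringE(6)[OF sub True] by blast
  next
    case False
    have sub: "subring W R" using W by (simp add: valuation_ring_def)
    have nz: "x \<noteq> \<zero>" using False subringE(2)[OF sub] by auto
    have iW: "inv x \<in> W" using W False x nz unfolding valuation_ring_def by blast
    have i: "inv x \<in> carrier R" "inv x \<noteq> \<zero>" "inv (inv x) = x" using x nz by (auto simp: inv_inv_nonzero)
    show ?thesis
    proof (cases q)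
      case Nil
      then have "eval p x = \<zero>" using rel ec by simp
      then show ?thesis using Nil subringE(2)[OF sub] by simp
    next
      case (Cons b r)
      then obtain n where n: "length q = Suc n" by simp
      have "eval q x \<in> poly_values V x (Suc n)" using eval_poly_values[OF V x pq(2)] n by simp
      then have "inv x [^] n \<otimes> eval q x \<in> poly_values V (inv x) (Suc n)"
        using poly_values_reverse[OF V i(1,2), of "eval q x" n] i(3) by simp
      then have e: "inv x [^] n \<otimes> eval q x \<in> W"
        using poly_values_subset[OF V i(1) sub W(2) iW] by blast
      have "eval q x = \<ominus> (eval p x \<otimes> (x [^] n \<otimes> x))"
        using rel n ec x by (metis add.inv_comm m_closed minus_equality nat_pow_Suc nat_pow_closed)
      then have "inv x [^] n \<otimes> eval q x = \<ominus> ((x [^] n \<otimes> inv x [^] n) \<otimes> (x \<otimes> eval p x))"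
        using x i ec by (simp add: r_minus m_ac)
      also have "x [^] n \<otimes> inv x [^] n = \<one>"
        using x i nz by (simp add: pow_mult_distrib[symmetric] m_comm)
      finally have "inv x [^] n \<otimes> eval q x = \<ominus> (x \<otimes> eval p x)" using x ec by simp
      then have xe: "x \<otimes> eval p x \<in> W"
        using e subringE(5)[OF sub] x ec by (metis m_closed minus_minus)
      moreover have "inv x \<otimes> (x \<otimes> eval p x) \<in> W" by (rule subringE(6)[OF sub iW xe])
      ultimately show ?thesis using x nz ec by simp
    qed
  qed
  show "eval p x \<in> integral_closure R V" "q \<noteq> [] \<Longrightarrow> x \<otimes> eval p x \<in> integral_closure R V"
    unfolding integral_closure_eq[OF V] using * ec x by auto
qed

end

section \<open>Discrete valuation rings\<close>

text \<open>Every irreducible element generates a nonzero prime ideal, and as there is only one, it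
  is \<pi> up to a unit. A factorization into irreducibles thus becomes a power of \<pi> times a
  unit.\<close>

lemma (in field) discrete_valuation_ring_uniformizer:
  assumes V: "subring V R" and dvr: "discrete_valuation_ring (R\<lparr>carrier := V\<rparr>)"
  shows "\<exists>\<pi> \<in> V. \<pi> \<noteq> \<zero> \<and> inv \<pi> \<notin> V \<and>
    (\<forall>a \<in> V - {\<zero>}. \<exists>n::nat. \<exists>u \<in> V. u \<noteq> \<zero> \<and> inv u \<in> V \<and> a = \<pi> [^] n \<otimes> u)"
proof -
  let ?V = "R\<lparr>carrier := V\<rparr>"
  have Vc: "a \<in> V \<Longrightarrow> a \<in> carrier R" for a using subringE(1)[OF V] by auto
  interpret V: principal_domain ?V using dvr by (simp add: discrete_valuation_ring_def)
  obtain P where P: "primeideal P ?V" "P \<noteq> {\<zero>}"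
    and unique: "\<And>Q. primeideal Q ?V \<Longrightarrow> Q \<noteq> {\<zero>} \<Longrightarrow> Q = P"
    using dvr unfolding discrete_valuation_ring_def by auto
  have "ideal P ?V" using P(1) by (simp add: primeideal_def)
  then obtain \<pi> where "\<pi> \<in> carrier ?V" "P = PIdl\<^bsub>?V\<^esub> \<pi>" using V.exists_gen by blast
  then have pi: "\<pi> \<in> V" "P = PIdl\<^bsub>?V\<^esub> \<pi>" by simp_all
  have unit: "u \<noteq> \<zero> \<and> inv u \<in> V \<and> u \<in> V" if u: "u \<in> Units ?V" for u
  proof -
    obtain w where w: "w \<in> V" "u \<in> V" "u \<otimes> w = \<one>" using u unfolding Units_def by auto
    then have "inv u = w" using comm_inv_char Vc by blast
    moreover have "u \<noteq> \<zero>" using w Vc by auto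
    ultimately show ?thesis using w by simp
  qed
  have nz: "\<pi> \<noteq> \<zero>"
  proof
    assume "\<pi> = \<zero>"
    then have "P = {\<zero>}" using pi subringE(2)[OF V] Vc by (auto simp: cgenideal_def)
    then show False using P(2) by simp
  qed
  have ni: "inv \<pi> \<notin> V"
  proof
    assume i: "inv \<pi> \<in> V"
    have "\<one> \<in> P" unfolding pi(2) cgenideal_def using i nz Vc[OF pi(1)] by (auto intro!: exI[of _ "inv \<pi>"])
    then have "P = carrier ?V" using ideal.one_imp_carrier[OF \<open>ideal P ?V\<close>] by simp
    then show False using primeideal.I_notcarr[OF P(1)] by simp
  qed
  have irr: "\<exists>u. u \<noteq> \<zero> \<and> inv u \<in> V \<and> u \<in> V \<and> q = \<pi> \<otimes> u"
    if q: "q \<in> carrier (mult_of ?V)" "irreducible (mult_of ?V) q" for q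
  proof -
    have qc: "q \<in> carrier ?V - {\<zero>\<^bsub>?V\<^esub>}" using q(1) by simp
    have "irreducible ?V q" using V.irreducible_mult_imp_irreducible qc q(2) by blast
    then have "ring_irreducible\<^bsub>?V\<^esub> q" using qc by (simp add: ring_irreducible_def)
    then have "ring_prime\<^bsub>?V\<^esub> q" using V.primeness_condition qc by blast
    then have "primeideal (PIdl\<^bsub>?V\<^esub> q) ?V" using V.primeideal_iff_prime qc by blast
    moreover have qq: "q \<in> PIdl\<^bsub>?V\<^esub> q" using V.cgenideal_self qc by blast
    then have "PIdl\<^bsub>?V\<^esub> q \<noteq> {\<zero>}" using qc by auto
    ultimately have "PIdl\<^bsub>?V\<^esub> q = PIdl\<^bsub>?V\<^esub> \<pi>" using unique pi(2) by blast
    moreover have "\<pi> \<in> PIdl\<^bsub>?V\<^esub> \<pi>" using V.cgenideal_self pi(1) by simp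
    ultimately have "q \<in> PIdl\<^bsub>?V\<^esub> \<pi>" "\<pi> \<in> PIdl\<^bsub>?V\<^esub> q" using qq by simp_all
    then obtain u w where u: "u \<in> V" "q = u \<otimes> \<pi>" and w: "w \<in> V" "\<pi> = w \<otimes> q"
      by (auto simp: cgenideal_def)
    have c: "u \<in> carrier R" "w \<in> carrier R" "\<pi> \<in> carrier R" using u w pi Vc by auto
    have "\<pi> \<otimes> \<one> = \<pi> \<otimes> (u \<otimes> w)" using u(2) w(2) c by (metis m_ac(1,2) m_closed r_one)
    then have "u \<otimes> w = \<one>" using c nz by (metis m_closed nonzero_cancel one_closed)
    then have "inv u = w" "u \<noteq> \<zero>" using comm_inv_char c by auto
    then show ?thesis using u w c by (auto simp: m_comm intro!: exI[of _ u])
  qed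
  have prod: "\<exists>u. u \<noteq> \<zero> \<and> inv u \<in> V \<and> u \<in> V \<and> foldr (\<otimes>) qs \<one> = \<pi> [^] length qs \<otimes> u"
    if "set qs \<subseteq> carrier (mult_of ?V)" "\<forall>q \<in> set qs. irreducible (mult_of ?V) q" for qs
    using that
  proof (induction qs)
    case Nil
    then show ?case using subringE(3)[OF V] by (auto intro!: exI[of _ \<one>])
  next
    case (Cons q qs)
    obtain u where u: "u \<noteq> \<zero>" "inv u \<in> V" "u \<in> V" "foldr (\<otimes>) qs \<one> = \<pi> [^] length qs \<otimes> u"
      using Cons by auto
    obtain w where w: "w \<noteq> \<zero>" "inv w \<in> V" "w \<in> V" "q = \<pi> \<otimes> w" using irr[of q] Cons.prems by auto
    have c: "u \<in> carrier R" "w \<in> carrier R" "\<pi> \<in> carrier R" using u w pi Vc by auto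
    have "foldr (\<otimes>) (q # qs) \<one> = \<pi> [^] length (q # qs) \<otimes> (w \<otimes> u)"
      using u(4) w(4) c by (simp add: m_ac)
    moreover have "w \<otimes> u \<noteq> \<zero>" "inv (w \<otimes> u) \<in> V" "w \<otimes> u \<in> V"
      using u w c subringE(6)[OF V] by (auto simp: inv_mult_nonzero)
    ultimately show ?case by blast
  qed
  have "\<exists>n::nat. \<exists>u \<in> V. u \<noteq> \<zero> \<and> inv u \<in> V \<and> a = \<pi> [^] n \<otimes> u" if a: "a \<in> V" "a \<noteq> \<zero>" for a
  proof (cases "a \<in> Units ?V")
    case True
    have "a = \<pi> [^] (0::nat) \<otimes> a" using Vc a by simp
    then show ?thesis using unit[OF True] by blast
  next
    case False
    have ac: "a \<in> carrier ?V - {\<zero>\<^bsub>?V\<^esub>}" using a by simp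
    obtain qs where qs: "set qs \<subseteq> carrier (mult_of ?V)" "wfactors (mult_of ?V) qs a"
      using V.factorization_property[OF ac False] by blast
    then have irr: "\<forall>q \<in> set qs. irreducible (mult_of ?V) q"
      and assoc: "foldr (\<otimes>) qs \<one> \<sim>\<^bsub>mult_of ?V\<^esub> a" by (auto simp: wfactors_def)
    obtain u where u: "u \<noteq> \<zero>" "inv u \<in> V" "u \<in> V" "foldr (\<otimes>) qs \<one> = \<pi> [^] length qs \<otimes> u"
      using prod[OF qs(1) irr] by blast
    let ?b = "\<pi> [^] length qs \<otimes> u"
    have c: "\<pi> \<in> carrier R" "u \<in> carrier R" "a \<in> carrier R" using u pi Vc a by auto
    obtain w z where w: "w \<in> V" "?b = a \<otimes> w" and z: "z \<in> V" "a = ?b \<otimes> z"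
      using assoc unfolding u(4) associated_def factor_def by auto
    have c': "w \<in> carrier R" "z \<in> carrier R" "?b \<in> carrier R" using w z Vc c by auto
    have "a \<otimes> \<one> = a \<otimes> (w \<otimes> z)" using w(2) z(2) c c' by (metis m_assoc r_one)
    then have wz: "w \<otimes> z = \<one>" using c c' a(2) by (metis m_closed nonzero_cancel one_closed)
    then have iz: "inv z = w" "z \<noteq> \<zero>"
      using comm_inv_char[of z w] c' wz m_comm[of z w] by auto
    have "a = \<pi> [^] length qs \<otimes> (u \<otimes> z)" by (subst z(2), subst m_assoc) (use c c' in auto)
    moreover have "inv (u \<otimes> z) = inv u \<otimes> w" using inv_mult_nonzero[of u z] u(1) c c' iz by simp
    then have "u \<otimes> z \<noteq> \<zero>" "inv (u \<otimes> z) \<in> V" "u \<otimes> z \<in> V"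
      using u(1-3) w(1) z(1) iz(2) c c' subringE(6)[OF V] by simp_all
    ultimately show ?thesis by blast
  qed
  then have all: "\<forall>a \<in> V - {\<zero>}. \<exists>n::nat. \<exists>u \<in> V. u \<noteq> \<zero> \<and> inv u \<in> V \<and> a = \<pi> [^] n \<otimes> u"
    by simp
  show ?thesis by (rule bexI[of _ \<pi>], intro conjI) (fact nz ni all pi(1))+
qed

text \<open>The relation stands for x = \<pi>^(m-n) u, written so that only natural exponents
  occur.\<close>

definition (in ring) val :: "'a set \<Rightarrow> 'a \<Rightarrow> 'a \<Rightarrow> int"
  where "val W \<pi> x = (THE k. \<exists>m::nat. \<exists>n::nat. \<exists>u \<in> W. u \<noteq> \<zero> \<and> inv u \<in> W \<and> k = int m - int n \<and>
    \<pi> [^] n \<otimes> x = \<pi> [^] m \<otimes> u)"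

locale uniformized = field K for K (structure) +
  fixes W and \<pi>
  assumes W: "subring W K" and pi: "\<pi> \<in> W" "\<pi> \<noteq> \<zero>" "inv \<pi> \<notin> W"
    and rep: "x \<in> carrier K \<Longrightarrow> x \<noteq> \<zero> \<Longrightarrow>
      \<exists>m::nat. \<exists>n::nat. \<exists>u \<in> W. u \<noteq> \<zero> \<and> inv u \<in> W \<and> \<pi> [^] n \<otimes> x = \<pi> [^] m \<otimes> u"
begin

lemma W_carrier [simp]: "a \<in> W \<Longrightarrow> a \<in> carrier K"
  using subringE(1)[OF W] by auto

lemma pi_pow_nonzero [simp]: "\<pi> [^] (n::nat) \<noteq> \<zero>"
  using pi by (induction n) auto

lemma pi_pow_unit:
  assumes "\<pi> [^] (m::nat) \<otimes> u = \<pi> [^] (n::nat) \<otimes> w" "u \<in> W" "u \<noteq> \<zero>" "inv u \<in> W" "w \<in> W"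
  shows "n \<le> m"
proof (rule ccontr)
  assume "\<not> n \<le> m"
  then obtain j where j: "n = Suc j + m" by (metis add.commute add_Suc_right less_iff_Suc_add not_le)
  have c: "\<pi> \<in> carrier K" "u \<in> carrier K" "w \<in> carrier K" "\<pi> [^] m \<in> carrier K" "\<pi> [^] j \<in> carrier K"
    using assms pi by auto
  have "\<pi> [^] n = \<pi> [^] j \<otimes> \<pi> \<otimes> \<pi> [^] m" unfolding j using pi by (simp add: nat_pow_mult[symmetric] m_ac)
  then have "\<pi> [^] m \<otimes> u = \<pi> [^] m \<otimes> (\<pi> \<otimes> (\<pi> [^] j \<otimes> w))"
    using assms(1) c by (simp add: m_ac)
  then have u: "u = \<pi> \<otimes> (\<pi> [^] j \<otimes> w)" using c by (metis m_closed nonzero_cancel pi_pow_nonzero)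
  have "\<pi> \<otimes> ((\<pi> [^] j \<otimes> w) \<otimes> inv u) = \<one>"
    using c assms u by (metis W_carrier m_assoc m_closed r_inv_nonzero)
  then have "inv \<pi> = (\<pi> [^] j \<otimes> w) \<otimes> inv u"
    using c assms comm_inv_char[OF c(1)] by (metis W_carrier m_closed)
  moreover have "\<pi> [^] j \<in> W" using pi(1) subringE(3,6)[OF W] by (induction j) auto
  ultimately have "inv \<pi> \<in> W" using assms subringE(6)[OF W] by metis
  then show False using pi by simp
qed

lemma val_eq:
  assumes x: "x \<in> carrier K" and u: "u \<in> W" "u \<noteq> \<zero>" "inv u \<in> W" "\<pi> [^] n \<otimes> x = \<pi> [^] m \<otimes> u"
  shows "val W \<pi> x = int m - int n"
  unfolding val_def
proof (rule the_equality)
  show "\<exists>m'::nat. \<exists>n'::nat. \<exists>u \<in> W. u \<noteq> \<zero> \<and> inv u \<in> W \<and> int m - int n = int m' - int n' \<and>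
      \<pi> [^] n' \<otimes> x = \<pi> [^] m' \<otimes> u" using u by blast
  fix k assume "\<exists>m::nat. \<exists>n::nat. \<exists>u \<in> W. u \<noteq> \<zero> \<and> inv u \<in> W \<and> k = int m - int n \<and> \<pi> [^] n \<otimes> x = \<pi> [^] m \<otimes> u"
  then obtain m' n' w where w: "w \<in> W" "w \<noteq> \<zero>" "inv w \<in> W" "k = int m' - int n'"
    "\<pi> [^] n' \<otimes> x = \<pi> [^] m' \<otimes> w" by blast
  have c: "\<pi> \<in> carrier K" "u \<in> carrier K" "w \<in> carrier K" using u w pi by auto
  have p: "\<pi> [^] (i::nat) \<in> carrier K" for i using c by simp
  have eq: "\<pi> [^] (n' + m) \<otimes> u = \<pi> [^] (n + m') \<otimes> w"
  proof -
    have "\<pi> [^] (n' + m) \<otimes> u = \<pi> [^] n' \<otimes> (\<pi> [^] m \<otimes> u)"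
      using c p by (simp add: nat_pow_mult[symmetric] m_assoc)
    also have "\<dots> = \<pi> [^] n \<otimes> (\<pi> [^] n' \<otimes> x)" unfolding u(4)[symmetric] using p x by (simp add: m_ac)
    finally show ?thesis using w(5) c p by (simp add: nat_pow_mult[symmetric] m_assoc)
  qed
  have "n + m' \<le> n' + m" by (rule pi_pow_unit[OF eq u(1-3) w(1)])
  moreover have "n' + m \<le> n + m'" by (rule pi_pow_unit[OF eq[symmetric] w(1-3) u(1)])
  ultimately show "k = int m - int n" using w(4) by simp
qed

lemma val_mult:
  assumes "x \<in> carrier K" "x \<noteq> \<zero>" "y \<in> carrier K" "y \<noteq> \<zero>"
  shows "val W \<pi> (x \<otimes> y) = val W \<pi> x + val W \<pi> y"
proof -
  obtain m n :: nat and u where u: "u \<in> W" "u \<noteq> \<zero>" "inv u \<in> W" "\<pi> [^] n \<otimes> x = \<pi> [^] m \<otimes> u"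
    using rep assms by blast
  obtain m' n' :: nat and w where w: "w \<in> W" "w \<noteq> \<zero>" "inv w \<in> W" "\<pi> [^] n' \<otimes> y = \<pi> [^] m' \<otimes> w"
    using rep assms by blast
  have c: "\<pi> \<in> carrier K" "u \<in> carrier K" "w \<in> carrier K" using u w pi by auto
  have p: "\<pi> [^] (i::nat) \<in> carrier K" for i using c by simp
  have "\<pi> [^] (n + n') \<otimes> (x \<otimes> y) = (\<pi> [^] n \<otimes> x) \<otimes> (\<pi> [^] n' \<otimes> y)"
    using c p assms by (simp add: nat_pow_mult[symmetric] m_ac)
  then have "\<pi> [^] (n + n') \<otimes> (x \<otimes> y) = \<pi> [^] (m + m') \<otimes> (u \<otimes> w)"
    unfolding u(4) w(4) using c p by (simp add: nat_pow_mult[symmetric] m_ac)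
  then have "val W \<pi> (x \<otimes> y) = int (m + m') - int (n + n')"
    by (intro val_eq[of _ "u \<otimes> w"]) (use assms u w c subringE(6)[OF W] in \<open>auto simp: inv_mult_nonzero\<close>)
  then show ?thesis using val_eq[OF assms(1) u] val_eq[OF assms(3) w] by simp
qed

lemma val_pi: "val W \<pi> \<pi> = 1"
  using val_eq[of \<pi> \<one> 0 1] pi subringE(3)[OF W] by simp

lemma val_nonneg_iff:
  assumes x: "x \<in> carrier K" "x \<noteq> \<zero>"
  shows "0 \<le> val W \<pi> x \<longleftrightarrow> x \<in> W"
proof -
  obtain m n :: nat and u where u: "u \<in> W" "u \<noteq> \<zero>" "inv u \<in> W" "\<pi> [^] n \<otimes> x = \<pi> [^] m \<otimes> u"
    using rep x by blast
  have v: "val W \<pi> x = int m - int n" by (rule val_eq[OF x(1) u])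
  have c: "\<pi> \<in> carrier K" "u \<in> carrier K" using u pi by auto
  show ?thesis
  proof
    assume "0 \<le> val W \<pi> x"
    then obtain j where j: "m = n + j" using v le_Suc_ex by (metis diff_ge_0_iff_ge of_nat_le_iff)
    have "\<pi> [^] n \<otimes> x = \<pi> [^] n \<otimes> (\<pi> [^] j \<otimes> u)"
      using u(4) c unfolding j by (simp add: nat_pow_mult[symmetric] m_assoc)
    then have "x = \<pi> [^] j \<otimes> u" using c x by (metis m_closed nat_pow_closed nonzero_cancel pi_pow_nonzero)
    moreover have "\<pi> [^] j \<in> W" using pi(1) subringE(3,6)[OF W] by (induction j) auto
    ultimately show "x \<in> W" using u subringE(6)[OF W] by simp
  next
    assume "x \<in> W"
    then show "0 \<le> val W \<pi> x" using pi_pow_unit[OF u(4)[symmetric] u(1-3)] v by simp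
  qed
qed

lemma val_add:
  assumes x: "x \<in> carrier K" "x \<noteq> \<zero>" and y: "y \<in> carrier K" "y \<noteq> \<zero>" and xy: "x \<oplus> y \<noteq> \<zero>"
  shows "min (val W \<pi> x) (val W \<pi> y) \<le> val W \<pi> (x \<oplus> y)"
proof -
  have *: "val W \<pi> a \<le> val W \<pi> (a \<oplus> b)"
    if a: "a \<in> carrier K" "a \<noteq> \<zero>" and b: "b \<in> carrier K" "b \<noteq> \<zero>"
      and ab: "a \<oplus> b \<noteq> \<zero>" and le: "val W \<pi> a \<le> val W \<pi> b" for a b
  proof -
    let ?c = "inv a \<otimes> b"
    have c: "?c \<in> carrier K" "?c \<noteq> \<zero>" "a \<otimes> ?c = b" using a b by auto
    have "val W \<pi> b = val W \<pi> a + val W \<pi> ?c" using val_mult[OF a c(1,2)] c(3) by simp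
    then have "?c \<in> W" using le val_nonneg_iff[OF c(1,2)] by simp
    then have d: "\<one> \<oplus> ?c \<in> W" by (rule subringE(7)[OF W subringE(3)[OF W]])
    have ad: "a \<oplus> b = a \<otimes> (\<one> \<oplus> ?c)" using a c by (simp add: r_distr)
    then have nz: "\<one> \<oplus> ?c \<noteq> \<zero>" using ab a by auto
    have "val W \<pi> (a \<oplus> b) = val W \<pi> a + val W \<pi> (\<one> \<oplus> ?c)"
      unfolding ad by (rule val_mult) (use a c nz in auto)
    then show ?thesis using val_nonneg_iff[of "\<one> \<oplus> ?c"] c nz d by simp
  qed
  show ?thesis
    using *[OF x y xy] *[OF y x] xy a_comm[OF x(1) y(1)] by (cases "val W \<pi> x \<le> val W \<pi> y") auto
qed

end

section \<open>Localization of the integral closure at its maximal ideals\<close>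

text \<open>\<open>algebraic\<close> is the form in which finite dimension enters: minimal
  polynomials, cleared of denominators and of common factors \<pi>, are relations over V with a unit
  coefficient. This coefficient makes the localizations valuation rings, and the common bound
  \<open>d\<close> on the length bounds the ramification.\<close>

locale dvr_extension = field K for K (structure) +
  fixes V :: "'a set" and \<pi> and d :: nat
  assumes V: "subring V K" and pi: "\<pi> \<in> V" "\<pi> \<noteq> \<zero>" "inv \<pi> \<notin> V"
    and dvr: "a \<in> V \<Longrightarrow> a \<noteq> \<zero> \<Longrightarrow>
      \<exists>n::nat. \<exists>u \<in> V. u \<noteq> \<zero> \<and> inv u \<in> V \<and> a = \<pi> [^] n \<otimes> u"
    and algebraic: "x \<in> carrier K \<Longrightarrow> \<exists>p. set p \<subseteq> V \<and> length p \<le> d \<and>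
      (\<exists>a \<in> set p. a \<noteq> \<zero> \<and> inv a \<in> V) \<and> eval p x = \<zero>"
begin

abbreviation "S \<equiv> integral_closure K V"
abbreviation "RS \<equiv> K\<lparr>carrier := S\<rparr>"

lemma S_subring: "subring S K" by (rule integral_closure_subring[OF V])
lemma V_S: "a \<in> V \<Longrightarrow> a \<in> S" using integral_closure_superset[OF V] by auto
lemma S_carrier [simp]: "a \<in> S \<Longrightarrow> a \<in> carrier K" using subringE(1)[OF S_subring] by auto
lemma V_carrier [simp]: "a \<in> V \<Longrightarrow> a \<in> carrier K" using subringE(1)[OF V] by auto
lemmas S_closed = subringE(2,3,5,6,7)[OF S_subring]
lemma S_pow: "a \<in> S \<Longrightarrow> a [^] (n::nat) \<in> S" by (induction n) (auto intro: S_closed)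

lemma RS_domain: "domain RS" using subring_is_domain[OF S_subring] .

text \<open>Maximal ideals of \<open>S\<close>, described inside the field.\<close>

definition maxid :: "'a set \<Rightarrow> bool"
  where "maxid M \<longleftrightarrow> M \<subseteq> S \<and> \<zero> \<in> M \<and> (\<forall>a \<in> M. \<forall>b \<in> M. a \<oplus> b \<in> M) \<and>
    (\<forall>s \<in> S. \<forall>a \<in> M. s \<otimes> a \<in> M) \<and> \<one> \<notin> M \<and> (\<forall>b \<in> S - M. \<exists>s \<in> S. \<exists>m \<in> M. \<one> = s \<otimes> b \<oplus> m)"

lemma maximalideal_iff: "maximalideal M RS \<longleftrightarrow> maxid M"
proof
  interpret RS: domain RS by (rule RS_domain)
  assume "maximalideal M RS"
  then interpret M: maximalideal M RS .
  have comax: "\<exists>s \<in> S. \<exists>m \<in> M. \<one> = s \<otimes> b \<oplus> m" if b: "b \<in> S - M" for b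
  proof -
    let ?J = "M <+>\<^bsub>RS\<^esub> PIdl\<^bsub>RS\<^esub> b"
    have bc: "b \<in> carrier RS" using b by simp
    have I: "ideal M RS" "ideal (PIdl\<^bsub>RS\<^esub> b) RS" using M.is_ideal RS.cgenideal_ideal[OF bc] by auto
    have J: "ideal ?J RS" by (rule RS.add_ideals[OF I])
    have z: "\<zero> \<in> M" "\<zero> \<in> PIdl\<^bsub>RS\<^esub> b"
      using additive_subgroup.zero_closed[OF ideal.axioms(1)[OF I(1)]]
        additive_subgroup.zero_closed[OF ideal.axioms(1)[OF I(2)]] by simp_all
    have MJ: "M \<subseteq> ?J"
    proof
      fix m assume m: "m \<in> M"
      then have "m = m \<oplus> \<zero>" using M.Icarr[OF m] by simp
      then show "m \<in> ?J" using m z(2) unfolding set_add_def' by auto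
    qed
    have "b = \<zero> \<oplus> b" using b by simp
    then have "b \<in> ?J" using z(1) RS.cgenideal_self[OF bc] unfolding set_add_def' by auto
    then have "?J \<noteq> M" using b by auto
    moreover have "?J \<subseteq> carrier RS" using ideal.Icarr[OF J] by auto
    ultimately have "?J = carrier RS" using M.I_maximal[OF J MJ] by auto
    then have "\<one> \<in> ?J" using S_closed by simp
    then obtain m c where "m \<in> M" "c \<in> PIdl\<^bsub>RS\<^esub> b" "\<one> = m \<oplus> c" unfolding set_add_def' by auto
    then obtain s where "m \<in> M" "s \<in> S" "\<one> = m \<oplus> s \<otimes> b" by (auto simp: cgenideal_def)
    moreover then have "m \<in> S" using M.Icarr by auto
    ultimately show ?thesis using b by (metis DiffD1 S_carrier S_closed(4) a_comm)
  qed
  have one: "\<one> \<notin> M"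
  proof
    assume "\<one> \<in> M"
    then show False using M.one_imp_carrier M.I_notcarr by simp
  qed
  show "maxid M"
    unfolding maxid_def using M.Icarr M.zero_closed M.a_closed M.I_l_closed one comax by auto
next
  interpret RS: domain RS by (rule RS_domain)
  assume M: "maxid M"
  have neg: "\<ominus>\<^bsub>RS\<^esub> a \<in> M" if "a \<in> M" for a
  proof -
    have "a \<in> carrier RS" "\<one>\<^bsub>RS\<^esub> \<in> carrier RS" using M that by (auto simp: maxid_def S_closed)
    then have "\<ominus>\<^bsub>RS\<^esub> a = (\<ominus>\<^bsub>RS\<^esub> \<one>\<^bsub>RS\<^esub>) \<otimes>\<^bsub>RS\<^esub> a" "\<ominus>\<^bsub>RS\<^esub> \<one>\<^bsub>RS\<^esub> \<in> carrier RS"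
      using RS.l_minus[of "\<one>\<^bsub>RS\<^esub>" a] RS.a_inv_closed RS.l_one by metis+
    then have "\<ominus>\<^bsub>RS\<^esub> a = (\<ominus>\<^bsub>RS\<^esub> \<one>\<^bsub>RS\<^esub>) \<otimes> a" "\<ominus>\<^bsub>RS\<^esub> \<one>\<^bsub>RS\<^esub> \<in> S" by simp_all
    then show ?thesis using M that unfolding maxid_def by metis
  qed
  show "maximalideal M RS"
  proof (rule maximalidealI)
    show I: "ideal M RS"
    proof (rule idealI)
      show "ring RS" by (rule RS.ring_axioms)
      show "subgroup M (add_monoid RS)"
        by (rule RS.add.subgroupI) (use M neg in \<open>auto simp: maxid_def a_inv_def\<close>)
      show "x \<otimes>\<^bsub>RS\<^esub> a \<in> M" if "a \<in> M" "x \<in> carrier RS" for a x using M that by (auto simp: maxid_def)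
      show "a \<otimes>\<^bsub>RS\<^esub> x \<in> M" if "a \<in> M" "x \<in> carrier RS" for a x
      proof -
        have "a \<in> S" "x \<otimes> a \<in> M" using M that by (auto simp: maxid_def)
        then show ?thesis using that m_comm[of a x] by simp
      qed
    qed
    show "carrier RS \<noteq> M" using M S_closed by (auto simp: maxid_def)
    fix J assume J: "ideal J RS" "M \<subseteq> J" "J \<subseteq> carrier RS"
    interpret J: ideal J RS by fact
    show "J = M \<or> J = carrier RS"
    proof (cases "J \<subseteq> M")
      case False
      then obtain b where b: "b \<in> J" "b \<notin> M" by auto
      then have bS: "b \<in> S - M" using J.Icarr by auto
      then obtain s m where "s \<in> S" "m \<in> M" "\<one> = s \<otimes> b \<oplus> m" using M unfolding maxid_def by blast
      then have "\<one> \<in> J" using J.I_l_closed[OF b(1), of s] J.a_closed[of "s \<otimes> b" m] J(2) by auto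
      then show ?thesis using J.one_imp_carrier by simp
    qed (use J in auto)
  qed
qed

definition loc :: "'a set \<Rightarrow> 'a set"
  where "loc M = {x \<in> carrier K. \<exists>b \<in> S - M. x \<otimes> b \<in> S}"

lemma integral_in_V: "x \<in> S \<Longrightarrow> inv x \<in> V \<Longrightarrow> x \<in> V"
  using integral_in_ring[OF V V] by blast

text \<open>The constant term of an integral equation of \<open>s\<close> is a multiple of \<open>s\<close>.\<close>

lemma divides_pi_pow:
  assumes s: "s \<in> S" "s \<noteq> \<zero>"
  shows "\<exists>k::nat. \<exists>t \<in> S. \<pi> [^] k = s \<otimes> t"
proof -
  have strip: "\<exists>q c. set q \<subseteq> V \<and> c \<in> V \<and> c \<noteq> \<zero> \<and> eval (q @ [c]) s = \<zero>"
    if "set p \<subseteq> V" "\<exists>a \<in> set p. a \<noteq> \<zero>" "eval p s = \<zero>" for p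
    using that
  proof (induction p rule: rev_induct)
    case (snoc c q)
    show ?case
    proof (cases "c = \<zero>")
      case True
      have q: "set q \<subseteq> carrier K" using snoc.prems by auto
      have "eval q s \<otimes> s = \<zero>" using snoc.prems(3) eval_append_aux[OF q, of c s] True s
          eval_in_carrier[OF q, of s] by simp
      then have "eval q s = \<zero>" using eval_in_carrier[OF q, of s] s by simp
      then show ?thesis using snoc True by auto
    qed (use snoc.prems in auto)
  qed simp
  obtain p where p: "set p \<subseteq> V" "\<exists>a \<in> set p. a \<noteq> \<zero>" "eval p s = \<zero>"
    using algebraic[of s] s by auto
  obtain q c where q: "set q \<subseteq> V" "c \<in> V" "c \<noteq> \<zero>" "eval (q @ [c]) s = \<zero>" using strip[OF p] by blast
  have qc: "set q \<subseteq> carrier K" using q by auto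
  have sc: "s \<in> carrier K" "c \<in> carrier K" using s q by auto
  have "eval q s \<in> poly_values V s (length q)" by (rule eval_poly_values[OF V sc(1) q(1)])
  then have eS: "eval q s \<in> S"
    using poly_values_subset[OF V sc(1) S_subring _ s(1)] V_S by blast
  have rel: "eval q s \<otimes> s \<oplus> c = \<zero>" using q(4) eval_append_aux[OF qc sc(2,1)] by simp
  obtain n :: nat and u where u: "u \<in> V" "u \<noteq> \<zero>" "inv u \<in> V" "c = \<pi> [^] n \<otimes> u"
    using dvr[OF q(2,3)] by blast
  have ec: "eval q s \<in> carrier K" using eS by simp
  have c: "c = \<ominus> (eval q s \<otimes> s)" using rel ec sc by (metis add.inv_comm m_closed minus_equality)
  have "\<pi> [^] n = c \<otimes> inv u" unfolding u(4) using u pi by (simp add: m_assoc)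
  also have "\<dots> = s \<otimes> (\<ominus> (eval q s) \<otimes> inv u)"
    unfolding c using ec sc u by (simp add: l_minus r_minus m_ac)
  finally have "\<pi> [^] n = s \<otimes> (\<ominus> (eval q s) \<otimes> inv u)" .
  moreover have "\<ominus> (eval q s) \<otimes> inv u \<in> S" using eS V_S[OF u(3)] S_closed by blast
  ultimately show ?thesis by blast
qed

context
  fixes M assumes M: "maxid M"
begin

lemma M_S: "a \<in> M \<Longrightarrow> a \<in> S" using M by (auto simp: maxid_def)
lemma M_zero: "\<zero> \<in> M" using M by (auto simp: maxid_def)
lemma M_add: "a \<in> M \<Longrightarrow> b \<in> M \<Longrightarrow> a \<oplus> b \<in> M" using M by (auto simp: maxid_def)
lemma M_smult: "s \<in> S \<Longrightarrow> a \<in> M \<Longrightarrow> s \<otimes> a \<in> M" using M by (auto simp: maxid_def)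
lemma M_smult2: "a \<in> M \<Longrightarrow> s \<in> S \<Longrightarrow> a \<otimes> s \<in> M" using M_smult[of s a] M_S m_comm by simp
lemma M_one: "\<one> \<notin> M" using M by (auto simp: maxid_def)
lemma M_comax: "b \<in> S \<Longrightarrow> b \<notin> M \<Longrightarrow> \<exists>s \<in> S. \<exists>m \<in> M. \<one> = s \<otimes> b \<oplus> m"
  using M by (auto simp: maxid_def)
lemma M_neg: "a \<in> M \<Longrightarrow> \<ominus> a \<in> M"
proof -
  assume a: "a \<in> M"
  have "(\<ominus> \<one>) \<otimes> a \<in> M" by (rule M_smult) (use a S_closed in auto)
  then show ?thesis using M_S[OF a] by (simp add: l_minus)
qed
lemma M_minus: "a \<in> M \<Longrightarrow> b \<in> M \<Longrightarrow> a \<ominus> b \<in> M"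
  using M_add[OF _ M_neg] by (simp add: a_minus_def)

lemma M_prime:
  assumes "a \<in> S" "b \<in> S" "a \<otimes> b \<in> M" shows "a \<in> M \<or> b \<in> M"
proof (rule ccontr)
  assume n: "\<not> (a \<in> M \<or> b \<in> M)"
  then obtain s m where s: "s \<in> S" "m \<in> M" "\<one> = s \<otimes> b \<oplus> m" using M_comax assms by blast
  have c: "a \<in> carrier K" "b \<in> carrier K" "s \<in> carrier K" "m \<in> carrier K"
    using assms s M_S by auto
  have "a = a \<otimes> (s \<otimes> b \<oplus> m)" using s(3) c by (metis r_one)
  also have "\<dots> = s \<otimes> (a \<otimes> b) \<oplus> a \<otimes> m" using c by algebra
  also have "\<dots> \<in> M" using assms s M_add M_smult by blast
  finally show False using n by simp
qed

lemma M_pow: "a \<in> S \<Longrightarrow> a [^] (n::nat) \<in> M \<Longrightarrow> a \<in> M"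
  by (induction n) (use M_one M_prime S_pow in auto)

lemma M_units: "u \<in> S \<Longrightarrow> u \<noteq> \<zero> \<Longrightarrow> inv u \<in> S \<Longrightarrow> u \<notin> M"
  using M_smult[of "inv u" u] M_one by auto

lemma S_loc: "a \<in> S \<Longrightarrow> a \<in> loc M"
  unfolding loc_def using M_one S_closed by (auto intro!: bexI[of _ \<one>])

lemma loc_subring: "subring (loc M) K"
proof (rule subringI)
  show "loc M \<subseteq> carrier K" by (auto simp: loc_def)
  show "\<one> \<in> loc M" using S_loc S_closed by blast
  show "\<ominus> a \<in> loc M" if a: "a \<in> loc M" for a
  proof -
    obtain b where b: "b \<in> S" "b \<notin> M" "a \<otimes> b \<in> S" "a \<in> carrier K"
      using a by (auto simp: loc_def)
    then have "\<ominus> a \<otimes> b \<in> S" using S_closed(3)[of "a \<otimes> b"] by (simp add: l_minus)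
    then show ?thesis using b by (auto simp: loc_def)
  qed
  fix a b assume "a \<in> loc M" "b \<in> loc M"
  then obtain p q where p: "p \<in> S" "p \<notin> M" "a \<otimes> p \<in> S" "a \<in> carrier K"
    and q: "q \<in> S" "q \<notin> M" "b \<otimes> q \<in> S" "b \<in> carrier K" by (auto simp: loc_def)
  have c: "p \<in> carrier K" "q \<in> carrier K" using p q by auto
  have pq: "p \<otimes> q \<in> S - M" using p q M_prime S_closed by auto
  have "(a \<otimes> b) \<otimes> (p \<otimes> q) = (a \<otimes> p) \<otimes> (b \<otimes> q)" using p q c by (simp add: m_ac)
  then have "(a \<otimes> b) \<otimes> (p \<otimes> q) \<in> S" using p q S_closed by simp
  then show "a \<otimes> b \<in> loc M" using pq p q by (auto simp: loc_def)
  have "(a \<oplus> b) \<otimes> (p \<otimes> q) = (a \<otimes> p) \<otimes> q \<oplus> (b \<otimes> q) \<otimes> p" using p(4) q(4) c by algebra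
  then have "(a \<oplus> b) \<otimes> (p \<otimes> q) \<in> S" using p q S_closed by simp
  then show "a \<oplus> b \<in> loc M" using pq p q by (auto simp: loc_def)
qed

text \<open>Cut the relation for x at its unit coefficient a. By \<open>integral_split\<close> the
  values b and c of the initial segments before and after a are integral, and so are x b and x c;
  moreover a = c - x b is outside M. So c or x b is an admissible denominator, for x = (x c)/c or
  for 1/x = b/(x b).\<close>

lemma loc_valuation:
  assumes x: "x \<in> carrier K" "x \<noteq> \<zero>" shows "x \<in> loc M \<or> inv x \<in> loc M"
proof -
  obtain p a where p: "set p \<subseteq> V" "eval p x = \<zero>" "a \<in> set p" "a \<noteq> \<zero>" "inv a \<in> V"
    using algebraic[OF x(1)] by blast
  obtain p1 p2 where s: "p = p1 @ a # p2" using p(3) by (auto dest: split_list)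
  have V12: "set p1 \<subseteq> V" "set p2 \<subseteq> V" "a \<in> V" "set p1 \<subseteq> carrier K" using p(1) s by auto
  let ?b = "eval p1 x" and ?c = "eval (p1 @ [a]) x"
  have b: "?b \<in> S" "x \<otimes> ?b \<in> S"
    using integral_split[OF V x(1) V12(1), of "a # p2"] V12 p(2) s by auto
  have c: "?c \<in> S" "x \<otimes> ?c \<in> S"
  proof -
    have 1: "set (p1 @ [a]) \<subseteq> V" "eval ((p1 @ [a]) @ p2) x = \<zero>" using V12 p(2) s by auto
    show "?c \<in> S" by (rule integral_split(1)[OF V x(1) 1(1) V12(2) 1(2)])
    show "x \<otimes> ?c \<in> S"
    proof (cases "p2 = []")
      case True
      then have "?c = \<zero>" using p(2) s by simp
      then show ?thesis using x S_closed by simp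
    next
      case False
      show ?thesis by (rule integral_split(2)[OF V x(1) 1(1) V12(2) 1(2) False])
    qed
  qed
  have ac: "a \<in> carrier K" "?b \<in> carrier K" using V12 b by auto
  have "?c = ?b \<otimes> x \<oplus> a" using eval_append_aux[OF V12(4) ac(1) x(1)] .
  then have "a = ?c \<ominus> x \<otimes> ?b" using ac x by algebra
  moreover have "a \<notin> M" using M_units V_S V12 p by blast
  ultimately have "?c \<notin> M \<or> x \<otimes> ?b \<notin> M" using M_minus by metis
  then show ?thesis
  proof
    assume "?c \<notin> M"
    then show ?thesis unfolding loc_def using c x by blast
  next
    assume "x \<otimes> ?b \<notin> M"
    moreover have "inv x \<otimes> (x \<otimes> ?b) \<in> S" using b x by simp
    ultimately show ?thesis unfolding loc_def using b x by blast
  qed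
qed

lemma loc_inv_iff:
  assumes "s \<in> S" "s \<noteq> \<zero>" shows "inv s \<in> loc M \<longleftrightarrow> s \<notin> M"
proof
  assume "inv s \<in> loc M"
  then obtain b where b: "b \<in> S" "b \<notin> M" "inv s \<otimes> b \<in> S" by (auto simp: loc_def)
  have "(inv s \<otimes> b) \<otimes> s \<in> M" if "s \<in> M" using M_smult[OF b(3) that] .
  moreover have "(inv s \<otimes> b) \<otimes> s = b" using assms b(1) by (simp add: m_ac)
  ultimately show "s \<notin> M" using b by auto
next
  assume "s \<notin> M"
  then show "inv s \<in> loc M" unfolding loc_def using assms S_closed by (auto intro!: bexI[of _ s])
qed

lemma loc_nonunit:
  assumes "x \<in> loc M" "x = \<zero> \<or> inv x \<notin> loc M"
  shows "\<exists>b \<in> S - M. x \<otimes> b \<in> M"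
proof -
  obtain b where b: "b \<in> S" "b \<notin> M" "x \<otimes> b \<in> S" "x \<in> carrier K" using assms by (auto simp: loc_def)
  have "x \<otimes> b \<in> M"
  proof (cases "x = \<zero>")
    case True
    then show ?thesis using b M_zero by simp
  next
    case False
    have "inv x \<otimes> (x \<otimes> b) \<in> S" using b False by simp
    then have "inv x \<in> loc M" if "x \<otimes> b \<notin> M"
      unfolding loc_def using that b False by blast
    then show ?thesis using assms False by blast
  qed
  then show ?thesis using b by blast
qed

lemma pi_M: "\<pi> \<in> M"
proof -
  have piS: "\<pi> \<in> S" using V_S pi by blast
  \<comment> \<open>If M were zero, \<pi> would be invertible in \<open>S\<close>, and
    \<open>integral_in_V\<close> would bring its inverse back into V.\<close>
  have "\<exists>m \<in> M. m \<noteq> \<zero>"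
  proof (rule ccontr)
    assume z: "\<not> (\<exists>m \<in> M. m \<noteq> \<zero>)"
    then obtain s m where s: "s \<in> S" "m \<in> M" "\<one> = s \<otimes> \<pi> \<oplus> m" using M_comax[OF piS] pi(2) by blast
    then have "\<one> = \<pi> \<otimes> s" using z pi by (auto simp: m_comm)
    then have "inv \<pi> = s" using comm_inv_char s pi by (metis S_carrier V_carrier)
    then have "inv \<pi> \<in> V" using integral_in_V[of "inv \<pi>"] s pi inv_inv_nonzero[of \<pi>] by simp
    then show False using pi by simp
  qed
  then obtain m where m: "m \<in> M" "m \<noteq> \<zero>" by blast
  then obtain k :: nat and t where "t \<in> S" "\<pi> [^] k = m \<otimes> t" using divides_pi_pow M_S by metis
  then have "\<pi> [^] k \<in> M" using M_smult2 m by simp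
  then show ?thesis using M_pow piS by blast
qed

lemma V_M: "v \<in> V \<Longrightarrow> v \<in> M \<Longrightarrow> \<exists>w \<in> V. v = w \<otimes> \<pi>"
proof (cases "v = \<zero>")
  case True
  then show ?thesis using subringE(2)[OF V] pi by (auto intro!: bexI[of _ \<zero>])
next
  case False
  assume v: "v \<in> V" "v \<in> M"
  obtain n :: nat and u where u: "u \<in> V" "u \<noteq> \<zero>" "inv u \<in> V" "v = \<pi> [^] n \<otimes> u"
    using dvr v False by blast
  have "n \<noteq> 0" using u v M_units[of u] V_S by (auto intro!: Nat.gr0I)
  then obtain k where k: "n = Suc k" by (cases n) auto
  have "\<pi> [^] k \<in> V" using pi(1) subringE(3,6)[OF V] by (induction k) auto
  then have "\<pi> [^] k \<otimes> u \<in> V" using u subringE(6)[OF V] by blast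
  moreover have "v = (\<pi> [^] k \<otimes> u) \<otimes> \<pi>" unfolding u(4) k using pi u by (simp add: m_ac)
  ultimately show ?thesis by blast
qed

end

end

section \<open>Powers of maximal ideals, and the uniformizer of the localization\<close>

lemma ideals_set_pow:
  "I [^]\<^bsub>ideals_set R\<^esub> (0::nat) = carrier R"
  "I [^]\<^bsub>ideals_set R\<^esub> Suc n = ideal_prod R (I [^]\<^bsub>ideals_set R\<^esub> n) I"
  by (simp_all add: nat_pow_def ideals_set_def)

lemma ideals_set_simps [simp]:
  "\<one>\<^bsub>ideals_set R\<^esub> = carrier R" "I \<otimes>\<^bsub>ideals_set R\<^esub> J = ideal_prod R I J"
  by (simp_all add: ideals_set_def)

context dvr_extension
begin

context
  fixes M assumes M: "maxid M"
begin

lemmas loc_closed = subringE(2,3,5,6,7)[OF loc_subring[OF M]]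

lemma loc_carrier: "a \<in> loc M \<Longrightarrow> a \<in> carrier K" by (simp add: loc_def)

lemma loc_pow: "a \<in> loc M \<Longrightarrow> a [^] (n::nat) \<in> loc M"
  by (induction n) (auto intro: loc_closed)

text \<open>As \<open>loc M\<close> is a valuation ring, one of the two elements divides the other
  there and serves as \<open>r\<close>.\<close>

lemma M_common_divisor:
  assumes "a \<in> M" "b \<in> M"
  shows "\<exists>r \<in> M. \<exists>v \<in> loc M. \<exists>w \<in> loc M. a = r \<otimes> v \<and> b = r \<otimes> w"
proof -
  have c: "a \<in> carrier K" "b \<in> carrier K" using assms M_S[OF M] by auto
  consider "a = \<zero>" | "a \<noteq> \<zero>" "inv a \<otimes> b \<in> loc M" | "a \<noteq> \<zero>" "b \<noteq> \<zero>" "inv (inv a \<otimes> b) \<in> loc M"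
    using loc_valuation[OF M, of "inv a \<otimes> b"] c loc_closed(1) by (cases "a = \<zero>"; cases "b = \<zero>") auto
  then show ?thesis
  proof cases
    case 1
    then have "a = b \<otimes> \<zero>" "b = b \<otimes> \<one>" using c by auto
    then show ?thesis using assms loc_closed(1,2) by blast
  next
    case 2
    then have "a = a \<otimes> \<one>" "b = a \<otimes> (inv a \<otimes> b)" using c by auto
    then show ?thesis using assms 2 loc_closed(1,2) by blast
  next
    case 3
    then have "inv (inv a \<otimes> b) = a \<otimes> inv b" using c by (simp add: inv_mult_nonzero inv_inv_nonzero)
    then have "a = b \<otimes> inv (inv a \<otimes> b)" "b = b \<otimes> \<one>" using c 3 by (auto simp: m_ac)
    then show ?thesis using assms 3 loc_closed(1,2) by blast
  qed
qed

text \<open>In the valuation ring \<open>loc M\<close> finitely many elements of \<open>M\<close> are multiples of one of them.\<close>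

lemma M_pow_power:
  "y \<in> M [^]\<^bsub>ideals_set RS\<^esub> (e::nat) \<Longrightarrow> \<exists>t \<in> M. \<exists>w \<in> loc M. y = t [^] e \<otimes> w"
proof (induction e arbitrary: y)
  case 0
  then have y: "y \<in> S" by (simp add: ideals_set_pow)
  then have "y = \<zero> [^] (0::nat) \<otimes> y" by simp
  then show ?case using y S_loc[OF M] M_zero[OF M] by blast
next
  case (Suc e)
  have common: "\<exists>r \<in> M. \<exists>v' \<in> loc M. \<exists>w' \<in> loc M. s [^] n \<otimes> v = r [^] n \<otimes> v' \<and> t [^] m \<otimes> w = r [^] m \<otimes> w'"
    if st: "s \<in> M" "t \<in> M" "v \<in> loc M" "w \<in> loc M" for s t v w and m n :: nat
  proof -
    obtain r v' w' where r: "r \<in> M" "v' \<in> loc M" "w' \<in> loc M" "s = r \<otimes> v'" "t = r \<otimes> w'"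
      using M_common_divisor[OF st(1,2)] by blast
    have c: "r \<in> carrier K" "v' \<in> carrier K" "w' \<in> carrier K" "v \<in> carrier K" "w \<in> carrier K"
      using r st M_S[OF M] loc_carrier by auto
    have "s [^] n \<otimes> v = r [^] n \<otimes> (v' [^] n \<otimes> v)" "t [^] m \<otimes> w = r [^] m \<otimes> (w' [^] m \<otimes> w)"
      unfolding r(4,5) using c by (simp_all add: nat_pow_distrib m_ac)
    moreover have "v' [^] n \<otimes> v \<in> loc M" "w' [^] m \<otimes> w \<in> loc M"
      using r st loc_pow loc_closed by auto
    ultimately show ?thesis using r(1) by blast
  qed
  have "y \<in> ideal_prod RS (M [^]\<^bsub>ideals_set RS\<^esub> e) M" using Suc.prems by (simp add: ideals_set_pow)
  then show ?case
  proof (induction y rule: ideal_prod.induct)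
    case (prod i j)
    obtain t w where t: "t \<in> M" "w \<in> loc M" "i = t [^] e \<otimes> w" using Suc.IH prod(1) by blast
    obtain r v' w' where r: "r \<in> M" "v' \<in> loc M" "w' \<in> loc M"
      "t [^] e \<otimes> w = r [^] e \<otimes> v'" "j [^] (1::nat) \<otimes> \<one> = r [^] (1::nat) \<otimes> w'"
      using common[OF t(1) prod(2) t(2) loc_closed(2)] by metis
    have c: "r \<in> carrier K" "v' \<in> carrier K" "w' \<in> carrier K" "j \<in> carrier K"
      using r prod M_S[OF M] loc_carrier by auto
    have "j = r \<otimes> w'" using r(5) c by simp
    then have "i \<otimes> j = (r [^] e \<otimes> v') \<otimes> (r \<otimes> w')" using t(3) r(4) by simp
    then have "i \<otimes> j = r [^] Suc e \<otimes> (v' \<otimes> w')" using c by (simp add: m_ac)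
    then show ?case using r loc_closed(4) by auto
  next
    case (sum a b)
    obtain s v where s: "s \<in> M" "v \<in> loc M" "a = s [^] Suc e \<otimes> v" using sum.IH by blast
    obtain t w where t: "t \<in> M" "w \<in> loc M" "b = t [^] Suc e \<otimes> w" using sum.IH by blast
    obtain r v' w' where r: "r \<in> M" "v' \<in> loc M" "w' \<in> loc M"
      "s [^] Suc e \<otimes> v = r [^] Suc e \<otimes> v'" "t [^] Suc e \<otimes> w = r [^] Suc e \<otimes> w'"
      using common[OF s(1) t(1) s(2) t(2)] by metis
    have c: "r \<in> carrier K" "v' \<in> carrier K" "w' \<in> carrier K" using r M_S[OF M] loc_carrier by auto
    then have rc: "r [^] Suc e \<in> carrier K" by blast
    have "a \<oplus> b = r [^] Suc e \<otimes> v' \<oplus> r [^] Suc e \<otimes> w'" using s(3) t(3) r(4,5) by metis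
    then have "a \<oplus> b = r [^] Suc e \<otimes> (v' \<oplus> w')" using r_distr[OF c(2,3) rc] by metis
    moreover have "v' \<oplus> w' \<in> loc M" using r loc_closed by blast
    ultimately show ?case using r(1) by auto
  qed
qed

lemma nonunit_V:
  assumes "v \<in> V" "\<not> (v \<noteq> \<zero> \<and> inv v \<in> V)" shows "\<exists>w \<in> V. v = w \<otimes> \<pi>"
proof (cases "v = \<zero>")
  case True
  then show ?thesis using V_M[OF M assms(1)] M_zero[OF M] by simp
next
  case False
  have "v \<in> M"
  proof (rule ccontr)
    assume "v \<notin> M"
    obtain n :: nat and u where u: "u \<in> V" "u \<noteq> \<zero>" "inv u \<in> V" "v = \<pi> [^] n \<otimes> u"
      using dvr assms(1) False by blast
    have "n = 0"
    proof (rule ccontr)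
      assume "n \<noteq> 0"
      then obtain k where k: "n = Suc k" by (cases n) auto
      have "v = (\<pi> [^] k \<otimes> u) \<otimes> \<pi>" unfolding u(4) k using pi u by (simp add: m_ac)
      moreover have "\<pi> [^] k \<otimes> u \<in> S" using u pi V_S S_closed S_pow by simp
      ultimately show False using \<open>v \<notin> M\<close> M_smult[OF M _ pi_M[OF M]] by simp
    qed
    then have "v = u" using u by simp
    then show False using u assms(2) by simp
  qed
  then show ?thesis using V_M[OF M assms(1)] by blast
qed

text \<open>If \<open>\<pi> = t\<^sup>e w\<close> with \<open>t \<in> M\<close>, then the last unit coefficient \<open>a t\<^sup>j\<close> of a relation for \<open>t\<close> cannot
  be cancelled by the other terms unless \<open>e \<le> j\<close>.\<close>

lemma ramification_bound:
  assumes "\<pi> \<in> M [^]\<^bsub>ideals_set RS\<^esub> (e::nat)"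
  shows "e \<le> d"
proof (rule ccontr)
  assume "\<not> e \<le> d"
  obtain t w where t: "t \<in> M" "w \<in> loc M" "\<pi> = t [^] e \<otimes> w" using M_pow_power[OF assms] by blast
  have c: "t \<in> carrier K" "w \<in> carrier K" "t \<in> S" using t M_S[OF M] loc_carrier by auto
  obtain p where p: "set p \<subseteq> V" "length p \<le> d" "\<exists>a \<in> set p. a \<noteq> \<zero> \<and> inv a \<in> V" "eval p t = \<zero>"
    using algebraic[OF c(1)] by blast
  \<comment> \<open>The last unit coefficient is chosen, so that all coefficients of
    \<open>p2\<close> are multiples of \<pi>, hence of t^e in the localization.\<close>
  obtain p1 a p2 where s: "p = p1 @ a # p2" "a \<noteq> \<zero> \<and> inv a \<in> V" "\<forall>z \<in> set p2. \<not> (z \<noteq> \<zero> \<and> inv z \<in> V)"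
    using split_list_last_prop[OF p(3)] by blast
  have V12: "set p1 \<subseteq> V" "set p2 \<subseteq> V" "a \<in> V" using p(1) s(1) by auto
  have Vc: "set p1 \<subseteq> carrier K" "set p2 \<subseteq> carrier K" "a \<in> carrier K" using V12 by auto
  have inS: "eval q t \<in> S" if "set q \<subseteq> V" for q
    using eval_poly_values[OF V c(1) that] poly_values_subset[OF V c(1) S_subring _ c(3)] V_S by blast
  have p2: "\<exists>q \<in> S. eval p2 t = q \<otimes> \<pi>"
    if "set p2 \<subseteq> V" "\<forall>z \<in> set p2. \<not> (z \<noteq> \<zero> \<and> inv z \<in> V)" for p2
    using that
  proof (induction p2)
    case Nil
    then show ?case using pi S_closed by (auto intro!: bexI[of _ \<zero>])
  next
    case (Cons z p2)
    obtain q where q: "q \<in> S" "eval p2 t = q \<otimes> \<pi>" using Cons by auto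
    obtain z' where z: "z' \<in> V" "z = z' \<otimes> \<pi>" using nonunit_V[of z] Cons.prems by auto
    have cc: "q \<in> carrier K" "z' \<in> carrier K" "\<pi> \<in> carrier K" "t [^] length p2 \<in> carrier K"
      using q z pi c by auto
    have "eval (z # p2) t = (z' \<otimes> \<pi>) \<otimes> t [^] length p2 \<oplus> q \<otimes> \<pi>" using q(2) z(2) by simp
    then have "eval (z # p2) t = (z' \<otimes> t [^] length p2 \<oplus> q) \<otimes> \<pi>" using cc by algebra
    moreover have "z' \<otimes> t [^] length p2 \<oplus> q \<in> S" using q z c V_S S_pow S_closed by simp
    ultimately show ?case by blast
  qed
  obtain q where q: "q \<in> S" "eval p2 t = q \<otimes> \<pi>" using p2[OF V12(2) s(3)] by blast
  let ?j = "length p2" and ?b = "eval p1 t"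
  have b: "?b \<in> S" using inS V12 by blast
  obtain k where k: "e = k + Suc ?j"
    using \<open>\<not> e \<le> d\<close> p(2) s(1) by (metis add.commute add_leD2 le_Suc_ex length_append length_Cons not_less_eq_eq order_trans nat_le_linear)
  have cc: "?b \<in> carrier K" "q \<in> carrier K" "t [^] ?j \<in> carrier K" "t [^] k \<in> carrier K" "inv a \<in> carrier K"
    using b q c s(2) Vc by auto
  have "e \<noteq> 0" using k by simp
  then have tnz: "t \<noteq> \<zero>" using t(3) pi c by (metis l_null nat_pow_zero)
  have tj: "t [^] ?j \<noteq> \<zero>" using tnz c(1) by (induction p2) auto
  have te: "t [^] e = t [^] k \<otimes> (t [^] ?j \<otimes> t)" unfolding k using c by (simp add: nat_pow_mult[symmetric] m_assoc)
  have "eval p t = ?b \<otimes> t [^] Suc ?j \<oplus> eval (a # p2) t"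
    unfolding s(1) using eval_append[of p1 "a # p2" t] Vc c by simp
  then have "\<zero> = ?b \<otimes> (t [^] ?j \<otimes> t) \<oplus> (a \<otimes> t [^] ?j \<oplus> q \<otimes> (t [^] k \<otimes> (t [^] ?j \<otimes> t) \<otimes> w))"
    using p(4) q(2) t(3) te c by simp
  \<comment> \<open>Since e > j, even t^(j+1) splits off \<pi>. After cancelling t^j only a is left
    without a factor t, which makes t a unit at M.\<close>
  also have "\<dots> = t [^] ?j \<otimes> (a \<oplus> t \<otimes> (?b \<oplus> q \<otimes> t [^] k \<otimes> w))" using cc c(1,2) Vc(3) by algebra
  finally have z: "a \<oplus> t \<otimes> (?b \<oplus> q \<otimes> t [^] k \<otimes> w) = \<zero>"
    using tj cc c(1,2) Vc(3) by (metis a_closed m_closed nonzero_mult)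
  let ?l = "\<ominus> (inv a) \<otimes> (?b \<oplus> q \<otimes> t [^] k \<otimes> w)"
  have "t \<otimes> ?l = \<one> \<ominus> inv a \<otimes> (a \<oplus> t \<otimes> (?b \<oplus> q \<otimes> t [^] k \<otimes> w))"
  proof -
    have "\<one> \<ominus> inv a \<otimes> (a \<oplus> t \<otimes> (?b \<oplus> q \<otimes> t [^] k \<otimes> w))
        = (\<one> \<ominus> inv a \<otimes> a) \<oplus> t \<otimes> ?l" using cc c(1,2) Vc(3) by algebra
    moreover have "\<one> \<ominus> inv a \<otimes> a = \<zero>" using s(2) Vc(3) by (simp add: a_minus_def r_neg)
    ultimately show ?thesis using cc c(1,2) by simp
  qed
  then have "t \<otimes> ?l = \<one>" unfolding z using cc by (simp add: a_minus_def)
  moreover have l: "?l \<in> loc M"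
    using s(2) b q t(2) c(3) S_loc[OF M] V_S loc_closed S_closed S_pow by simp
  ultimately have "inv t \<in> loc M" using comm_inv_char[OF c(1)] loc_carrier[OF l] by simp
  then show False using loc_inv_iff[OF M c(3) tnz] t(1) by simp
qed

lemma M_pow_ideal: "ideal (M [^]\<^bsub>ideals_set RS\<^esub> (n::nat)) RS"
proof -
  interpret RS: domain RS by (rule RS_domain)
  have M': "ideal M RS" using M maximalideal_iff maximalideal.axioms(1) by blast
  show ?thesis
    by (induction n) (use RS.oneideal RS.ideal_prod_is_ideal M' in \<open>auto simp: ideals_set_pow\<close>)
qed

lemma M_square_prod: "a \<in> M \<Longrightarrow> b \<in> M \<Longrightarrow> a \<otimes> b \<in> M [^]\<^bsub>ideals_set RS\<^esub> (2::nat)"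
proof -
  assume ab: "a \<in> M" "b \<in> M"
  have "\<one> \<otimes>\<^bsub>RS\<^esub> a \<in> ideal_prod RS S M" by (rule ideal_prod.prod) (use ab S_closed in auto)
  then have "a \<in> ideal_prod RS S M" using M_S[OF M] ab by simp
  then have "a \<otimes>\<^bsub>RS\<^esub> b \<in> ideal_prod RS (ideal_prod RS S M) M" using ab by (intro ideal_prod.prod)
  then show ?thesis unfolding numeral_2_eq_2 ideals_set_pow by simp
qed

text \<open>If \<open>y b \<in> M\<^sup>2\<close> with \<open>b \<notin> M\<close>, then \<open>y \<in> M\<^sup>2\<close>, since \<open>1 = s b + m\<close>.\<close>

lemma M_square_cancel:
  assumes "y \<in> M" "b \<in> S" "b \<notin> M" "y \<otimes> b \<in> M [^]\<^bsub>ideals_set RS\<^esub> (2::nat)"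
  shows "y \<in> M [^]\<^bsub>ideals_set RS\<^esub> (2::nat)"
proof -
  interpret I: ideal "M [^]\<^bsub>ideals_set RS\<^esub> (2::nat)" RS by (rule M_pow_ideal)
  obtain s m where s: "s \<in> S" "m \<in> M" "\<one> = s \<otimes> b \<oplus> m" using M_comax[OF M] assms by blast
  have c: "y \<in> carrier K" "b \<in> carrier K" "s \<in> carrier K" "m \<in> carrier K" using assms s M_S[OF M] by auto
  have "y = y \<otimes> (s \<otimes> b \<oplus> m)" using s(3) c by (metis r_one)
  then have "y = s \<otimes> (y \<otimes> b) \<oplus> y \<otimes> m" using c by algebra
  moreover have "s \<otimes> (y \<otimes> b) \<in> M [^]\<^bsub>ideals_set RS\<^esub> (2::nat)" using I.I_l_closed[OF assms(4), of s] s by simp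
  moreover then have "s \<otimes> (y \<otimes> b) \<oplus> y \<otimes> m \<in> M [^]\<^bsub>ideals_set RS\<^esub> (2::nat)"
    using additive_subgroup.a_closed[OF ideal.axioms(1)[OF M_pow_ideal], of "s \<otimes> (y \<otimes> b)" 2 "y \<otimes> m"]
      M_square_prod[OF assms(1) s(2)] by simp
  ultimately show ?thesis by metis
qed

text \<open>Otherwise \<pi>/a is a nonunit of the valuation ring \<open>loc M\<close>, which puts
  \<pi>, and with it \<open>M \<inter> V\<close>, into the square of M. The ramification index would
  then be at least 2; \<open>ramification_bound\<close> enters because a greatest exponent is
  meaningful only for a bounded set.\<close>

lemma loc_uniformizer:
  assumes ram: "ramification_index RS V M = 1" and a: "a \<in> M"
  shows "a \<otimes> inv \<pi> \<in> loc M"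
proof (rule ccontr)
  assume n: "a \<otimes> inv \<pi> \<notin> loc M"
  interpret RS: domain RS by (rule RS_domain)
  interpret I: ideal "M [^]\<^bsub>ideals_set RS\<^esub> (2::nat)" RS by (rule M_pow_ideal)
  have c: "a \<in> carrier K" "\<pi> \<in> carrier K" using a M_S[OF M] pi by auto
  have a0: "a \<noteq> \<zero>" using n loc_closed(1) c pi by auto
  have iv: "inv (\<pi> \<otimes> inv a) = a \<otimes> inv \<pi>" "\<pi> \<otimes> inv a \<in> carrier K" "\<pi> \<otimes> inv a \<noteq> \<zero>"
    using c a0 pi by (auto simp: inv_mult_nonzero inv_inv_nonzero m_comm)
  then have "\<pi> \<otimes> inv a \<in> loc M" using loc_valuation[OF M iv(2,3)] n by auto
  then obtain b where b: "b \<in> S - M" "(\<pi> \<otimes> inv a) \<otimes> b \<in> M"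
    using loc_nonunit[OF M, of "\<pi> \<otimes> inv a"] iv n by auto
  have "a \<otimes> ((\<pi> \<otimes> inv a) \<otimes> b) = (a \<otimes> inv a) \<otimes> (\<pi> \<otimes> b)"
    using c a0 b(1) by (simp add: m_ac del: r_inv_nonzero inv_cancel)
  then have "a \<otimes> ((\<pi> \<otimes> inv a) \<otimes> b) = \<pi> \<otimes> b" using c a0 b(1) by simp
  then have "\<pi> \<otimes> b \<in> M [^]\<^bsub>ideals_set RS\<^esub> (2::nat)" using M_square_prod[OF a b(2)] by simp
  then have pi2: "\<pi> \<in> M [^]\<^bsub>ideals_set RS\<^esub> (2::nat)" using M_square_cancel[OF pi_M[OF M]] b by blast
  have sub: "M \<inter> V \<subseteq> M [^]\<^bsub>ideals_set RS\<^esub> (2::nat)"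
  proof
    fix v assume "v \<in> M \<inter> V"
    then obtain w where "w \<in> V" "v = w \<otimes> \<pi>" using V_M[OF M] by blast
    then show "v \<in> M [^]\<^bsub>ideals_set RS\<^esub> (2::nat)" using I.I_l_closed[OF pi2, of w] V_S by simp
  qed
  have "2 \<le> ramification_index RS V M"
    unfolding ramification_index_def
  proof (rule Greatest_le_nat)
    show "Idl\<^bsub>RS\<^esub> (M \<inter> V) \<subseteq> M [^]\<^bsub>ideals_set RS\<^esub> (2::nat)"
      by (rule RS.genideal_minimal[OF M_pow_ideal sub])
    fix e :: nat assume e: "Idl\<^bsub>RS\<^esub> (M \<inter> V) \<subseteq> M [^]\<^bsub>ideals_set RS\<^esub> e"
    have "M \<inter> V \<subseteq> carrier RS" using M_S[OF M] by auto
    then have "\<pi> \<in> Idl\<^bsub>RS\<^esub> (M \<inter> V)" using RS.genideal_self pi_M[OF M] pi by blast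
    then show "e \<le> d" using e ramification_bound by blast
  qed
  then show False using ram by simp
qed

lemma loc_uniformized:
  assumes ram: "ramification_index RS V M = 1"
  shows "uniformized K (loc M) \<pi>"
proof (rule uniformized.intro[OF field_axioms], rule uniformized_axioms.intro)
  have piS: "\<pi> \<in> S" using V_S pi by blast
  have c: "\<pi> \<in> carrier K" "\<pi> \<noteq> \<zero>" "inv \<pi> \<in> carrier K" using pi by auto
  show "subring (loc M) K" by (rule loc_subring[OF M])
  show "\<pi> \<in> loc M" by (rule S_loc[OF M piS])
  show "\<pi> \<noteq> \<zero>" by (rule pi(2))
  show ni: "inv \<pi> \<notin> loc M" using loc_inv_iff[OF M piS pi(2)] pi_M[OF M] by simp
  have S_rep: "\<exists>m::nat. \<exists>u \<in> loc M. u \<noteq> \<zero> \<and> inv u \<in> loc M \<and> s = \<pi> [^] m \<otimes> u" if s: "s \<in> S" "s \<noteq> \<zero>" for s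
  proof -
    have sc: "s \<in> carrier K" using s by simp
    obtain k :: nat and t where t: "t \<in> S" "\<pi> [^] k = s \<otimes> t" using divides_pi_pow[OF s] by blast
    \<comment> \<open>The valuation of s is the largest j with \<open>?P j\<close>; it is at most k
      because s divides \<pi>^k in \<open>S\<close>.\<close>
    let ?P = "\<lambda>j::nat. \<exists>w \<in> loc M. s = \<pi> [^] j \<otimes> w"
    have bound: "j \<le> k" if Pj: "?P j" for j
    proof (rule ccontr)
      assume "\<not> j \<le> k"
      then obtain i where i: "j = i + Suc k" by (metis add.commute le_Suc_ex not_less_eq_eq)
      obtain w where w: "w \<in> loc M" "s = \<pi> [^] j \<otimes> w" using Pj by blast
      have cc: "w \<in> carrier K" "t \<in> carrier K" "\<pi> [^] i \<in> carrier K" "\<pi> [^] k \<in> carrier K"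
        using w t loc_carrier c by auto
      have pk: "\<pi> [^] k \<noteq> \<zero>" using c by (induction k) auto
      have "\<pi> [^] k \<otimes> \<one> = \<pi> [^] i \<otimes> (\<pi> [^] k \<otimes> \<pi>) \<otimes> w \<otimes> t"
        using t(2) w(2) cc c unfolding i by (simp add: nat_pow_mult[symmetric] m_assoc)
      also have "\<dots> = \<pi> [^] k \<otimes> (\<pi> \<otimes> (\<pi> [^] i \<otimes> w \<otimes> t))" using cc c(1) by algebra
      finally have "\<one> = \<pi> \<otimes> (\<pi> [^] i \<otimes> w \<otimes> t)"
        using cc c pk by (metis m_closed nonzero_cancel one_closed)
      then have "inv \<pi> = \<pi> [^] i \<otimes> w \<otimes> t" using comm_inv_char[OF c(1), of "\<pi> [^] i \<otimes> w \<otimes> t"] cc by simp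
      moreover have "\<pi> [^] i \<otimes> w \<otimes> t \<in> loc M"
        using w t piS S_loc[OF M] loc_closed loc_pow by simp
      ultimately show False using ni by simp
    qed
    have "?P 0" using s S_loc[OF M] by (auto intro!: bexI[of _ s])
    then have G: "?P (Greatest ?P)" using bound by (rule GreatestI_nat)
    then obtain w where w: "w \<in> loc M" "s = \<pi> [^] (Greatest ?P) \<otimes> w" by blast
    have wc: "w \<in> carrier K" using w loc_carrier by blast
    have w0: "w \<noteq> \<zero>" using w(2) s c by auto
    have "inv w \<in> loc M"
    proof (rule ccontr)
      assume "inv w \<notin> loc M"
      then obtain b where b: "b \<in> S" "b \<notin> M" "w \<otimes> b \<in> M" using loc_nonunit[OF M w(1)] by blast
      have b0: "b \<noteq> \<zero>" using b M_zero[OF M] by auto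
      have ib: "inv b \<in> loc M" using loc_inv_iff[OF M b(1) b0] b by simp
      \<comment> \<open>A nonunit w contains another factor \<pi>: w b is in M, hence \<pi> times an
        element of \<open>loc M\<close>, and b is a unit there.\<close>
      let ?w = "(w \<otimes> b) \<otimes> inv \<pi> \<otimes> inv b"
      have cc: "b \<in> carrier K" "inv b \<in> carrier K" using b b0 by auto
      have "\<pi> \<otimes> ?w = w \<otimes> (b \<otimes> inv b) \<otimes> (\<pi> \<otimes> inv \<pi>)" using c cc wc by algebra
      then have "w = \<pi> \<otimes> ?w" using c cc wc b0 by simp
      moreover have "s = \<pi> [^] Greatest ?P \<otimes> w" by (rule w(2))
      ultimately have "s = \<pi> [^] Greatest ?P \<otimes> (\<pi> \<otimes> ?w)" by (rule subst)
      then have "s = \<pi> [^] Suc (Greatest ?P) \<otimes> ?w" using c cc wc by (simp only: nat_pow_Suc m_assoc nat_pow_closed m_closed)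
      moreover have "?w \<in> loc M" using loc_closed(4)[OF loc_uniformizer[OF ram b(3)] ib] .
      ultimately have "?P (Suc (Greatest ?P))" by (rule bexI)
      then have "Suc (Greatest ?P) \<le> Greatest ?P" using bound by (rule Greatest_le_nat)
      then show False by simp
    qed
    then show ?thesis using w w0 by blast
  qed
  have loc_rep: "\<exists>m::nat. \<exists>u \<in> loc M. u \<noteq> \<zero> \<and> inv u \<in> loc M \<and> x = \<pi> [^] m \<otimes> u"
    if x: "x \<in> loc M" "x \<noteq> \<zero>" for x
  proof -
    obtain b where b: "b \<in> S" "b \<notin> M" "x \<otimes> b \<in> S" using x by (auto simp: loc_def)
    have b0: "b \<noteq> \<zero>" using b M_zero[OF M] by auto
    have ib: "inv b \<in> loc M" using loc_inv_iff[OF M b(1) b0] b by simp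
    have xc: "x \<in> carrier K" "b \<in> carrier K" using x b loc_carrier by auto
    obtain m :: nat and u where u: "u \<in> loc M" "u \<noteq> \<zero>" "inv u \<in> loc M" "x \<otimes> b = \<pi> [^] m \<otimes> u"
      using S_rep[OF b(3)] x xc b0 by auto
    have uc: "u \<in> carrier K" using u loc_carrier by blast
    have "x = (x \<otimes> b) \<otimes> inv b" using xc b0 by (simp add: m_assoc)
    then have "x = \<pi> [^] m \<otimes> (u \<otimes> inv b)" unfolding u(4) using xc uc c b0 by (simp add: m_assoc)
    moreover have "inv (u \<otimes> inv b) = inv u \<otimes> b"
      using uc u xc b0 by (simp add: inv_mult_nonzero inv_inv_nonzero)
    then have "u \<otimes> inv b \<noteq> \<zero>" "u \<otimes> inv b \<in> loc M" "inv (u \<otimes> inv b) \<in> loc M"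
      using u ib b S_loc[OF M] loc_closed(4) uc xc b0 by auto
    ultimately show ?thesis by blast
  qed
  fix x assume x: "x \<in> carrier K" "x \<noteq> \<zero>"
  show "\<exists>m::nat. \<exists>n::nat. \<exists>u \<in> loc M. u \<noteq> \<zero> \<and> inv u \<in> loc M \<and> \<pi> [^] n \<otimes> x = \<pi> [^] m \<otimes> u"
  proof (cases "x \<in> loc M")
    case True
    then obtain m :: nat and u where "u \<in> loc M" "u \<noteq> \<zero>" "inv u \<in> loc M" "x = \<pi> [^] m \<otimes> u"
      using loc_rep x by blast
    moreover then have "\<pi> [^] (0::nat) \<otimes> x = \<pi> [^] m \<otimes> u" using x by simp
    ultimately show ?thesis by blast
  next
    case False
    then have "inv x \<in> loc M" using loc_valuation[OF M x] by blast
    then obtain m :: nat and u where u: "u \<in> loc M" "u \<noteq> \<zero>" "inv u \<in> loc M" "inv x = \<pi> [^] m \<otimes> u"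
      using loc_rep[of "inv x"] x by auto
    have uc: "u \<in> carrier K" "\<pi> [^] m \<in> carrier K" using u loc_carrier c by auto
    have iu: "inv u \<in> carrier K" using uc u by simp
    have "inv u = inv u \<otimes> (inv x \<otimes> x)" using iu x by simp
    also have "\<dots> = inv u \<otimes> ((\<pi> [^] m \<otimes> u) \<otimes> x)" by (simp only: u(4))
    also have "\<dots> = (inv u \<otimes> u) \<otimes> (\<pi> [^] m \<otimes> x)" using iu uc x(1) by algebra
    finally have "\<pi> [^] m \<otimes> x = \<pi> [^] (0::nat) \<otimes> inv u" using iu uc u x by simp
    moreover have "inv (inv u) = u" "inv u \<noteq> \<zero>" using uc u inv_inv_nonzero by auto
    ultimately show ?thesis using u by metis
  qed
qed

end

end

section \<open>Galois extensions of discrete valuation rings\<close>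

lemma (in ring) exists_maximalideal:
  assumes I: "ideal I R" and one: "\<one> \<notin> I"
  shows "\<exists>M. maximalideal M R \<and> I \<subseteq> M"
proof -
  let ?\<A> = "{J. ideal J R \<and> I \<subseteq> J \<and> \<one> \<notin> J}"
  have "\<exists>M \<in> ?\<A>. \<forall>J \<in> ?\<A>. M \<subseteq> J \<longrightarrow> J = M"
  proof (rule subset_Zorn_nonempty)
    show "?\<A> \<noteq> {}" using I one by blast
    fix \<C> assume ne: "\<C> \<noteq> {}" and ch: "subset.chain ?\<A> \<C>"
    have "subset.chain {J. ideal J R} \<C>" using ch unfolding subset_chain_def by blast
    then have "ideal (\<Union>\<C>) R" using chain_Union_is_ideal[of \<C>] ne by simp
    moreover have "I \<subseteq> \<Union>\<C>" "\<one> \<notin> \<Union>\<C>" using ne ch unfolding subset_chain_def by blast+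
    ultimately show "\<Union>\<C> \<in> ?\<A>" by simp
  qed
  then obtain M where M: "ideal M R" "I \<subseteq> M" "\<one> \<notin> M"
    and max: "\<forall>J \<in> ?\<A>. M \<subseteq> J \<longrightarrow> J = M" by blast
  have "maximalideal M R"
  proof (rule maximalidealI)
    show "ideal M R" by (rule M(1))
    show "carrier R \<noteq> M" using M(3) by auto
    fix J assume J: "ideal J R" "M \<subseteq> J" "J \<subseteq> carrier R"
    show "J = M \<or> J = carrier R"
    proof (cases "\<one> \<in> J")
      case True
      then show ?thesis using ideal.one_imp_carrier[OF J(1)] by simp
    next
      case False
      then have "J \<in> ?\<A>" using J M by auto
      then show ?thesis using max J(2) by simp
    qed
  qed
  then show ?thesis using M(2) by blast
qed

locale galois_dvr = crossed K G f + dvr_extension K V \<pi> d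
  for K (structure) and G :: "('a \<Rightarrow> 'a) monoid" and f and V :: "'a set" and \<pi> and d :: nat +
  assumes fixV: "\<sigma> \<in> carrier G \<Longrightarrow> a \<in> V \<Longrightarrow> \<sigma> a = a"
    and fixed: "x \<in> carrier K \<Longrightarrow> (\<And>\<sigma>. \<sigma> \<in> carrier G \<Longrightarrow> \<sigma> x = x) \<Longrightarrow>
      \<exists>a \<in> V. \<exists>b \<in> V. b \<noteq> \<zero> \<and> x = a \<otimes> inv b"
    and distinct_act: "\<sigma> \<in> carrier G \<Longrightarrow> \<tau> \<in> carrier G \<Longrightarrow> \<sigma> \<noteq> \<tau> \<Longrightarrow> \<exists>s \<in> carrier K. \<sigma> s \<noteq> \<tau> s"
    and ramification: "maxid M \<Longrightarrow> ramification_index RS V M = 1"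
    and residue_separable: "maxid M \<Longrightarrow>
      ring.separable_extension (RS Quot M) ((\<lambda>v. M +>\<^bsub>RS\<^esub> v) ` V)"
begin

lemma act_pow: "\<sigma> \<in> carrier G \<Longrightarrow> a \<in> carrier K \<Longrightarrow> \<sigma> (a [^] (n::nat)) = \<sigma> a [^] n"
  by (induction n) (simp_all add: act_times)

lemma act_eval: "\<sigma> \<in> carrier G \<Longrightarrow> set p \<subseteq> V \<Longrightarrow> x \<in> carrier K \<Longrightarrow> \<sigma> (eval p x) = eval p (\<sigma> x)"
proof (induction p)
  case (Cons a p)
  have "set p \<subseteq> carrier K" using Cons.prems V_carrier by auto
  then have c: "a \<in> carrier K" "eval p x \<in> carrier K" "x [^] length p \<in> carrier K"
    using Cons.prems eval_in_carrier[of p x] by auto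
  have \<sigma>: "\<sigma> \<in> carrier G" by (rule Cons.prems(1))
  have a: "\<sigma> a = a" using fixV[OF \<sigma>] Cons.prems(2) by simp
  have IH: "\<sigma> (eval p x) = eval p (\<sigma> x)" using Cons.IH[OF \<sigma> _ Cons.prems(3)] Cons.prems(2) by simp
  have "\<sigma> (a \<otimes> x [^] length p \<oplus> eval p x) = \<sigma> a \<otimes> \<sigma> x [^] length p \<oplus> \<sigma> (eval p x)"
    by (simp only: act_add[OF \<sigma> m_closed[OF c(1,3)] c(2)] act_times[OF \<sigma> c(1,3)]
        act_pow[OF \<sigma> Cons.prems(3)])
  then show ?case by (simp add: a IH)
qed simp

lemma act_S [simp]: "\<sigma> \<in> carrier G \<Longrightarrow> s \<in> S \<Longrightarrow> \<sigma> s \<in> S"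
proof -
  assume \<sigma>: "\<sigma> \<in> carrier G" and s: "s \<in> S"
  obtain p where p: "polynomial V p" "p \<noteq> []" "lead_coeff p = \<one>" "eval p s = \<zero>"
    using s unfolding integral_closure_def by blast
  have "set p \<subseteq> V" using p(1) by (auto simp: polynomial_def)
  then have "eval p (\<sigma> s) = \<zero>" using act_eval[OF \<sigma>, of p s] p(4) s \<sigma> by simp
  then show ?thesis unfolding integral_closure_def using p(1-3) act_closed[OF \<sigma> S_carrier[OF s]] by blast
qed

lemma act_image:
  assumes \<sigma>: "\<sigma> \<in> carrier G" and M: "M \<subseteq> S" and s: "s \<in> S"
  shows "\<sigma> s \<in> \<sigma> ` M \<longleftrightarrow> s \<in> M"
proof
  assume "\<sigma> s \<in> \<sigma> ` M"
  then obtain m where m: "m \<in> M" "\<sigma> s = \<sigma> m" by blast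
  then have "(\<iota> \<sigma>) (\<sigma> s) = (\<iota> \<sigma>) (\<sigma> m)" by simp
  moreover have "m \<in> S" using m(1) M by blast
  ultimately have "s = m" using \<sigma> s by simp
  then show "s \<in> M" using m by simp
qed blast

lemma maxid_image:
  assumes \<sigma>: "\<sigma> \<in> carrier G" and M: "maxid M"
  shows "maxid (\<sigma> ` M)"
proof -
  have i: "\<iota> \<sigma> \<in> carrier G" using \<sigma> by simp
  have MS: "M \<subseteq> S" using M_S[OF M] by blast
  have mem: "\<sigma> s \<in> \<sigma> ` M \<longleftrightarrow> s \<in> M" if "s \<in> S" for s by (rule act_image[OF \<sigma> MS that])
  have 1: "\<sigma> ` M \<subseteq> S" using \<sigma> M_S[OF M] by auto
  have 2: "\<zero> \<in> \<sigma> ` M" using M_zero[OF M] \<sigma> by (metis act_zero imageI)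
  have 3: "a \<oplus> b \<in> \<sigma> ` M" if ab: "a \<in> \<sigma> ` M" "b \<in> \<sigma> ` M" for a b
  proof -
    obtain m n where mn: "m \<in> M" "n \<in> M" "a = \<sigma> m" "b = \<sigma> n" using ab by blast
    then have "a \<oplus> b = \<sigma> (m \<oplus> n)" using act_add[OF \<sigma>] M_S[OF M] by simp
    then show ?thesis using M_add[OF M mn(1,2)] by blast
  qed
  have 4: "s \<otimes> a \<in> \<sigma> ` M" if sa: "s \<in> S" "a \<in> \<sigma> ` M" for s a
  proof -
    obtain m where m: "m \<in> M" "a = \<sigma> m" using sa by blast
    let ?t = "(\<iota> \<sigma>) s"
    have t: "?t \<in> S" "\<sigma> ?t = s" using sa i \<sigma> by auto
    have "s \<otimes> a = \<sigma> (?t \<otimes> m)" using m t \<sigma> M_S[OF M] by (simp add: act_times)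
    then show ?thesis using M_smult[OF M t(1) m(1)] by blast
  qed
  have 5: "\<one> \<notin> \<sigma> ` M" using mem[of \<one>] M_one[OF M] \<sigma> S_closed by simp
  have 6: "\<exists>s \<in> S. \<exists>m \<in> \<sigma> ` M. \<one> = s \<otimes> b \<oplus> m" if b: "b \<in> S - \<sigma> ` M" for b
  proof -
    let ?c = "(\<iota> \<sigma>) b"
    have c: "?c \<in> S" "\<sigma> ?c = b" using b i \<sigma> by auto
    then have "?c \<notin> M" using b by (metis DiffD2 imageI)
    then obtain s m where s: "s \<in> S" "m \<in> M" "\<one> = s \<otimes> ?c \<oplus> m" using M_comax[OF M c(1)] by blast
    have "\<one> = \<sigma> (s \<otimes> ?c \<oplus> m)" using s(3) \<sigma> by (metis act_unit)
    also have "\<dots> = \<sigma> s \<otimes> b \<oplus> \<sigma> m"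
      using \<sigma> s(1,2) c M_S[OF M] by (simp add: act_add act_times)
    finally show ?thesis using act_S[OF \<sigma> s(1)] s(2) by blast
  qed
  show ?thesis unfolding maxid_def using 1 2 3 4 5 6 by simp
qed

lemma loc_image:
  assumes \<sigma>: "\<sigma> \<in> carrier G" and M: "maxid M" and u: "u \<in> loc M"
  shows "\<sigma> u \<in> loc (\<sigma> ` M)"
proof -
  obtain b where b: "b \<in> S" "b \<notin> M" "u \<otimes> b \<in> S" "u \<in> carrier K" using u by (auto simp: loc_def)
  have "M \<subseteq> S" using M_S[OF M] by blast
  then have "\<sigma> b \<in> S - \<sigma> ` M" using act_image[OF \<sigma>, of M b] b \<sigma> by auto
  moreover have "\<sigma> u \<otimes> \<sigma> b \<in> S" using act_S[OF \<sigma> b(3)] b \<sigma> by (simp add: act_times)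
  ultimately show ?thesis using b \<sigma> unfolding loc_def by auto
qed

abbreviation "v M \<equiv> val (loc M) \<pi>"

lemmas uniformized_loc = loc_uniformized[OF _ ramification]

lemma v_image:
  assumes \<sigma>: "\<sigma> \<in> carrier G" and M: "maxid M" and x: "x \<in> carrier K" "x \<noteq> \<zero>"
  shows "v (\<sigma> ` M) (\<sigma> x) = v M x"
proof -
  interpret U: uniformized K "loc M" \<pi> by (rule uniformized_loc[OF M M])
  interpret U': uniformized K "loc (\<sigma> ` M)" \<pi>
    using uniformized_loc maxid_image[OF \<sigma> M] by blast
  obtain m n :: nat and u where u: "u \<in> loc M" "u \<noteq> \<zero>" "inv u \<in> loc M" "\<pi> [^] n \<otimes> x = \<pi> [^] m \<otimes> u"
    using U.rep[OF x] by blast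
  have c: "u \<in> carrier K" "\<pi> \<in> carrier K" using u pi by auto
  have "\<sigma> (\<pi> [^] n \<otimes> x) = \<sigma> (\<pi> [^] m \<otimes> u)" using u(4) by simp
  then have "\<pi> [^] n \<otimes> \<sigma> x = \<pi> [^] m \<otimes> \<sigma> u" using \<sigma> c x pi by (simp add: act_times act_pow fixV)
  moreover have "inv (\<sigma> u) \<in> loc (\<sigma> ` M)"
    using loc_image[OF \<sigma> M u(3)] act_inverse[OF \<sigma> c(1) u(2)] by simp
  ultimately have "v (\<sigma> ` M) (\<sigma> x) = int m - int n"
    by (intro U'.val_eq) (use loc_image[OF \<sigma> M u(1)] \<sigma> c u x in auto)
  then show ?thesis using U.val_eq[OF x(1) u] by simp
qed

lemma v_pos_iff:
  assumes M: "maxid M" and s: "s \<in> S" "s \<noteq> \<zero>"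
  shows "1 \<le> v M s \<longleftrightarrow> s \<in> M"
proof -
  interpret U: uniformized K "loc M" \<pi> by (rule uniformized_loc[OF M M])
  have c: "s \<in> carrier K" "\<pi> \<in> carrier K" "inv s \<in> carrier K" "inv \<pi> \<in> carrier K" using s pi by auto
  have one: "v M \<one> = 0" using U.val_mult[of \<one> \<one>] by simp
  show ?thesis
  proof
    assume le: "1 \<le> v M s"
    have "v M s + v M (inv s) = 0" using U.val_mult[of s "inv s"] c s one by simp
    then have "inv s \<notin> loc M" using U.val_nonneg_iff[of "inv s"] c s le by auto
    then show "s \<in> M" using loc_inv_iff[OF M s] by simp
  next
    assume "s \<in> M"
    then have "s \<otimes> inv \<pi> \<in> loc M" by (rule loc_uniformizer[OF M ramification[OF M]])
    then have "0 \<le> v M (s \<otimes> inv \<pi>)" using U.val_nonneg_iff[of "s \<otimes> inv \<pi>"] c s pi by simp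
    moreover have "(s \<otimes> inv \<pi>) \<otimes> \<pi> = s" using c pi by (simp add: m_assoc)
    then have "v M s = v M (s \<otimes> inv \<pi>) + 1"
      using U.val_mult[of "s \<otimes> inv \<pi>" \<pi>] U.val_pi c s pi by simp
    ultimately show "1 \<le> v M s" by simp
  qed
qed

text \<open>A maximal ideal N other than M contains an element s b that is 1 modulo M; multiplying
  the \<open>e\<close> found so far by it adds N to the set.\<close>

lemma crt:
  assumes M: "maxid M" and Z: "finite Z" "\<forall>N \<in> Z. maxid N \<and> N \<noteq> M"
  shows "\<exists>e \<in> S. e \<ominus> \<one> \<in> M \<and> (\<forall>N \<in> Z. e \<in> N)"
  using Z
proof (induction Z rule: finite_induct)
  case empty
  have "\<one> \<ominus> \<one> \<in> M" using M_zero[OF M] by (simp add: a_minus_def r_neg)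
  then show ?case using S_closed(2) by blast
next
  case (insert N Z)
  have N: "maxid N" "N \<noteq> M" using insert by auto
  obtain e where e: "e \<in> S" "e \<ominus> \<one> \<in> M" "\<forall>L \<in> Z. e \<in> L" using insert by auto
  have "\<not> N \<subseteq> M"
  proof
    assume sub: "N \<subseteq> M"
    then obtain b where b: "b \<in> M" "b \<notin> N" using N(2) by blast
    then obtain s n where "s \<in> S" "n \<in> N" "\<one> = s \<otimes> b \<oplus> n" using M_comax[OF N(1)] M_S[OF M] by blast
    then have "\<one> \<in> M" using sub M_add[OF M] M_smult[OF M] b by auto
    then show False using M_one[OF M] by simp
  qed
  then obtain b where b: "b \<in> N" "b \<notin> M" by blast
  have bS: "b \<in> S" using M_S[OF N(1) b(1)] .
  obtain s m where s: "s \<in> S" "m \<in> M" "\<one> = s \<otimes> b \<oplus> m" using M_comax[OF M bS b(2)] by blast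
  have c: "e \<in> carrier K" "s \<in> carrier K" "b \<in> carrier K" "m \<in> carrier K"
    using e s bS M_S[OF M] by auto
  have m: "m = \<one> \<ominus> s \<otimes> b" unfolding s(3) using c by algebra
  have "e \<otimes> (s \<otimes> b) \<ominus> \<one> = (e \<ominus> \<one>) \<ominus> e \<otimes> m" unfolding m using c by algebra
  then have 1: "e \<otimes> (s \<otimes> b) \<ominus> \<one> \<in> M"
    using M_minus[OF M e(2) M_smult[OF M e(1) s(2)]] by simp
  have 2: "e \<otimes> (s \<otimes> b) \<in> N" using M_smult[OF N(1) e(1) M_smult[OF N(1) s(1) b(1)]] .
  have 3: "e \<otimes> (s \<otimes> b) \<in> L" if L: "L \<in> Z" for L
    using M_smult2[of L e "s \<otimes> b"] e(3) L insert.prems s(1) bS S_closed(4) by auto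
  have "e \<otimes> (s \<otimes> b) \<in> S" using e s bS S_closed by simp
  then show ?case using 1 2 3 by blast
qed

lemma finprod_maxid:
  assumes M: "maxid M" and A: "finite A" "\<And>i. i \<in> A \<Longrightarrow> g i \<in> S"
  shows "finprod K g A \<in> S \<and> (finprod K g A \<in> M \<longleftrightarrow> (\<exists>i \<in> A. g i \<in> M))"
  using A
proof (induction A rule: finite_induct)
  case empty
  then show ?case using S_closed M_one[OF M] by simp
next
  case (insert i A)
  have g: "g \<in> A \<rightarrow> carrier K" "g i \<in> carrier K" using insert.prems by auto
  have e: "finprod K g (insert i A) = g i \<otimes> finprod K g A"
    using finprod_insert[OF insert(1,2) g] .
  have S: "finprod K g A \<in> S" "g i \<in> S" "finprod K g A \<in> M \<longleftrightarrow> (\<exists>i \<in> A. g i \<in> M)"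
    using insert by auto
  show ?case unfolding e
    using S S_closed(4) M_prime[OF M S(2,1)] M_smult[OF M S(2), of "finprod K g A"]
      M_smult2[OF M, of "g i" "finprod K g A"] by auto
qed

text \<open>V is integrally closed: x is a quotient of elements of V, so x or its inverse is in V,
  and in the second case \<open>integral_in_V\<close> applies.\<close>

lemma fixed_S:
  assumes "x \<in> S" "\<And>\<sigma>. \<sigma> \<in> carrier G \<Longrightarrow> \<sigma> x = x" shows "x \<in> V"
proof -
  obtain a b where ab: "a \<in> V" "b \<in> V" "b \<noteq> \<zero>" "x = a \<otimes> inv b" using fixed[of x] assms by auto
  show ?thesis
  proof (cases "a = \<zero>")
    case True
    then show ?thesis using ab subringE(2)[OF V] by simp
  next
    case False
    obtain n :: nat and u where u: "u \<in> V" "u \<noteq> \<zero>" "inv u \<in> V" "a = \<pi> [^] n \<otimes> u"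
      using dvr ab(1) False by blast
    obtain m :: nat and w where w: "w \<in> V" "w \<noteq> \<zero>" "inv w \<in> V" "b = \<pi> [^] m \<otimes> w"
      using dvr ab(2,3) by blast
    have piV: "\<pi> [^] (i::nat) \<in> V" for i using pi(1) subringE(3,6)[OF V] by (induction i) auto
    have c: "u \<in> carrier K" "w \<in> carrier K" "\<pi> \<in> carrier K" using u w pi by auto
    have p: "\<pi> [^] (i::nat) \<in> carrier K" "\<pi> [^] (i::nat) \<noteq> \<zero>" for i
      using c pi(2) by (induction i) auto
    show ?thesis
    proof (cases "m \<le> n")
      case True
      then obtain k where k: "n = m + k" using le_Suc_ex by blast
      have "x = (\<pi> [^] m \<otimes> \<pi> [^] k \<otimes> u) \<otimes> (inv (\<pi> [^] m) \<otimes> inv w)"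
        unfolding ab(4) u(4) w(4) k using c p w by (simp add: inv_mult_nonzero nat_pow_mult)
      also have "\<dots> = (\<pi> [^] m \<otimes> inv (\<pi> [^] m)) \<otimes> (\<pi> [^] k \<otimes> u \<otimes> inv w)"
        using c p[of m] p[of k] w inv_nonzero_closed[OF p[of m]] inv_nonzero_closed[OF c(2) w(2)] by algebra
      also have "\<dots> = \<pi> [^] k \<otimes> u \<otimes> inv w" using c p w by simp
      finally show ?thesis using piV u w subringE(6)[OF V] by simp
    next
      case False
      then obtain k where k: "m = n + k" using le_Suc_ex by (metis nat_le_linear)
      have ix: "inv x = inv a \<otimes> b" using ab False \<open>a \<noteq> \<zero>\<close> by (simp add: inv_mult_nonzero inv_inv_nonzero)
      have "inv x = (inv (\<pi> [^] n) \<otimes> inv u) \<otimes> (\<pi> [^] n \<otimes> \<pi> [^] k \<otimes> w)"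
        unfolding ix u(4) w(4) k using c p u by (simp add: inv_mult_nonzero nat_pow_mult)
      also have "\<dots> = (\<pi> [^] n \<otimes> inv (\<pi> [^] n)) \<otimes> (\<pi> [^] k \<otimes> w \<otimes> inv u)"
        using c p[of n] p[of k] u inv_nonzero_closed[OF p[of n]] inv_nonzero_closed[OF c(1) u(2)] by algebra
      also have "\<dots> = \<pi> [^] k \<otimes> w \<otimes> inv u" using c p u by simp
      finally have "inv x \<in> V" using piV u w subringE(6)[OF V] by simp
      then show ?thesis using integral_in_V assms(1) by blast
    qed
  qed
qed

lemma act_finprod: "\<sigma> \<in> carrier G \<Longrightarrow> h \<in> A \<rightarrow> carrier K \<Longrightarrow> \<sigma> (finprod K h A) = finprod K (\<lambda>i. \<sigma> (h i)) A"
  using ring_hom_cring.hom_finprod[OF hom_cring, of \<sigma> h A] by (simp add: o_def)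

text \<open>An element of \<open>M\<close> outside all conjugates of \<open>N\<close> would have its norm in \<open>M \<inter> V = \<pi>V \<subseteq> N\<close>.\<close>

lemma maxid_transitive:
  assumes M: "maxid M" and N: "maxid N"
  shows "\<exists>\<sigma> \<in> carrier G. M = \<sigma> ` N"
proof (rule ccontr)
  assume n: "\<not> (\<exists>\<sigma> \<in> carrier G. M = \<sigma> ` N)"
  let ?Z = "(\<lambda>\<sigma>. \<sigma> ` N) ` carrier G"
  have "\<forall>L \<in> ?Z. maxid L \<and> L \<noteq> M" using maxid_image[OF _ N] n by auto
  then obtain e where e: "e \<in> S" "e \<ominus> \<one> \<in> M" "\<forall>L \<in> ?Z. e \<in> L"
    using crt[OF M, of ?Z] fin by auto
  have ec: "e \<in> carrier K" using e by simp
  let ?x = "\<one> \<ominus> e"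
  have xS: "?x \<in> S" using e(1) S_closed by (simp add: a_minus_def)
  have "?x = \<ominus> (e \<ominus> \<one>)" using ec by algebra
  then have xM: "?x \<in> M" using M_neg[OF M e(2)] by simp
  have xN: "?x \<notin> \<sigma> ` N" if \<sigma>: "\<sigma> \<in> carrier G" for \<sigma>
  proof
    assume "?x \<in> \<sigma> ` N"
    moreover have "e \<in> \<sigma> ` N" using e(3) \<sigma> by blast
    ultimately have "?x \<oplus> e \<in> \<sigma> ` N" by (rule M_add[OF maxid_image[OF \<sigma> N]])
    moreover have "?x \<oplus> e = \<one>" using ec by algebra
    ultimately show False using M_one[OF maxid_image[OF \<sigma> N]] by simp
  qed
  let ?n = "finprod K (\<lambda>\<sigma>. \<sigma> ?x) (carrier G)"
  have prod: "?n \<in> S" "?n \<in> M \<longleftrightarrow> (\<exists>\<sigma> \<in> carrier G. \<sigma> ?x \<in> M)" "?n \<in> N \<longleftrightarrow> (\<exists>\<sigma> \<in> carrier G. \<sigma> ?x \<in> N)"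
    using finprod_maxid[OF M fin, of "\<lambda>\<sigma>. \<sigma> ?x"] finprod_maxid[OF N fin, of "\<lambda>\<sigma>. \<sigma> ?x"] xS by auto
  have "\<one>\<^bsub>G\<^esub> ?x = ?x" using xS by simp
  then have nM: "?n \<in> M" using prod(2) xM G.one_closed by metis
  have "\<tau> ?n = ?n" if \<tau>: "\<tau> \<in> carrier G" for \<tau>
  proof -
    have "\<tau> ?n = finprod K (\<lambda>\<sigma>. \<tau> (\<sigma> ?x)) (carrier G)"
      by (rule act_finprod[OF \<tau>]) (use xS in auto)
    also have "\<dots> = finprod K (\<lambda>\<sigma>. (\<tau> \<bullet> \<sigma>) ?x) (carrier G)"
      by (rule finprod_cong') (use xS \<tau> in \<open>auto simp: act_mult\<close>)
    also have "\<dots> = finprod K (\<lambda>\<sigma>. \<sigma> ?x) ((\<lambda>\<sigma>. \<tau> \<bullet> \<sigma>) ` carrier G)"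
      by (rule finprod_reindex[symmetric]) (use xS \<tau> in \<open>auto simp: inj_on_def\<close>)
    also have "(\<lambda>\<sigma>. \<tau> \<bullet> \<sigma>) ` carrier G = carrier G"
      using G.surj_const_mult[OF \<tau>] by simp
    finally show ?thesis .
  qed
  then have "?n \<in> V" using fixed_S[OF prod(1)] by blast
  then obtain w where "w \<in> V" "?n = w \<otimes> \<pi>" using V_M[OF M _ nM] by blast
  then have "?n \<in> N" using M_smult[OF N V_S pi_M[OF N]] by simp
  then obtain \<sigma> where \<sigma>: "\<sigma> \<in> carrier G" "\<sigma> ?x \<in> N" using prod(3) by blast
  then have "?x = (\<iota> \<sigma>) (\<sigma> ?x)" using xS by simp
  then have "?x \<in> (\<iota> \<sigma>) ` N" using \<sigma>(2) by blast
  then show False using xN[of "\<iota> \<sigma>"] \<sigma>(1) by simp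
qed

lemma exists_maxid_above:
  assumes I: "ideal I RS" "\<one> \<notin> I" shows "\<exists>M. maxid M \<and> I \<subseteq> M"
proof -
  interpret RS: domain RS by (rule RS_domain)
  show ?thesis using RS.exists_maximalideal[OF I(1)] I(2) maximalideal_iff by simp
qed

lemma exists_maxid: "\<exists>M. maxid M"
proof -
  interpret RS: domain RS by (rule RS_domain)
  show ?thesis using exists_maxid_above[OF RS.zeroideal] by auto
qed

lemma finite_maxid: "finite {M. maxid M}"
proof -
  obtain N where N: "maxid N" using exists_maxid by blast
  have "{M. maxid M} \<subseteq> (\<lambda>\<sigma>. \<sigma> ` N) ` carrier G" using maxid_transitive[OF _ N] by blast
  then show ?thesis using fin finite_subset by blast
qed

text \<open>The denominators of \<open>x\<close> form an ideal that is contained in no maximal ideal.\<close>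

lemma S_eq_loc: "x \<in> S \<longleftrightarrow> x \<in> carrier K \<and> (\<forall>M. maxid M \<longrightarrow> x \<in> loc M)"
proof
  assume "x \<in> S"
  then show "x \<in> carrier K \<and> (\<forall>M. maxid M \<longrightarrow> x \<in> loc M)" using S_loc by auto
next
  assume x: "x \<in> carrier K \<and> (\<forall>M. maxid M \<longrightarrow> x \<in> loc M)"
  interpret RS: domain RS by (rule RS_domain)
  let ?I = "{s \<in> S. x \<otimes> s \<in> S}"
  have neg: "\<ominus>\<^bsub>RS\<^esub> s \<in> ?I" if s: "s \<in> ?I" for s
  proof -
    have m: "\<ominus>\<^bsub>RS\<^esub> \<one>\<^bsub>RS\<^esub> \<in> S" "\<ominus>\<^bsub>RS\<^esub> s = (\<ominus>\<^bsub>RS\<^esub> \<one>\<^bsub>RS\<^esub>) \<otimes> s"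
      using RS.a_inv_closed[of "\<one>\<^bsub>RS\<^esub>"] RS.l_minus[of "\<one>\<^bsub>RS\<^esub>" s] s S_closed by simp_all
    have "x \<otimes> (\<ominus>\<^bsub>RS\<^esub> s) = (\<ominus>\<^bsub>RS\<^esub> \<one>\<^bsub>RS\<^esub>) \<otimes> (x \<otimes> s)"
      unfolding m(2) using x m(1) s m_lcomm S_carrier by simp
    then show ?thesis using m s S_closed(4) by auto
  qed
  have I: "ideal ?I RS"
  proof (rule idealI)
    show "ring RS" by (rule RS.ring_axioms)
    show "subgroup ?I (add_monoid RS)"
    proof (rule RS.add.subgroupI)
      show "?I \<noteq> {}" using S_closed(1) x by (auto intro!: exI[of _ \<zero>])
      show "\<ominus>\<^bsub>RS\<^esub> s \<in> ?I" if "s \<in> ?I" for s by (rule neg[OF that])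
      show "a \<oplus>\<^bsub>RS\<^esub> b \<in> ?I" if "a \<in> ?I" "b \<in> ?I" for a b
        using that x S_closed by (auto simp: r_distr)
    qed auto
    show "s \<otimes>\<^bsub>RS\<^esub> a \<in> ?I" if "a \<in> ?I" "s \<in> carrier RS" for a s
      using that x S_closed(4) m_lcomm[of x s a] by auto
    show "a \<otimes>\<^bsub>RS\<^esub> s \<in> ?I" if "a \<in> ?I" "s \<in> carrier RS" for a s
      using that x S_closed(4)[of a s] S_closed(4)[of "x \<otimes> a" s] m_assoc[of x a s] by auto
  qed
  have "\<one> \<in> ?I"
  proof (rule ccontr)
    assume "\<one> \<notin> ?I"
    then obtain M where M: "maxid M" "?I \<subseteq> M" using exists_maxid_above[OF I] by blast
    then have "x \<in> loc M" using x by blast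
    then obtain b where "b \<in> S" "b \<notin> M" "x \<otimes> b \<in> S" by (auto simp: loc_def)
    then show False using M(2) by blast
  qed
  then show "x \<in> S" using x by simp
qed

text \<open>The n-th power of an element from \<open>crt\<close> stays 1 modulo M, and each of its n
  factors contributes at least 1 to the valuation at every other place.\<close>

lemma approximation:
  assumes M: "maxid M"
  shows "\<exists>e \<in> S. (e = \<one> \<or> 1 \<le> v M (e \<ominus> \<one>)) \<and>
    (\<forall>N \<in> {N. maxid N} - {M}. e = \<zero> \<or> int n \<le> v N e)"
proof -
  have fin': "finite ({N. maxid N} - {M})" using finite_maxid by simp
  have Z: "\<forall>N \<in> {N. maxid N} - {M}. maxid N \<and> N \<noteq> M" by simp
  obtain e where e: "e \<in> S" "e \<ominus> \<one> \<in> M" "\<forall>N \<in> {N. maxid N} - {M}. e \<in> N"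
    using crt[OF M fin' Z] by blast
  have ec: "e \<in> carrier K" using e by simp
  have p: "e [^] (k::nat) \<in> S" for k using S_pow[OF e(1)] .
  have 1: "e [^] (k::nat) \<ominus> \<one> \<in> M" for k
  proof (induction k)
    case 0
    then show ?case using M_zero[OF M] by (simp add: a_minus_def r_neg)
  next
    case (Suc k)
    have "e [^] Suc k \<ominus> \<one> = e \<otimes> (e [^] k \<ominus> \<one>) \<oplus> (e \<ominus> \<one>)"
      unfolding nat_pow_Suc using ec nat_pow_closed[OF ec, of k] by algebra
    then show ?case using M_add[OF M M_smult[OF M e(1) Suc] e(2)] by simp
  qed
  have 2: "e [^] n = \<one> \<or> 1 \<le> v M (e [^] n \<ominus> \<one>)"
  proof (cases "e [^] n = \<one>")
    case False
    have "e [^] n \<ominus> \<one> \<noteq> \<zero>" using False ec by (metis nat_pow_closed one_closed r_right_minus_eq)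
    then show ?thesis using v_pos_iff[OF M _ _] 1[of n] M_S[OF M] by blast
  qed simp
  have 3: "e [^] n = \<zero> \<or> int n \<le> v N (e [^] n)" if N: "maxid N" "N \<noteq> M" for N
  proof -
    interpret U: uniformized K "loc N" \<pi> by (rule uniformized_loc[OF N(1) N(1)])
    have one: "v N \<one> = 0" using U.val_mult[of \<one> \<one>] by simp
    show ?thesis
    proof (cases "e = \<zero>")
      case True
      then show ?thesis using one by (cases n) auto
    next
      case False
      have "1 \<le> v N e" using v_pos_iff[OF N(1) e(1) False] e(3) N by blast
      moreover have "e [^] k \<noteq> \<zero> \<and> v N (e [^] k) = int k * v N e" for k :: nat
        using False ec one by (induction k) (auto simp: U.val_mult algebra_simps)
      ultimately have "int n * 1 \<le> v N (e [^] n)" using mult_left_mono[of 1 "v N e" "int n"] by simp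
      then show ?thesis by simp
    qed
  qed
  show ?thesis using p 2 3 by (intro bexI[of _ "e [^] n"]) auto
qed

text \<open>Links the valuations of the main argument with the ideal powers of the theorem. If the
  valuation is at least 2, then s = \<pi>^2 w with w in \<open>loc M\<close>, and
  \<open>M_square_cancel\<close> removes the denominator of w. Conversely,
  \<open>M_pow_power\<close> writes s as t^2 w with t in M.\<close>

lemma v_square_iff:
  assumes M: "maxid M" and s: "s \<in> S" "s \<noteq> \<zero>"
  shows "2 \<le> v M s \<longleftrightarrow> s \<in> M [^]\<^bsub>ideals_set RS\<^esub> (2::nat)"
proof -
  interpret U: uniformized K "loc M" \<pi> by (rule uniformized_loc[OF M M])
  have c: "s \<in> carrier K" "\<pi> \<in> carrier K" "inv \<pi> \<in> carrier K" using s pi by auto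
  show ?thesis
  proof
    assume le: "2 \<le> v M s"
    have sM: "s \<in> M" using v_pos_iff[OF M s] le by simp
    have "\<exists>w. w \<in> carrier K \<and> s = \<pi> \<otimes> (\<pi> \<otimes> w)"
    proof (intro exI conjI)
      show "s \<otimes> inv \<pi> \<otimes> inv \<pi> \<in> carrier K" using c by simp
      have "\<pi> \<otimes> (\<pi> \<otimes> (s \<otimes> inv \<pi> \<otimes> inv \<pi>)) = (\<pi> \<otimes> inv \<pi>) \<otimes> (\<pi> \<otimes> inv \<pi>) \<otimes> s" using c by algebra
      then show "s = \<pi> \<otimes> (\<pi> \<otimes> (s \<otimes> inv \<pi> \<otimes> inv \<pi>))" using c(1,2) pi(2) by simp
    qed
    then obtain w where w: "w \<in> carrier K" "s = \<pi> \<otimes> (\<pi> \<otimes> w)" by blast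
    have w0: "w \<noteq> \<zero>" using s(2) w(2) c(2) by auto
    have pw: "\<pi> \<otimes> w \<in> carrier K" "\<pi> \<otimes> w \<noteq> \<zero>" using c(2) w(1) w0 pi(2) by simp_all
    have "v M s = v M \<pi> + (v M \<pi> + v M w)"
      unfolding w(2) by (simp only: U.val_mult[OF c(2) pi(2) pw] U.val_mult[OF c(2) pi(2) w(1) w0])
    then have "w \<in> loc M" using U.val_nonneg_iff[OF w(1) w0] U.val_pi le by simp
    then obtain b where b: "b \<in> S" "b \<notin> M" "w \<otimes> b \<in> S" unfolding loc_def by blast
    have "s \<otimes> b = \<pi> \<otimes> (\<pi> \<otimes> (w \<otimes> b))"
      unfolding w(2) using c(2) w(1) S_carrier[OF b(1)] by (simp only: m_assoc m_closed)
    then have "s \<otimes> b \<in> M [^]\<^bsub>ideals_set RS\<^esub> (2::nat)"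
      using M_square_prod[OF M pi_M[OF M] M_smult2[OF M pi_M[OF M] b(3)]] by simp
    then show "s \<in> M [^]\<^bsub>ideals_set RS\<^esub> (2::nat)" using M_square_cancel[OF M sM b(1,2)] by blast
  next
    assume "s \<in> M [^]\<^bsub>ideals_set RS\<^esub> (2::nat)"
    then obtain t w where t: "t \<in> M" "w \<in> loc M" "s = t [^] (2::nat) \<otimes> w" using M_pow_power[OF M] by blast
    have tc: "t \<in> carrier K" "w \<in> carrier K" "t \<in> S" using t M_S[OF M] by auto
    have s2: "s = t \<otimes> (t \<otimes> w)" using t(3) tc by (simp add: numeral_2_eq_2 m_assoc)
    then have nz: "t \<noteq> \<zero>" "w \<noteq> \<zero>" using s tc by auto
    have "v M s = v M t + (v M t + v M w)"
      unfolding s2 using U.val_mult[of t "t \<otimes> w"] U.val_mult[of t w] tc nz by simp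
    moreover have "1 \<le> v M t" using v_pos_iff[OF M tc(3) nz(1)] t(1) by simp
    moreover have "0 \<le> v M w" using U.val_nonneg_iff[OF tc(2) nz(2)] t(2) by simp
    ultimately show "2 \<le> v M s" by simp
  qed
qed

end

section \<open>Separable residue fields\<close>

text \<open>\<open>poly_slope p x y\<close> is \<open>(p(y) - p(x)) / (y - x)\<close>, computed without division; on the diagonal it is the
  derivative.\<close>

primrec (in ring) power_slope :: "nat \<Rightarrow> 'a \<Rightarrow> 'a \<Rightarrow> 'a" where
  "power_slope 0 x y = \<zero>"
| "power_slope (Suc n) x y = x [^] n \<oplus> y \<otimes> power_slope n x y"

primrec (in ring) poly_slope :: "'a list \<Rightarrow> 'a \<Rightarrow> 'a \<Rightarrow> 'a" where
  "poly_slope [] x y = \<zero>"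
| "poly_slope (a # p) x y = a \<otimes> power_slope (length p) x y \<oplus> poly_slope p x y"

lemma (in ring) power_slope_closed [simp]:
  "x \<in> carrier R \<Longrightarrow> y \<in> carrier R \<Longrightarrow> power_slope n x y \<in> carrier R"
  by (induction n) auto

lemma (in ring) poly_slope_closed [simp]:
  "set p \<subseteq> carrier R \<Longrightarrow> x \<in> carrier R \<Longrightarrow> y \<in> carrier R \<Longrightarrow> poly_slope p x y \<in> carrier R"
  by (induction p) auto

lemma (in cring) pow_diff:
  assumes "x \<in> carrier R" "y \<in> carrier R"
  shows "y [^] (n::nat) \<ominus> x [^] n = (y \<ominus> x) \<otimes> power_slope n x y"
proof (induction n)
  case 0
  then show ?case using assms by (simp add: a_minus_def r_neg)
next
  case (Suc n)
  have c: "x [^] n \<in> carrier R" "y [^] n \<in> carrier R" "power_slope n x y \<in> carrier R" using assms by auto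
  have "y [^] Suc n \<ominus> x [^] Suc n = (y \<ominus> x) \<otimes> x [^] n \<oplus> y \<otimes> (y [^] n \<ominus> x [^] n)"
    unfolding nat_pow_Suc using assms c by algebra
  also have "\<dots> = (y \<ominus> x) \<otimes> (x [^] n \<oplus> y \<otimes> power_slope n x y)" unfolding Suc using assms c by algebra
  finally show ?case by simp
qed

lemma (in cring) eval_diff:
  assumes "set p \<subseteq> carrier R" "x \<in> carrier R" "y \<in> carrier R"
  shows "eval p y \<ominus> eval p x = (y \<ominus> x) \<otimes> poly_slope p x y"
  using assms(1)
proof (induction p)
  case Nil
  then show ?case using assms by (simp add: a_minus_def r_neg)
next
  case (Cons a p)
  have p: "set p \<subseteq> carrier R" and a: "a \<in> carrier R" using Cons.prems by auto
  have c: "x [^] length p \<in> carrier R" "y [^] length p \<in> carrier R" "power_slope (length p) x y \<in> carrier R"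
    "poly_slope p x y \<in> carrier R" "eval p x \<in> carrier R" "eval p y \<in> carrier R"
    using assms p eval_in_carrier[OF p] by auto
  have "eval (a # p) y \<ominus> eval (a # p) x
      = a \<otimes> (y [^] length p \<ominus> x [^] length p) \<oplus> (eval p y \<ominus> eval p x)"
    using a c by simp algebra
  also have "\<dots> = (y \<ominus> x) \<otimes> (a \<otimes> power_slope (length p) x y \<oplus> poly_slope p x y)"
    unfolding Cons.IH[OF p] pow_diff[OF assms(2,3)] using a c assms(2,3) by algebra
  finally show ?case by simp
qed

lemma (in cring) power_slope_diag:
  "x \<in> carrier R \<Longrightarrow> power_slope (Suc n) x x = add_pow R (Suc n) (x [^] n)"
proof (induction n)
  case (Suc n)
  have c: "add_pow R k (x [^] n) \<in> carrier R" "x [^] n \<in> carrier R" for k :: nat using Suc.prems by auto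
  have "power_slope (Suc (Suc n)) x x = x [^] Suc n \<oplus> x \<otimes> add_pow R (Suc n) (x [^] n)"
    using Suc by simp
  also have "x \<otimes> add_pow R (Suc n) (x [^] n) = add_pow R (Suc n) (x [^] Suc n)"
    using Suc.prems c by (simp add: add_pow_rdistr m_comm del: add.nat_pow_Suc)
  also have "x [^] Suc n \<oplus> \<dots> = add_pow R (Suc (Suc n)) (x [^] Suc n)"
    using Suc.prems a_comm by (simp del: nat_pow_Suc)
  finally show ?case .
qed simp

lemma (in cring) eval_poly_deriv:
  assumes p: "set p \<subseteq> carrier R" and x: "x \<in> carrier R"
  shows "eval (poly_deriv p) x = poly_slope p x x"
proof -
  let ?L = "\<lambda>p. map (\<lambda>i. add_pow R i (coeff p i)) (rev [1..<length p])"
  have L: "set (?L p) \<subseteq> carrier R" using p by auto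
  have "eval (?L p) x = poly_slope p x x"
    using p
  proof (induction p)
    case (Cons a p)
    have pc: "set p \<subseteq> carrier R" "a \<in> carrier R" using Cons.prems by auto
    show ?case
    proof (cases p)
      case Nil
      then show ?thesis using pc by simp
    next
      case (Cons b q)
      then obtain n where n: "length p = Suc n" by simp
      have "?L (a # p) = add_pow R (Suc n) a # map (\<lambda>i. add_pow R i (coeff (a # p) i)) (rev [1..<Suc n])"
        using n by (simp del: add.nat_pow_Suc)
      also have "map (\<lambda>i. add_pow R i (coeff (a # p) i)) (rev [1..<Suc n]) = ?L p"
        unfolding n by (rule map_cong) (use n in auto)
      finally have L': "?L (a # p) = add_pow R (Suc n) a # ?L p" .
      have gen: "eval (b # l) x = b \<otimes> x [^] length l \<oplus> eval l x" for b l by simp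
      have len: "length (?L p) = n" by (simp add: n)
      have "eval (?L (a # p)) x = add_pow R (Suc n) a \<otimes> x [^] n \<oplus> eval (?L p) x"
        unfolding L' gen len ..
      also have "add_pow R (Suc n) a \<otimes> x [^] n = a \<otimes> power_slope (length p) x x"
        unfolding n power_slope_diag[OF x]
        using pc x by (simp add: add_pow_ldistr add_pow_rdistr del: add.nat_pow_Suc)
      finally show ?thesis using Cons.IH[OF pc(1)] by simp
    qed
  qed simp
  then show ?thesis unfolding poly_deriv_def using eval_normalize[OF L x] by simp
qed

text \<open>Otherwise the minimal polynomial would divide its own derivative and be a common divisor
  of both, which separability makes a unit.\<close>

lemma (in domain) eval_poly_deriv_Irr:
  assumes k: "subfield k R" and x: "x \<in> carrier R" "(algebraic over k) x"
    and sep: "separable_poly k (Irr k x)"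
  shows "eval (poly_deriv (Irr k x)) x \<noteq> \<zero>"
proof
  assume z: "eval (poly_deriv (Irr k x)) x = \<zero>"
  let ?p = "Irr k x"
  note Irr = IrrE[OF k x]
  have ks: "subring k R" using subfieldE(1)[OF k] .
  interpret UP: domain "univ_poly R k" by (rule univ_poly_is_domain[OF ks])
  have pk: "set ?p \<subseteq> k" using Irr(1) by (auto simp: univ_poly_carrier[symmetric] polynomial_def)
  have coeffk: "coeff p i \<in> k" if "set p \<subseteq> k" for p i
    using that by (induction p) (auto intro: subringE(2)[OF ks])
  have "add_pow R (n::nat) a \<in> k" if "a \<in> k" for n a
    using that by (induction n) (auto intro: subringE(2,7)[OF ks])
  then have "set (map (\<lambda>i. add_pow R i (coeff ?p i)) (rev [1..<length ?p])) \<subseteq> k"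
    using coeffk[OF pk] by auto
  then have d: "poly_deriv ?p \<in> carrier (univ_poly R k)"
    unfolding poly_deriv_def univ_poly_carrier[symmetric] by (rule normalize_gives_polynomial)
  have "?p divides\<^bsub>univ_poly R k\<^esub> poly_deriv ?p"
    using Irr_minimal[OF k x d z] pdivides_iff_shell[OF k Irr(1) d] by simp
  moreover have "?p divides\<^bsub>univ_poly R k\<^esub> ?p" using Irr(1) by (rule UP.divides_refl)
  ultimately have "?p \<in> Units (univ_poly R k)" using sep Irr(1) unfolding separable_poly_def by blast
  then show False using UP.ring_irreducibleE(4)[OF Irr(1,2)] by simp
qed

text \<open>The residue map is defined on \<open>S\<close> alone while polynomials are evaluated in
  \<open>K\<close>, so \<open>h\<close> is a homomorphism on a subring \<open>A\<close>. With
  \<open>A\<close> the whole field the same rules serve for automorphisms.\<close>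

context
  fixes R (structure) and Q and A h
  assumes R: "ring R" and Q: "ring Q" and A: "subring A R" and h: "h \<in> ring_hom (R\<lparr>carrier := A\<rparr>) Q"
begin

interpretation ring R by (rule R)
interpretation Q: ring Q by (rule Q)

lemma hom_on:
  shows hom_on_closed: "a \<in> A \<Longrightarrow> h a \<in> carrier Q"
    and hom_on_mult: "a \<in> A \<Longrightarrow> b \<in> A \<Longrightarrow> h (a \<otimes> b) = h a \<otimes>\<^bsub>Q\<^esub> h b"
    and hom_on_add: "a \<in> A \<Longrightarrow> b \<in> A \<Longrightarrow> h (a \<oplus> b) = h a \<oplus>\<^bsub>Q\<^esub> h b"
    and hom_on_one: "h \<one> = \<one>\<^bsub>Q\<^esub>" and hom_on_zero: "h \<zero> = \<zero>\<^bsub>Q\<^esub>"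
  using ring_hom_closed[OF h] ring_hom_mult[OF h] ring_hom_add[OF h] ring_hom_one[OF h]
    ring_hom_zero[OF h subring_is_ring[OF A] Q] by simp_all

lemma subring_pow: "x \<in> A \<Longrightarrow> x [^] (n::nat) \<in> A"
  by (induction n) (auto intro: subringE(3,6)[OF A])

lemma subring_eval: "set p \<subseteq> A \<Longrightarrow> x \<in> A \<Longrightarrow> eval p x \<in> A"
  by (induction p) (auto intro: subringE(2,6,7)[OF A] subring_pow)

lemma subring_power_slope: "x \<in> A \<Longrightarrow> y \<in> A \<Longrightarrow> power_slope n x y \<in> A"
  by (induction n) (auto intro: subringE(2,6,7)[OF A] subring_pow)

lemma subring_poly_slope: "set p \<subseteq> A \<Longrightarrow> x \<in> A \<Longrightarrow> y \<in> A \<Longrightarrow> poly_slope p x y \<in> A"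
  by (induction p) (auto intro: subringE(2,6,7)[OF A] subring_power_slope)

lemma hom_on_pow: "x \<in> A \<Longrightarrow> h (x [^] (n::nat)) = h x [^]\<^bsub>Q\<^esub> n"
  by (induction n) (simp_all add: hom_on_one hom_on_mult subring_pow)

lemma hom_on_eval: "set p \<subseteq> A \<Longrightarrow> x \<in> A \<Longrightarrow> h (eval p x) = Q.eval (map h p) (h x)"
  by (induction p)
    (simp_all add: hom_on_zero hom_on_add hom_on_mult hom_on_pow subring_pow subring_eval subringE(6)[OF A])

lemma hom_on_power_slope:
  "x \<in> A \<Longrightarrow> y \<in> A \<Longrightarrow> h (power_slope n x y) = Q.power_slope n (h x) (h y)"
  by (induction n)
    (simp_all add: hom_on_zero hom_on_add hom_on_mult hom_on_pow subring_pow subring_power_slope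
      subringE(6)[OF A])

lemma hom_on_poly_slope:
  "set p \<subseteq> A \<Longrightarrow> x \<in> A \<Longrightarrow> y \<in> A \<Longrightarrow> h (poly_slope p x y) = Q.poly_slope (map h p) (h x) (h y)"
  by (induction p)
    (simp_all add: hom_on_zero hom_on_add hom_on_mult hom_on_power_slope subring_power_slope
      subring_poly_slope subringE(6)[OF A])

end

context galois_dvr
begin

lemma S_poly_slope: "set p \<subseteq> S \<Longrightarrow> x \<in> S \<Longrightarrow> y \<in> S \<Longrightarrow> poly_slope p x y \<in> S"
proof -
  have pw: "x \<in> S \<Longrightarrow> y \<in> S \<Longrightarrow> power_slope n x y \<in> S" for n x y
    by (induction n) (auto intro: S_closed S_pow)
  show "set p \<subseteq> S \<Longrightarrow> x \<in> S \<Longrightarrow> y \<in> S \<Longrightarrow> poly_slope p x y \<in> S"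
    by (induction p) (auto intro: S_closed pw)
qed

text \<open>A lift to \<open>V\<close> of the minimal polynomial of the residue class of \<open>s\<close>.\<close>

lemma residue_polynomial:
  assumes M: "maxid M" and s: "s \<in> S"
  shows "\<exists>g. set g \<subseteq> V \<and> eval g s \<in> M \<and> (\<forall>t \<in> S. t \<ominus> s \<in> M \<longrightarrow> poly_slope g s t \<notin> M)"
proof -
  interpret RS: domain RS by (rule RS_domain)
  have M': "maximalideal M RS" using M maximalideal_iff by simp
  then have MI: "ideal M RS" by (rule maximalideal.axioms(1))
  let ?Q = "RS Quot M" and ?h = "\<lambda>a. M +>\<^bsub>RS\<^esub> a"
  interpret Q: field ?Q by (rule maximalideal.quotient_is_field[OF M' RS.is_cring])
  have h: "?h \<in> ring_hom RS ?Q" using ideal.rcos_ring_hom[OF MI] .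
  have R: "ring K" "ring ?Q" by (rule ring_axioms, rule Q.ring_axioms)
  note hS = R S_subring h
  have h0: "?h a = \<zero>\<^bsub>?Q\<^esub> \<longleftrightarrow> a \<in> M" if "a \<in> S" for a
    using ideal.rcos_const_imp_mem[OF MI, of a] RS.a_rcos_zero[OF MI, of a] that
    by (auto simp: FactRing_def)
  have hV: "?h v \<in> carrier ?Q" if "v \<in> V" for v using hom_on_closed[OF hS V_S[OF that]] .
  have one: "\<one> \<in> V" using subringE(3)[OF V] .
  have sub: "subring (?h ` V) ?Q"
  proof (rule Q.subringI)
    show "?h ` V \<subseteq> carrier ?Q" using hV by blast
    show "\<one>\<^bsub>?Q\<^esub> \<in> ?h ` V" using hom_on_one[OF hS] one by (metis imageI)
    have mult: "a \<otimes>\<^bsub>?Q\<^esub> b \<in> ?h ` V" if ab: "a \<in> ?h ` V" "b \<in> ?h ` V" for a b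
    proof -
      obtain v w where vw: "v \<in> V" "w \<in> V" "a = ?h v" "b = ?h w" using ab by blast
      then have "a \<otimes>\<^bsub>?Q\<^esub> b = ?h (v \<otimes> w)" using hom_on_mult[OF hS V_S V_S] by simp
      then show ?thesis using subringE(6)[OF V vw(1,2)] by blast
    qed
    then show "a \<otimes>\<^bsub>?Q\<^esub> b \<in> ?h ` V" if "a \<in> ?h ` V" "b \<in> ?h ` V" for a b using that .
    show "a \<oplus>\<^bsub>?Q\<^esub> b \<in> ?h ` V" if ab: "a \<in> ?h ` V" "b \<in> ?h ` V" for a b
    proof -
      obtain v w where vw: "v \<in> V" "w \<in> V" "a = ?h v" "b = ?h w" using ab by blast
      then have "a \<oplus>\<^bsub>?Q\<^esub> b = ?h (v \<oplus> w)" using hom_on_add[OF hS V_S V_S] by simp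
      then show ?thesis using subringE(7)[OF V vw(1,2)] by blast
    qed
    show "\<ominus>\<^bsub>?Q\<^esub> a \<in> ?h ` V" if a: "a \<in> ?h ` V" for a
    proof -
      obtain v where v: "v \<in> V" "a = ?h v" using a by blast
      have nv: "\<ominus> v \<in> V" using subringE(5)[OF V v(1)] .
      have "?h (\<ominus> v) \<oplus>\<^bsub>?Q\<^esub> ?h v = ?h (\<ominus> v \<oplus> v)"
        using hom_on_add[OF hS V_S[OF nv] V_S[OF v(1)]] by simp
      then have "?h (\<ominus> v) \<oplus>\<^bsub>?Q\<^esub> a = \<zero>\<^bsub>?Q\<^esub>"
        using v hom_on_zero[OF hS] by (simp add: l_neg)
      then have "\<ominus>\<^bsub>?Q\<^esub> a = ?h (\<ominus> v)" using Q.minus_equality hV nv v by simp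
      then show ?thesis using nv by blast
    qed
  qed
  have k: "subfield (?h ` V) ?Q"
  proof (rule Q.subfieldI'[OF sub])
    fix a assume "a \<in> ?h ` V - {\<zero>\<^bsub>?Q\<^esub>}"
    then obtain w where w: "w \<in> V" "a = ?h w" "?h w \<noteq> \<zero>\<^bsub>?Q\<^esub>" by blast
    then have wM: "w \<notin> M" using h0[OF V_S[OF w(1)]] by simp
    have iw: "w \<noteq> \<zero> \<and> inv w \<in> V"
    proof (rule ccontr)
      assume "\<not> (w \<noteq> \<zero> \<and> inv w \<in> V)"
      then obtain z where "z \<in> V" "w = z \<otimes> \<pi>" using nonunit_V[OF M w(1)] by blast
      then show False using wM M_smult[OF M V_S pi_M[OF M]] by simp
    qed
    have "?h w \<otimes>\<^bsub>?Q\<^esub> ?h (inv w) = ?h (w \<otimes> inv w)"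
      using hom_on_mult[OF hS V_S[OF w(1)] V_S[of "inv w"]] iw by simp
    then have "a \<otimes>\<^bsub>?Q\<^esub> ?h (inv w) = \<one>\<^bsub>?Q\<^esub>" using iw w V_carrier hom_on_one[OF hS] by simp
    then have "inv\<^bsub>?Q\<^esub> a = ?h (inv w)"
      using Q.comm_inv_char[of a "?h (inv w)"] w(2) hV[OF w(1)] hV[of "inv w"] iw by simp
    then show "inv\<^bsub>?Q\<^esub> a \<in> ?h ` V" using iw by blast
  qed
  let ?x = "?h s"
  have x: "?x \<in> carrier ?Q" using hom_on_closed[OF hS s] .
  have sep: "(Q.algebraic over (?h ` V)) ?x" "Q.separable_poly (?h ` V) (Q.Irr (?h ` V) ?x)"
    using residue_separable[OF M] x unfolding Q.separable_extension_def over_def by blast+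
  let ?p = "Q.Irr (?h ` V) ?x"
  note Irr = Q.IrrE[OF k x sep(1)]
  have "set ?p \<subseteq> ?h ` V" using Irr(1) by (auto simp: univ_poly_carrier[symmetric] polynomial_def)
  then have "?p \<in> map ?h ` lists V" by (metis in_listsI lists_image subset_iff)
  then obtain g where g: "set g \<subseteq> V" "?p = map ?h g" by (auto simp: lists_eq_set)
  have gS: "set g \<subseteq> S" using g(1) V_S by blast
  have pc: "set ?p \<subseteq> carrier ?Q" unfolding g(2) using g(1) hV by auto
  have "?h (eval g s) = \<zero>\<^bsub>?Q\<^esub>" using hom_on_eval[OF hS gS s] Irr(4) g(2) by simp
  then have 1: "eval g s \<in> M" using h0[OF subring_eval[OF hS gS s]] by simp
  have 2: "poly_slope g s t \<notin> M" if t: "t \<in> S" "t \<ominus> s \<in> M" for t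
  proof -
    have "t = (t \<ominus> s) \<oplus> s" using t(1) s by (metis S_carrier a_minus_def a_assoc a_inv_closed l_neg r_zero)
    then have "?h t = ?h (t \<ominus> s) \<oplus>\<^bsub>?Q\<^esub> ?x" using hom_on_add[OF hS M_S[OF M t(2)] s] by simp
    then have ht: "?h t = ?x" using h0[OF M_S[OF M t(2)]] t(2) x by simp
    \<comment> \<open>t and s have the same residue, so the slope reduces to a value on the
      diagonal, the derivative of a separable polynomial at its root.\<close>
    have "?h (poly_slope g s t) = Q.poly_slope ?p ?x ?x"
      using hom_on_poly_slope[OF hS gS s t(1)] ht g(2) by simp
    also have "\<dots> = Q.eval (Q.poly_deriv ?p) ?x" using Q.eval_poly_deriv[OF pc x] by simp
    also have "\<dots> \<noteq> \<zero>\<^bsub>?Q\<^esub>" by (rule Q.eval_poly_deriv_Irr[OF k x sep])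
    finally show ?thesis using h0[OF S_poly_slope[OF gS s t(1)]] by simp
  qed
  show ?thesis using g(1) 1 2 by blast
qed

text \<open>An automorphism that acts trivially on the residue field at \<open>M\<close> is congruent to the identity modulo all powers
  of \<open>\<pi>\<close>, by Newton's argument: if \<open>g(s) = \<pi> u\<close>, then \<open>g(\<sigma> s) - g(s) = \<pi> (\<sigma> u - u)\<close>, while the
  left-hand side is \<open>\<sigma> s - s\<close> up to a unit.\<close>

lemma inertia_congruence:
  assumes M: "maxid M" and \<sigma>: "\<sigma> \<in> carrier G" and fix_M: "\<sigma> ` M = M"
    and triv: "\<And>s. s \<in> S \<Longrightarrow> \<sigma> s \<ominus> s \<in> M"
  shows "s \<in> S \<Longrightarrow> \<exists>w \<in> loc M. \<sigma> s \<ominus> s = \<pi> [^] (n::nat) \<otimes> w"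
proof (induction n arbitrary: s)
  case 0
  then have "\<sigma> s \<ominus> s \<in> loc M" "\<sigma> s \<ominus> s \<in> carrier K" using triv M_S[OF M] S_loc[OF M] by auto
  then show ?case by (intro bexI[of _ "\<sigma> s \<ominus> s"]) simp_all
next
  case (Suc n)
  note lc = loc_closed[OF M]
  have loc_inv: "inv b \<in> loc M" if "b \<in> S" "b \<notin> M" for b
    using loc_inv_iff[OF M that(1)] that M_zero[OF M] by metis
  have pin: "\<pi> [^] n \<in> carrier K" "\<pi> \<in> carrier K" using pi by auto
  \<comment> \<open>The induction hypothesis concerns \<open>S\<close>, but is needed for
    \<open>?u\<close>, which is only known to be in \<open>loc M\<close>. It extends to a fraction
    (u b)/b because \<open>\<sigma> b\<close> is again a unit at M.\<close>
  have ext: "\<exists>w \<in> loc M. \<sigma> u \<ominus> u = \<pi> [^] n \<otimes> w" if u: "u \<in> loc M" for u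
  proof -
    obtain b where b: "b \<in> S" "b \<notin> M" "u \<otimes> b \<in> S" "u \<in> carrier K" using u unfolding loc_def by blast
    obtain w where w: "w \<in> loc M" "\<sigma> (u \<otimes> b) \<ominus> u \<otimes> b = \<pi> [^] n \<otimes> w" using Suc.IH[OF b(3)] by blast
    obtain z where z: "z \<in> loc M" "\<sigma> b \<ominus> b = \<pi> [^] n \<otimes> z" using Suc.IH[OF b(1)] by blast
    have sb: "\<sigma> b \<in> S" "\<sigma> b \<notin> M"
    proof -
      show "\<sigma> b \<in> S" using \<sigma> b by simp
      have "M \<subseteq> S" using M_S[OF M] by blast
      then show "\<sigma> b \<notin> M" using act_image[OF \<sigma> _ b(1), of M] fix_M b(2) by simp
    qed
    have nz: "\<sigma> b \<noteq> \<zero>" using sb M_zero[OF M] by metis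
    have c: "b \<in> carrier K" "\<sigma> b \<in> carrier K" "\<sigma> u \<in> carrier K" "w \<in> carrier K" "z \<in> carrier K"
      "inv (\<sigma> b) \<in> carrier K"
      using b sb w z nz loc_carrier[OF M] \<sigma> by auto
    have su: "\<sigma> (u \<otimes> b) = \<sigma> u \<otimes> \<sigma> b" using act_times[OF \<sigma> b(4) c(1)] .
    have "(\<sigma> u \<ominus> u) \<otimes> (\<sigma> b \<otimes> inv (\<sigma> b))
        = ((\<sigma> u \<otimes> \<sigma> b \<ominus> u \<otimes> b) \<ominus> u \<otimes> (\<sigma> b \<ominus> b)) \<otimes> inv (\<sigma> b)" using c b(4) by algebra
    also have "\<dots> = \<pi> [^] n \<otimes> ((w \<ominus> u \<otimes> z) \<otimes> inv (\<sigma> b))"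
      unfolding w(2)[unfolded su] z(2) using c b(4) pin by algebra
    finally have "\<sigma> u \<ominus> u = \<pi> [^] n \<otimes> ((w \<ominus> u \<otimes> z) \<otimes> inv (\<sigma> b))" using c b(4) nz by simp
    moreover have "(w \<ominus> u \<otimes> z) \<otimes> inv (\<sigma> b) \<in> loc M"
      unfolding a_minus_def by (intro lc(3,4,5) w(1) u z(1) loc_inv[OF sb])
    ultimately show ?thesis by blast
  qed
  have s: "s \<in> S" "\<sigma> s \<in> S" using Suc.prems \<sigma> by auto
  obtain g where g: "set g \<subseteq> V" "eval g s \<in> M" "\<forall>t \<in> S. t \<ominus> s \<in> M \<longrightarrow> poly_slope g s t \<notin> M"
    using residue_polynomial[OF M s(1)] by blast
  have gS: "set g \<subseteq> S" and gc: "set g \<subseteq> carrier K" using g(1) V_S V_carrier by blast+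
  let ?q = "poly_slope g s (\<sigma> s)" and ?u = "eval g s \<otimes> inv \<pi>"
  have q: "?q \<in> S" "?q \<notin> M" using S_poly_slope[OF gS s] g(3) s(2) triv[OF s(1)] by auto
  have qnz: "?q \<noteq> \<zero>" using q(2) M_zero[OF M] by metis
  have u: "?u \<in> loc M" by (rule loc_uniformizer[OF M ramification[OF M] g(2)])
  obtain w where w: "w \<in> loc M" "\<sigma> ?u \<ominus> ?u = \<pi> [^] n \<otimes> w" using ext[OF u] by blast
  have e: "eval g s \<in> carrier K" using M_S[OF M g(2)] by simp
  have c: "?u \<in> carrier K" "\<sigma> ?u \<in> carrier K" "w \<in> carrier K" "?q \<in> carrier K" "inv ?q \<in> carrier K"
    "s \<in> carrier K" "\<sigma> s \<in> carrier K"
    using loc_carrier[OF M u] loc_carrier[OF M w(1)] q(1) qnz s \<sigma> by auto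
  have eu: "eval g s = \<pi> \<otimes> ?u"
  proof -
    have "inv \<pi> \<in> carrier K" using pi(2) pin(2) by simp
    then have "\<pi> \<otimes> ?u = (\<pi> \<otimes> inv \<pi>) \<otimes> eval g s" using e pin(2) by algebra
    then show ?thesis using e pi(2) pin(2) by simp
  qed
  have "eval g (\<sigma> s) = \<sigma> (eval g s)" using act_eval[OF \<sigma> g(1) c(6)] by simp
  also have "\<dots> = \<pi> \<otimes> \<sigma> ?u" by (subst eu) (simp only: act_times[OF \<sigma> pin(2) c(1)] fixV[OF \<sigma> pi(1)])
  finally have "(\<sigma> s \<ominus> s) \<otimes> ?q = \<pi> \<otimes> \<sigma> ?u \<ominus> \<pi> \<otimes> ?u"
    using eval_diff[OF gc c(6,7)] eu by simp
  also have "\<dots> = \<pi> \<otimes> (\<sigma> ?u \<ominus> ?u)" using c(1,2) pin(2) by algebra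
  finally have "(\<sigma> s \<ominus> s) \<otimes> ?q = \<pi> \<otimes> (\<pi> [^] n \<otimes> w)" by (simp only: w(2))
  then have "(\<sigma> s \<ominus> s) \<otimes> ?q \<otimes> inv ?q = \<pi> \<otimes> (\<pi> [^] n \<otimes> w) \<otimes> inv ?q" by simp
  then have "\<sigma> s \<ominus> s = \<pi> [^] Suc n \<otimes> (w \<otimes> inv ?q)"
    using c(3-7) pin qnz by (simp add: m_ac)
  moreover have "w \<otimes> inv ?q \<in> loc M" by (rule lc(4)[OF w(1) loc_inv[OF q]])
  ultimately show ?case by blast
qed

text \<open>If \<sigma> fixed all residues, \<open>inertia_congruence\<close> would make \<sigma> s
  - s divisible by every power of \<pi>, hence zero. As K consists of elements of
  \<open>loc M\<close> and their inverses, \<sigma> would be the identity.\<close>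

lemma faithful_residue:
  assumes M: "maxid M" and \<sigma>: "\<sigma> \<in> carrier G" "\<sigma> \<noteq> \<one>\<^bsub>G\<^esub>" and fix_M: "\<sigma> ` M = M"
  shows "\<exists>s \<in> S. \<sigma> s \<noteq> s \<and> v M (\<sigma> s \<ominus> s) \<le> 0"
proof (rule ccontr)
  assume n: "\<not> (\<exists>s \<in> S. \<sigma> s \<noteq> s \<and> v M (\<sigma> s \<ominus> s) \<le> 0)"
  interpret U: uniformized K "loc M" \<pi> by (rule uniformized_loc[OF M M])
  have triv: "\<sigma> s \<ominus> s \<in> M" if s: "s \<in> S" for s
  proof (cases "\<sigma> s = s")
    case True
    then show ?thesis using s M_zero[OF M] by (simp add: a_minus_def r_neg)
  next
    case False
    then have "\<not> v M (\<sigma> s \<ominus> s) \<le> 0" using n s by blast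
    moreover have "\<sigma> s \<ominus> s \<in> S" using S_closed(5)[OF act_S[OF \<sigma>(1) s] S_closed(3)[OF s]]
      by (simp add: a_minus_def)
    moreover have "\<sigma> s \<ominus> s \<noteq> \<zero>" using False s \<sigma> by simp
    ultimately show ?thesis using v_pos_iff[OF M, of "\<sigma> s \<ominus> s"] by simp
  qed
  have fix_S: "\<sigma> s = s" if s: "s \<in> S" for s
  proof (rule ccontr)
    assume "\<sigma> s \<noteq> s"
    then have y: "\<sigma> s \<ominus> s \<in> carrier K" "\<sigma> s \<ominus> s \<noteq> \<zero>" using s \<sigma> by auto
    obtain m n :: nat and u where u: "u \<in> loc M" "u \<noteq> \<zero>" "inv u \<in> loc M"
      "\<pi> [^] n \<otimes> (\<sigma> s \<ominus> s) = \<pi> [^] m \<otimes> u" using U.rep[OF y] by blast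
    obtain w where w: "w \<in> loc M" "\<sigma> s \<ominus> s = \<pi> [^] Suc m \<otimes> w"
      using inertia_congruence[OF M \<sigma>(1) fix_M triv s] by blast
    have wc: "w \<in> carrier K" "\<pi> \<in> carrier K" using loc_carrier[OF M w(1)] pi by auto
    have "\<pi> [^] m \<otimes> u = \<pi> [^] n \<otimes> (\<pi> [^] Suc m \<otimes> w)" using u(4) w(2) by metis
    also have "\<dots> = \<pi> [^] (n + Suc m) \<otimes> w"
      using wc m_assoc[of "\<pi> [^] n" "\<pi> [^] Suc m" w] nat_pow_mult[OF wc(2), of n "Suc m"] by simp
    finally have "n + Suc m \<le> m" using U.pi_pow_unit u w by metis
    then show False by simp
  qed
  have "\<sigma> x = x" if x: "x \<in> carrier K" for x
  proof -
    have *: "\<sigma> u = u" if u: "u \<in> loc M" for u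
    proof -
      obtain b where b: "b \<in> S" "b \<notin> M" "u \<otimes> b \<in> S" "u \<in> carrier K" using u unfolding loc_def by blast
      have nz: "b \<noteq> \<zero>" using b(2) M_zero[OF M] by metis
      have "\<sigma> u \<otimes> b = u \<otimes> b" using fix_S[OF b(3)] fix_S[OF b(1)] act_times[OF \<sigma>(1) b(4), of b] b(1) by simp
      then show ?thesis using b nz \<sigma> by (metis S_carrier act_closed m_comm nonzero_cancel)
    qed
    show ?thesis
    proof (cases "x \<in> loc M")
      case False
      then have nz: "x \<noteq> \<zero>" using loc_closed(1)[OF M] by metis
      then have "\<sigma> (inv x) = inv x" using * loc_valuation[OF M x nz] False by blast
      then have "inv (\<sigma> x) = inv x" using act_inverse[OF \<sigma>(1) x nz] by simp
      then show ?thesis using inv_inv_nonzero[OF x nz] inv_inv_nonzero[of "\<sigma> x"] x nz \<sigma> by simp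
    qed (rule *)
  qed
  then show False using distinct_act[OF \<sigma>(1) G.one_closed \<sigma>(2)] by auto
qed

end

section \<open>The Galois group\<close>

context field
begin

lemma galois_group_memD:
  assumes "\<sigma> \<in> carrier (galois_group R F)"
  shows "\<sigma> \<in> ring_iso R R" "\<sigma> \<in> extensional (carrier R)" "\<And>a. a \<in> F \<Longrightarrow> \<sigma> a = a" "\<sigma> \<in> Bij (carrier R)"
  using assms by (auto simp: galois_group_def Bij_def ring_iso_def)

lemma galois_group_mult:
  assumes "\<sigma> \<in> carrier (galois_group R F)" "\<tau> \<in> carrier (galois_group R F)"
  shows "\<sigma> \<otimes>\<^bsub>galois_group R F\<^esub> \<tau> = compose (carrier R) \<sigma> \<tau>"
  using galois_group_memD(4)[OF assms(1)] galois_group_memD(4)[OF assms(2)]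
  by (simp add: galois_group_def BijGroup_def)

lemma galois_group_one: "\<one>\<^bsub>galois_group R F\<^esub> = (\<lambda>x \<in> carrier R. x)"
  by (simp add: galois_group_def BijGroup_def)

lemma ring_iso_restrict:
  assumes "h \<in> ring_iso R R" shows "restrict h (carrier R) \<in> ring_iso R R"
  using assms by (auto simp: ring_iso_def ring_hom_def Pi_iff)

lemma galois_group_is_group:
  assumes F: "F \<subseteq> carrier R"
  shows "group (galois_group R F)"
proof -
  let ?H = "{\<sigma> \<in> ring_iso R R \<inter> extensional (carrier R). \<forall>a \<in> F. \<sigma> a = a}"
  interpret B: group "BijGroup (carrier R)" by (rule group_BijGroup)
  have HB: "\<sigma> \<in> Bij (carrier R)" if "\<sigma> \<in> ?H" for \<sigma> using that by (auto simp: Bij_def ring_iso_def)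
  have "subgroup ?H (BijGroup (carrier R))"
  proof (rule B.subgroupI)
    show "?H \<subseteq> carrier (BijGroup (carrier R))" using HB by (auto simp: BijGroup_def)
    have "(\<lambda>x \<in> carrier R. x) \<in> ring_iso R R"
      by (auto simp: ring_iso_def ring_hom_def bij_betw_def inj_on_def)
    then have "(\<lambda>x \<in> carrier R. x) \<in> ?H" using F by auto
    then show "?H \<noteq> {}" by blast
    fix \<sigma> assume \<sigma>: "\<sigma> \<in> ?H"
    have i: "inv\<^bsub>BijGroup (carrier R)\<^esub> \<sigma> = restrict (inv_into (carrier R) \<sigma>) (carrier R)"
      using inv_BijGroup[OF HB[OF \<sigma>]] by simp
    have inj: "inj_on \<sigma> (carrier R)" using HB[OF \<sigma>] by (auto simp: Bij_def bij_betw_def)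
    have "inv_into (carrier R) \<sigma> a = a" if "a \<in> F" for a
      using inv_into_f_f[OF inj, of a] \<sigma> that F by auto
    moreover have "restrict (inv_into (carrier R) \<sigma>) (carrier R) \<in> ring_iso R R"
      using ring_iso_restrict[OF ring_iso_set_sym[OF ring_axioms]] \<sigma> by blast
    ultimately show "inv\<^bsub>BijGroup (carrier R)\<^esub> \<sigma> \<in> ?H" unfolding i using F by auto
    fix \<tau> assume \<tau>: "\<tau> \<in> ?H"
    have m: "\<sigma> \<otimes>\<^bsub>BijGroup (carrier R)\<^esub> \<tau> = restrict (\<sigma> \<circ> \<tau>) (carrier R)"
      using HB[OF \<sigma>] HB[OF \<tau>] by (simp add: BijGroup_def compose_def o_def)
    have "restrict (\<sigma> \<circ> \<tau>) (carrier R) \<in> ring_iso R R"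
      using ring_iso_restrict ring_iso_set_trans \<sigma> \<tau> by blast
    then show "\<sigma> \<otimes>\<^bsub>BijGroup (carrier R)\<^esub> \<tau> \<in> ?H" unfolding m using F \<sigma> \<tau> by auto
  qed
  then show ?thesis unfolding galois_group_def using subgroup.subgroup_is_group group_BijGroup by blast
qed

lemma galois_group_hom: "\<sigma> \<in> carrier (galois_group R F) \<Longrightarrow> \<sigma> \<in> ring_hom R R"
  using galois_group_memD(1)[of \<sigma> F] by (simp add: ring_iso_def)

lemma finite_roots:
  assumes k: "subfield k R" and p: "p \<in> carrier (univ_poly R k)" "p \<noteq> []"
  shows "finite {x \<in> carrier R. eval p x = \<zero>}"
proof -
  have "p \<in> carrier (poly_ring R)" by (rule carrier_polynomial_shell[OF subfieldE(1)[OF k] p(1)])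
  then have "{x \<in> carrier R. eval p x = \<zero>} \<subseteq> set_mset (roots p)"
    using roots_mem_iff_is_root p(2) by (auto simp: is_root_def)
  then show ?thesis using finite_subset by blast
qed

text \<open>An automorphism is determined by the images of a basis, which are roots of the minimal polynomials.\<close>

lemma finite_galois_group:
  assumes F: "subfield F R" and fin: "finite_dimension F (carrier R)"
  shows "finite (carrier (galois_group R F))"
proof -
  let ?G = "carrier (galois_group R F)"
  have Fc: "F \<subseteq> carrier R" using subringE(1)[OF subfieldE(1)[OF F]] .
  obtain n where "dimension n F (carrier R)" using fin by blast
  then obtain us where us: "set us \<subseteq> carrier R" "Span F us = carrier R" using exists_base[OF F] by blast
  let ?B = "\<Union>u \<in> set us. {x \<in> carrier R. eval (Irr F u) x = \<zero>}"
  have "finite {x \<in> carrier R. eval (Irr F u) x = \<zero>}" if "u \<in> set us" for u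
  proof -
    have u: "u \<in> carrier R" using us that by auto
    have alg: "(algebraic over F) u" using finite_dimension_imp_algebraic[OF F carrier_is_subring fin u] .
    interpret UP: domain "univ_poly R F" by (rule univ_poly_is_domain[OF subfieldE(1)[OF F]])
    have "Irr F u \<noteq> []" using UP.ring_irreducibleE(1)[OF IrrE(1,2)[OF F u alg]] by (simp add: univ_poly_zero)
    then show ?thesis using finite_roots[OF F IrrE(1)[OF F u alg]] by blast
  qed
  then have finB: "finite ?B" by blast
  have inB: "\<sigma> u \<in> ?B" if \<sigma>: "\<sigma> \<in> ?G" and u: "u \<in> set us" for \<sigma> u
  proof -
    have uc: "u \<in> carrier R" using us u by auto
    have alg: "(algebraic over F) u" using finite_dimension_imp_algebraic[OF F carrier_is_subring fin uc] .
    have pF: "set (Irr F u) \<subseteq> F"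
      using IrrE(1)[OF F uc alg] by (auto simp: univ_poly_carrier[symmetric] polynomial_def)
    have h: "\<sigma> \<in> ring_hom (R\<lparr>carrier := carrier R\<rparr>) R" using galois_group_hom[OF \<sigma>] by simp
    note hR = ring_axioms ring_axioms carrier_is_subring h
    have "\<sigma> (eval (Irr F u) u) = eval (map \<sigma> (Irr F u)) (\<sigma> u)"
      by (rule hom_on_eval[OF hR]) (use pF Fc uc in auto)
    moreover have "map \<sigma> (Irr F u) = Irr F u"
      by (rule map_idI) (use pF galois_group_memD(3)[OF \<sigma>] in blast)
    ultimately have "eval (Irr F u) (\<sigma> u) = \<zero>"
      using IrrE(4)[OF F uc alg] hom_on_zero[OF hR] by simp
    then show ?thesis using u hom_on_closed[OF hR uc] by blast
  qed
  have inj: "inj_on (\<lambda>\<sigma>. map \<sigma> us) ?G"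
  proof (rule inj_onI)
    fix \<sigma> \<tau> assume st: "\<sigma> \<in> ?G" "\<tau> \<in> ?G" "map \<sigma> us = map \<tau> us"
    have comb: "\<rho> (combine ks vs) = combine ks (map \<rho> vs)"
      if "\<rho> \<in> ?G" "set ks \<subseteq> F" "set vs \<subseteq> carrier R" for \<rho> ks vs
      using that(2,3)
    proof (induction ks vs rule: combine.induct)
      case (1 k ks u vs)
      have c: "k \<in> carrier R" "u \<in> carrier R" "combine ks vs \<in> carrier R"
        using 1 Fc combine_in_carrier[of ks vs] by auto
      have "\<rho> (k \<otimes> u \<oplus> combine ks vs) = \<rho> k \<otimes> \<rho> u \<oplus> \<rho> (combine ks vs)"
        using ring_hom_add[OF galois_group_hom[OF that(1)] m_closed[OF c(1,2)] c(3)]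
          ring_hom_mult[OF galois_group_hom[OF that(1)] c(1,2)] by simp
      moreover have "\<rho> k = k" using galois_group_memD(3)[OF that(1)] 1 by simp
      ultimately show ?case using 1 by simp
    qed (use ring_hom_zero[OF galois_group_hom[OF that(1)] ring_axioms ring_axioms] in auto)
    have "\<sigma> x = \<tau> x" if x: "x \<in> carrier R" for x
    proof -
      obtain ks where "set ks \<subseteq> F" "x = combine ks us"
        using Span_eq_combine_set[OF F us(1)] us(2) x by blast
      then show ?thesis using comb[OF st(1) _ us(1)] comb[OF st(2) _ us(1)] st(3) by simp
    qed
    then show "\<sigma> = \<tau>"
      by (rule extensionalityI[OF galois_group_memD(2)[OF st(1)] galois_group_memD(2)[OF st(2)]])
  qed
  have "(\<lambda>\<sigma>. map \<sigma> us) ` ?G \<subseteq> {xs. set xs \<subseteq> ?B \<and> length xs = length us}" using inB by fastforce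
  then have "finite ((\<lambda>\<sigma>. map \<sigma> us) ` ?G)"
    using finite_lists_length_eq[OF finB] finite_subset by blast
  then show ?thesis using inj by (rule finite_imageD)
qed

text \<open>Clear denominators, then divide by the largest power of \<open>\<pi>\<close> that divides all coefficients.\<close>

lemma primitive_multiple:
  assumes V: "subring V R" and pi: "\<pi> \<in> V" "\<pi> \<noteq> \<zero>"
    and dvr: "\<forall>a \<in> V - {\<zero>}. \<exists>n::nat. \<exists>u \<in> V. u \<noteq> \<zero> \<and> inv u \<in> V \<and> a = \<pi> [^] n \<otimes> u"
    and p: "set p \<subseteq> quotient_field_in R V" "\<exists>a \<in> set p. a \<noteq> \<zero>"
  shows "\<exists>c \<in> carrier R. set (map ((\<otimes>) c) p) \<subseteq> V \<and> (\<exists>a \<in> set (map ((\<otimes>) c) p). a \<noteq> \<zero> \<and> inv a \<in> V)"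
proof -
  have Vc: "a \<in> V \<Longrightarrow> a \<in> carrier R" for a using subringE(1)[OF V] by auto
  have Qc: "a \<in> carrier R" if "a \<in> quotient_field_in R V" for a
    using that Vc by (auto simp: quotient_field_in_def)
  have den: "\<exists>b \<in> V. b \<noteq> \<zero> \<and> (\<forall>a \<in> set p. b \<otimes> a \<in> V)"
    if "set p \<subseteq> quotient_field_in R V" for p
    using that
  proof (induction p)
    case Nil
    then show ?case using subringE(3)[OF V] by (auto intro!: bexI[of _ \<one>])
  next
    case (Cons a p)
    obtain b where b: "b \<in> V" "b \<noteq> \<zero>" "\<forall>a \<in> set p. b \<otimes> a \<in> V" using Cons by auto
    obtain r s where r: "r \<in> V" "s \<in> V" "s \<noteq> \<zero>" "a = r \<otimes> inv s"
      using Cons.prems by (auto simp: quotient_field_in_def)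
    have c: "b \<in> carrier R" "r \<in> carrier R" "s \<in> carrier R" "inv s \<in> carrier R" using b r Vc by auto
    have "(s \<otimes> b) \<otimes> a = (s \<otimes> inv s) \<otimes> (b \<otimes> r)" unfolding r(4) using c by algebra
    then have "(s \<otimes> b) \<otimes> a \<in> V" using c r b subringE(6)[OF V] by simp
    moreover have "(s \<otimes> b) \<otimes> z \<in> V" if z: "z \<in> set p" for z
    proof -
      have "z \<in> carrier R" using z Cons.prems Qc by auto
      then have "(s \<otimes> b) \<otimes> z = s \<otimes> (b \<otimes> z)" using c m_assoc by simp
      then show ?thesis using subringE(6)[OF V r(2)] b(3) z by simp
    qed
    moreover have "s \<otimes> b \<in> V" "s \<otimes> b \<noteq> \<zero>" using c r b subringE(6)[OF V] by auto
    ultimately show ?case by auto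
  qed
  obtain b where b: "b \<in> V" "b \<noteq> \<zero>" "\<forall>a \<in> set p. b \<otimes> a \<in> V" using den[OF p(1)] by blast
  let ?P = "\<lambda>n::nat. \<exists>a \<in> set p. \<exists>u \<in> V. u \<noteq> \<zero> \<and> inv u \<in> V \<and> b \<otimes> a = \<pi> [^] n \<otimes> u"
  have pc: "a \<in> carrier R" if "a \<in> set p" for a using that p(1) Qc by auto
  have ba: "\<exists>n::nat. \<exists>u \<in> V. u \<noteq> \<zero> \<and> inv u \<in> V \<and> b \<otimes> a = \<pi> [^] n \<otimes> u"
    if a: "a \<in> set p" "a \<noteq> \<zero>" for a
  proof -
    have "b \<otimes> a \<in> V - {\<zero>}" using a b pc Vc by simp
    then show ?thesis using dvr by blast
  qed
  then have ex: "\<exists>n. ?P n" using p(2) by blast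
  \<comment> \<open>The least valuation among the nonzero coefficients of b p; dividing by this
    power of \<pi> keeps all coefficients in V and turns one into a unit.\<close>
  let ?N = "LEAST n. ?P n"
  have N: "?P ?N" by (rule LeastI_ex[OF ex])
  have pic: "\<pi> \<in> carrier R" using pi Vc by simp
  have pn: "\<pi> [^] (k::nat) \<in> carrier R" "\<pi> [^] (k::nat) \<noteq> \<zero>" for k using pic pi(2) by (induction k) auto
  have pV: "\<pi> [^] (k::nat) \<in> V" for k using pi(1) subringE(3,6)[OF V] by (induction k) auto
  let ?c = "inv (\<pi> [^] ?N) \<otimes> b"
  have ic: "inv (\<pi> [^] ?N) \<in> carrier R" using inv_nonzero_closed[OF pn] .
  have cV: "?c \<otimes> a \<in> V" if a: "a \<in> set p" for a
  proof (cases "a = \<zero>")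
    case True
    then show ?thesis using ic b Vc subringE(2)[OF V] by simp
  next
    case False
    obtain n :: nat and u where u: "u \<in> V" "u \<noteq> \<zero>" "inv u \<in> V" "b \<otimes> a = \<pi> [^] n \<otimes> u"
      using ba[OF a False] by blast
    have "?N \<le> n" by (rule Least_le) (use a u in blast)
    then obtain k where k: "n = ?N + k" using le_Suc_ex by blast
    have uc: "u \<in> carrier R" and bc: "b \<in> carrier R" using u(1) b(1) Vc by blast+
    have "?c \<otimes> a = inv (\<pi> [^] ?N) \<otimes> (b \<otimes> a)" by (rule m_assoc[OF ic bc pc[OF a]])
    also have "b \<otimes> a = \<pi> [^] ?N \<otimes> (\<pi> [^] k \<otimes> u)"
      unfolding u(4) k nat_pow_mult[OF pic, of ?N k, symmetric] by (rule m_assoc[OF pn(1) pn(1) uc])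
    also have "inv (\<pi> [^] ?N) \<otimes> (\<pi> [^] ?N \<otimes> (\<pi> [^] k \<otimes> u)) = \<pi> [^] k \<otimes> u"
      by (rule inv_cancel(2)[OF pn m_closed[OF pn(1) uc]])
    finally show ?thesis using subringE(6)[OF V pV u(1)] by simp
  qed
  obtain a u where a: "a \<in> set p" and u: "u \<in> V" "u \<noteq> \<zero>" "inv u \<in> V" "b \<otimes> a = \<pi> [^] ?N \<otimes> u"
    using N by blast
  have uc: "u \<in> carrier R" and bc: "b \<in> carrier R" using u(1) b(1) Vc by blast+
  have "?c \<otimes> a = inv (\<pi> [^] ?N) \<otimes> (b \<otimes> a)" by (rule m_assoc[OF ic bc pc[OF a]])
  also have "\<dots> = u" unfolding u(4) by (rule inv_cancel(2)[OF pn uc])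
  finally have "?c \<otimes> a = u" .
  then have "\<exists>z \<in> set (map ((\<otimes>) ?c) p). z \<noteq> \<zero> \<and> inv z \<in> V" using a u by auto
  moreover have "set (map ((\<otimes>) ?c) p) \<subseteq> V" using cV by auto
  moreover have "?c \<in> carrier R" using ic b(1) Vc by simp
  ultimately show ?thesis by blast
qed

lemma eval_smult:
  "set p \<subseteq> carrier R \<Longrightarrow> c \<in> carrier R \<Longrightarrow> x \<in> carrier R \<Longrightarrow>
    eval (map ((\<otimes>) c) p) x = c \<otimes> eval p x"
proof (induction p)
  case (Cons a p)
  have "a \<in> carrier R" "eval p x \<in> carrier R" "x [^] length p \<in> carrier R"
    using Cons.prems eval_in_carrier[of p x] by auto
  then show ?case using Cons by (simp add: r_distr m_assoc)
qed simp

text \<open>The powers of x below the degree of its minimal polynomial are independent, so the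
  degree is at most n; the coefficient list has one more entry.\<close>

lemma length_Irr_le:
  assumes F: "subfield F R" and dim: "dimension n F (carrier R)" and x: "x \<in> carrier R" "(algebraic over F) x"
  shows "length (Irr F x) \<le> Suc n"
proof -
  have "length (exp_base x (degree (Irr F x))) \<le> n"
    by (rule independent_length_le_dimension[OF F dim exp_base_independent[OF F x] exp_base_closed[OF x(1)]])
  then show ?thesis by (simp add: exp_base_def)
qed

end

theorem corollary1:
  fixes K :: "('a, 'b) ring_scheme"
    and F V S :: "'a set"
    and G :: "('a \<Rightarrow> 'a) monoid"
    and f :: "('a \<Rightarrow> 'a) \<Rightarrow> ('a \<Rightarrow> 'a) \<Rightarrow> 'a"
  assumes galois: "finite_galois_extension K F"
    and G: "G = galois_group K F"
    and V: "subring V K" "discrete_valuation_ring (K\<lparr>carrier := V\<rparr>)"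
    and F: "F = quotient_field_in K V"
    and S: "S = integral_closure K V"
    and unram: "unramified (K\<lparr>carrier := S\<rparr>) V"
    and cocycle: "normalized_cocycle K G f"
    and f_in_S: "\<forall>\<tau> \<in> carrier G. \<forall>\<gamma> \<in> carrier G. f \<tau> \<gamma> \<in> S - {\<zero>\<^bsub>K\<^esub>}"
  shows "hereditary (crossed_product_order K G S f) \<longleftrightarrow>
    (\<forall>\<tau> \<in> carrier G. \<forall>\<gamma> \<in> carrier G. \<forall>M. maximalideal M (K\<lparr>carrier := S\<rparr>) \<longrightarrow>
      f \<tau> \<gamma> \<notin> M [^]\<^bsub>ideals_set (K\<lparr>carrier := S\<rparr>)\<^esub> (2::nat))"
proof -
  have field: "field K" and subF: "subfield F K" and finF: "ring.finite_dimension K F (carrier K)"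
    and fixF: "{x \<in> carrier K. \<forall>\<sigma> \<in> carrier G. \<sigma> x = x} = F"
    using galois by (simp_all add: finite_galois_extension_def G)
  interpret field K by (rule field)
  have Fc: "F \<subseteq> carrier K" using subringE(1)[OF subfieldE(1)[OF subF]] .
  obtain n where dim: "dimension n F (carrier K)" using finF by blast
  obtain \<pi> where pi: "\<pi> \<in> V" "\<pi> \<noteq> \<zero>\<^bsub>K\<^esub>" "inv\<^bsub>K\<^esub> \<pi> \<notin> V"
    and dvr: "\<forall>a \<in> V - {\<zero>\<^bsub>K\<^esub>}. \<exists>n::nat. \<exists>u \<in> V. u \<noteq> \<zero>\<^bsub>K\<^esub> \<and> inv\<^bsub>K\<^esub> u \<in> V \<and> a = \<pi> [^]\<^bsub>K\<^esub> n \<otimes>\<^bsub>K\<^esub> u"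
    using discrete_valuation_ring_uniformizer[OF V] by blast
  have VF: "V \<subseteq> F"
  proof
    fix a assume a: "a \<in> V"
    then have "a = a \<otimes>\<^bsub>K\<^esub> inv\<^bsub>K\<^esub> \<one>\<^bsub>K\<^esub>" using subringE(1)[OF V(1)] by auto
    then show "a \<in> F" unfolding F quotient_field_in_def using a subringE(3)[OF V(1)] by force
  qed
  \<comment> \<open>The minimal polynomial of x over F, made primitive over V. Its degree is at most
    n, whence the bound \<open>Suc n\<close> on the number of coefficients.\<close>
  have algebraic: "\<exists>p. set p \<subseteq> V \<and> length p \<le> Suc n \<and> (\<exists>a \<in> set p. a \<noteq> \<zero>\<^bsub>K\<^esub> \<and> inv\<^bsub>K\<^esub> a \<in> V) \<and>
      eval p x = \<zero>\<^bsub>K\<^esub>" if x: "x \<in> carrier K" for x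
  proof -
    have alg: "(algebraic over F) x" by (rule finite_dimension_imp_algebraic[OF subF carrier_is_subring finF x])
    note Irr = IrrE[OF subF x alg]
    interpret UP: domain "univ_poly K F" by (rule univ_poly_is_domain[OF subfieldE(1)[OF subF]])
    have ne: "Irr F x \<noteq> []" using UP.ring_irreducibleE(1)[OF Irr(1,2)] by (simp add: univ_poly_zero)
    have pF: "set (Irr F x) \<subseteq> F" using Irr(1) by (auto simp: univ_poly_carrier[symmetric] polynomial_def)
    have "\<exists>a \<in> set (Irr F x). a \<noteq> \<zero>\<^bsub>K\<^esub>"
      using Irr(3) hd_in_set[OF ne] one_not_zero by metis
    then obtain c where c: "c \<in> carrier K" "set (map ((\<otimes>\<^bsub>K\<^esub>) c) (Irr F x)) \<subseteq> V"
      "\<exists>a \<in> set (map ((\<otimes>\<^bsub>K\<^esub>) c) (Irr F x)). a \<noteq> \<zero>\<^bsub>K\<^esub> \<and> inv\<^bsub>K\<^esub> a \<in> V"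
      using primitive_multiple[OF V(1) pi(1,2) dvr pF[unfolded F]] unfolding F by blast
    have "eval (map ((\<otimes>\<^bsub>K\<^esub>) c) (Irr F x)) x = \<zero>\<^bsub>K\<^esub>"
      using eval_smult[OF _ c(1) x, of "Irr F x"] pF Fc Irr(4) c(1) by auto
    then show ?thesis
      using c(2,3) length_Irr_le[OF subF dim x alg]
      by (intro exI[of _ "map ((\<otimes>\<^bsub>K\<^esub>) c) (Irr F x)"]) simp
  qed
  interpret E: dvr_extension K V \<pi> "Suc n"
  proof (rule dvr_extension.intro[OF field], rule dvr_extension_axioms.intro)
    show "\<exists>n::nat. \<exists>u \<in> V. u \<noteq> \<zero>\<^bsub>K\<^esub> \<and> inv\<^bsub>K\<^esub> u \<in> V \<and> a = \<pi> [^]\<^bsub>K\<^esub> n \<otimes>\<^bsub>K\<^esub> u"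
      if "a \<in> V" "a \<noteq> \<zero>\<^bsub>K\<^esub>" for a using dvr that by simp
  qed (fact V(1) pi algebraic)+
  have hom: "\<And>\<sigma>. \<sigma> \<in> carrier G \<Longrightarrow> \<sigma> \<in> ring_hom K K" unfolding G by (rule galois_group_hom)
  interpret C: crossed K G f
  proof (rule crossed.intro[OF field], rule crossed_axioms.intro)
    show "group G" unfolding G by (rule galois_group_is_group[OF Fc])
    show "finite (carrier G)" unfolding G by (rule finite_galois_group[OF subF finF])
    show "(\<sigma> \<otimes>\<^bsub>G\<^esub> \<tau>) a = \<sigma> (\<tau> a)" if "\<sigma> \<in> carrier G" "\<tau> \<in> carrier G" "a \<in> carrier K" for \<sigma> \<tau> a
      using that galois_group_mult unfolding G by (simp add: compose_def)
    show "\<one>\<^bsub>G\<^esub> a = a" if "a \<in> carrier K" for a using that unfolding G galois_group_one by simp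
  qed (use hom cocycle in auto)
  interpret D: galois_dvr K G f V \<pi> "Suc n"
  proof (rule galois_dvr.intro[OF C.crossed_axioms E.dvr_extension_axioms], rule galois_dvr_axioms.intro)
    show "\<sigma> a = a" if "\<sigma> \<in> carrier G" "a \<in> V" for \<sigma> a
      using that VF galois_group_memD(3) unfolding G by blast
    show "\<exists>a \<in> V. \<exists>b \<in> V. b \<noteq> \<zero>\<^bsub>K\<^esub> \<and> x = a \<otimes>\<^bsub>K\<^esub> inv\<^bsub>K\<^esub> b"
      if x: "x \<in> carrier K" "\<And>\<sigma>. \<sigma> \<in> carrier G \<Longrightarrow> \<sigma> x = x" for x
    proof -
      have "x \<in> F" using x fixF by blast
      then show ?thesis unfolding F quotient_field_in_def by blast
    qed
    show "\<exists>s \<in> carrier K. \<sigma> s \<noteq> \<tau> s" if st: "\<sigma> \<in> carrier G" "\<tau> \<in> carrier G" "\<sigma> \<noteq> \<tau>" for \<sigma> \<tau>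
      using st extensionalityI[of \<sigma> "carrier K" \<tau>] galois_group_memD(2)[of _ F] unfolding G by blast
    fix M assume "E.maxid M"
    then have "maximalideal M (K\<lparr>carrier := integral_closure K V\<rparr>)" using E.maximalideal_iff by simp
    then show "ramification_index (K\<lparr>carrier := integral_closure K V\<rparr>) V M = 1"
      "ring.separable_extension (K\<lparr>carrier := integral_closure K V\<rparr> Quot M)
        ((\<lambda>v. M +>\<^bsub>K\<lparr>carrier := integral_closure K V\<rparr>\<^esub> v) ` V)"
      using unram unfolding unramified_def S by blast+
  qed
  have order: "crossed_order K G f S"
  proof (rule crossed_order.intro[OF C.crossed_axioms], rule crossed_order_axioms.intro)
    show "subring S K" unfolding S by (rule E.S_subring)
    show "\<sigma> a \<in> S" if "\<sigma> \<in> carrier G" "a \<in> S" for \<sigma> a using that unfolding S by (rule D.act_S)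
    show "f \<sigma> \<tau> \<in> S" if "\<sigma> \<in> carrier G" "\<tau> \<in> carrier G" for \<sigma> \<tau> using that f_in_S by blast
  qed
  \<comment> \<open>The places are the maximal ideals of S, permuted by taking images under G; \<pi>
    is a uniformizer at all of them because S is unramified over V.\<close>
  interpret W: valued_crossed K G f S "{M. E.maxid M}" "\<lambda>\<sigma> M. \<sigma> ` M" "\<lambda>M. val (E.loc M) \<pi>" \<pi>
  proof (rule valued_crossed.intro[OF order], rule valued_crossed_axioms.intro)
    note U = D.uniformized_loc
    show "finite {M. E.maxid M}" by (rule D.finite_maxid)
    show "{M. E.maxid M} \<noteq> {}" using D.exists_maxid by blast
    show "\<sigma> ` M \<in> {M. E.maxid M}" if "\<sigma> \<in> carrier G" "M \<in> {M. E.maxid M}" for \<sigma> M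
      using that D.maxid_image by blast
    have Mc: "M \<subseteq> carrier K" if "M \<in> {M. E.maxid M}" for M using that E.M_S E.S_carrier by blast
    show "\<one>\<^bsub>G\<^esub> ` M = M" if "M \<in> {M. E.maxid M}" for M
    proof -
      have "\<one>\<^bsub>G\<^esub> ` M = (\<lambda>a. a) ` M" by (rule image_cong[OF refl]) (use Mc[OF that] in \<open>auto intro: C.act_one\<close>)
      then show ?thesis by simp
    qed
    show "(\<sigma> \<otimes>\<^bsub>G\<^esub> \<tau>) ` M = \<sigma> ` \<tau> ` M"
      if "\<sigma> \<in> carrier G" "\<tau> \<in> carrier G" "M \<in> {M. E.maxid M}" for \<sigma> \<tau> M
      unfolding image_image
      by (rule image_cong[OF refl]) (use Mc[OF that(3)] C.act_mult[OF that(1,2)] in blast)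
    show "val (E.loc (\<sigma> ` M)) \<pi> (\<sigma> a) = val (E.loc M) \<pi> a"
      if "\<sigma> \<in> carrier G" "M \<in> {M. E.maxid M}" "a \<in> carrier K" "a \<noteq> \<zero>\<^bsub>K\<^esub>" for \<sigma> M a
      using that D.v_image by blast
    show "val (E.loc M) \<pi> (a \<otimes>\<^bsub>K\<^esub> b) = val (E.loc M) \<pi> a + val (E.loc M) \<pi> b"
      if "M \<in> {M. E.maxid M}" "a \<in> carrier K" "a \<noteq> \<zero>\<^bsub>K\<^esub>" "b \<in> carrier K" "b \<noteq> \<zero>\<^bsub>K\<^esub>" for M a b
      using that uniformized.val_mult[OF U] by blast
    show "min (val (E.loc M) \<pi> a) (val (E.loc M) \<pi> b) \<le> val (E.loc M) \<pi> (a \<oplus>\<^bsub>K\<^esub> b)"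
      if "M \<in> {M. E.maxid M}" "a \<in> carrier K" "a \<noteq> \<zero>\<^bsub>K\<^esub>" "b \<in> carrier K" "b \<noteq> \<zero>\<^bsub>K\<^esub>" "a \<oplus>\<^bsub>K\<^esub> b \<noteq> \<zero>\<^bsub>K\<^esub>"
      for M a b
      using that uniformized.val_add[OF U] by blast
    show "S = {a \<in> carrier K. a = \<zero>\<^bsub>K\<^esub> \<or> (\<forall>M \<in> {M. E.maxid M}. 0 \<le> val (E.loc M) \<pi> a)}"
    proof (rule Set.set_eqI)
      fix a
      have 1: "a \<in> S \<longleftrightarrow> a \<in> carrier K \<and> (\<forall>M. E.maxid M \<longrightarrow> a \<in> E.loc M)"
        unfolding S by (rule D.S_eq_loc)
      have 2: "\<zero>\<^bsub>K\<^esub> \<in> S" unfolding S by (rule E.S_closed(1))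
      have 3: "0 \<le> val (E.loc M) \<pi> a \<longleftrightarrow> a \<in> E.loc M"
        if "a \<in> carrier K" "a \<noteq> \<zero>\<^bsub>K\<^esub>" "E.maxid M" for M
        using uniformized.val_nonneg_iff[OF U[OF that(3) that(3)] that(1,2)] .
      show "a \<in> S \<longleftrightarrow> a \<in> {a \<in> carrier K. a = \<zero>\<^bsub>K\<^esub> \<or> (\<forall>M \<in> {M. E.maxid M}. 0 \<le> val (E.loc M) \<pi> a)}"
      proof (cases "a = \<zero>\<^bsub>K\<^esub>")
        case True
        then show ?thesis using 2 by simp
      next
        case False
        then show ?thesis unfolding 1 using 3 by blast
      qed
    qed
    show "\<pi> \<in> carrier K" "\<pi> \<noteq> \<zero>\<^bsub>K\<^esub>" using pi E.V_carrier by blast+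
    show "\<sigma> \<pi> = \<pi>" if "\<sigma> \<in> carrier G" for \<sigma> by (rule D.fixV[OF that pi(1)])
    show "val (E.loc M) \<pi> \<pi> = 1" if "M \<in> {M. E.maxid M}" for M
      using that uniformized.val_pi[OF U] by blast
    show "\<exists>e \<in> S. (e = \<one>\<^bsub>K\<^esub> \<or> 1 \<le> val (E.loc M) \<pi> (e \<ominus>\<^bsub>K\<^esub> \<one>\<^bsub>K\<^esub>)) \<and>
        (\<forall>N \<in> {M. E.maxid M} - {M}. e = \<zero>\<^bsub>K\<^esub> \<or> int k \<le> val (E.loc N) \<pi> e)"
      if "M \<in> {M. E.maxid M}" for M k
      unfolding S by (rule D.approximation) (use that in blast)
    show "\<exists>s \<in> S. \<sigma> s \<noteq> s \<and> val (E.loc M) \<pi> (\<sigma> s \<ominus>\<^bsub>K\<^esub> s) \<le> 0"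
      if "\<sigma> \<in> carrier G" "\<sigma> \<noteq> \<one>\<^bsub>G\<^esub>" "M \<in> {M. E.maxid M}" "\<sigma> ` M = M" for \<sigma> M
      unfolding S by (rule D.faithful_residue) (use that in blast)+
    show "\<exists>s \<in> carrier K. \<sigma> s \<noteq> \<tau> s" if "\<sigma> \<in> carrier G" "\<tau> \<in> carrier G" "\<sigma> \<noteq> \<tau>" for \<sigma> \<tau>
      using D.distinct_act[OF that] .
  qed
  have sq: "W.vge M 2 (f \<tau> \<gamma>) \<longleftrightarrow> f \<tau> \<gamma> \<in> M [^]\<^bsub>ideals_set (K\<lparr>carrier := S\<rparr>)\<^esub> (2::nat)"
    if "\<tau> \<in> carrier G" "\<gamma> \<in> carrier G" "E.maxid M" for \<tau> \<gamma> M
  proof -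
    have "f \<tau> \<gamma> \<in> integral_closure K V" "f \<tau> \<gamma> \<noteq> \<zero>\<^bsub>K\<^esub>" using that f_in_S unfolding S by auto
    then show ?thesis
      using D.v_square_iff[OF that(3)] E.S_carrier unfolding W.vge_def S by blast
  qed
  have mx: "maximalideal M (K\<lparr>carrier := S\<rparr>) \<longleftrightarrow> E.maxid M" for M
    unfolding S by (rule E.maximalideal_iff)
  show ?thesis unfolding W.hereditary_iff mx using sq by blast
qed

end
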